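(* Let $D=(0,\infty)$ and let $m$ be a measure on $\mathbb{R}^\circ=\mathbb{R}\setminus\{0\}$ such that $|u|\,m(du)$ is a finite measure, and let $\varphi(z)=\int_{\mathbb{R}^\circ}(e^{iuz}-1-iuz)\,m(du)$ for $z\in\mathbb{R}$. Let $N(ds,du)$ be a Poisson random measure on $[0,\infty)\times\mathbb{R}^\circ$ with intensity $ds\,m(du)$, let $\tilde N(ds,du)=N(ds,du)-ds\,m(du)$, and let $\{Y_t:t\ge0\}$ be the $S(D)$-valued process defined by $$Y_t(f):=\int_0^t\int_{\mathbb{R}^\circ}u\,\kappa_{t-s}(f)\,\tilde N(ds,du),\qquad t\ge0,\ f\in B(D).$$ Define $Z_t(\{0\})=0$ and $Z_t(dx)=(1-e^{-x})Y_t(dx)$ for $x>0$. Then $\{Z_t:t\ge0\}$ is an $S([0,\infty))$-valued Markov process with transition semigroup $(S_t)_{t\ge0}$ defined by $$\int_{S([0,\infty))}e^{i\nu(f)}S_t(\mu,d\nu)=\exp\Big\{i\mu(T_tf)+\int_0^t\varphi(\kappa_s(hf))\,ds\Big\},\qquad f\in B([0,\infty)),$$ where $h(x)=1-e^{-x}$. Moreover, $\{Z_t:t\ge0\}$ has a right continuous strong Markov realization.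
   Context: $B(E)$ is the set of bounded Borel functions on $E$; $\mu(f)=\int f\,d\mu$. With $g_t(x)=(2\pi t)^{-1/2}\exp\{-x^2/2t\}$, $p_t(x,y)=g_t(x-y)-g_t(x+y)$ and $k_t(y)=y\,g_t(y)/t$ for $t>0$, $x,y\in D$: $(P_t)_{t\ge0}$ is the transition semigroup of the absorbing barrier Brownian motion in $D$ ($P_0f=f$, $P_tf(x)=\int_0^\infty p_t(x,y)f(y)\,dy$ for $t>0$), and $\kappa_t(dy)=k_t(y)\,dy$, $t>0$. The integral with respect to $\tilde N$ is the integral with respect to $N$ minus the integral with respect to $ds\,m(du)$. $(T_t)_{t\ge0}$ is the transition semigroup of a Markov process on $[0,\infty)$ given for $t>0$ by $T_tf(x)=h(x)^{-1}P_t(hf)(x)$ for $x>0$ and $T_tf(0)=2\kappa_t(hf)=\frac{d}{dx}P_t(hf)(0^+)$ (and $T_0f=f$). For a locally compact metric space $E$ (metrized so that the space of bounded uniformly continuous functions on $E$ with the supremum norm is separable), $M(E)$ is the space of finite Borel measures on $E$ and $S(E)=\{\mu^+-\mu^-:\mu^+,\mu^-\in M(E)\}$ is the space of finite signed measures. Fix a countable dense subset $\{f_n\}_{n\ge1}$ of the space of bounded uniformly continuous functions on $E$ and put $r(\mu,\nu)=\sum_{n=1}^\infty2^{-n}(1\wedge|\mu(f_n)-\nu(f_n)|)$ for $\mu,\nu\in M(E)$, a metric compatible with weak convergence on $M(E)$. $S(E)$ is given the metric $$\rho(\mu,\nu)=\inf\{r(\mu^+,\nu^+)+r(\mu^-,\nu^-):\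 \mu^\pm,\nu^\pm\in M(E),\ \mu^+-\mu^-=\mu,\ \nu^+-\nu^-=\nu\}.$$ Right continuity in $S([0,\infty))$ is with respect to $\rho$ (with $E=[0,\infty)$). *)

theory Defs
  imports "HOL-Probability.Probability"
begin

section \<open>Finite measures and finite signed measures\<close>

definition bounded_borel :: "'a::topological_space set \<Rightarrow> ('a \<Rightarrow> real) set" where
  "bounded_borel E = {f. f \<in> borel_measurable (restrict_space borel E) \<and> bounded (f ` E)}"

definition finite_measures :: "'a::topological_space set \<Rightarrow> 'a measure set" where
  "finite_measures E = {\<mu>. finite_measure \<mu> \<and> sets \<mu> = sets (restrict_space borel E)}"

text \<open>
  A finite signed measure is represented by its set function. As \<^const>\<open>measure\<close> vanishes outside
  the sigma-algebra, two differences of finite measures on \<open>E\<close> are equal as functions if and only if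
  they agree on all Borel subsets of \<open>E\<close>.
\<close>
definition measure_diff :: "'a measure \<Rightarrow> 'a measure \<Rightarrow> 'a set \<Rightarrow> real" where
  "measure_diff \<mu>p \<mu>n = (\<lambda>A. measure \<mu>p A - measure \<mu>n A)"

definition signed_measures :: "'a::topological_space set \<Rightarrow> ('a set \<Rightarrow> real) set" where
  "signed_measures E =
    {measure_diff \<mu>p \<mu>n | \<mu>p \<mu>n. \<mu>p \<in> finite_measures E \<and> \<mu>n \<in> finite_measures E}"

text \<open>
  The integral of a bounded Borel function does not depend on the decomposition, so the
  description below is unique for \<open>\<nu> \<in> signed_measures E\<close> and \<open>f \<in> bounded_borel E\<close>.
\<close>
definition signed_integral ::
  "'a::topological_space set \<Rightarrow> ('a set \<Rightarrow> real) \<Rightarrow> ('a \<Rightarrow> real) \<Rightarrow> real" where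
  "signed_integral E \<nu> f =
    (THE c. \<exists>\<mu>p \<in> finite_measures E. \<exists>\<mu>n \<in> finite_measures E.
       \<nu> = measure_diff \<mu>p \<mu>n \<and> c = (\<integral>x. f x \<partial>\<mu>p) - (\<integral>x. f x \<partial>\<mu>n))"

text \<open>The sigma-algebra generated by the maps \<open>\<nu> \<mapsto> \<nu>(f)\<close>, \<open>f\<close> bounded Borel.\<close>
definition signed_algebra :: "'a::topological_space set \<Rightarrow> ('a set \<Rightarrow> real) measure" where
  "signed_algebra E = sigma (signed_measures E)
     {{\<nu> \<in> signed_measures E. signed_integral E \<nu> f \<in> B} | f B. f \<in> bounded_borel E \<and> B \<in> sets borel}"


section \<open>The metrics on finite measures and on finite signed measures\<close>

text \<open>
  \<open>E\<close> carries a metric \<open>d\<close> which need not be the one of the ambient type. This matters already for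
  \<open>E = {0..}\<close>: under the Euclidean metric the bounded uniformly continuous functions are not
  separable.
\<close>
definition bounded_uniformly_continuous :: "'a set \<Rightarrow> ('a \<Rightarrow> 'a \<Rightarrow> real) \<Rightarrow> ('a \<Rightarrow> real) set" where
  "bounded_uniformly_continuous E d =
    {f. uniformly_continuous_map (metric (E, d)) euclidean_metric f \<and> bounded (f ` E)}"

definition compatible_metric :: "'a::topological_space set \<Rightarrow> ('a \<Rightarrow> 'a \<Rightarrow> real) \<Rightarrow> bool" where
  "compatible_metric E d \<longleftrightarrow>
    Metric_space E d \<and> Metric_space.mtopology E d = top_of_set E"

text \<open>Sequences are indexed by \<open>n \<ge> 1\<close>; the entry at \<open>0\<close> is ignored.\<close>
definition uniformly_dense_seq :: "'a set \<Rightarrow> ('a \<Rightarrow> 'a \<Rightarrow> real) \<Rightarrow> (nat \<Rightarrow> 'a \<Rightarrow> real) \<Rightarrow> bool" where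
  "uniformly_dense_seq E d F \<longleftrightarrow>
    (\<forall>n\<ge>1. F n \<in> bounded_uniformly_continuous E d) \<and>
    (\<forall>g \<in> bounded_uniformly_continuous E d. \<forall>\<epsilon>>0. \<exists>n\<ge>1. \<forall>x\<in>E. \<bar>F n x - g x\<bar> < \<epsilon>)"

definition r_dist :: "(nat \<Rightarrow> 'a \<Rightarrow> real) \<Rightarrow> 'a measure \<Rightarrow> 'a measure \<Rightarrow> real" where
  "r_dist F \<mu> \<nu> =
    (\<Sum>n. (1 / 2) ^ Suc n * min 1 \<bar>(\<integral>x. F (Suc n) x \<partial>\<mu>) - (\<integral>x. F (Suc n) x \<partial>\<nu>)\<bar>)"

definition rho_dist :: "'a::topological_space set \<Rightarrow> (nat \<Rightarrow> 'a \<Rightarrow> real) \<Rightarrow>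
    ('a set \<Rightarrow> real) \<Rightarrow> ('a set \<Rightarrow> real) \<Rightarrow> real" where
  "rho_dist E F \<mu> \<nu> =
    Inf {r_dist F \<mu>p \<nu>p + r_dist F \<mu>n \<nu>n | \<mu>p \<mu>n \<nu>p \<nu>n.
      \<mu>p \<in> finite_measures E \<and> \<mu>n \<in> finite_measures E \<and>
      \<nu>p \<in> finite_measures E \<and> \<nu>n \<in> finite_measures E \<and>
      measure_diff \<mu>p \<mu>n = \<mu> \<and> measure_diff \<nu>p \<nu>n = \<nu>}"


section \<open>Markov processes\<close>

text \<open>
  Processes have time set \<open>{0..} :: real set\<close>. Filtrations are indexed by \<^typ>\<open>ennreal\<close>, so that
  \<^const>\<open>stopping_time\<close> and \<^const>\<open>filtration.pre_sigma\<close> apply to stopping times with values in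
  \<open>[0,\<infinity>]\<close>.
\<close>
definition natural_filtration ::
  "'w measure \<Rightarrow> 's measure \<Rightarrow> (real \<Rightarrow> 'w \<Rightarrow> 's) \<Rightarrow> ennreal \<Rightarrow> 'w measure" where
  "natural_filtration M S X t =
    sigma (space M) {X s -` B \<inter> space M | s B. 0 \<le> s \<and> ennreal s \<le> t \<and> B \<in> sets S}"

definition right_limit_filtration :: "(ennreal \<Rightarrow> 'w measure) \<Rightarrow> ennreal \<Rightarrow> 'w measure" where
  "right_limit_filtration F t =
    (if t = \<infinity> then F \<infinity> else sigma (space (F t)) (\<Inter>u\<in>{t<..}. sets (F u)))"

definition transition_semigroup :: "'s measure \<Rightarrow> (real \<Rightarrow> 's \<Rightarrow> 's measure) \<Rightarrow> bool" where
  "transition_semigroup S K \<longleftrightarrow>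
    (\<forall>t\<ge>0. K t \<in> measurable S (prob_algebra S)) \<and>
    (\<forall>x\<in>space S. K 0 x = return S x) \<and>
    (\<forall>s\<ge>0. \<forall>t\<ge>0. \<forall>x\<in>space S. K (s + t) x = K s x \<bind> K t)"

definition markov_process ::
  "'w measure \<Rightarrow> 's measure \<Rightarrow> (ennreal \<Rightarrow> 'w measure) \<Rightarrow> (real \<Rightarrow> 'w \<Rightarrow> 's) \<Rightarrow>
    (real \<Rightarrow> 's \<Rightarrow> 's measure) \<Rightarrow> bool" where
  "markov_process M S F X K \<longleftrightarrow>
    (\<forall>t\<ge>0. X t \<in> measurable M S) \<and>
    (\<forall>t\<ge>0. X t \<in> measurable (F (ennreal t)) S) \<and>
    (\<forall>s\<ge>0. \<forall>t\<ge>0. \<forall>B\<in>sets S.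
      AE \<omega> in M. real_cond_exp M (F (ennreal s))
          (indicator {\<omega> \<in> space M. X (s + t) \<omega> \<in> B}) \<omega> = measure (K t (X s \<omega>)) B)"

definition strong_markov_process ::
  "'w measure \<Rightarrow> 's measure \<Rightarrow> (ennreal \<Rightarrow> 'w measure) \<Rightarrow> (real \<Rightarrow> 'w \<Rightarrow> 's) \<Rightarrow>
    (real \<Rightarrow> 's \<Rightarrow> 's measure) \<Rightarrow> bool" where
  "strong_markov_process M S F X K \<longleftrightarrow>
    markov_process M S F X K \<and>
    (\<forall>\<tau>. stopping_time F \<tau> \<longrightarrow>
      (\<lambda>\<omega>. X (enn2real (\<tau> \<omega>)) \<omega>)
        \<in> measurable (restrict_space (filtration.pre_sigma (space M) F \<tau>) {\<omega>. \<tau> \<omega> < \<infinity>}) S \<and>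
      (\<forall>t\<ge>0. \<forall>B\<in>sets S.
        AE \<omega> in M. \<tau> \<omega> < \<infinity> \<longrightarrow>
          real_cond_exp M (filtration.pre_sigma (space M) F \<tau>)
            (indicator {\<omega> \<in> space M. \<tau> \<omega> < \<infinity> \<and> X (enn2real (\<tau> \<omega>) + t) \<omega> \<in> B}) \<omega>
          = measure (K t (X (enn2real (\<tau> \<omega>)) \<omega>)) B))"

definition same_fdds ::
  "'s measure \<Rightarrow> 'w measure \<Rightarrow> (real \<Rightarrow> 'w \<Rightarrow> 's) \<Rightarrow> 'v measure \<Rightarrow> (real \<Rightarrow> 'v \<Rightarrow> 's) \<Rightarrow> bool" where
  "same_fdds S M X M' X' \<longleftrightarrow>
    (\<forall>J. finite J \<and> J \<subseteq> {0..} \<longrightarrow>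
      distr M (PiM J (\<lambda>_. S)) (\<lambda>\<omega>. \<lambda>t\<in>J. X t \<omega>) = distr M' (PiM J (\<lambda>_. S)) (\<lambda>\<omega>. \<lambda>t\<in>J. X' t \<omega>))"

definition right_continuous_paths ::
  "('s \<Rightarrow> 's \<Rightarrow> real) \<Rightarrow> 'w measure \<Rightarrow> (real \<Rightarrow> 'w \<Rightarrow> 's) \<Rightarrow> bool" where
  "right_continuous_paths \<rho> M X \<longleftrightarrow>
    (\<forall>\<omega>\<in>space M. \<forall>t\<ge>0. ((\<lambda>s. \<rho> (X s \<omega>) (X t \<omega>)) \<longlongrightarrow> 0) (at_right t))"


section \<open>Poisson random measures\<close>

definition poisson_random_measure :: "'w measure \<Rightarrow> 'b measure \<Rightarrow> ('w \<Rightarrow> 'b measure) \<Rightarrow> bool" where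
  "poisson_random_measure M \<Lambda> N \<longleftrightarrow>
    (\<forall>\<omega>\<in>space M. sets (N \<omega>) = sets \<Lambda> \<and> (\<forall>A\<in>sets \<Lambda>. emeasure (N \<omega>) A \<in> range ennreal_of_enat)) \<and>
    (\<forall>A\<in>sets \<Lambda>. (\<lambda>\<omega>. emeasure (N \<omega>) A) \<in> borel_measurable M) \<and>
    (\<forall>A\<in>sets \<Lambda>. emeasure \<Lambda> A < \<infinity> \<longrightarrow>
      (\<forall>n::nat. measure M {\<omega> \<in> space M. emeasure (N \<omega>) A = of_nat n}
         = measure \<Lambda> A ^ n / fact n * exp (- measure \<Lambda> A))) \<and>
    (\<forall>A\<in>sets \<Lambda>. emeasure \<Lambda> A = \<infinity> \<longrightarrow> (AE \<omega> in M. emeasure (N \<omega>) A = \<infinity>)) \<and>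
    (\<forall>(n::nat) A. A ` {..<n} \<subseteq> sets \<Lambda> \<and> disjoint_family_on A {..<n} \<longrightarrow>
      prob_space.indep_vars M (\<lambda>_. borel) (\<lambda>i \<omega>. emeasure (N \<omega>) (A i)) {..<n})"


section \<open>Absorbing barrier Brownian motion and the semigroup \<open>T\<close>\<close>

definition gauss_kernel :: "real \<Rightarrow> real \<Rightarrow> real" where
  "gauss_kernel t x = 1 / sqrt (2 * pi * t) * exp (- (x\<^sup>2 / (2 * t)))"

definition p_kernel :: "real \<Rightarrow> real \<Rightarrow> real \<Rightarrow> real" where
  "p_kernel t x y = gauss_kernel t (x - y) - gauss_kernel t (x + y)"

definition k_density :: "real \<Rightarrow> real \<Rightarrow> real" where
  "k_density t y = y * gauss_kernel t y / t"

definition absorbed_semigroup :: "real \<Rightarrow> (real \<Rightarrow> real) \<Rightarrow> real \<Rightarrow> real" where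
  "absorbed_semigroup t f x =
    (if t = 0 then f x else (LINT y:{0<..}|lborel. p_kernel t x y * f y))"

text \<open>Only used for \<open>t > 0\<close>, up to null sets; at \<open>t = 0\<close> division by zero makes it the zero measure.\<close>
definition kappa :: "real \<Rightarrow> real measure" where
  "kappa t = density (restrict_space lborel {0<..}) (\<lambda>y. ennreal (k_density t y))"

definition h_weight :: "real \<Rightarrow> real" where
  "h_weight x = 1 - exp (- x)"

definition T_semigroup :: "real \<Rightarrow> (real \<Rightarrow> real) \<Rightarrow> real \<Rightarrow> real" where
  "T_semigroup t f x =
    (if t = 0 then f x
     else if x = 0 then 2 * (\<integral>y. h_weight y * f y \<partial>kappa t)
     else absorbed_semigroup t (\<lambda>y. h_weight y * f y) x / h_weight x)"


section \<open>The processes \<open>Y\<close> and \<open>Z\<close> and the semigroup \<open>S\<close>\<close>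

definition jump_exponent :: "real measure \<Rightarrow> real \<Rightarrow> complex" where
  "jump_exponent m z = (\<integral>u. (iexp (u * z) - 1 - \<i> * of_real (u * z)) \<partial>m)"

definition jump_intensity :: "real measure \<Rightarrow> (real \<times> real) measure" where
  "jump_intensity m = restrict_space lborel {0..} \<Otimes>\<^sub>M m"

definition compensated_integral ::
  "(real \<times> real) measure \<Rightarrow> (real \<times> real) measure \<Rightarrow> real \<Rightarrow> (real \<Rightarrow> real \<Rightarrow> real) \<Rightarrow> real" where
  "compensated_integral n \<Lambda> t G =
    (LINT x:{0..t} \<times> UNIV|n. G (fst x) (snd x)) - (LINT x:{0..t} \<times> UNIV|\<Lambda>. G (fst x) (snd x))"

text \<open>
  Stochastic integrals are determined up to null sets only, so the defining equation of \<open>Y\<close> is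
  required almost surely, separately for each \<open>t\<close> and \<open>f\<close>.
\<close>
definition is_Y_process ::
  "'w measure \<Rightarrow> real measure \<Rightarrow> ('w \<Rightarrow> (real \<times> real) measure) \<Rightarrow>
    (real \<Rightarrow> 'w \<Rightarrow> real set \<Rightarrow> real) \<Rightarrow> bool" where
  "is_Y_process M m N Y \<longleftrightarrow>
    (\<forall>t\<ge>0. Y t \<in> measurable M (signed_algebra {0<..})) \<and>
    (\<forall>t\<ge>0. \<forall>f\<in>bounded_borel {0<..}. AE \<omega> in M.
      signed_integral {0<..} (Y t \<omega>) f =
        compensated_integral (N \<omega>) (jump_intensity m) t (\<lambda>s u. u * (\<integral>y. f y \<partial>kappa (t - s))))"

text \<open>The measure \<open>h(x) Y\<^sub>t(dx)\<close> on \<open>(0,\<infinity>)\<close>, extended to \<open>[0,\<infinity>)\<close> with no mass at \<open>0\<close>.\<close>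
definition Z_process ::
  "(real \<Rightarrow> 'w \<Rightarrow> real set \<Rightarrow> real) \<Rightarrow> real \<Rightarrow> 'w \<Rightarrow> real set \<Rightarrow> real" where
  "Z_process Y t \<omega> = (\<lambda>A. if A \<in> sets (restrict_space borel {0..})
     then signed_integral {0<..} (Y t \<omega>) (\<lambda>x. h_weight x * indicator A x) else 0)"

definition has_S_law ::
  "real measure \<Rightarrow> real \<Rightarrow> (real set \<Rightarrow> real) \<Rightarrow> (real set \<Rightarrow> real) measure \<Rightarrow> bool" where
  "has_S_law m t \<mu> Q \<longleftrightarrow>
    prob_space Q \<and> sets Q = sets (signed_algebra {0..}) \<and>
    (\<forall>f\<in>bounded_borel {0..}.
      (\<integral>\<nu>. iexp (signed_integral {0..} \<nu> f) \<partial>Q) =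
        exp (\<i> * of_real (signed_integral {0..} \<mu> (T_semigroup t f)) +
          (LINT s:{0..t}|lborel. jump_exponent m (\<integral>y. h_weight y * f y \<partial>kappa s))))"

definition S_semigroup :: "real measure \<Rightarrow> real \<Rightarrow> (real set \<Rightarrow> real) \<Rightarrow> (real set \<Rightarrow> real) measure" where
  "S_semigroup m t \<mu> = (THE Q. has_S_law m t \<mu> Q)"

end

theory Submission
  imports Defs
begin

text \<open>
  \<open>Z\<^sub>t(f)\<close> is the compensated Poisson integral of \<open>u \<kappa>\<^sub>t\<^sub>-\<^sub>s(h f)\<close>, and \<open>\<kappa>\<^sub>r(h f) = T\<^sub>r f(0) / 2\<close> for \<open>r > 0\<close>.
  The semigroup property of \<open>T\<close> splits the integrand of \<open>Z\<^sub>s\<^sub>+\<^sub>t(f)\<close> into that of \<open>Z\<^sub>s(T\<^sub>t f)\<close> and a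
  remainder carried by jump times after \<open>s\<close>. The exponential formula for Poisson random measures turns
  this into an identity of characteristic functionals, and these determine laws on the space of signed
  measures; this gives the transition semigroup and the Markov property.

  For the realization, \<open>\<kappa>\<^sub>0 h\<close> is replaced by the limit \<open>\<delta>\<^sub>0 / 2\<close>, which changes \<open>Z\<^sub>t\<close> only on a null set.
  Then \<open>r \<mapsto> T\<^sub>r f(0)\<close> is continuous on \<open>[0,\<infinity>)\<close> for bounded continuous \<open>f\<close>, and summing over the jumps
  gives right continuous paths. Since \<open>T\<^sub>t\<close> preserves bounded continuous functions, the Markov property
  at dyadic times passes to the limit at stopping times of the right limit filtration.
\<close>

subsection \<open>Bounded Borel functions and monotone class arguments\<close>

text \<open>The total mass of \<open>kappa r\<close> grows like r^(-1/2) as the age r of a jump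
  tends to 0. The weight h repairs this: h(y) is at most y, and 2 y^2 g_r(y) / r has mass 1 on the
  half-line, so the measures h(y) \<open>kappa r\<close> (dy) have mass at most 1/2 and a limit at r
  = 0. Two obstacles shape the proof. Y is given only almost surely, separately for each t and f, so
  nothing pathwise can be said about Z itself; hence the notion \<open>driven\<close>, shared by Z
  and an explicitly built version, under which all laws are computed. And the space of signed
  measures carries just the sigma-algebra of the maps nu(f), so past and future are compared through
  characteristic functionals; as f -> nu(f) is linear, finitely many such maps are tested by one.
  Since |u| m(du) is finite, the jumps in a bounded time interval are almost surely absolutely
  summable, and compensated integrals are differences of Lebesgue integrals. Right continuity in
  \<open>rho_dist\<close> needs only one decomposition into two measures, each weakly right
  continuous.\<close>

definition bounded_continuous :: "'a::topological_space set \<Rightarrow> ('a \<Rightarrow> real) set" where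
  "bounded_continuous E = {f. continuous_on E f \<and> bounded (f ` E)}"

lemma bounded_borelE:
  assumes "f \<in> bounded_borel E"
  obtains c where "0 \<le> c" "\<And>x. x \<in> E \<Longrightarrow> \<bar>f x\<bar> \<le> c"
proof -
  from assms obtain a where "\<And>x. x \<in> E \<Longrightarrow> \<bar>f x\<bar> \<le> a"
    by (auto simp: bounded_borel_def bounded_iff)
  then show ?thesis
    by (intro that[of "max a 0"]) (force intro: max.coboundedI1)+
qed

lemma bounded_borelI:
  assumes "f \<in> borel_measurable (restrict_space borel E)" "\<And>x. x \<in> E \<Longrightarrow> \<bar>f x\<bar> \<le> c"
  shows "f \<in> bounded_borel E"
  using assms by (auto simp: bounded_borel_def bounded_iff)

lemma bounded_borel_measurable:
  "f \<in> bounded_borel E \<Longrightarrow> f \<in> borel_measurable (restrict_space borel E)"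
  by (simp add: bounded_borel_def)

lemma bounded_borel_lincomb:
  assumes "f \<in> bounded_borel E" "g \<in> bounded_borel E"
  shows "(\<lambda>x. a * f x + b * g x) \<in> bounded_borel E"
proof -
  obtain c d where cd: "\<And>x. x \<in> E \<Longrightarrow> \<bar>f x\<bar> \<le> c" "\<And>x. x \<in> E \<Longrightarrow> \<bar>g x\<bar> \<le> d"
    using assms by (metis bounded_borelE)
  have [measurable]: "f \<in> borel_measurable (restrict_space borel E)" "g \<in> borel_measurable (restrict_space borel E)"
    using assms by (auto simp: bounded_borel_def)
  show ?thesis
  proof (rule bounded_borelI)
    fix x assume x: "x \<in> E"
    have "\<bar>a * f x + b * g x\<bar> \<le> \<bar>a\<bar> * \<bar>f x\<bar> + \<bar>b\<bar> * \<bar>g x\<bar>"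
      by (metis abs_mult abs_triangle_ineq)
    also have "\<dots> \<le> \<bar>a\<bar> * c + \<bar>b\<bar> * d"
      using cd x by (intro add_mono mult_left_mono) auto
    finally show "\<bar>a * f x + b * g x\<bar> \<le> \<bar>a\<bar> * c + \<bar>b\<bar> * d" .
  qed simp
qed

lemma bounded_borel_indicator:
  "A \<in> sets (restrict_space borel E) \<Longrightarrow> indicator A \<in> bounded_borel E"
  by (intro bounded_borelI[where c=1]) (auto split: split_indicator)

lemma bounded_continuous_lincomb:
  assumes "f \<in> bounded_continuous E" "g \<in> bounded_continuous E"
  shows "(\<lambda>x. a * f x + b * g x) \<in> bounded_continuous E"
proof -
  obtain c d where cd: "\<And>x. x \<in> E \<Longrightarrow> \<bar>f x\<bar> \<le> c" "\<And>x. x \<in> E \<Longrightarrow> \<bar>g x\<bar> \<le> d"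
    using assms by (auto simp: bounded_continuous_def bounded_iff)
  have "\<bar>a * f x + b * g x\<bar> \<le> \<bar>a\<bar> * c + \<bar>b\<bar> * d" if x: "x \<in> E" for x
  proof -
    have "\<bar>a * f x + b * g x\<bar> \<le> \<bar>a\<bar> * \<bar>f x\<bar> + \<bar>b\<bar> * \<bar>g x\<bar>"
      by (metis abs_mult abs_triangle_ineq)
    also have "\<dots> \<le> \<bar>a\<bar> * c + \<bar>b\<bar> * d"
      using cd x by (intro add_mono mult_left_mono) auto
    finally show ?thesis .
  qed
  then show ?thesis
    using assms by (auto simp: bounded_continuous_def bounded_iff intro!: continuous_intros)
qed

lemma bounded_continuous_subset: "bounded_continuous E \<subseteq> bounded_borel E"
  by (auto simp: bounded_continuous_def bounded_borel_def intro: borel_measurable_continuous_on_restrict)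

text \<open>The limit rule looks at functions only on E, so with a constant sequence it shows that P
  ignores values off E. This allows f to be shifted by a multiple of \<open>indicator E\<close>,
  treated as a nonnegative function, and shifted back.\<close>

lemma bounded_borel_induct [consumes 1, case_names indicator lincomb limit]:
  assumes f: "f \<in> bounded_borel E"
    and ind: "\<And>A. A \<in> sets (restrict_space borel E) \<Longrightarrow> P (indicator A)"
    and lin: "\<And>f g a b. f \<in> bounded_borel E \<Longrightarrow> g \<in> bounded_borel E \<Longrightarrow> P f \<Longrightarrow> P g \<Longrightarrow>
      P (\<lambda>x. a * f x + b * g x)"
    and lim: "\<And>F f c. (\<And>n. F n \<in> bounded_borel E) \<Longrightarrow> (\<And>n. P (F n)) \<Longrightarrow> f \<in> bounded_borel E \<Longrightarrow>
      (\<And>n x. x \<in> E \<Longrightarrow> \<bar>F n x\<bar> \<le> c) \<Longrightarrow> (\<And>x. x \<in> E \<Longrightarrow> (\<lambda>n. F n x) \<longlonglongrightarrow> f x) \<Longrightarrow> P f"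
  shows "P f"
proof -
  let ?M = "restrict_space borel E"
  have cong: "P g" if cg: "P f'" "f' \<in> bounded_borel E" "g \<in> bounded_borel E" "\<And>x. x \<in> E \<Longrightarrow> g x = f' x" for f' g
  proof -
    obtain c where c: "\<And>x. x \<in> E \<Longrightarrow> \<bar>f' x\<bar> \<le> c" using bounded_borelE[OF cg(2)] by metis
    show ?thesis
      by (rule lim[where F="\<lambda>_. f'" and c=c]) (use cg c in auto)
  qed
  have nonneg: "bounded (u ` E) \<longrightarrow> P u" if "u \<in> borel_measurable ?M" "\<And>x. 0 \<le> u x" for u
    using that
  proof (induction rule: borel_measurable_induct_real)
    case (set A)
    then show ?case using ind by simp
  next
    case (mult u c)
    show ?case
    proof
      assume b: "bounded ((\<lambda>x. c * u x) ` E)"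
      have m: "(\<lambda>x. c * u x) \<in> bounded_borel E"
        using b mult by (auto simp: bounded_borel_def)
      show "P (\<lambda>x. c * u x)"
      proof (cases "c = 0")
        case True
        have "P (indicator {})" by (rule ind) simp
        from cong[OF this _ m] show ?thesis using True bounded_borel_indicator[of "{}"] by auto
      next
        case False
        obtain d where "\<And>x. x \<in> E \<Longrightarrow> \<bar>c * u x\<bar> \<le> d"
          using bounded_borelE[OF m] by metis
        then have "u \<in> bounded_borel E"
          using mult False by (intro bounded_borelI[where c="d / c"]) (auto simp: field_simps)
        with lin[of u u c 0] mult show ?thesis by (auto simp: bounded_borel_def)
      qed
    qed
  next
    case (add u v)
    show ?case
    proof
      assume "bounded ((\<lambda>x. v x + u x) ` E)"
      then obtain d where d: "\<And>x. x \<in> E \<Longrightarrow> \<bar>v x + u x\<bar> \<le> d"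
        by (auto simp: bounded_iff)
      have nn: "0 \<le> u x" "0 \<le> v x" for x using add.hyps by auto
      have le_d: "u x \<le> d" "v x \<le> d" if "x \<in> E" for x
        using d[OF that] nn[of x] by auto
      have "u \<in> bounded_borel E"
        using nn le_d by (intro bounded_borelI[where c=d] add.hyps) auto
      moreover have "v \<in> bounded_borel E"
        using nn le_d by (intro bounded_borelI[where c=d] add.hyps) auto
      ultimately show "P (\<lambda>x. v x + u x)"
        using lin[of v u 1 1] add by (auto simp: bounded_borel_def)
    qed
  next
    case (seq U)
    show ?case
    proof
      assume "bounded (u ` E)"
      then obtain d where d: "\<And>x. x \<in> E \<Longrightarrow> \<bar>u x\<bar> \<le> d"
        by (auto simp: bounded_iff)
      have le: "U n x \<le> u x" if "x \<in> E" for n x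
        by (rule incseq_le) (use seq that in \<open>auto simp: mono_def le_fun_def space_restrict_space\<close>)
      have Unn: "0 \<le> U n x" for n x using seq by auto
      have UE: "\<bar>U n x\<bar> \<le> d" if "x \<in> E" for n x
        using le[OF that, of n] d[OF that] Unn[of n x] by auto
      show "P u"
      proof (rule lim[where F=U and c=d])
        show "U n \<in> bounded_borel E" for n
          using UE seq by (intro bounded_borelI[where c=d]) auto
        then show "P (U n)" for n
          using seq.IH[of n] by (auto simp: bounded_borel_def)
        show "u \<in> bounded_borel E"
        proof (rule bounded_borelI[where c=d])
          show "u \<in> borel_measurable ?M"
            by (rule borel_measurable_LIMSEQ_real[where u=U]) (use seq.hyps in auto)
        qed (rule d)
      qed (use seq UE in \<open>auto simp: space_restrict_space\<close>)
    qed
  qed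
  obtain c where c: "0 \<le> c" "\<And>x. x \<in> E \<Longrightarrow> \<bar>f x\<bar> \<le> c"
    using bounded_borelE[OF f] by metis
  let ?g = "\<lambda>x. max 0 (f x + c)"
  have [measurable]: "f \<in> borel_measurable ?M" using f by (rule bounded_borel_measurable)
  have g: "?g \<in> bounded_borel E"
    by (rule bounded_borelI[where c="2 * c"]) (use c in \<open>auto simp: abs_le_iff\<close>)
  have one: "indicator E \<in> bounded_borel E"
    by (rule bounded_borel_indicator) (auto simp: sets_restrict_space)
  have "P ?g" using nonneg[of ?g] g by (auto simp: bounded_borel_def)
  moreover have "P (indicator E)" by (rule ind) (auto simp: sets_restrict_space)
  ultimately have "P (\<lambda>x. 1 * ?g x + (-c) * indicator E x)"
    by (intro lin g one)
  then show ?thesis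
    by (rule cong[OF _ bounded_borel_lincomb[OF g one] f]) (use c in force)
qed

text \<open>The Borel sets whose trace on E satisfies P form a Dynkin system: complements come from
  the linear rule, disjoint unions from the bounded limit of partial sums. The generator lives in
  the ambient space, so closed sets and half-lines can serve for any E.\<close>

lemma bounded_borel_pi_system_induct [consumes 3, case_names basic whole lincomb limit]:
  fixes P :: "('a::topological_space \<Rightarrow> real) \<Rightarrow> bool"
  assumes G: "Int_stable G" "sigma_sets UNIV G = sets borel" and "B \<in> sets borel"
    and basic: "\<And>C. C \<in> G \<Longrightarrow> P (indicator (C \<inter> E))" and whole: "P (indicator E)"
    and lin: "\<And>f g a b. f \<in> bounded_borel E \<Longrightarrow> g \<in> bounded_borel E \<Longrightarrow> P f \<Longrightarrow> P g \<Longrightarrow>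
      P (\<lambda>x. a * f x + b * g x)"
    and lim: "\<And>F f c. (\<And>n. F n \<in> bounded_borel E) \<Longrightarrow> (\<And>n. P (F n)) \<Longrightarrow> f \<in> bounded_borel E \<Longrightarrow>
      (\<And>n x. x \<in> E \<Longrightarrow> \<bar>F n x\<bar> \<le> c) \<Longrightarrow> (\<And>x. x \<in> E \<Longrightarrow> (\<lambda>n. F n x) \<longlonglongrightarrow> f x) \<Longrightarrow> P f"
  shows "P (indicator (B \<inter> E))"
proof -
  have BB: "indicator (B \<inter> E) \<in> bounded_borel E" if "B \<in> sets borel" for B
    using that by (intro bounded_borel_indicator) (auto simp: sets_restrict_space)
  have one: "indicator E \<in> bounded_borel E" using BB[of UNIV] by simp
  have sPow: "G \<subseteq> Pow UNIV" by simp
  have "B \<in> sigma_sets UNIV G" using assms by simp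
  with G(1) sPow show ?thesis
  proof (induction rule: sigma_sets_induct_disjoint)
    case (basic C)
    then show ?case by (rule assms)
  next
    case empty
    have eq: "(indicator ({} \<inter> E) :: 'a \<Rightarrow> real) = (\<lambda>x. 0 * indicator E x + 0 * indicator E x)" by auto
    show ?case unfolding eq by (rule lin[OF one one whole whole])
  next
    case (compl B)
    have B: "B \<in> sets borel" using compl G(2) by auto
    have eq: "(indicator ((UNIV - B) \<inter> E) :: 'a \<Rightarrow> real) = (\<lambda>x. 1 * indicator E x + (-1) * indicator (B \<inter> E) x)"
      by (auto split: split_indicator)
    show ?case unfolding eq by (rule lin[OF one BB[OF B] whole compl.IH])
  next
    case (union B)
    have B: "B i \<in> sets borel" for i using union G(2) by auto
    have fin: "P (\<lambda>x. \<Sum>i<n. indicator (B i \<inter> E) x) \<and> (\<lambda>x. \<Sum>i<n. indicator (B i \<inter> E) x :: real) \<in> bounded_borel E" for n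
    proof (induction n)
      case 0
      show ?case using lin[OF one one whole whole, of 0 0] bounded_borel_lincomb[OF one one, of 0 0] by simp
    next
      case (Suc n)
      from lin[of "\<lambda>x. \<Sum>i<n. indicator (B i \<inter> E) x" "indicator (B n \<inter> E)" 1 1]
        bounded_borel_lincomb[of "\<lambda>x. \<Sum>i<n. indicator (B i \<inter> E) x" E "indicator (B n \<inter> E)" 1 1] Suc union BB[OF B]
      show ?case by auto
    qed
    have dj: "disjoint_family (\<lambda>i. B i \<inter> E)" using union by (auto simp: disjoint_family_on_def)
    have sum_eq: "(\<Sum>i<n. indicator (B i \<inter> E) x :: real) = indicator ((\<Union>i<n. B i) \<inter> E) x" for n x
    proof -
      have "indicator (\<Union>i<n. B i \<inter> E) x = (\<Sum>i<n. indicator (B i \<inter> E) x :: real)"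
        by (rule indicator_UN_disjoint) (use dj in \<open>auto simp: disjoint_family_on_def\<close>)
      then show ?thesis by (simp add: Int_UN_distrib2 flip: UN_simps)
    qed
    show ?case
    proof (rule lim[where F="\<lambda>n x. \<Sum>i<n. indicator (B i \<inter> E) x" and c=1])
      show "indicator ((\<Union>i. B i) \<inter> E) \<in> bounded_borel E" using B by (intro BB) auto
      show "(\<lambda>n. \<Sum>i<n. indicator (B i \<inter> E) x :: real) \<longlonglongrightarrow> indicator ((\<Union>i. B i) \<inter> E) x" for x
        unfolding sum_eq using LIMSEQ_indicator_UN[of "\<lambda>i. B i \<inter> E" x] by (simp flip: UN_simps)
    show "\<bar>\<Sum>i<n. indicator (B i \<inter> E) x\<bar> \<le> (1::real)" for n x
        unfolding sum_eq by (auto split: split_indicator)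
    qed (use fin in auto)
  qed
qed

text \<open>Closed sets generate the Borel sets, and the indicator of a nonempty closed C is the
  limit of the Lipschitz functions max 0 (1 - n dist(x, C)).\<close>

lemma bounded_borel_induct_continuous [consumes 1, case_names continuous lincomb limit]:
  fixes E :: "'a::metric_space set"
  assumes f: "f \<in> bounded_borel E"
    and cont: "\<And>f. f \<in> bounded_continuous E \<Longrightarrow> P f"
    and lin: "\<And>f g a b. f \<in> bounded_borel E \<Longrightarrow> g \<in> bounded_borel E \<Longrightarrow> P f \<Longrightarrow> P g \<Longrightarrow>
      P (\<lambda>x. a * f x + b * g x)"
    and lim: "\<And>F f c. (\<And>n. F n \<in> bounded_borel E) \<Longrightarrow> (\<And>n. P (F n)) \<Longrightarrow> f \<in> bounded_borel E \<Longrightarrow>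
      (\<And>n x. x \<in> E \<Longrightarrow> \<bar>F n x\<bar> \<le> c) \<Longrightarrow> (\<And>x. x \<in> E \<Longrightarrow> (\<lambda>n. F n x) \<longlonglongrightarrow> f x) \<Longrightarrow> P f"
  shows "P f"
  using f
proof (rule bounded_borel_induct)
  fix A assume "A \<in> sets (restrict_space borel E)"
  then obtain B where A: "A = B \<inter> E" and "B \<in> sets borel" by (auto simp: sets_restrict_space)
  have const: "P (\<lambda>x. c)" for c
    by (rule cont) (auto simp: bounded_continuous_def bounded_iff)
  have BB: "indicator (B \<inter> E) \<in> bounded_borel E" if "B \<in> sets borel" for B
    using that by (intro bounded_borel_indicator) (auto simp: sets_restrict_space)
  have sub: "sigma_sets UNIV (Collect closed) = sets (borel :: 'a measure)"
    by (simp add: borel_eq_closed)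
  have st: "Int_stable (Collect (closed :: 'a set \<Rightarrow> bool))"
    by (auto simp: Int_stable_def)
  have "P (indicator (B \<inter> E))"
    using st sub \<open>B \<in> sets borel\<close>
  proof (rule bounded_borel_pi_system_induct)
    fix C :: "'a set" assume "C \<in> Collect closed"
    then have C: "closed C" by simp
    show "P (indicator (C \<inter> E))"
    \<comment> \<open>\<open>infdist\<close> to the empty set is 0, so the approximating functions
      would be 1 instead of tending to 0.\<close>
    proof (cases "C = {}")
      case True
      have "P (\<lambda>x. 0)" by (rule const)
      also have "(\<lambda>x. 0) = indicator (C \<inter> E)" using True by auto
      finally show ?thesis .
    next
      case False
      let ?F = "\<lambda>n x. max 0 (1 - real n * infdist x C)"
      have bc: "?F n \<in> bounded_continuous E" for n
        by (auto simp: bounded_continuous_def bounded_iff infdist_nonneg intro!: continuous_intros exI[of _ 1])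
      have tend: "(\<lambda>n. ?F n x) \<longlonglongrightarrow> indicator (C \<inter> E) x" if "x \<in> E" for x
      proof (cases "x \<in> C")
        case True
        then show ?thesis using that by simp
      next
        case notin: False
        then have "infdist x C > 0"
          using C False in_closed_iff_infdist_zero[of C x] infdist_nonneg[of x C] by force
        then obtain N :: nat where N: "1 < real N * infdist x C"
          using reals_Archimedean3 by blast
        have "?F n x = 0" if "n \<ge> N" for n
        proof -
          have "real N * infdist x C \<le> real n * infdist x C"
            using that by (intro mult_right_mono) (auto simp: infdist_nonneg)
          with N show ?thesis by auto
        qed
        then have "(\<lambda>n. ?F n x) \<longlonglongrightarrow> 0"
          by (intro tendsto_eventually eventually_sequentiallyI[of N]) auto
        then show ?thesis using notin by simp
      qed
      show ?thesis
      proof (rule lim[where F="?F" and c=1])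
        show "?F n \<in> bounded_borel E" for n using bc bounded_continuous_subset by auto
        show "P (?F n)" for n by (rule cont, rule bc)
        show "indicator (C \<inter> E) \<in> bounded_borel E" using C by (intro BB) auto
        show "\<bar>?F n x\<bar> \<le> 1" for n x by (auto simp: infdist_nonneg)
      qed (rule tend)
    qed
  next
    have "(\<lambda>x. 1) \<in> bounded_borel E" by (rule bounded_borelI[where c=1]) auto
    moreover have "indicator E \<in> bounded_borel E" using BB[of UNIV] by simp
    ultimately show "P (indicator E)"
      by - (rule lim[where F="\<lambda>_ _. 1" and c=1], auto intro: const)
  qed (fact lin, fact lim)
  then show "P (indicator A)" by (simp add: A)
qed (fact lin, fact lim)

subsection \<open>Uniqueness by characteristic functionals\<close>

text \<open>The hypothesis at s = 0 says that w has the same integral a under both measures. Divided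
  by a, the weighted measures are probabilities whose images under v have equal characteristic
  functions. If a = 0, then w vanishes almost everywhere.\<close>

lemma weighted_Levy_uniqueness:
  fixes w v :: "'a \<Rightarrow> real"
  assumes fin: "finite_measure Q1" "finite_measure Q2" and sets: "sets Q1 = sets Q2"
    and w[measurable]: "w \<in> borel_measurable Q1" "\<And>x. 0 \<le> w x" "\<And>x. w x \<le> c"
    and v[measurable]: "v \<in> borel_measurable Q1"
    and cf: "\<And>s. (\<integral>x. w x * iexp (s * v x) \<partial>Q1) = (\<integral>x. w x * iexp (s * v x) \<partial>Q2)"
    and B[measurable]: "B \<in> sets borel"
  shows "(\<integral>x. w x * indicator B (v x) \<partial>Q1) = (\<integral>x. w x * indicator B (v x) \<partial>Q2)"
proof -
  interpret Q1: finite_measure Q1 by fact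
  interpret Q2: finite_measure Q2 by fact
  have w2[measurable]: "w \<in> borel_measurable Q2" and v2[measurable]: "v \<in> borel_measurable Q2"
    using w v sets by (auto cong: measurable_cong_sets)
  have c0: "0 \<le> c" using w(2,3) order_trans by blast
  have bint: "integrable Q1 (\<lambda>x. w x * u x)" "integrable Q2 (\<lambda>x. w x * u x)"
    if "u \<in> borel_measurable Q1" "\<And>x. \<bar>u x\<bar> \<le> 1" for u :: "'a \<Rightarrow> real"
  proof -
    have "u \<in> borel_measurable Q2" using that sets by (auto cong: measurable_cong_sets)
    moreover have "\<bar>w x * u x\<bar> \<le> c * 1" for x
      unfolding abs_mult using w that(2) c0 by (intro mult_mono) auto
    ultimately show "integrable Q1 (\<lambda>x. w x * u x)" "integrable Q2 (\<lambda>x. w x * u x)"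
      using that by (auto intro!: Q1.integrable_const_bound[where B=c] Q2.integrable_const_bound[where B=c])
  qed
  have wint: "integrable Q1 w" "integrable Q2 w" using bint[of "\<lambda>_. 1"] by auto
  define a where "a = (\<integral>x. w x \<partial>Q1)"
  have "complex_of_real (\<integral>x. w x \<partial>Q1) = complex_of_real (\<integral>x. w x \<partial>Q2)"
    using cf[of 0] by simp
  then have a2: "a = (\<integral>x. w x \<partial>Q2)" unfolding a_def by (simp only: of_real_eq_iff)
  have a0: "0 \<le> a" unfolding a_def using w by (intro integral_nonneg_AE) auto
  show ?thesis
  proof (cases "a = 0")
    case True
    have "AE x in Q1. w x = 0" "AE x in Q2. w x = 0"
      using True a_def a2 wint w integral_nonneg_eq_0_iff_AE[of Q1 w] integral_nonneg_eq_0_iff_AE[of Q2 w] by auto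
    then have "(\<integral>x. w x * indicator B (v x) \<partial>Q1) = 0" "(\<integral>x. w x * indicator B (v x) \<partial>Q2) = 0"
      by (auto intro!: integral_eq_zero_AE elim: eventually_mono)
    then show ?thesis by simp
  next
    case False
    then have apos: "0 < a" using a0 by simp
    define D where "D Q = distr (density Q (\<lambda>x. ennreal (w x / a))) borel v" for Q
    have pd: "real_distribution (D Q)" and
      cD: "char (D Q) s = (\<integral>x. w x * iexp (s * v x) \<partial>Q) / a" and
      mD: "measure (D Q) B = (\<integral>x. w x * indicator B (v x) \<partial>Q) / a"
      if "finite_measure Q" and [measurable]: "w \<in> borel_measurable Q" "v \<in> borel_measurable Q" and
        i: "integrable Q w" and ia: "(\<integral>x. w x \<partial>Q) = a" for Q s
    proof -
      interpret finite_measure Q by fact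
      have "prob_space (density Q (\<lambda>x. ennreal (w x / a)))"
      proof
        have "(\<integral>\<^sup>+x. ennreal (w x / a) \<partial>Q) = ennreal (\<integral>x. w x / a \<partial>Q)"
          using w i a0 by (intro nn_integral_eq_integral) auto
        then show "emeasure (density Q (\<lambda>x. ennreal (w x / a))) (space (density Q (\<lambda>x. ennreal (w x / a)))) = 1"
          using ia False by (auto simp: emeasure_density cong: nn_integral_cong)
      qed
      then have "prob_space (D Q)" unfolding D_def by (intro prob_space.prob_space_distr) auto
      then interpret prob_space "D Q" .
      show "real_distribution (D Q)"
        by (intro real_distribution.intro real_distribution_axioms.intro \<open>prob_space (D Q)\<close>) (auto simp: D_def)
      have "char (D Q) s = (\<integral>x. (w x / a) *\<^sub>R iexp (s * v x) \<partial>Q)"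
        unfolding char_def D_def using w a0
        by (subst integral_distr) (auto simp: integral_density)
      also have "\<dots> = (\<integral>x. w x * iexp (s * v x) / a \<partial>Q)"
        by (intro Bochner_Integration.integral_cong) (auto simp: scaleR_conv_of_real)
      finally show "char (D Q) s = (\<integral>x. w x * iexp (s * v x) \<partial>Q) / a"
        by simp
      have "measure (D Q) B = (\<integral>x. indicator B x \<partial>(D Q))" by (simp add: D_def)
      also have "\<dots> = (\<integral>x. (w x / a) *\<^sub>R indicator B (v x) \<partial>Q)"
        unfolding D_def using w a0 by (subst integral_distr) (auto simp: integral_density)
      also have "\<dots> = (\<integral>x. w x * indicator B (v x) / a \<partial>Q)"
        by (intro Bochner_Integration.integral_cong) auto
      finally show "measure (D Q) B = (\<integral>x. w x * indicator B (v x) \<partial>Q) / a"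
        by simp
    qed
    have "char (D Q1) s = char (D Q2) s" for s
      unfolding cD[OF fin(1) w(1) v wint(1) a_def[symmetric]] cD[OF fin(2) w2 v2 wint(2) a2[symmetric]] cf ..
    then have "D Q1 = D Q2"
      using pd[OF fin(1) w(1) v wint(1) a_def[symmetric]] pd[OF fin(2) w2 v2 wint(2) a2[symmetric]]
      by (intro Levy_uniqueness) auto
    then have "measure (D Q1) B = measure (D Q2) B" by simp
    then show ?thesis
      using wint a_def a2 False by (simp add: mD fin)
  qed
qed

text \<open>The multivariate uniqueness theorem reduces to the one-dimensional one by using the
  nonnegative weights \<open>1 + cos v\<close> and \<open>1 + sin v\<close>.\<close>

lemma finite_measure_eq_char:
  fixes v :: "'i \<Rightarrow> 'a \<Rightarrow> real"
  assumes fin: "finite_measure Q1" "finite_measure Q2" and sets: "sets Q1 = sets Q2"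
    and v: "\<And>i. i \<in> I \<Longrightarrow> v i \<in> borel_measurable Q1" and ne: "I \<noteq> {}"
    and lin: "\<And>i j a b. i \<in> I \<Longrightarrow> j \<in> I \<Longrightarrow> \<exists>k\<in>I. \<forall>x\<in>space Q1. v k x = a * v i x + b * v j x"
    and cf: "\<And>i. i \<in> I \<Longrightarrow> (\<integral>x. iexp (v i x) \<partial>Q1) = (\<integral>x. iexp (v i x) \<partial>Q2)"
    and gen: "(\<lambda>x. x) \<in> measurable (sigma (space Q1) {v i -` B \<inter> space Q1 | i B. i \<in> I \<and> B \<in> sets borel}) Q1"
  shows "Q1 = Q2"
proof -
  interpret Q1: finite_measure Q1 by fact
  interpret Q2: finite_measure Q2 by fact
  have sp: "space Q2 = space Q1" using sets by (metis sets_eq_imp_space_eq)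
  have v2: "v i \<in> borel_measurable Q2" if "i \<in> I" for i
    using v[OF that] sets by (auto cong: measurable_cong_sets)
  define W where "W xs x = (\<Prod>(j, B)\<leftarrow>xs. indicator B (v j x) :: real)" for xs :: "('i \<times> real set) list" and x
  define ok where "ok xs \<longleftrightarrow> (\<forall>(j, B)\<in>set xs. j \<in> I \<and> B \<in> sets borel)" for xs :: "('i \<times> real set) list"
  have W01: "0 \<le> W xs x" "W xs x \<le> 1" for xs x
    unfolding W_def by (induction xs) (auto split: split_indicator)
  have Wm: "W xs \<in> borel_measurable Q1" if "ok xs" for xs
    using that
  proof (induction xs)
    case (Cons jB xs)
    then have [measurable]: "W xs \<in> borel_measurable Q1" "v (fst jB) \<in> borel_measurable Q1" "snd jB \<in> sets borel"
      using v by (auto simp: ok_def split: prod.splits)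
    have "W (jB # xs) = (\<lambda>x. indicator (snd jB) (v (fst jB) x) * W xs x)"
      by (auto simp: W_def split: prod.splits)
    then show ?case by simp
  next
    case Nil
    have "W [] = (\<lambda>x. 1)" by (auto simp: W_def)
    then show ?case by simp
  qed
  have Wm2: "W xs \<in> borel_measurable Q2" if "ok xs" for xs
    using Wm[OF that] sets by (auto cong: measurable_cong_sets)
  have bnd: "integrable Q1 f" "integrable Q2 f" if "f \<in> borel_measurable Q1" "\<And>x. norm (f x) \<le> 10" for f :: "'a \<Rightarrow> complex"
  proof -
    have "f \<in> borel_measurable Q2" using that sets by (auto cong: measurable_cong_sets)
    then show "integrable Q1 f" "integrable Q2 f"
      using that by (auto intro!: Q1.integrable_const_bound[where B=10] Q2.integrable_const_bound[where B=10])
  qed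
  \<comment> \<open>Induction on the number of indicator factors: the one-dimensional theorem
    converts the exponential of one functional into an indicator, while the exponential of a second
    functional is kept for the next round.\<close>
  have claim: "\<forall>i\<in>I. (\<integral>x. W xs x * iexp (v i x) \<partial>Q1) = (\<integral>x. W xs x * iexp (v i x) \<partial>Q2)" if "ok xs" for xs
    using that
  proof (induction xs)
    case Nil
    then show ?case using cf by (simp add: W_def)
  next
    case (Cons jB xs)
    obtain j B where jB: "jB = (j, B)" by force
    have j: "j \<in> I" and [measurable]: "B \<in> sets borel" and okx: "ok xs"
      using Cons.prems by (auto simp: ok_def jB)
    note [measurable] = Wm[OF okx] Wm2[OF okx] v[OF j] v2[OF j]
    have IH: "(\<integral>x. W xs x * iexp (v i x) \<partial>Q1) = (\<integral>x. W xs x * iexp (v i x) \<partial>Q2)" if "i \<in> I" for i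
      using Cons.IH okx that by auto
    have IHlin: "(\<integral>x. W xs x * iexp (a * v i x + b * v k x) \<partial>Q1) = (\<integral>x. W xs x * iexp (a * v i x + b * v k x) \<partial>Q2)"
      if "i \<in> I" "k \<in> I" for i k a b
    proof -
      obtain l where l: "l \<in> I" "\<forall>x\<in>space Q1. v l x = a * v i x + b * v k x" using lin[OF \<open>i \<in> I\<close> \<open>k \<in> I\<close>] by blast
      have "(\<integral>x. W xs x * iexp (a * v i x + b * v k x) \<partial>Q) = (\<integral>x. W xs x * iexp (v l x) \<partial>Q)"
        if "space Q = space Q1" for Q
        using l(2) that by (intro Bochner_Integration.integral_cong) auto
      then show ?thesis using IH[OF l(1)] sp by presburger
    qed
    show ?case
    proof
      fix i assume i: "i \<in> I"
      note [measurable] = v[OF i] v2[OF i]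
      \<comment> \<open>For cmod q at most 1 the weight 1 + Re (q e^(iv)) lies between 0 and 2. The
        values q = 0, 1, -i give 1, 1 + cos v and 1 + sin v; subtracting the first case leaves the
        real and imaginary parts of e^(iv).\<close>
      have key: "(\<integral>x. (W xs x * (p + Re (q * iexp (v i x)))) * indicator B (v j x) \<partial>Q1) =
          (\<integral>x. (W xs x * (p + Re (q * iexp (v i x)))) * indicator B (v j x) \<partial>Q2)"
        if pq: "p = 1" "cmod q \<le> 1" for p :: real and q :: complex
      proof (rule weighted_Levy_uniqueness[where c=2])
        have Re1: "\<bar>Re (q * iexp (v i x))\<bar> \<le> 1" for x
          using abs_Re_le_cmod[of "q * iexp (v i x)"] pq by (simp add: norm_mult)
        have Re2: "0 \<le> p + Re (q * iexp (v i x))" "p + Re (q * iexp (v i x)) \<le> 2" for x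
          using Re1[of x] pq by auto
        show "0 \<le> W xs x * (p + Re (q * iexp (v i x)))" for x
          by (rule mult_nonneg_nonneg[OF W01(1) Re2(1)])
        show "W xs x * (p + Re (q * iexp (v i x))) \<le> 2" for x
          using mult_mono[OF W01(2) Re2(2) _ Re2(1), of xs x] by simp
        show "(\<integral>x. complex_of_real (W xs x * (p + Re (q * iexp (v i x)))) * iexp (s * v j x) \<partial>Q1) =
          (\<integral>x. complex_of_real (W xs x * (p + Re (q * iexp (v i x)))) * iexp (s * v j x) \<partial>Q2)" for s
        proof -
          define e where "e a x = W xs x * iexp (s * v j x + a * v i x)" for a x
          have eint: "integrable Q1 (e a)" "integrable Q2 (e a)" for a
          proof -
            have "norm (e a x) \<le> 10" for x
              using W01[of xs x] by (simp add: e_def norm_mult)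
            moreover have "e a \<in> borel_measurable Q1" unfolding e_def[abs_def] by measurable
            ultimately show "integrable Q1 (e a)" "integrable Q2 (e a)" by (auto intro: bnd)
          qed
          have eq: "complex_of_real (W xs x * (p + Re (q * iexp (v i x)))) * iexp (s * v j x) =
            p * e 0 x + q / 2 * e 1 x + cnj q / 2 * e (-1) x" for x
          proof -
            have Rez: "complex_of_real (Re z) = (z + cnj z) / 2" for z
              by (simp add: complex_add_cnj)
            have R: "complex_of_real (Re (q * iexp (v i x))) = (q * iexp (v i x) + cnj q * iexp (- v i x)) / 2"
              unfolding Rez by (simp add: exp_cnj)
            have E: "e a x = W xs x * iexp (s * v j x) * iexp (a * v i x)" for a
              by (simp add: e_def ring_distribs exp_add)
            have E0: "e 0 x = W xs x * iexp (s * v j x) * 1" using E[of 0] by simp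
            have E1: "e 1 x = W xs x * iexp (s * v j x) * iexp (v i x)" using E[of 1] by simp
            have E2: "e (-1) x = W xs x * iexp (s * v j x) * iexp (- v i x)" using E[of "-1"] by simp
            have alg: "w * (p' + (q * b + q' * b') / 2) * a = p' * (w * a * 1) + q / 2 * (w * a * b) + q' / 2 * (w * a * b')"
              for w a b b' p' q' :: complex
              by (simp add: field_simps)
            show ?thesis
              unfolding E0 E1 E2 of_real_mult[of "W xs x"] of_real_add[of p] R by (rule alg)
          qed
          have ee: "(\<integral>x. e a x \<partial>Q1) = (\<integral>x. e a x \<partial>Q2)" for a
            unfolding e_def using IHlin[OF j i] .
          show ?thesis unfolding eq by (simp add: eint ee)
        qed
      qed (use fin sets in auto)
      have WW: "W (jB # xs) x = W xs x * indicator B (v j x)" for x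
        by (simp add: W_def jB)
      define R where "R q x = W xs x * Re (q * iexp (v i x)) * indicator B (v j x)" for q x
      have Rm: "R q \<in> borel_measurable Q1" "R q \<in> borel_measurable Q2" for q
        unfolding R_def by measurable
      have Rb: "\<bar>R q x\<bar> \<le> 1" if "cmod q \<le> 1" for q x
      proof -
        have "\<bar>Re (q * iexp (v i x))\<bar> \<le> 1" 
          using abs_Re_le_cmod[of "q * iexp (v i x)"] that by (simp add: norm_mult)
        then show ?thesis using W01[of xs x]
          by (auto simp: R_def abs_mult mult_le_one split: split_indicator)
      qed
      have Ri: "integrable Q1 (R q)" "integrable Q2 (R q)" if "cmod q \<le> 1" for q
        using Rm[of q] Rb[OF that] by (auto intro!: Q1.integrable_const_bound[where B=1] Q2.integrable_const_bound[where B=1])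
      have WBi: "integrable Q1 (\<lambda>x. W xs x * indicator B (v j x))" "integrable Q2 (\<lambda>x. W xs x * indicator B (v j x))"
        using W01[of xs] by (auto intro!: Q1.integrable_const_bound[where B=1] Q2.integrable_const_bound[where B=1] split: split_indicator)
      have W0: "(\<integral>x. W xs x * indicator B (v j x) \<partial>Q1) = (\<integral>x. W xs x * indicator B (v j x) \<partial>Q2)"
        using key[of 1 0] by simp
      have RR: "(\<integral>x. R q x \<partial>Q1) = (\<integral>x. R q x \<partial>Q2)" if q: "cmod q \<le> 1" for q
      proof -
        have "(\<integral>x. W xs x * indicator B (v j x) + R q x \<partial>Q1) = (\<integral>x. W xs x * indicator B (v j x) + R q x \<partial>Q2)"
          using key[of 1 q] q by (simp add: R_def algebra_simps)
        then show ?thesis using W0 Ri[OF q] WBi by simp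
      qed
      have dec: "complex_of_real (W (jB # xs) x) * iexp (v i x) = complex_of_real (R 1 x) + \<i> * complex_of_real (R (-\<i>) x)" for x
        by (auto simp: R_def WW complex_eq_iff Re_exp Im_exp split: split_indicator)
      show "(\<integral>x. W (jB # xs) x * iexp (v i x) \<partial>Q1) = (\<integral>x. W (jB # xs) x * iexp (v i x) \<partial>Q2)"
        unfolding dec using RR[of 1] RR[of "-\<i>"] Ri[of 1] Ri[of "-\<i>"] by simp
    qed
  qed
  define cyl where "cyl xs = {x \<in> space Q1. \<forall>(j, B)\<in>set xs. v j x \<in> B}" for xs
  have W_cyl: "W xs x = indicator (cyl xs) x" if "x \<in> space Q1" for xs x
    using that unfolding W_def cyl_def by (induction xs) (auto split: split_indicator)
  let ?P = "{cyl xs | xs. ok xs}"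
  let ?G = "{v i -` B \<inter> space Q1 | i B. i \<in> I \<and> B \<in> sets borel}"
  have cyl_sets: "cyl xs \<in> sets Q1" if "ok xs" for xs
  proof -
    have "cyl xs = W xs -` {1} \<inter> space Q1"
    proof (intro set_eqI iffI)
      fix x assume "x \<in> cyl xs"
      moreover from this have "x \<in> space Q1" by (simp add: cyl_def)
      ultimately show "x \<in> W xs -` {1} \<inter> space Q1" using W_cyl[of x xs] by simp
    next
      fix x assume "x \<in> W xs -` {1} \<inter> space Q1"
      then show "x \<in> cyl xs" using W_cyl[of x xs] by (simp add: indicator_eq_1_iff)
    qed
    also have "\<dots> \<in> sets Q1" using Wm[OF that] by measurable
    finally show ?thesis .
  qed
  have meas_eq: "emeasure Q1 (cyl xs) = emeasure Q2 (cyl xs)" if "ok xs" for xs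
  proof -
    obtain i where i: "i \<in> I" using ne by auto
    \<comment> \<open>A functional that is identically 0 removes the exponential from
      \<open>claim\<close> and leaves the measure of a cylinder.\<close>
    obtain k where k: "k \<in> I" "\<forall>x\<in>space Q1. v k x = 0 * v i x + 0 * v i x" using lin[OF i i] by blast
    have "(\<integral>x. complex_of_real (indicator (cyl xs) x) \<partial>Q1) = (\<integral>x. W xs x * iexp (v k x) \<partial>Q1)"
      using k by (intro Bochner_Integration.integral_cong) (auto simp: W_cyl)
    also have "\<dots> = (\<integral>x. W xs x * iexp (v k x) \<partial>Q2)" using claim[OF that] k by blast
    also have "\<dots> = (\<integral>x. complex_of_real (indicator (cyl xs) x) \<partial>Q2)"
      using k by (intro Bochner_Integration.integral_cong) (auto simp: W_cyl sp)
    finally have "measure Q1 (cyl xs) = measure Q2 (cyl xs)"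
      using cyl_sets[OF that] sets sp by (simp add: cyl_def)
    then show ?thesis by (simp add: Q1.emeasure_eq_measure Q2.emeasure_eq_measure)
  qed
  have GP: "?G \<subseteq> ?P"
  proof
    fix A assume "A \<in> ?G"
    then obtain i B where A: "A = v i -` B \<inter> space Q1" "i \<in> I" "B \<in> sets borel" by auto
    then have "A = cyl [(i, B)]" "ok [(i, B)]" by (auto simp: cyl_def ok_def)
    then show "A \<in> ?P" by blast
  qed
  have PQ: "?P \<subseteq> sets Q1" using cyl_sets by auto
  have GPow: "?G \<subseteq> Pow (space Q1)" by auto
  have s1: "sets Q1 = sigma_sets (space Q1) ?P"
  proof (intro antisym)
    show "sigma_sets (space Q1) ?P \<subseteq> sets Q1" using PQ by (rule sets.sigma_sets_subset)
    have "A \<in> sigma_sets (space Q1) ?G" if "A \<in> sets Q1" for A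
    proof -
      have "(\<lambda>x. x) -` A \<inter> space (sigma (space Q1) ?G) \<in> sets (sigma (space Q1) ?G)"
        using gen that by (rule measurable_sets)
      moreover have "(\<lambda>x. x) -` A \<inter> space Q1 = A" using sets.sets_into_space[OF that] by auto
      ultimately show ?thesis using GPow by (simp add: space_measure_of sets_measure_of)
    qed
    moreover have "sigma_sets (space Q1) ?G \<subseteq> sigma_sets (space Q1) ?P"
      by (rule sigma_sets_mono'[OF GP])
    ultimately show "sets Q1 \<subseteq> sigma_sets (space Q1) ?P" by auto
  qed
  show ?thesis
  proof (rule measure_eqI_generator_eq[where E="?P" and \<Omega>="space Q1" and A="\<lambda>_. space Q1"])
    show "Int_stable ?P"
    proof (rule Int_stableI)
      fix a b assume "a \<in> ?P" "b \<in> ?P"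
      then obtain xs ys where "a = cyl xs" "b = cyl ys" "ok xs" "ok ys" by auto
      then have "a \<inter> b = cyl (xs @ ys)" "ok (xs @ ys)" by (auto simp: cyl_def ok_def)
      then show "a \<inter> b \<in> ?P" by blast
    qed
    show "?P \<subseteq> Pow (space Q1)" by (auto simp: cyl_def)
    show "emeasure Q1 X = emeasure Q2 X" if "X \<in> ?P" for X using that meas_eq by auto
    have "space Q1 = cyl []" "ok []" by (auto simp: cyl_def ok_def)
    then show "range (\<lambda>_. space Q1) \<subseteq> ?P" by blast
  qed (use s1 sets in auto)
qed

subsection \<open>Finite signed measures\<close>

lemma finite_measuresD:
  assumes "p \<in> finite_measures E"
  shows "finite_measure p" "sets p = sets (restrict_space borel E)" "space p = E"
  using assms sets_eq_imp_space_eq[of p "restrict_space borel E"]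
  by (auto simp: finite_measures_def space_restrict_space)

lemma bounded_borel_measurable_fm:
  "p \<in> finite_measures E \<Longrightarrow> f \<in> bounded_borel E \<Longrightarrow> f \<in> borel_measurable p"
  using bounded_borel_measurable finite_measuresD(2) by (metis measurable_cong_sets)

lemma integrable_bounded_borel:
  assumes p: "p \<in> finite_measures E" and f: "f \<in> bounded_borel E"
  shows "integrable p f"
proof -
  interpret finite_measure p by (rule finite_measuresD[OF p])
  obtain c where "\<And>x. x \<in> E \<Longrightarrow> \<bar>f x\<bar> \<le> c" using bounded_borelE[OF f] by metis
  then show ?thesis
    using bounded_borel_measurable_fm[OF p f] finite_measuresD(3)[OF p]
    by (intro integrable_const_bound[where B=c]) auto
qed

lemma integral_bounded_limit:
  fixes F :: "nat \<Rightarrow> 'a::topological_space \<Rightarrow> real"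
  assumes p: "p \<in> finite_measures E" and F: "\<And>n. F n \<in> bounded_borel E" "f \<in> bounded_borel E"
    and b: "\<And>n x. x \<in> E \<Longrightarrow> \<bar>F n x\<bar> \<le> c" and l: "\<And>x. x \<in> E \<Longrightarrow> (\<lambda>n. F n x) \<longlonglongrightarrow> f x"
  shows "(\<lambda>n. \<integral>x. F n x \<partial>p) \<longlonglongrightarrow> (\<integral>x. f x \<partial>p)"
proof -
  interpret finite_measure p by (rule finite_measuresD[OF p])
  show ?thesis
    by (rule integral_dominated_convergence[where w="\<lambda>_. c"])
      (use F bounded_borel_measurable_fm[OF p] b l finite_measuresD(3)[OF p] in auto)
qed

text \<open>This is what makes the description inside \<open>signed_integral\<close> unique.\<close>

lemma measure_diff_eq_integral:
  fixes E :: "'a::topological_space set"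
  assumes pn: "p \<in> finite_measures E" "n \<in> finite_measures E" "p' \<in> finite_measures E" "n' \<in> finite_measures E"
    and eq: "\<And>A. A \<in> sets (restrict_space borel E) \<Longrightarrow> measure_diff p n A = measure_diff p' n' A"
    and f: "f \<in> bounded_borel E"
  shows "(\<integral>x. f x \<partial>p) - (\<integral>x. f x \<partial>n) = (\<integral>x. f x \<partial>p') - (\<integral>x. f x \<partial>n')"
  using f
proof (induction rule: bounded_borel_induct)
  case (indicator A)
  then have "A \<inter> space q = A" if "q \<in> {p, n, p', n'}" for q
    using that pn finite_measuresD(3) sets.sets_into_space[of A "restrict_space borel E"] by (auto simp: space_restrict_space)
  then show ?case using eq[OF indicator] by (simp add: measure_diff_def)
next
  case (lincomb f g a b)
  have "(\<integral>x. a * f x + b * g x \<partial>p) - (\<integral>x. a * f x + b * g x \<partial>n) =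
    a * ((\<integral>x. f x \<partial>p) - (\<integral>x. f x \<partial>n)) + b * ((\<integral>x. g x \<partial>p) - (\<integral>x. g x \<partial>n))"
    if "p \<in> finite_measures E" "n \<in> finite_measures E" for p n
    using that lincomb.hyps by (simp add: integrable_bounded_borel algebra_simps)
  then show ?case using pn lincomb.IH by simp
next
  case (limit F f c)
  have "(\<lambda>k. (\<integral>x. F k x \<partial>p) - (\<integral>x. F k x \<partial>n)) \<longlonglongrightarrow> (\<integral>x. f x \<partial>p) - (\<integral>x. f x \<partial>n)"
    using limit by (intro tendsto_diff integral_bounded_limit[OF pn(1)] integral_bounded_limit[OF pn(2)]) auto
  moreover have "(\<lambda>k. (\<integral>x. F k x \<partial>p') - (\<integral>x. F k x \<partial>n')) \<longlonglongrightarrow> (\<integral>x. f x \<partial>p') - (\<integral>x. f x \<partial>n')"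
    using limit by (intro tendsto_diff integral_bounded_limit[OF pn(3)] integral_bounded_limit[OF pn(4)]) auto
  ultimately show ?case using limit.IH LIMSEQ_unique by fastforce
qed

lemma signed_integral_diff:
  assumes "p \<in> finite_measures E" "n \<in> finite_measures E" "f \<in> bounded_borel E"
  shows "signed_integral E (measure_diff p n) f = (\<integral>x. f x \<partial>p) - (\<integral>x. f x \<partial>n)"
  unfolding signed_integral_def
proof (rule the_equality)
  fix c
  assume "\<exists>p'\<in>finite_measures E. \<exists>n'\<in>finite_measures E.
    measure_diff p n = measure_diff p' n' \<and> c = (\<integral>x. f x \<partial>p') - (\<integral>x. f x \<partial>n')"
  then obtain p' n' where "p' \<in> finite_measures E" "n' \<in> finite_measures E"
    "measure_diff p n = measure_diff p' n'" "c = (\<integral>x. f x \<partial>p') - (\<integral>x. f x \<partial>n')" by blast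
  with measure_diff_eq_integral[OF assms(1,2) this(1,2) _ assms(3)]
  show "c = (\<integral>x. f x \<partial>p) - (\<integral>x. f x \<partial>n)" by simp
qed (use assms in blast)

lemma signed_measuresE:
  assumes "\<nu> \<in> signed_measures E"
  obtains p n where "p \<in> finite_measures E" "n \<in> finite_measures E" "\<nu> = measure_diff p n"
    "\<And>f. f \<in> bounded_borel E \<Longrightarrow> signed_integral E \<nu> f = (\<integral>x. f x \<partial>p) - (\<integral>x. f x \<partial>n)"
  using assms signed_integral_diff unfolding signed_measures_def by blast

lemma measure_diff_signed:
  "p \<in> finite_measures E \<Longrightarrow> n \<in> finite_measures E \<Longrightarrow> measure_diff p n \<in> signed_measures E"
  by (auto simp: signed_measures_def)

lemma signed_integral_lincomb:
  assumes "\<nu> \<in> signed_measures E" "f \<in> bounded_borel E" "g \<in> bounded_borel E"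
  shows "signed_integral E \<nu> (\<lambda>x. a * f x + b * g x) = a * signed_integral E \<nu> f + b * signed_integral E \<nu> g"
proof -
  obtain p q where pq: "p \<in> finite_measures E" "q \<in> finite_measures E"
    "\<And>f. f \<in> bounded_borel E \<Longrightarrow> signed_integral E \<nu> f = (\<integral>x. f x \<partial>p) - (\<integral>x. f x \<partial>q)"
    using signed_measuresE[OF assms(1)] by metis
  show ?thesis
    using assms(2,3) pq(1,2)
    by (simp add: pq(3) bounded_borel_lincomb integrable_bounded_borel algebra_simps)
qed

lemma signed_integral_limit:
  fixes F :: "nat \<Rightarrow> 'a::topological_space \<Rightarrow> real"
  assumes "\<nu> \<in> signed_measures E" and F: "\<And>n. F n \<in> bounded_borel E" "f \<in> bounded_borel E"
    and b: "\<And>n x. x \<in> E \<Longrightarrow> \<bar>F n x\<bar> \<le> c" and l: "\<And>x. x \<in> E \<Longrightarrow> (\<lambda>n. F n x) \<longlonglongrightarrow> f x"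
  shows "(\<lambda>n. signed_integral E \<nu> (F n)) \<longlonglongrightarrow> signed_integral E \<nu> f"
proof -
  obtain p q where pq: "p \<in> finite_measures E" "q \<in> finite_measures E"
    "\<And>f. f \<in> bounded_borel E \<Longrightarrow> signed_integral E \<nu> f = (\<integral>x. f x \<partial>p) - (\<integral>x. f x \<partial>q)"
    using signed_measuresE[OF assms(1)] by metis
  show ?thesis
    unfolding pq(3)[OF F(1)] pq(3)[OF F(2)]
    by (intro tendsto_diff integral_bounded_limit[OF pq(1) F b l] integral_bounded_limit[OF pq(2) F b l])
qed

lemma signed_integral_cong:
  assumes "\<nu> \<in> signed_measures E" "f \<in> bounded_borel E" "\<And>x. x \<in> E \<Longrightarrow> f x = g x"
  shows "signed_integral E \<nu> f = signed_integral E \<nu> g"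
proof -
  obtain p q where pq: "p \<in> finite_measures E" "q \<in> finite_measures E"
    "\<And>f. f \<in> bounded_borel E \<Longrightarrow> signed_integral E \<nu> f = (\<integral>x. f x \<partial>p) - (\<integral>x. f x \<partial>q)"
    using signed_measuresE[OF assms(1)] by metis
  have "g \<in> borel_measurable (restrict_space borel E) \<longleftrightarrow> f \<in> borel_measurable (restrict_space borel E)"
    by (rule measurable_cong) (auto simp: space_restrict_space assms(3))
  moreover have "g ` E = f ` E" using assms(3) by auto
  ultimately have "g \<in> bounded_borel E"
    using assms(2) by (simp add: bounded_borel_def)
  moreover have "(\<integral>x. f x \<partial>r) = (\<integral>x. g x \<partial>r)" if "r \<in> finite_measures E" for r
    using assms(3) finite_measuresD(3)[OF that] by (intro Bochner_Integration.integral_cong) auto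
  ultimately show ?thesis using pq assms by simp
qed

lemma signed_integral_indicator:
  assumes "\<nu> \<in> signed_measures E" "A \<in> sets (restrict_space borel E)"
  shows "signed_integral E \<nu> (indicator A) = \<nu> A"
proof -
  obtain p q where pq: "p \<in> finite_measures E" "q \<in> finite_measures E" "\<nu> = measure_diff p q"
    "\<And>f. f \<in> bounded_borel E \<Longrightarrow> signed_integral E \<nu> f = (\<integral>x. f x \<partial>p) - (\<integral>x. f x \<partial>q)"
    using signed_measuresE[OF assms(1)] by metis
  have "A \<inter> space r = A" if "r \<in> finite_measures E" for r
    using that finite_measuresD(3) sets.sets_into_space[OF assms(2)] by (auto simp: space_restrict_space)
  then show ?thesis using pq assms by (simp add: bounded_borel_indicator measure_diff_def)
qed

lemma signed_measures_notin_sets: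
  assumes "\<nu> \<in> signed_measures E" "A \<notin> sets (restrict_space borel E)"
  shows "\<nu> A = 0"
  using assms by (auto simp: signed_measures_def measure_diff_def measure_notin_sets finite_measuresD(2))

lemma signed_measures_eqI:
  assumes "\<mu> \<in> signed_measures E" "\<nu> \<in> signed_measures E"
    and "\<And>A. A \<in> sets (restrict_space borel E) \<Longrightarrow> \<mu> A = \<nu> A"
  shows "\<mu> = \<nu>"
proof
  show "\<mu> A = \<nu> A" for A
    using assms(3) signed_measures_notin_sets[OF assms(1)] signed_measures_notin_sets[OF assms(2)]
    by (cases "A \<in> sets (restrict_space borel E)") auto
qed

text \<open>Stated through integrals because these determine the sum and are the form in which it
  enters \<open>signed_plus\<close> and the realization.\<close>

lemma finite_measures_add:
  fixes E :: "'a::topological_space set"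
  assumes p: "p \<in> finite_measures E" and q: "q \<in> finite_measures E"
  shows "\<exists>r\<in>finite_measures E. \<forall>f\<in>bounded_borel E. (\<integral>x. f x \<partial>r) = (\<integral>x. f x \<partial>p) + (\<integral>x. f x \<partial>q)"
proof -
  let ?S = "restrict_space borel E :: 'a measure"
  define r where "r = measure_of (space ?S) (sets ?S) (\<lambda>A. emeasure p A + emeasure q A)"
  have ca: "countably_additive (sets ?S) (\<lambda>A. emeasure p A + emeasure q A)"
  proof (rule countably_additiveI)
    fix A :: "nat \<Rightarrow> 'a set"
    assume A: "range A \<subseteq> sets ?S" "disjoint_family A" "(\<Union>i. A i) \<in> sets ?S"
    then have "(\<Sum>i. emeasure p (A i)) = emeasure p (\<Union>i. A i)" "(\<Sum>i. emeasure q (A i)) = emeasure q (\<Union>i. A i)"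
      using finite_measuresD(2)[OF p] finite_measuresD(2)[OF q] by (auto intro!: suminf_emeasure)
    then show "(\<Sum>i. emeasure p (A i) + emeasure q (A i)) = emeasure p (\<Union>i. A i) + emeasure q (\<Union>i. A i)"
      by (subst suminf_add[symmetric]) auto
  qed
  have em: "emeasure r A = emeasure p A + emeasure q A" if "A \<in> sets ?S" for A
    unfolding r_def using ca that
    by (intro emeasure_measure_of_sigma sets.sigma_algebra_axioms) (auto simp: positive_def)
  have sr: "sets r = sets ?S" by (simp add: r_def)
  have spr: "space r = E" using sets_eq_imp_space_eq[OF sr] by (simp add: space_restrict_space)
  interpret p: finite_measure p by (rule finite_measuresD[OF p])
  interpret q: finite_measure q by (rule finite_measuresD[OF q])
  have "E \<in> sets ?S" using sets.top[of ?S] by (simp add: space_restrict_space)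
  from em[OF this] have "emeasure r (space r) \<noteq> \<infinity>"
    using spr p.emeasure_finite q.emeasure_finite by (simp add: ennreal_add_eq_top)
  then have r: "r \<in> finite_measures E" using sr by (auto simp: finite_measures_def intro: finite_measureI)
  interpret r: finite_measure r by (rule finite_measuresD[OF r])
  have "(\<integral>x. f x \<partial>r) = (\<integral>x. f x \<partial>p) + (\<integral>x. f x \<partial>q)" if "f \<in> bounded_borel E" for f
    using that
  proof (induction rule: bounded_borel_induct)
    case (indicator A)
    then have "A \<inter> space s = A" if "s \<in> {p, q, r}" for s
      using that p q r finite_measuresD(3) sets.sets_into_space[of A "restrict_space borel E"] by (auto simp: space_restrict_space)
    from this[of p] this[of q] this[of r] show ?case using em[OF indicator]
      by (simp add: p.emeasure_eq_measure q.emeasure_eq_measure r.emeasure_eq_measure flip: ennreal_plus)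
  next
    case (lincomb f g a b)
    then show ?case using p q r by (simp add: integrable_bounded_borel algebra_simps)
  next
    case (limit F f c)
    have "(\<lambda>k. (\<integral>x. F k x \<partial>p) + (\<integral>x. F k x \<partial>q)) \<longlonglongrightarrow> (\<integral>x. f x \<partial>p) + (\<integral>x. f x \<partial>q)"
      using limit by (intro tendsto_add integral_bounded_limit[OF p] integral_bounded_limit[OF q]) auto
    moreover have "(\<lambda>k. \<integral>x. F k x \<partial>r) \<longlonglongrightarrow> (\<integral>x. f x \<partial>r)"
      using limit by (intro integral_bounded_limit[OF r]) auto
    ultimately show ?case using limit.IH LIMSEQ_unique by fastforce
  qed
  with r show ?thesis by blast
qed

definition signed_plus :: "('a set \<Rightarrow> real) \<Rightarrow> ('a set \<Rightarrow> real) \<Rightarrow> 'a set \<Rightarrow> real" where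
  "signed_plus \<mu> \<nu> = (\<lambda>A. \<mu> A + \<nu> A)"

lemma signed_plus:
  assumes "\<mu> \<in> signed_measures E" "\<nu> \<in> signed_measures E"
  shows signed_plus_in: "signed_plus \<mu> \<nu> \<in> signed_measures E"
    and signed_integral_plus: "\<And>f. f \<in> bounded_borel E \<Longrightarrow>
      signed_integral E (signed_plus \<mu> \<nu>) f = signed_integral E \<mu> f + signed_integral E \<nu> f"
proof -
  obtain p q where pq: "p \<in> finite_measures E" "q \<in> finite_measures E" "\<mu> = measure_diff p q"
    "\<And>f. f \<in> bounded_borel E \<Longrightarrow> signed_integral E \<mu> f = (\<integral>x. f x \<partial>p) - (\<integral>x. f x \<partial>q)"
    using signed_measuresE[OF assms(1)] by metis
  obtain p' q' where pq': "p' \<in> finite_measures E" "q' \<in> finite_measures E" "\<nu> = measure_diff p' q'"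
    "\<And>f. f \<in> bounded_borel E \<Longrightarrow> signed_integral E \<nu> f = (\<integral>x. f x \<partial>p') - (\<integral>x. f x \<partial>q')"
    using signed_measuresE[OF assms(2)] by metis
  obtain r where r: "r \<in> finite_measures E" "\<And>f. f\<in>bounded_borel E \<Longrightarrow> (\<integral>x. f x \<partial>r) = (\<integral>x. f x \<partial>p) + (\<integral>x. f x \<partial>p')"
    using finite_measures_add[OF pq(1) pq'(1)] by metis
  obtain s where s: "s \<in> finite_measures E" "\<And>f. f\<in>bounded_borel E \<Longrightarrow> (\<integral>x. f x \<partial>s) = (\<integral>x. f x \<partial>q) + (\<integral>x. f x \<partial>q')"
    using finite_measures_add[OF pq(2) pq'(2)] by metis
  have rs: "measure_diff r s \<in> signed_measures E" by (rule measure_diff_signed[OF r(1) s(1)])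
  have "measure_diff r s A = signed_plus \<mu> \<nu> A" for A
  proof (cases "A \<in> sets (restrict_space borel E)")
    case True
    note i = bounded_borel_indicator[OF True]
    have "measure_diff r s A = signed_integral E (measure_diff r s) (indicator A)"
      by (rule signed_integral_indicator[OF rs True, symmetric])
    also have "\<dots> = signed_integral E \<mu> (indicator A) + signed_integral E \<nu> (indicator A)"
      unfolding signed_integral_diff[OF r(1) s(1) i] r(2)[OF i] s(2)[OF i] pq(4)[OF i] pq'(4)[OF i] by simp
    finally show ?thesis
      by (simp add: signed_integral_indicator assms True signed_plus_def)
  next
    case False
    then show ?thesis
      by (simp add: signed_measures_notin_sets[OF rs] signed_measures_notin_sets[OF assms(1)]
          signed_measures_notin_sets[OF assms(2)] signed_plus_def)
  qed
  then have eq: "signed_plus \<mu> \<nu> = measure_diff r s" by (intro ext) simp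
  show "signed_plus \<mu> \<nu> \<in> signed_measures E" using rs eq by simp
  show "signed_integral E (signed_plus \<mu> \<nu>) f = signed_integral E \<mu> f + signed_integral E \<nu> f"
    if "f \<in> bounded_borel E" for f
    using that by (simp add: eq signed_integral_diff[OF r(1) s(1)] r(2) s(2) pq(4) pq'(4))
qed

lemma space_signed_algebra [simp]: "space (signed_algebra E) = signed_measures E"
  by (auto simp: signed_algebra_def space_measure_of_conv)

lemma measurable_signed_integral [measurable (raw)]:
  assumes "f \<in> bounded_borel E" "X \<in> measurable A (signed_algebra E)"
  shows "(\<lambda>\<omega>. signed_integral E (X \<omega>) f) \<in> borel_measurable A"
proof (rule measurable_compose[OF assms(2)], rule measurableI)
  fix B :: "real set" assume "B \<in> sets borel"
  then have "{\<nu> \<in> signed_measures E. signed_integral E \<nu> f \<in> B} \<in> sets (signed_algebra E)"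
    using assms unfolding signed_algebra_def by (auto intro!: sigma_sets.Basic)
  also have "{\<nu> \<in> signed_measures E. signed_integral E \<nu> f \<in> B} =
      (\<lambda>\<nu>. signed_integral E \<nu> f) -` B \<inter> space (signed_algebra E)" by auto
  finally show "(\<lambda>\<nu>. signed_integral E \<nu> f) -` B \<inter> space (signed_algebra E) \<in> sets (signed_algebra E)" .
qed simp

lemma measurable_signed_algebraI:
  assumes sp: "\<And>\<omega>. \<omega> \<in> space A \<Longrightarrow> X \<omega> \<in> signed_measures E"
    and m: "\<And>f. f \<in> bounded_borel E \<Longrightarrow> (\<lambda>\<omega>. signed_integral E (X \<omega>) f) \<in> borel_measurable A"
  shows "X \<in> measurable A (signed_algebra E)"
  unfolding signed_algebra_def
proof (rule measurable_measure_of)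
  fix B assume "B \<in> {{\<nu> \<in> signed_measures E. signed_integral E \<nu> f \<in> B} |f B. f \<in> bounded_borel E \<and> B \<in> sets borel}"
  then obtain f C where f: "f \<in> bounded_borel E" "C \<in> sets borel"
    and B: "B = {\<nu> \<in> signed_measures E. signed_integral E \<nu> f \<in> C}" by auto
  have "X -` B \<inter> space A = (\<lambda>\<omega>. signed_integral E (X \<omega>) f) -` C \<inter> space A"
    using sp by (auto simp: B)
  also have "\<dots> \<in> sets A" using m f by (intro measurable_sets)
  finally show "X -` B \<inter> space A \<in> sets A" .
qed (use sp in auto)

text \<open>Limits in time are available only against continuous test functions; this reduces
  measurability of stopped states to them.\<close>

lemma measurable_signed_algebraI_continuous:
  fixes E :: "'a::metric_space set"
  assumes sp: "\<And>\<omega>. \<omega> \<in> space A \<Longrightarrow> X \<omega> \<in> signed_measures E"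
    and m: "\<And>f. f \<in> bounded_continuous E \<Longrightarrow> (\<lambda>\<omega>. signed_integral E (X \<omega>) f) \<in> borel_measurable A"
  shows "X \<in> measurable A (signed_algebra E)"
  using sp
proof (rule measurable_signed_algebraI)
  fix f assume "f \<in> bounded_borel E"
  then show "(\<lambda>\<omega>. signed_integral E (X \<omega>) f) \<in> borel_measurable A"
  proof (induction rule: bounded_borel_induct_continuous)
    case (lincomb f g a b)
    have "(\<lambda>\<omega>. a * signed_integral E (X \<omega>) f + b * signed_integral E (X \<omega>) g) \<in> borel_measurable A"
      using lincomb by measurable
    then show ?case
      using lincomb sp by (simp add: signed_integral_lincomb cong: measurable_cong)
  next
    case (limit F f c)
    show ?case
    proof (rule borel_measurable_LIMSEQ_real)
      show "(\<lambda>n. signed_integral E (X \<omega>) (F n)) \<longlonglongrightarrow> signed_integral E (X \<omega>) f" if "\<omega> \<in> space A" for \<omega>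
        by (rule signed_integral_limit[where c=c]) (use limit sp that in auto)
    qed (use limit in auto)
  qed (rule m)
qed

text \<open>The test functions form a vector space, so a joint characteristic function of several
  functionals is a value of the single functional at a linear combination. Continuous test functions
  already generate the sigma-algebra.\<close>

lemma signed_law_unique:
  fixes E :: "'a::metric_space set"
  assumes fin: "finite_measure Q1" "finite_measure Q2"
    and sets: "sets Q1 = sets (signed_algebra E)" "sets Q2 = sets (signed_algebra E)"
    and cf: "\<And>f. f \<in> bounded_continuous E \<Longrightarrow>
      (\<integral>\<nu>. iexp (signed_integral E \<nu> f) \<partial>Q1) = (\<integral>\<nu>. iexp (signed_integral E \<nu> f) \<partial>Q2)"
  shows "Q1 = Q2"
proof (rule finite_measure_eq_char[where I="bounded_continuous E" and v="\<lambda>f \<nu>. signed_integral E \<nu> f"])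
  have sp: "space Q1 = signed_measures E" using sets_eq_imp_space_eq[OF sets(1)] by simp
  note subD = bounded_continuous_subset[THEN subsetD]
  show "(\<lambda>\<nu>. signed_integral E \<nu> f) \<in> borel_measurable Q1" if "f \<in> bounded_continuous E" for f
    using subD[OF that] by (intro measurable_signed_integral) (auto simp: measurable_ident_sets[OF sets(1)])
  have "(\<lambda>x. 0) \<in> bounded_continuous E" by (auto simp: bounded_continuous_def bounded_iff)
  then show "bounded_continuous E \<noteq> {}" by blast
  show "\<exists>k\<in>bounded_continuous E. \<forall>\<nu>\<in>space Q1. signed_integral E \<nu> k = a * signed_integral E \<nu> f + b * signed_integral E \<nu> g"
    if "f \<in> bounded_continuous E" "g \<in> bounded_continuous E" for f g a b
    using that by (intro bexI[of _ "\<lambda>x. a * f x + b * g x"])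
      (auto simp: sp subD intro!: signed_integral_lincomb bounded_continuous_lincomb)
  let ?G = "{(\<lambda>\<nu>. signed_integral E \<nu> f) -` B \<inter> space Q1 |f B. f \<in> bounded_continuous E \<and> B \<in> sets borel}"
  have "(\<lambda>x. x) \<in> measurable (sigma (space Q1) ?G) (signed_algebra E)"
  proof (rule measurable_signed_algebraI_continuous)
    fix f assume f: "f \<in> bounded_continuous E"
    show "(\<lambda>\<nu>. signed_integral E \<nu> f) \<in> borel_measurable (sigma (space Q1) ?G)"
      using f by (intro measurableI) (auto simp: space_measure_of_conv intro!: sigma_sets.Basic)
  qed (auto simp: space_measure_of_conv sp)
  then show "(\<lambda>x. x) \<in> measurable (sigma (space Q1) ?G) Q1"
    using sets by (auto cong: measurable_cong_sets)
qed (use assms in auto)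

text \<open>Countably many values determine a signed measure, so one null set suffices when two
  random signed measures agree almost surely on each set. Real half-lines are reached from rational
  ones by approaching the endpoint from above. The value on E is a separate hypothesis, as E need
  not be the trace of a half-line.\<close>

lemma signed_measures_eqI_rat:
  fixes \<mu> \<nu> :: "real set \<Rightarrow> real"
  assumes \<mu>: "\<mu> \<in> signed_measures E" and \<nu>: "\<nu> \<in> signed_measures E"
    and eq: "\<And>q. q \<in> \<rat> \<Longrightarrow> \<mu> ({..q} \<inter> E) = \<nu> ({..q} \<inter> E)" and total: "\<mu> E = \<nu> E"
  shows "\<mu> = \<nu>"
proof (rule signed_measures_eqI[OF \<mu> \<nu>])
  fix A assume "A \<in> sets (restrict_space borel E)"
  then obtain B where A: "A = B \<inter> E" and "B \<in> sets borel" by (auto simp: sets_restrict_space)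
  have rs: "B \<inter> E \<in> sets (restrict_space borel E)" if "B \<in> sets borel" for B
    using that by (auto simp: sets_restrict_space)
  define P where "P f \<longleftrightarrow> signed_integral E \<mu> f = signed_integral E \<nu> f" for f
  have PI: "P (indicator (B \<inter> E)) \<longleftrightarrow> \<mu> (B \<inter> E) = \<nu> (B \<inter> E)" if "B \<in> sets borel" for B
    using that rs by (simp add: P_def signed_integral_indicator \<mu> \<nu>)
  have lim: "P f" if "\<And>n. F n \<in> bounded_borel E" "\<And>n. P (F n)" "f \<in> bounded_borel E"
      "\<And>n x. x \<in> E \<Longrightarrow> \<bar>F n x\<bar> \<le> c" "\<And>x. x \<in> E \<Longrightarrow> (\<lambda>n. F n x) \<longlonglongrightarrow> f x" for F f c
    using signed_integral_limit[OF \<mu> that(1,3-5)] signed_integral_limit[OF \<nu> that(1,3-5)] that(2)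
    by (simp add: P_def LIMSEQ_unique)
  have real_case: "\<mu> ({..a} \<inter> E) = \<nu> ({..a} \<inter> E)" for a
  proof -
    have "\<exists>q. q \<in> \<rat> \<and> a < q \<and> q < a + 1 / real (Suc n)" for n
      using Rats_dense_in_real[of a "a + 1 / real (Suc n)"] by auto
    then obtain q where q: "\<And>n. q n \<in> \<rat>" "\<And>n. a < q n" "\<And>n. q n < a + 1 / real (Suc n)" by metis
    have ql: "q \<longlonglongrightarrow> a"
    proof (rule tendsto_sandwich[where f="\<lambda>_. a" and h="\<lambda>n. a + 1 / real (Suc n)"])
      show "(\<lambda>n. a + 1 / real (Suc n)) \<longlonglongrightarrow> a"
        using tendsto_add[OF tendsto_const LIMSEQ_inverse_real_of_nat, of a] by (simp add: inverse_eq_divide)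
      show "\<forall>\<^sub>F n in sequentially. a \<le> q n" using q(2) by (simp add: less_imp_le)
      show "\<forall>\<^sub>F n in sequentially. q n \<le> a + 1 / real (Suc n)" using q(3) by (simp add: less_imp_le del: of_nat_Suc)
    qed simp
    have "P (indicator ({..a} \<inter> E))"
    proof (rule lim[where F="\<lambda>n. indicator ({..q n} \<inter> E)" and c=1])
      show "P (indicator ({..q n} \<inter> E))" for n using PI eq q by simp
      fix x assume "x \<in> E"
      show "(\<lambda>n. indicator ({..q n} \<inter> E) x :: real) \<longlonglongrightarrow> indicator ({..a} \<inter> E) x"
      proof (cases "x \<le> a")
        case True
        then have "x \<le> q n" for n using q(2)[of n] by simp
        then show ?thesis using True \<open>x \<in> E\<close> by simp
      next
        case False
        then have "eventually (\<lambda>n. q n < x) sequentially"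
          using order_tendstoD(2)[OF ql] by simp
        then show ?thesis using False by (intro tendsto_eventually) (auto elim: eventually_mono)
      qed
    qed (auto intro!: bounded_borel_indicator rs)
    then show ?thesis using PI by simp
  qed
  have st: "Int_stable (range (\<lambda>a::real. {..a}))"
  proof (rule Int_stableI)
    fix a b :: "real set" assume "a \<in> range (\<lambda>a. {..a})" "b \<in> range (\<lambda>a. {..a})"
    then obtain c d where "a = {..c}" "b = {..d}" by auto
    then have "a \<inter> b = {..min c d}" by auto
    then show "a \<inter> b \<in> range (\<lambda>a. {..a})" by blast
  qed
  have sub: "sigma_sets UNIV (range (\<lambda>a::real. {..a})) = sets borel"
    by (simp add: borel_eq_atMost)
  have "P (indicator (B \<inter> E))"
    using st sub \<open>B \<in> sets borel\<close>
  proof (rule bounded_borel_pi_system_induct)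
    show "P (indicator (C \<inter> E))" if "C \<in> range (\<lambda>a::real. {..a})" for C
      using that real_case PI by auto
    show "P (indicator E)" using PI[of UNIV] total by simp
    show "P (\<lambda>x. a * f x + b * g x)"
      if "f \<in> bounded_borel E" "g \<in> bounded_borel E" "P f" "P g" for f g a b
      using that by (simp add: P_def signed_integral_lincomb[OF \<mu>] signed_integral_lincomb[OF \<nu>])
  qed (fact lim)
  then show "\<mu> A = \<nu> A" using PI \<open>B \<in> sets borel\<close> by (simp add: A)
qed

subsection \<open>Gaussian convolutions\<close>

lemma gauss_kernel_normal: "t > 0 \<Longrightarrow> gauss_kernel t x = normal_density 0 (sqrt t) x"
  by (simp add: gauss_kernel_def normal_density_def)

lemma gauss_kernel_shift_normal: "t > 0 \<Longrightarrow> gauss_kernel t (x - y) = normal_density x (sqrt t) y"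
  by (simp add: gauss_kernel_def normal_density_def power2_commute)

lemma gauss_kernel_measurable [measurable]: "(\<lambda>x. gauss_kernel (f x) (g x)) \<in> borel_measurable M"
  if [measurable]: "f \<in> borel_measurable M" "g \<in> borel_measurable M"
  unfolding gauss_kernel_def by measurable

lemma p_kernel_measurable [measurable]: "(\<lambda>x. p_kernel (f x) (g x) (k x)) \<in> borel_measurable M"
  if [measurable]: "f \<in> borel_measurable M" "g \<in> borel_measurable M" "k \<in> borel_measurable M"
  unfolding p_kernel_def by measurable

lemma k_density_measurable [measurable]: "(\<lambda>x. k_density (f x) (g x)) \<in> borel_measurable M"
  if [measurable]: "f \<in> borel_measurable M" "g \<in> borel_measurable M"
  unfolding k_density_def by measurable

lemma h_weight_measurable [measurable]: "(\<lambda>x. h_weight (f x)) \<in> borel_measurable M"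
  if [measurable]: "f \<in> borel_measurable M"
  unfolding h_weight_def by measurable

lemma gauss_kernel_nonneg [simp]: "0 \<le> t \<Longrightarrow> 0 \<le> gauss_kernel t x"
  unfolding gauss_kernel_def by simp

lemma gauss_kernel_minus [simp]: "gauss_kernel t (- x) = gauss_kernel t x"
  by (simp add: gauss_kernel_def)

lemma gauss_kernel_antimono: "t > 0 \<Longrightarrow> \<bar>x\<bar> \<le> \<bar>y\<bar> \<Longrightarrow> gauss_kernel t y \<le> gauss_kernel t x"
  unfolding gauss_kernel_def
  by (intro mult_left_mono) (auto simp: divide_right_mono abs_le_square_iff)

lemma integral_gauss_kernel:
  assumes "t > 0"
  shows "integrable lborel (\<lambda>y. gauss_kernel t (x - y))" "(\<integral>y. gauss_kernel t (x - y) \<partial>lborel) = 1"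
  using assms by (simp_all add: gauss_kernel_shift_normal)

text \<open>Translation by z reduces this to the convolution of two centred normal densities, whose
  variances add.\<close>

lemma gauss_kernel_convolution:
  assumes "s > 0" "t > 0"
  shows "(\<integral>y. gauss_kernel s (x - y) * gauss_kernel t (y - z) \<partial>lborel) = gauss_kernel (s + t) (x - z)"
proof -
  have "(\<integral>\<^sup>+y. ennreal (gauss_kernel s (x - y) * gauss_kernel t (y - z)) \<partial>lborel) =
    (\<integral>\<^sup>+y. ennreal (gauss_kernel s (x - (z + 1 * y)) * gauss_kernel t (z + 1 * y - z)) \<partial>lborel)"
    by (subst nn_integral_real_affine[where c=1 and t=z]) auto
  also have "\<dots> = (\<integral>\<^sup>+y. ennreal (normal_density 0 (sqrt s) (x - z - y) * normal_density 0 (sqrt t) y) \<partial>lborel)"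
    using assms by (intro nn_integral_cong) (simp add: gauss_kernel_normal algebra_simps)
  also have "\<dots> = normal_density 0 (sqrt ((sqrt s)\<^sup>2 + (sqrt t)\<^sup>2)) (x - z)"
    using conv_normal_density_zero_mean[of "sqrt s" "sqrt t"] assms by (metis real_sqrt_gt_0_iff)
  also have "\<dots> = ennreal (gauss_kernel (s + t) (x - z))"
    using assms by (simp add: gauss_kernel_normal)
  finally show ?thesis
    using assms by (intro integral_eq_nn_integral[THEN trans]) auto
qed

text \<open>The heat semigroup on the whole line. The absorbed semigroup is its restriction to odd
  functions.\<close>

definition gauss_op :: "real \<Rightarrow> (real \<Rightarrow> real) \<Rightarrow> real \<Rightarrow> real" where
  "gauss_op t u x = (\<integral>y. u y * gauss_kernel t (x - y) \<partial>lborel)"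

lemma gauss_op_integrable:
  assumes [measurable]: "u \<in> borel_measurable borel" and b: "\<And>y. \<bar>u y\<bar> \<le> c" and t: "t > 0"
  shows "integrable lborel (\<lambda>y. u y * gauss_kernel t (x - y))"
proof (rule Bochner_Integration.integrable_bound)
  show "integrable lborel (\<lambda>y. c * gauss_kernel t (x - y))" by (simp add: integral_gauss_kernel t)
  have "\<bar>u y\<bar> * gauss_kernel t (x - y) \<le> \<bar>c\<bar> * gauss_kernel t (x - y)" for y
    using b[of y] t by (intro mult_right_mono) auto
  then show "AE y in lborel. norm (u y * gauss_kernel t (x - y)) \<le> norm (c * gauss_kernel t (x - y))"
    using t by (simp add: abs_mult)
qed measurable

lemma gauss_op_measurable [measurable]:
  assumes [measurable]: "u \<in> borel_measurable borel"
  shows "gauss_op t u \<in> borel_measurable borel"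
  unfolding gauss_op_def[abs_def] by measurable

lemma gauss_op_bound:
  assumes [measurable]: "u \<in> borel_measurable borel" and b: "\<And>y. \<bar>u y\<bar> \<le> c" and t: "t > 0"
  shows "\<bar>gauss_op t u x\<bar> \<le> c"
proof -
  have "norm (gauss_op t u x) \<le> (\<integral>y. c * gauss_kernel t (x - y) \<partial>lborel)"
    unfolding gauss_op_def
  proof (rule Bochner_Integration.integral_norm_bound_integral)
    show "norm (u y * gauss_kernel t (x - y)) \<le> c * gauss_kernel t (x - y)" for y
      using b[of y] t by (auto simp: abs_mult intro!: mult_right_mono)
  qed (use gauss_op_integrable[OF assms] integral_gauss_kernel t in auto)
  then show ?thesis by (simp add: integral_gauss_kernel t)
qed

text \<open>The semigroup law of the kernel passes to functions by Fubini, the double integral being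
  absolutely convergent because u is bounded.\<close>

lemma gauss_op_add:
  assumes [measurable]: "u \<in> borel_measurable borel" and b: "\<And>y. \<bar>u y\<bar> \<le> c" and st: "s > 0" "t > 0"
  shows "gauss_op s (gauss_op t u) x = gauss_op (s + t) u x"
proof -
  have c0: "0 \<le> c" using b[of 0] by simp
  let ?f = "\<lambda>(y, z). u z * gauss_kernel t (y - z) * gauss_kernel s (x - y)"
  have int: "integrable (lborel \<Otimes>\<^sub>M lborel) ?f"
  proof (rule lborel_pair.Fubini_integrable)
    have "integrable lborel (\<lambda>y. gauss_op t (\<lambda>z. \<bar>u z\<bar>) y * gauss_kernel s (x - y))"
      by (rule gauss_op_integrable[where c=c]) (auto intro!: gauss_op_bound b st)
    moreover have "(\<integral>z. norm (?f (y, z)) \<partial>lborel) = gauss_op t (\<lambda>z. \<bar>u z\<bar>) y * gauss_kernel s (x - y)" for y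
      unfolding gauss_op_def using st by (simp add: abs_mult)
    ultimately show "integrable lborel (\<lambda>y. \<integral>z. norm (?f (y, z)) \<partial>lborel)" by simp
    show "AE y in lborel. integrable lborel (\<lambda>z. ?f (y, z))"
      using gauss_op_integrable[OF assms(1) b st(2)] by (auto intro!: integrable_mult_left)
  qed measurable
  have "gauss_op s (gauss_op t u) x = (\<integral>y. \<integral>z. u z * gauss_kernel t (y - z) * gauss_kernel s (x - y) \<partial>lborel \<partial>lborel)"
    unfolding gauss_op_def by simp
  also have "\<dots> = (\<integral>z. \<integral>y. u z * gauss_kernel t (y - z) * gauss_kernel s (x - y) \<partial>lborel \<partial>lborel)"
    using lborel_pair.Fubini_integral[OF int] by simp
  also have "\<dots> = (\<integral>z. u z * (\<integral>y. gauss_kernel s (x - y) * gauss_kernel t (y - z) \<partial>lborel) \<partial>lborel)"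
    by (subst integral_mult_right_zero[symmetric]) (simp add: ac_simps)
  also have "\<dots> = gauss_op (s + t) u x"
    by (simp add: gauss_kernel_convolution st gauss_op_def)
  finally show ?thesis .
qed

lemma gauss_op_odd:
  assumes "\<And>y. u (- y) = - u y"
  shows "gauss_op t u (- x) = - gauss_op t u x"
proof -
  have "gauss_op t u (- x) = (\<integral>y. u (- y) * gauss_kernel t (- x - (- y)) \<partial>lborel)"
    unfolding gauss_op_def by (subst lborel_integral_real_affine[where c="-1" and t=0]) simp_all
  also have "\<dots> = - gauss_op t u x"
    using gauss_kernel_minus[of t "x - y" for y] by (simp add: assms gauss_op_def)
  finally show ?thesis .
qed

text \<open>As \<open>sgn 0 = 0\<close>, the extension is odd at the origin too, whatever the value
  of f there.\<close>

definition odd_ext :: "(real \<Rightarrow> real) \<Rightarrow> real \<Rightarrow> real" where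
  "odd_ext f y = sgn y * f \<bar>y\<bar>"

lemma odd_ext_minus: "odd_ext f (- y) = - odd_ext f y"
  by (simp add: odd_ext_def)

text \<open>The reflection principle: the substitution y -> -y turns the subtracted kernel g(x + y)
  on the positive half-line into g(x - y) on the negative one, with the sign absorbed by the odd
  extension.\<close>

lemma p_kernel_integral_odd_ext:
  assumes int: "integrable lborel (\<lambda>y. odd_ext f y * gauss_kernel t (x - y))"
  shows "set_integrable lborel {0<..} (\<lambda>y. p_kernel t x y * f y)"
    "(LINT y:{0<..}|lborel. p_kernel t x y * f y) = gauss_op t (odd_ext f) x"
proof -
  let ?F = "\<lambda>y. odd_ext f y * gauss_kernel t (x - y)"
  have i1: "integrable lborel (\<lambda>y. indicator {0<..} y *\<^sub>R ?F y)"
    and i2: "integrable lborel (\<lambda>y. indicator {..<0} y *\<^sub>R ?F y)"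
    by (rule integrable_mult_indicator[OF _ int]; simp)+
  have i3: "integrable lborel (\<lambda>y. indicator {..<0} (- y) *\<^sub>R ?F (- y))"
    using i2 lborel_integrable_real_affine[of _ "-1" 0] by force
  have e: "indicator {0<..} y *\<^sub>R (p_kernel t x y * f y) =
      indicator {0<..} y *\<^sub>R ?F y + indicator {..<0} (- y) *\<^sub>R ?F (- y)" for y
    by (auto simp: odd_ext_def p_kernel_def algebra_simps split: split_indicator)
  show "set_integrable lborel {0<..} (\<lambda>y. p_kernel t x y * f y)"
    unfolding set_integrable_def e using i1 i3 by simp
  have "(LINT y:{0<..}|lborel. p_kernel t x y * f y) =
    (\<integral>y. indicator {0<..} y *\<^sub>R ?F y \<partial>lborel) + (\<integral>y. indicator {..<0} (- y) *\<^sub>R ?F (- y) \<partial>lborel)"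
    unfolding set_lebesgue_integral_def e using i1 i3 by simp
  also have "(\<integral>y. indicator {..<0} (- y) *\<^sub>R ?F (- y) \<partial>lborel) = (\<integral>y. indicator {..<0} y *\<^sub>R ?F y \<partial>lborel)"
    by (subst (2) lborel_integral_real_affine[where c="-1" and t=0]) simp_all
  also have "(\<integral>y. indicator {0<..} y *\<^sub>R ?F y \<partial>lborel) + \<dots> =
    (\<integral>y. indicator {0<..} y *\<^sub>R ?F y + indicator {..<0} y *\<^sub>R ?F y \<partial>lborel)"
    using i1 i2 by simp
  also have "\<dots> = gauss_op t (odd_ext f) x"
    unfolding gauss_op_def by (intro Bochner_Integration.integral_cong) (auto simp: odd_ext_def split: split_indicator)
  finally show "(LINT y:{0<..}|lborel. p_kernel t x y * f y) = gauss_op t (odd_ext f) x" .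
qed

subsection \<open>The semigroup T\<close>

lemma h_weight_le: "h_weight x \<le> x" "h_weight x \<le> 1"
  using exp_ge_add_one_self[of "-x"] by (auto simp: h_weight_def)

lemma h_weight_nonneg: "0 \<le> x \<Longrightarrow> 0 \<le> h_weight x"
  by (simp add: h_weight_def)

lemma h_weight_pos: "0 < x \<Longrightarrow> 0 < h_weight x"
  by (simp add: h_weight_def)

lemma h_weight_0 [simp]: "h_weight 0 = 0"
  by (simp add: h_weight_def)

lemma h_weight_mono: "x \<le> y \<Longrightarrow> h_weight x \<le> h_weight y"
  by (simp add: h_weight_def)

text \<open>Used in the form x / h(x) <= exp x, which controls the division by h near the
  origin.\<close>

lemma h_weight_ge: "x * exp (- x) \<le> h_weight x"
proof -
  have "(1 + x) * exp (- x) \<le> exp x * exp (- x)"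
    by (intro mult_right_mono) auto
  then show ?thesis by (simp add: h_weight_def algebra_simps flip: exp_add)
qed

lemma h_weight_deriv: "(h_weight has_real_derivative 1) (at 0)"
  unfolding h_weight_def[abs_def] by (auto intro!: derivative_eq_intros)

text \<open>The kernel of \<open>T\<close> with respect to Lebesgue measure; the value at \<open>x = 0\<close> is the limit as
  \<open>x\<close> tends to \<open>0\<close>.\<close>

definition T_density :: "real \<Rightarrow> real \<Rightarrow> real \<Rightarrow> real" where
  "T_density t x y =
    (if x = 0 then 2 * h_weight y * k_density t y else h_weight y * p_kernel t x y / h_weight x)"

lemma T_density_measurable [measurable]: "(\<lambda>x. T_density (f x) (g x) (k x)) \<in> borel_measurable M"
  if [measurable]: "f \<in> borel_measurable M" "g \<in> borel_measurable M" "k \<in> borel_measurable M"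
  unfolding T_density_def by measurable

text \<open>A test function is known to be measurable only on the half-line, whereas the Lebesgue
  integrals run over the line. Cutting at the open half-line changes nothing, since the kernels are
  integrated over it alone.\<close>

lemma bounded_borel_pos_measurable:
  fixes f :: "real \<Rightarrow> real"
  assumes "f \<in> bounded_borel {0..}"
  shows "(\<lambda>y. indicator {0<..} y * f y :: real) \<in> borel_measurable borel"
proof -
  have "(\<lambda>y. indicator {0..} y *\<^sub>R f y) \<in> borel_measurable borel"
    by (rule iffD1[OF borel_measurable_restrict_space_iff bounded_borel_measurable[OF assms]]) simp
  then have "(\<lambda>y. indicator {0<..} y * (indicator {0..} y *\<^sub>R f y)) \<in> borel_measurable borel"
    by (intro borel_measurable_times) auto
  also have "(\<lambda>y. indicator {0<..} y * (indicator {0..} y *\<^sub>R f y)) = (\<lambda>y. indicator {0<..} y * f y)"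
    by (auto split: split_indicator)
  finally show ?thesis .
qed

lemma k_density_nonneg: "t \<ge> 0 \<Longrightarrow> 0 \<le> y \<Longrightarrow> 0 \<le> k_density t y"
  by (simp add: k_density_def)

lemma kappa_integral:
  assumes f: "(\<lambda>y. indicator {0<..} y * f y :: real) \<in> borel_measurable borel" and t: "t \<ge> 0"
  shows "(\<integral>y. f y \<partial>kappa t) = (\<integral>y. indicator {0<..} y * (k_density t y * f y) \<partial>lborel)"
proof -
  have m: "f \<in> borel_measurable (restrict_space lborel {0<..})"
    by (rule iffD2[OF borel_measurable_restrict_space_iff]) (use f in simp_all)
  have [measurable]: "k_density t \<in> borel_measurable (restrict_space lborel {0<..})"
    by (rule measurable_restrict_space1) simp
  have "(\<integral>y. f y \<partial>kappa t) = (\<integral>y. k_density t y *\<^sub>R f y \<partial>restrict_space lborel {0<..})"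
    unfolding kappa_def using m t
    by (intro integral_density) (auto simp: space_restrict_space k_density_nonneg intro!: AE_I2)
  also have "\<dots> = (\<integral>y. indicator {0<..} y *\<^sub>R (k_density t y *\<^sub>R f y) \<partial>lborel)"
    by (rule integral_restrict_space) simp
  finally show ?thesis by simp
qed

lemma T_semigroup_density:
  assumes f: "f \<in> bounded_borel {0..}" and t: "t > 0"
  shows "T_semigroup t f x = (\<integral>y. T_density t x y * (indicator {0<..} y * f y) \<partial>lborel)"
proof (cases "x = 0")
  case True
  have "(\<lambda>y. h_weight y * (indicator {0<..} y * f y)) \<in> borel_measurable borel"
    using bounded_borel_pos_measurable[OF f] by measurable
  then have "(\<lambda>y. indicator {0<..} y * (h_weight y * f y)) \<in> borel_measurable borel"
    by (simp add: ac_simps)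
  then have "T_semigroup t f x = (\<integral>y. 2 * (indicator {0<..} y * (k_density t y * (h_weight y * f y))) \<partial>lborel)"
    using True t by (simp add: T_semigroup_def kappa_integral)
  then show ?thesis using True by (simp add: T_density_def ac_simps)
next
  case False
  then have "T_semigroup t f x = (\<integral>y. (indicator {0<..} y *\<^sub>R (p_kernel t x y * (h_weight y * f y))) / h_weight x \<partial>lborel)"
    using t by (simp add: T_semigroup_def absorbed_semigroup_def set_lebesgue_integral_def)
  then show ?thesis using False by (simp add: T_density_def ac_simps)
qed

lemma p_kernel_nonneg: "t > 0 \<Longrightarrow> 0 \<le> x \<Longrightarrow> 0 \<le> y \<Longrightarrow> 0 \<le> p_kernel t x y"
  unfolding p_kernel_def by (simp add: gauss_kernel_antimono)

lemma T_density_nonneg: "t > 0 \<Longrightarrow> 0 \<le> x \<Longrightarrow> 0 \<le> y \<Longrightarrow> 0 \<le> T_density t x y"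
  unfolding T_density_def by (simp add: p_kernel_nonneg k_density_nonneg h_weight_nonneg)

text \<open>Expanding the squares gives 2 g_t(y) exp(-x^2/2t) sinh(x y / t). The linear order of
  sinh at 0 exhibits the factor x that cancels against h(x).\<close>

lemma p_kernel_exp:
  assumes "t > 0"
  shows "p_kernel t x y = gauss_kernel t y * exp (- (x\<^sup>2 / (2 * t))) * (exp (x * y / t) - exp (- (x * y / t)))"
proof -
  have e: "exp (- ((x + a * y)\<^sup>2 / (2 * t))) = exp (- (y\<^sup>2 / (2 * t))) * exp (- (x\<^sup>2 / (2 * t))) * exp (- (a * (x * y / t)))"
    if "a\<^sup>2 = 1" for a
  proof -
    have "(x + a * y)\<^sup>2 = y\<^sup>2 + x\<^sup>2 + 2 * a * x * y"
      using that by (simp add: power2_sum power_mult_distrib)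
    then have "- ((x + a * y)\<^sup>2 / (2 * t)) = - (y\<^sup>2 / (2 * t)) + - (x\<^sup>2 / (2 * t)) + - (a * (x * y / t))"
      using assms by (simp add: field_simps)
    then show ?thesis by (simp only: exp_add)
  qed
  show ?thesis
    using e[of 1] e[of "-1"] unfolding p_kernel_def gauss_kernel_def
    by (simp add: diff_divide_distrib[symmetric] right_diff_distrib mult.commute mult.left_commute)
qed

text \<open>With a = x y / t, exp a - exp (-a) = exp a (1 - exp (-2a)), and the bracket is at most
  2a.\<close>

lemma p_kernel_le:
  assumes "t > 0" "0 \<le> x" "0 \<le> y"
  shows "p_kernel t x y \<le> gauss_kernel t y * (2 * (x * y / t) * exp (x * y / t))"
proof -
  define a where "a = x * y / t"
  have a0: "0 \<le> a" using assms by (simp add: a_def)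
  have "exp a - exp (- a) = exp a * (1 - exp (- (2 * a)))"
    by (simp add: algebra_simps flip: exp_add)
  also have "\<dots> \<le> exp a * (2 * a)"
    using exp_ge_add_one_self[of "- (2 * a)"] by (intro mult_left_mono) auto
  finally have "1 * (exp a - exp (- a)) \<le> 2 * a * exp a" by (simp add: ac_simps)
  moreover have "exp (- (x\<^sup>2 / (2 * t))) * (exp a - exp (- a)) \<le> 1 * (exp a - exp (- a))"
    using a0 assms by (intro mult_right_mono) auto
  ultimately have "gauss_kernel t y * (exp (- (x\<^sup>2 / (2 * t))) * (exp a - exp (- a))) \<le> gauss_kernel t y * (2 * a * exp a)"
    using assms by (intro mult_left_mono) auto
  then show ?thesis by (simp add: p_kernel_exp assms a_def ac_simps)
qed

text \<open>An upper bound for \<open>T_density t x y\<close> that is uniform over x in [0, R], as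
  dominated convergence in x requires. It is the bound of \<open>p_kernel_le\<close> with x replaced
  by R in the exponential; \<open>exp R\<close> bounds the remaining quotient x / h(x).\<close>

definition T_majorant :: "real \<Rightarrow> real \<Rightarrow> real \<Rightarrow> real" where
  "T_majorant t R y = 2 / t * exp R * (y * exp (R * y / t) * gauss_kernel t y)"

lemma T_density_le_majorant:
  assumes "t > 0" "0 \<le> x" "x \<le> R" "0 \<le> y"
  shows "T_density t x y \<le> T_majorant t R y"
proof (cases "x = 0")
  case True
  have "h_weight y * (y * gauss_kernel t y / t) \<le> 1 * (y * gauss_kernel t y / t)"
    using assms h_weight_le by (intro mult_right_mono) auto
  also have "\<dots> \<le> exp R * exp (R * y / t) * (y * gauss_kernel t y / t)"
  proof (rule mult_right_mono)
    have "1 * 1 \<le> exp R * exp (R * y / t)"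
      using assms by (intro mult_mono) auto
    then show "1 \<le> exp R * exp (R * y / t)" by simp
  qed (use assms in auto)
  finally have "2 * (h_weight y * (y * gauss_kernel t y / t)) \<le> 2 * (exp R * exp (R * y / t) * (y * gauss_kernel t y / t))"
    by simp
  then show ?thesis using True by (simp add: T_density_def k_density_def T_majorant_def ac_simps)
next
  case False
  then have x: "0 < x" using assms by simp
  have hx: "0 < h_weight x" using x by (rule h_weight_pos)
  have "x \<le> exp x * h_weight x"
    using mult_left_mono[OF h_weight_ge[of x], of "exp x"] by (simp add: ac_simps flip: exp_add)
  also have "\<dots> \<le> exp R * h_weight x" using assms hx by (intro mult_right_mono) auto
  finally have xh: "x / h_weight x \<le> exp R" using hx by (simp add: field_simps)
  have ey: "exp (x * y / t) \<le> exp (R * y / t)"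
    using assms by (simp add: divide_right_mono mult_right_mono)
  have "h_weight y * p_kernel t x y / h_weight x \<le> 1 * (gauss_kernel t y * (2 * (x * y / t) * exp (x * y / t))) / h_weight x"
    using assms hx h_weight_le h_weight_nonneg[of y] p_kernel_nonneg[of t x y]
    by (intro divide_right_mono mult_mono p_kernel_le) auto
  also have "\<dots> = (x / h_weight x) * exp (x * y / t) * (gauss_kernel t y * (2 * (y / t)))"
    by (simp add: ac_simps)
  also have "\<dots> \<le> exp R * exp (R * y / t) * (gauss_kernel t y * (2 * (y / t)))"
    using xh ey assms x hx by (intro mult_right_mono mult_mono) auto
  finally show ?thesis using False by (simp add: T_density_def T_majorant_def ac_simps)
qed

text \<open>Completing the square, exp(R y / t) g_t(y) is a multiple of the normal density centred
  at R, so the majorant is the integrand of a first moment.\<close>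

lemma T_majorant_integrable:
  assumes t: "t > 0"
  shows "integrable lborel (\<lambda>y. T_majorant t R y * indicator {0<..} y)"
proof -
  have "exp (R * y / t) * gauss_kernel t y = exp (R\<^sup>2 / (2 * t)) * normal_density R (sqrt t) y" for y
  proof -
    have "R * y / t + - (y\<^sup>2 / (2 * t)) = R\<^sup>2 / (2 * t) + - ((y - R)\<^sup>2 / (2 * t))"
      using t by (simp add: field_simps power2_eq_square)
    then have "exp (R * y / t) * exp (- (y\<^sup>2 / (2 * t))) = exp (R\<^sup>2 / (2 * t)) * exp (- ((y - R)\<^sup>2 / (2 * t)))"
      by (simp only: flip: exp_add)
    then show ?thesis using t by (simp add: gauss_kernel_def normal_density_def)
  qed
  then have "T_majorant t R y = 2 / t * exp R * exp (R\<^sup>2 / (2 * t)) * (normal_density R (sqrt t) y * y)" for y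
    unfolding T_majorant_def by (simp add: mult.assoc)
  moreover have "integrable lborel (\<lambda>y. normal_density R (sqrt t) y * y)"
    using t by (intro integrable_normal_moment_nz_1) simp
  ultimately have "integrable lborel (\<lambda>y. T_majorant t R y)" by simp
  then show ?thesis by (intro integrable_real_mult_indicator) auto
qed

lemma exp1_ge_2: "2 \<le> exp (1::real)"
  using exp_ge_add_one_self[of "1::real"] by simp

lemma T_density_integrable:
  assumes t: "t > 0" and x: "0 \<le> x"
  shows "integrable lborel (\<lambda>y. T_density t x y * indicator {0<..} y)"
proof (rule Bochner_Integration.integrable_bound[OF T_majorant_integrable[OF t, of x]])
  show "AE y in lborel. norm (T_density t x y * indicator {0<..} y) \<le> norm (T_majorant t x y * indicator {0<..} y)"
  proof (rule AE_I2)
    show "norm (T_density t x y * indicator {0<..} y) \<le> norm (T_majorant t x y * indicator {0<..} y)" for y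
      using T_density_le_majorant[OF t x order_refl, of y] T_density_nonneg[OF t x, of y]
      by (cases "0 < y") auto
  qed
qed measurable

lemma odd_ext_h_bound: "\<bar>odd_ext h_weight y\<bar> \<le> 1"
  using h_weight_le(2)[of "\<bar>y\<bar>"] h_weight_nonneg[of "\<bar>y\<bar>"]
  by (auto simp: odd_ext_def abs_mult sgn_if)

lemma odd_ext_h_measurable [measurable]: "odd_ext h_weight \<in> borel_measurable borel"
  unfolding odd_ext_def[abs_def] by measurable

text \<open>The function x is invariant under the absorbed semigroup: it is its own odd extension,
  and a normal law has its centre as mean. Hence h(y) <= min y 1 gives P_t h(x) <= min x 1, which is
  at most e h(x). At x = 0, h(y) <= y leaves 2/t times the second moment t, and 2 <= e. What matters
  is a bound uniform in t and x.\<close>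

lemma T_density_mass:
  assumes t: "t > 0" and x: "0 \<le> x"
  shows "(\<integral>y. T_density t x y * indicator {0<..} y \<partial>lborel) \<le> exp 1"
proof (cases "x = 0")
  case True
  have m: "has_bochner_integral lborel (\<lambda>y. normal_density 0 (sqrt t) y * (y - 0) ^ (2 * 1)) (fact (2 * 1) / ((2 / (sqrt t)\<^sup>2) ^ 1 * fact 1))"
    using t by (intro normal_moment_even) simp
  then have m: "has_bochner_integral lborel (\<lambda>y. gauss_kernel t y * y\<^sup>2) t"
    using t by (simp add: gauss_kernel_normal)
  have "(\<integral>y. T_density t x y * indicator {0<..} y \<partial>lborel) \<le> (\<integral>y. 2 / t * (gauss_kernel t y * y\<^sup>2) \<partial>lborel)"
  proof (rule integral_mono)
    show "integrable lborel (\<lambda>y. 2 / t * (gauss_kernel t y * y\<^sup>2))" using m by (intro integrable_mult_right) (rule integrable.intros)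
    fix y :: real
    show "T_density t x y * indicator {0<..} y \<le> 2 / t * (gauss_kernel t y * y\<^sup>2)"
    proof (cases "0 < y")
      case pos: True
      have "T_density t x y = 2 * (h_weight y * (y * gauss_kernel t y / t))"
        by (simp add: True T_density_def k_density_def)
      also have "\<dots> \<le> 2 * (y * (y * gauss_kernel t y / t))"
        using pos t h_weight_le by (intro mult_left_mono mult_right_mono) auto
      also have "\<dots> = 2 / t * (gauss_kernel t y * y\<^sup>2)" by (simp add: power2_eq_square)
      finally show ?thesis using pos by simp
    qed (use t in simp)
  qed (rule T_density_integrable[OF t x])
  also have "\<dots> = 2" using m t by (simp add: has_bochner_integral_integral_eq)
  finally show ?thesis using exp1_ge_2 by linarith
next
  case False
  then have x: "0 < x" using x by simp
  have hx: "0 < h_weight x" using x by (rule h_weight_pos)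
  have i1: "set_integrable lborel {0<..} (\<lambda>y. p_kernel t x y * h_weight y)"
    and e1: "(LINT y:{0<..}|lborel. p_kernel t x y * h_weight y) = gauss_op t (odd_ext h_weight) x"
    using p_kernel_integral_odd_ext[OF gauss_op_integrable[OF odd_ext_h_measurable odd_ext_h_bound t]] by auto
  have oid: "odd_ext (\<lambda>y. y) y = y" for y by (simp add: odd_ext_def sgn_mult_abs)
  have in2: "integrable lborel (\<lambda>y. odd_ext (\<lambda>y. y) y * gauss_kernel t (x - y))"
    using integrable_normal_moment_nz_1[of "sqrt t" x] t by (simp add: oid gauss_kernel_shift_normal mult.commute)
  have i2: "set_integrable lborel {0<..} (\<lambda>y. p_kernel t x y * y)"
    and e2: "(LINT y:{0<..}|lborel. p_kernel t x y * y) = gauss_op t (odd_ext (\<lambda>y. y)) x"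
    using p_kernel_integral_odd_ext[OF in2] by auto
  have "gauss_op t (odd_ext (\<lambda>y. y)) x = (\<integral>y. normal_density x (sqrt t) y * y \<partial>lborel)"
    using t unfolding gauss_op_def by (simp add: oid gauss_kernel_shift_normal mult.commute)
  also have "\<dots> = x" using normal_moment_nz_1[of "sqrt t" x] t by (simp add: has_bochner_integral_integral_eq)
  finally have e2: "(LINT y:{0<..}|lborel. p_kernel t x y * y) = x" using e2 by simp
  have "(LINT y:{0<..}|lborel. p_kernel t x y * h_weight y) \<le> (LINT y:{0<..}|lborel. p_kernel t x y * y)"
    by (intro set_integral_mono i1 i2 mult_left_mono) (use t x h_weight_le p_kernel_nonneg in auto)
  then have le1: "gauss_op t (odd_ext h_weight) x \<le> x" using e1 e2 by simp
  have le2: "gauss_op t (odd_ext h_weight) x \<le> 1"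
    using gauss_op_bound[OF odd_ext_h_measurable odd_ext_h_bound t, of x] by auto
  have "gauss_op t (odd_ext h_weight) x \<le> exp 1 * h_weight x"
  proof (cases "x \<le> 1")
    case True
    have "x = exp x * (x * exp (- x))" by (simp flip: exp_add add: ac_simps)
    also have "\<dots> \<le> exp 1 * h_weight x"
      using True h_weight_ge[of x] hx x by (intro mult_mono) auto
    finally show ?thesis using le1 by simp
  next
    case False
    have "1 = exp 1 * (1 * exp (- 1 :: real))" by (simp flip: exp_add)
    also have "\<dots> \<le> exp 1 * h_weight x"
      using False h_weight_ge[of 1] h_weight_mono[of 1 x] by (intro mult_left_mono) auto
    finally show ?thesis using le2 by simp
  qed
  moreover have "(\<integral>y. T_density t x y * indicator {0<..} y \<partial>lborel) = gauss_op t (odd_ext h_weight) x / h_weight x"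
    using False unfolding e1[symmetric] set_lebesgue_integral_def
    by (simp add: T_density_def ac_simps flip: Bochner_Integration.integral_divide_zero)
  ultimately show ?thesis using hx by (simp only: pos_divide_le_eq)
qed

lemma T_semigroup_0 [simp]: "T_semigroup 0 f = f"
  by (auto simp: T_semigroup_def)

lemma T_semigroup_integrable:
  assumes f: "f \<in> bounded_borel {0..}" and t: "t > 0" and x: "0 \<le> x"
  shows "integrable lborel (\<lambda>y. T_density t x y * (indicator {0<..} y * f y))"
proof -
  obtain c where c: "0 \<le> c" "\<And>x. x \<in> {0..} \<Longrightarrow> \<bar>f x\<bar> \<le> c" using bounded_borelE[OF f] by metis
  note [measurable] = bounded_borel_pos_measurable[OF f]
  show ?thesis
  proof (rule Bochner_Integration.integrable_bound)
    show "integrable lborel (\<lambda>y. c * (T_density t x y * indicator {0<..} y))"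
      using T_density_integrable[OF t x] by simp
    show "AE y in lborel. norm (T_density t x y * (indicator {0<..} y * f y)) \<le> norm (c * (T_density t x y * indicator {0<..} y))"
    proof (rule AE_I2)
      fix y :: real
      show "norm (T_density t x y * (indicator {0<..} y * f y)) \<le> norm (c * (T_density t x y * indicator {0<..} y))"
      proof (cases "0 < y")
        case True
        have "\<bar>T_density t x y\<bar> * \<bar>f y\<bar> \<le> \<bar>T_density t x y\<bar> * c"
          using c True by (intro mult_left_mono) auto
        then show ?thesis using True c(1) by (simp add: abs_mult mult.commute)
      qed simp
    qed
  qed measurable
qed

lemma T_semigroup_bound:
  assumes f: "f \<in> bounded_borel {0..}" and c: "\<And>x. x \<in> {0..} \<Longrightarrow> \<bar>f x\<bar> \<le> c" and t: "t \<ge> 0" and x: "0 \<le> x"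
  shows "\<bar>T_semigroup t f x\<bar> \<le> exp 1 * c"
proof (cases "t = 0")
  case True
  have "\<bar>f x\<bar> \<le> c" using c x by auto
  then have "1 * \<bar>f x\<bar> \<le> exp 1 * c" by (intro mult_mono) auto
  then show ?thesis using True by simp
next
  case False
  then have t: "t > 0" using t by simp
  have c0: "0 \<le> c" using c[of 0] by simp
  have "norm (T_semigroup t f x) \<le> (\<integral>y. c * (T_density t x y * indicator {0<..} y) \<partial>lborel)"
    unfolding T_semigroup_density[OF f t]
  proof (rule Bochner_Integration.integral_norm_bound_integral)
    show "norm (T_density t x y * (indicator {0<..} y * f y)) \<le> c * (T_density t x y * indicator {0<..} y)" for y
    proof (cases "0 < y")
      case True
      have "T_density t x y * \<bar>f y\<bar> \<le> T_density t x y * c"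
        using c[of y] True T_density_nonneg[OF t x, of y] by (intro mult_left_mono) auto
      then show ?thesis using True T_density_nonneg[OF t x, of y] by (simp add: abs_mult mult.commute)
    qed simp
  qed (use T_density_integrable[OF t x] T_semigroup_integrable[OF f t x] in auto)
  also have "\<dots> \<le> c * exp 1"
    using T_density_mass[OF t x] c0 by (simp add: mult_left_mono)
  finally show ?thesis by (simp add: mult.commute)
qed

text \<open>At x = 0 both p_t(x, y) and h(x) vanish, so the limit is a quotient of derivatives: the
  x-derivative of p_t(x, y) at 0 is 2 k_t(y), and h'(0) = 1. This is the origin of the factor 2 in
  T_t f(0).\<close>

lemma T_density_continuous:
  assumes t: "t > 0" and y: "0 < y"
  shows "continuous_on {0..} (\<lambda>x. T_density t x y)"
  unfolding continuous_on_def
proof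
  fix x :: real assume "x \<in> {0..}"
  then have "0 \<le> x" by simp
  show "((\<lambda>x. T_density t x y) \<longlongrightarrow> T_density t x y) (at x within {0..})"
  proof (cases "x = 0")
    case True
    have "((\<lambda>x. p_kernel t x y) has_real_derivative 2 * k_density t y) (at 0)"
      unfolding p_kernel_def gauss_kernel_def k_density_def
      using t by (auto intro!: derivative_eq_intros simp: field_simps power2_eq_square)
    then have "((\<lambda>x. (p_kernel t x y - p_kernel t 0 y) / (x - 0)) \<longlongrightarrow> 2 * k_density t y) (at 0)"
      by (simp only: has_field_derivative_iff)
    moreover have "p_kernel t 0 y = 0" by (simp add: p_kernel_def)
    ultimately have l1: "((\<lambda>x. p_kernel t x y / x) \<longlongrightarrow> 2 * k_density t y) (at 0)" by simp
    have l2: "((\<lambda>x. h_weight x / x) \<longlongrightarrow> 1) (at 0)"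
      using h_weight_deriv by (simp add: has_field_derivative_iff)
    have "((\<lambda>x. h_weight y * ((p_kernel t x y / x) / (h_weight x / x))) \<longlongrightarrow> h_weight y * (2 * k_density t y / 1)) (at 0)"
      by (intro tendsto_intros l1 l2) simp
    then have "((\<lambda>x. T_density t x y) \<longlongrightarrow> T_density t 0 y) (at 0)"
      by (rule filterlim_cong[THEN iffD1, rotated -1])
        (auto simp: T_density_def eventually_at_filter ac_simps intro!: always_eventually)
    then show ?thesis using True by (metis tendsto_within_subset subset_UNIV)
  next
    case False
    then have x: "0 < x" using \<open>0 \<le> x\<close> by simp
    have "isCont (\<lambda>x. h_weight y * p_kernel t x y / h_weight x) x"
      unfolding p_kernel_def gauss_kernel_def h_weight_def
      using x t by (intro continuous_intros) auto
    then have "((\<lambda>x. h_weight y * p_kernel t x y / h_weight x) \<longlongrightarrow> h_weight y * p_kernel t x y / h_weight x) (at x)"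
      by (simp add: isCont_def)
    then have "((\<lambda>x. T_density t x y) \<longlongrightarrow> T_density t x y) (at x)"
    proof (rule filterlim_cong[THEN iffD1, rotated -1])
      have "\<forall>\<^sub>F x' in nhds x. 0 < x'" using x by (intro eventually_nhds_in_open[of "{0<..}", simplified]) auto
      then show "\<forall>\<^sub>F x in at x. h_weight y * p_kernel t x y / h_weight x = T_density t x y"
        unfolding eventually_at_filter by (rule eventually_mono) (simp add: T_density_def)
    qed (use False in \<open>simp_all add: T_density_def\<close>)
    then show ?thesis by (metis tendsto_within_subset subset_UNIV)
  qed
qed

text \<open>The strong Feller property, by dominated convergence: a convergent sequence of starting
  points stays in some [0, R], where \<open>T_majorant\<close> applies. It also carries identities
  from x > 0 to x = 0.\<close>

lemma T_semigroup_continuous: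
  assumes f: "f \<in> bounded_borel {0..}" and t: "t > 0"
  shows "T_semigroup t f \<in> bounded_continuous {0..}"
proof -
  obtain c where c: "0 \<le> c" "\<And>x. x \<in> {0..} \<Longrightarrow> \<bar>f x\<bar> \<le> c" using bounded_borelE[OF f] by metis
  note [measurable] = bounded_borel_pos_measurable[OF f]
  have "continuous_on {0..} (T_semigroup t f)"
    unfolding continuous_on_sequentially
  proof (intro allI ballI impI)
    fix X :: "nat \<Rightarrow> real" and x :: real
    assume "x \<in> {0..}" and X: "(\<forall>n. X n \<in> {0..}) \<and> X \<longlonglongrightarrow> x"
    obtain R where R: "\<And>n. \<bar>X n\<bar> \<le> R"
      using X convergent_imp_bounded[of X x] by (auto simp: bounded_iff)
    have "(\<lambda>n. \<integral>y. T_density t (X n) y * (indicator {0<..} y * f y) \<partial>lborel) \<longlonglongrightarrow>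
        (\<integral>y. T_density t x y * (indicator {0<..} y * f y) \<partial>lborel)"
    proof (rule integral_dominated_convergence)
      show "integrable lborel (\<lambda>y. c * (T_majorant t R y * indicator {0<..} y))"
        using T_majorant_integrable[OF t] by simp
      show "AE y in lborel. (\<lambda>n. T_density t (X n) y * (indicator {0<..} y * f y)) \<longlonglongrightarrow> T_density t x y * (indicator {0<..} y * f y)"
      proof (rule AE_I2)
        fix y :: real
        show "(\<lambda>n. T_density t (X n) y * (indicator {0<..} y * f y)) \<longlonglongrightarrow> T_density t x y * (indicator {0<..} y * f y)"
        proof (cases "0 < y")
          case True
          have "(\<lambda>n. T_density t (X n) y) \<longlonglongrightarrow> T_density t x y"
            using T_density_continuous[OF t True] X \<open>x \<in> {0..}\<close> unfolding continuous_on_sequentially comp_def by blast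
          then show ?thesis by (intro tendsto_mult tendsto_const)
        qed simp
      qed
      show "AE y in lborel. norm (T_density t (X n) y * (indicator {0<..} y * f y)) \<le> c * (T_majorant t R y * indicator {0<..} y)" for n
      proof (rule AE_I2)
        fix y :: real
        show "norm (T_density t (X n) y * (indicator {0<..} y * f y)) \<le> c * (T_majorant t R y * indicator {0<..} y)"
        proof (cases "0 < y")
          case True
          have "X n \<in> {0..}" using X by auto
          then have "\<bar>T_density t (X n) y\<bar> \<le> T_majorant t R y"
            using T_density_nonneg[OF t, of "X n" y] T_density_le_majorant[OF t, of "X n" R y] R[of n] True by auto
          moreover have "\<bar>f y\<bar> \<le> c" using c True by auto
          ultimately have "\<bar>T_density t (X n) y\<bar> * \<bar>f y\<bar> \<le> T_majorant t R y * c"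
            by (intro mult_mono) auto
          then show ?thesis using True by (simp add: abs_mult mult.commute)
        qed simp
      qed
    qed measurable
    then show "(T_semigroup t f \<circ> X) \<longlonglongrightarrow> T_semigroup t f x"
      by (simp add: comp_def T_semigroup_density[OF f t])
  qed
  then show ?thesis
    using T_semigroup_bound[OF f c(2), of t] t by (auto simp: bounded_continuous_def bounded_iff)
qed

lemma T_semigroup_bounded_borel:
  assumes "f \<in> bounded_borel {0..}" "t \<ge> 0"
  shows "T_semigroup t f \<in> bounded_borel {0..}"
  using T_semigroup_continuous[OF assms(1), of t] bounded_continuous_subset[of "{0::real..}"] assms by (cases "t = 0") auto

lemma T_semigroup_bounded_continuous:
  assumes "f \<in> bounded_continuous {0..}" "t \<ge> 0"
  shows "T_semigroup t f \<in> bounded_continuous {0..}"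
  using T_semigroup_continuous[of f t] bounded_continuous_subset[of "{0::real..}"] assms by (cases "t = 0") auto

text \<open>For x > 0, T is the heat semigroup on odd functions conjugated by h.\<close>

lemma T_semigroup_gauss_op:
  assumes f: "f \<in> bounded_borel {0..}" and t: "t > 0" and x: "0 < x"
  shows "odd_ext (\<lambda>y. h_weight y * f y) \<in> borel_measurable borel"
    and "\<exists>c. \<forall>y. \<bar>odd_ext (\<lambda>y. h_weight y * f y) y\<bar> \<le> c"
    and "T_semigroup t f x = gauss_op t (odd_ext (\<lambda>y. h_weight y * f y)) x / h_weight x"
proof -
  let ?u = "odd_ext (\<lambda>y. h_weight y * f y)"
  obtain c where c: "0 \<le> c" "\<And>x. x \<in> {0..} \<Longrightarrow> \<bar>f x\<bar> \<le> c" using bounded_borelE[OF f] by metis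
  note m = bounded_borel_pos_measurable[OF f]
  have "?u = (\<lambda>y. sgn y * (h_weight \<bar>y\<bar> * (\<lambda>y. indicator {0<..} y * f y) \<bar>y\<bar>))"
    by (auto simp: odd_ext_def fun_eq_iff sgn_if)
  also have "\<dots> \<in> borel_measurable borel"
    by (intro borel_measurable_times measurable_compose[OF _ m]) measurable
  finally show mu: "?u \<in> borel_measurable borel" .
  have bu: "\<bar>?u y\<bar> \<le> c" for y
  proof -
    have "\<bar>h_weight \<bar>y\<bar>\<bar> * \<bar>f \<bar>y\<bar>\<bar> \<le> 1 * c"
      using h_weight_le(2)[of "\<bar>y\<bar>"] h_weight_nonneg[of "\<bar>y\<bar>"] c by (intro mult_mono) auto
    then show ?thesis using c(1) by (auto simp: odd_ext_def abs_mult sgn_if)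
  qed
  then show "\<exists>c. \<forall>y. \<bar>?u y\<bar> \<le> c" by blast
  have "(LINT y:{0<..}|lborel. p_kernel t x y * (h_weight y * f y)) = gauss_op t ?u x"
    by (rule p_kernel_integral_odd_ext(2)[OF gauss_op_integrable[OF mu bu t]])
  then show "T_semigroup t f x = gauss_op t ?u x / h_weight x"
    using x t by (simp add: T_semigroup_def absorbed_semigroup_def)
qed

text \<open>Gaussian convolution preserves oddness, so the odd extension of h T_t f is again the
  convolution of the odd extension of h f. For x > 0 the claim is then the semigroup law of
  \<open>gauss_op\<close>; x = 0 follows by right continuity of both sides.\<close>

lemma T_semigroup_add:
  assumes f: "f \<in> bounded_borel {0..}" and s: "s \<ge> 0" and t: "t \<ge> 0" and x: "0 \<le> x"
  shows "T_semigroup s (T_semigroup t f) x = T_semigroup (s + t) f x"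
proof (cases "s = 0 \<or> t = 0")
  case True
  then show ?thesis by auto
next
  case False
  then have st: "s > 0" "t > 0" "s + t > 0" using s t by auto
  let ?u = "odd_ext (\<lambda>y. h_weight y * f y)"
  have Tf: "T_semigroup t f \<in> bounded_borel {0..}" by (rule T_semigroup_bounded_borel[OF f t])
  have pos: "T_semigroup s (T_semigroup t f) x = T_semigroup (s + t) f x" if x: "0 < x" for x
  proof -
    obtain c where c: "\<And>y. \<bar>?u y\<bar> \<le> c" using T_semigroup_gauss_op(2)[OF f st(2) x] by blast
    have mu: "?u \<in> borel_measurable borel" by (rule T_semigroup_gauss_op(1)[OF f st(2) x])
    have odd: "gauss_op t ?u (- y) = - gauss_op t ?u y" for y
      by (rule gauss_op_odd) (rule odd_ext_minus)
    have pos: "h_weight y * T_semigroup t f y = gauss_op t ?u y" if "0 < y" for y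
      using h_weight_pos[OF that] T_semigroup_gauss_op(3)[OF f st(2) that] by simp
    have "odd_ext (\<lambda>y. h_weight y * T_semigroup t f y) y = gauss_op t ?u y" for y
    proof -
      consider "0 < y" | "y = 0" | "0 < - y" by linarith
      then show ?thesis
      proof cases
        case 1
        then show ?thesis using pos by (simp add: odd_ext_def)
      next
        case 2
        then show ?thesis using odd[of 0] by (simp add: odd_ext_def)
      next
        case 3
        then show ?thesis using pos[OF 3] odd[of y] by (simp add: odd_ext_def)
      qed
    qed
    then have "odd_ext (\<lambda>y. h_weight y * T_semigroup t f y) = gauss_op t ?u" by auto
    then have "T_semigroup s (T_semigroup t f) x = gauss_op s (gauss_op t ?u) x / h_weight x"
      using T_semigroup_gauss_op(3)[OF Tf st(1) x] by simp
    also have "gauss_op s (gauss_op t ?u) x = gauss_op (s + t) ?u x"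
      by (rule gauss_op_add[OF mu c st(1,2)])
    also have "\<dots> / h_weight x = T_semigroup (s + t) f x"
      using T_semigroup_gauss_op(3)[OF f st(3) x] by simp
    finally show ?thesis .
  qed
  show ?thesis
  proof (cases "x = 0")
    case True
    have X: "(\<lambda>n. inverse (real (Suc n))) \<longlonglongrightarrow> 0" by (rule LIMSEQ_inverse_real_of_nat)
    have lim: "(\<lambda>n. g (inverse (real (Suc n)))) \<longlonglongrightarrow> g 0" if "g \<in> bounded_continuous {0..}" for g :: "real \<Rightarrow> real"
    proof (rule continuous_on_tendsto_compose[OF _ X])
      show "continuous_on {0..} g" using that by (simp add: bounded_continuous_def)
    qed auto
    have "(\<lambda>n. T_semigroup s (T_semigroup t f) (inverse (real (Suc n)))) \<longlonglongrightarrow> T_semigroup s (T_semigroup t f) 0"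
      by (rule lim) (rule T_semigroup_continuous[OF Tf st(1)])
    moreover have "(\<lambda>n. T_semigroup (s + t) f (inverse (real (Suc n)))) \<longlonglongrightarrow> T_semigroup (s + t) f 0"
      by (rule lim) (rule T_semigroup_continuous[OF f st(3)])
    ultimately show ?thesis using True pos by (simp add: LIMSEQ_unique)
  qed (use pos x in simp)
qed

text \<open>The image under g of the measure with density D with respect to the product of \<nu> and
  Lebesgue measure. All measures constructed later are of this kind: duals of T_t, superpositions of
  entrance laws, and h(x) Y_t(dx).\<close>

lemma mixture_measure:
  fixes D :: "'b \<Rightarrow> real \<Rightarrow> real"
  assumes fin: "finite_measure \<nu>"
    and [measurable]: "case_prod D \<in> borel_measurable (\<nu> \<Otimes>\<^sub>M lborel)"
    and D0: "\<And>s z. s \<in> space \<nu> \<Longrightarrow> 0 \<le> D s z"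
    and Dint: "\<And>s. s \<in> space \<nu> \<Longrightarrow> integrable lborel (D s)"
    and DC: "\<And>s. s \<in> space \<nu> \<Longrightarrow> (\<integral>z. D s z \<partial>lborel) \<le> C"
    and g[measurable]: "case_prod g \<in> measurable (\<nu> \<Otimes>\<^sub>M lborel) (restrict_space borel E)"
  shows "\<exists>p\<in>finite_measures E. \<forall>f\<in>bounded_borel E.
    (\<integral>x. f x \<partial>p) = (\<integral>s. (\<integral>z. D s z * f (g s z) \<partial>lborel) \<partial>\<nu>)"
proof -
  interpret finite_measure \<nu> by fact
  interpret pair_sigma_finite \<nu> lborel ..
  let ?P = "\<nu> \<Otimes>\<^sub>M (lborel :: real measure)"
  define p where "p = distr (density ?P (\<lambda>x. ennreal (case_prod D x))) (restrict_space borel E) (case_prod g)"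
  have sp: "sets p = sets (restrict_space borel E)" by (simp add: p_def)
  have "emeasure p (space p) = emeasure (density ?P (\<lambda>x. ennreal (case_prod D x))) (space ?P)"
    unfolding p_def by (subst emeasure_distr) (auto intro!: arg_cong2[where f=emeasure] dest: measurable_space[OF g])
  also have "\<dots> = (\<integral>\<^sup>+x. ennreal (case_prod D x) \<partial>?P)"
    by (subst emeasure_density[OF _ sets.top]) (auto intro!: nn_integral_cong)
  also have "\<dots> = (\<integral>\<^sup>+s. \<integral>\<^sup>+z. ennreal (D s z) \<partial>lborel \<partial>\<nu>)"
    by (subst lborel.nn_integral_fst[symmetric]) auto
  also have "\<dots> \<le> (\<integral>\<^sup>+s. ennreal C \<partial>\<nu>)"
  proof (rule nn_integral_mono)
    fix s assume s: "s \<in> space \<nu>"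
    have "(\<integral>\<^sup>+z. ennreal (D s z) \<partial>lborel) = ennreal (\<integral>z. D s z \<partial>lborel)"
      using D0 Dint s by (intro nn_integral_eq_integral) auto
    then show "(\<integral>\<^sup>+z. ennreal (D s z) \<partial>lborel) \<le> ennreal C" using DC[OF s] by (simp add: ennreal_leI)
  qed
  also have "\<dots> < \<infinity>" by (simp add: emeasure_eq_measure ennreal_mult_eq_top_iff less_top[symmetric])
  finally have "emeasure p (space p) \<noteq> \<infinity>" by simp
  then have p: "p \<in> finite_measures E" using sp by (auto simp: finite_measures_def intro: finite_measureI)
  have "(\<integral>x. f x \<partial>p) = (\<integral>s. (\<integral>z. D s z * f (g s z) \<partial>lborel) \<partial>\<nu>)" if f: "f \<in> bounded_borel E" for f
  proof -
    have [measurable]: "f \<in> borel_measurable (restrict_space borel E)" by (rule bounded_borel_measurable[OF f])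
    have D0': "AE x in ?P. 0 \<le> case_prod D x"
      by (rule AE_I2) (auto simp: space_pair_measure D0)
    have "integrable p f" by (rule integrable_bounded_borel[OF p f])
    then have "integrable (density ?P (\<lambda>x. ennreal (case_prod D x))) (\<lambda>x. f (case_prod g x))"
      unfolding p_def by (subst (asm) integrable_distr_eq) auto
    then have i: "integrable ?P (\<lambda>x. case_prod D x *\<^sub>R f (case_prod g x))"
      using D0' by (subst (asm) integrable_density) auto
    have "(\<integral>x. f x \<partial>p) = (\<integral>x. case_prod D x *\<^sub>R f (case_prod g x) \<partial>?P)"
      unfolding p_def using D0' by (subst integral_distr) (auto simp: integral_density)
    also have "\<dots> = (\<integral>s. (\<integral>z. D s z * f (g s z) \<partial>lborel) \<partial>\<nu>)"
      using integral_fst'[OF i] by simp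
    finally show ?thesis .
  qed
  with p show ?thesis by blast
qed

text \<open>Positivity of \<open>T_density\<close> allows the two measures of a decomposition to be
  transported separately.\<close>

lemma T_semigroup_dual:
  assumes \<mu>: "\<mu> \<in> signed_measures {0..}" and t: "t \<ge> 0"
  shows "\<exists>\<mu>'\<in>signed_measures {0..}. \<forall>f\<in>bounded_borel {0..}.
    signed_integral {0..} \<mu>' f = signed_integral {0..} \<mu> (T_semigroup t f)"
proof (cases "t = 0")
  case True
  then show ?thesis using \<mu> by auto
next
  case False
  then have t: "t > 0" using t by simp
  have ex: "\<exists>p'\<in>finite_measures {0..}. \<forall>f\<in>bounded_borel {0..}. (\<integral>x. f x \<partial>p') = (\<integral>x. T_semigroup t f x \<partial>p)"
    if p: "p \<in> finite_measures {0..}" for p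
  proof -
    have sp: "sets p = sets (restrict_space borel {0..})" and spp: "space p = {0..}" using finite_measuresD[OF p] by auto
    have idm: "(\<lambda>x. x) \<in> borel_measurable p"
      using measurable_restrict_space1[OF measurable_ident, of borel "{0..}"] sp by (simp add: id_def cong: measurable_cong_sets)
    have [measurable]: "fst \<in> borel_measurable (p \<Otimes>\<^sub>M (lborel :: real measure))"
      by (rule measurable_compose[OF measurable_fst idm])
    \<comment> \<open>\<open>max 0 y\<close> only keeps the argument in the half-line; the density
      vanishes for y <= 0.\<close>
    have "\<exists>p'\<in>finite_measures {0..}. \<forall>f\<in>bounded_borel {0..}.
      (\<integral>x. f x \<partial>p') = (\<integral>x. (\<integral>y. (T_density t x y * indicator {0<..} y) * f (max 0 y) \<partial>lborel) \<partial>p)"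
    proof (rule mixture_measure)
      show "finite_measure p" by (rule finite_measuresD[OF p])
      show "(\<lambda>(x, y). T_density t x y * indicator {0<..} y) \<in> borel_measurable (p \<Otimes>\<^sub>M lborel)"
        unfolding case_prod_beta by measurable
      show "(\<lambda>(x, y). max 0 y) \<in> measurable (p \<Otimes>\<^sub>M lborel) (restrict_space borel {0::real..})"
        unfolding case_prod_beta by (rule measurable_restrict_space2, simp, measurable)
      show "0 \<le> T_density t x y * indicator {0<..} y" if "x \<in> space p" for x y
        using that t by (auto simp: spp T_density_nonneg split: split_indicator)
      show "integrable lborel (\<lambda>y. T_density t x y * indicator {0<..} y)" if "x \<in> space p" for x
        using that by (intro T_density_integrable t) (auto simp: spp)
      show "(\<integral>y. T_density t x y * indicator {0<..} y \<partial>lborel) \<le> exp 1" if "x \<in> space p" for x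
        using that by (intro T_density_mass t) (auto simp: spp)
    qed
    moreover have "(\<integral>y. (T_density t x y * indicator {0<..} y) * f (max 0 y) \<partial>lborel) = T_semigroup t f x"
      if "f \<in> bounded_borel {0..}" for f x
      unfolding T_semigroup_density[OF that t]
      by (intro Bochner_Integration.integral_cong) (auto split: split_indicator)
    ultimately show ?thesis by auto
  qed
  obtain p q where pq: "p \<in> finite_measures {0..}" "q \<in> finite_measures {0..}"
    "\<And>f. f \<in> bounded_borel {0..} \<Longrightarrow> signed_integral {0..} \<mu> f = (\<integral>x. f x \<partial>p) - (\<integral>x. f x \<partial>q)"
    using signed_measuresE[OF \<mu>] by metis
  obtain p' q' where pq': "p' \<in> finite_measures {0..}" "q' \<in> finite_measures {0..}"
    "\<And>f. f\<in>bounded_borel {0..} \<Longrightarrow> (\<integral>x. f x \<partial>p') = (\<integral>x. T_semigroup t f x \<partial>p)"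
    "\<And>f. f\<in>bounded_borel {0..} \<Longrightarrow> (\<integral>x. f x \<partial>q') = (\<integral>x. T_semigroup t f x \<partial>q)"
    using ex[OF pq(1)] ex[OF pq(2)] by metis
  show ?thesis
    by (rule bexI[OF _ measure_diff_signed[OF pq'(1,2)]])
      (use t in \<open>simp add: signed_integral_diff[OF pq'(1,2)] pq' pq(3) T_semigroup_bounded_borel\<close>)
qed

subsection \<open>The entrance law at zero\<close>

text \<open>The density in z whose image under z -> sqrt r * z is the measure 2 h(y)
  \<open>kappa r\<close> (dy). As r tends to 0, h(sqrt r z) / sqrt r tends to z, which is the value
  chosen at r = 0; there the image is the unit mass at 0.\<close>

definition entrance_density :: "real \<Rightarrow> real \<Rightarrow> real" where
  "entrance_density r z = indicator {0<..} z * (2 * z * std_normal_density z *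
    (if r = 0 then z else h_weight (sqrt r * z) / sqrt r))"

lemma entrance_density_measurable [measurable]:
  "(\<lambda>x. entrance_density (f x) (g x)) \<in> borel_measurable M"
  if [measurable]: "f \<in> borel_measurable M" "g \<in> borel_measurable M"
  unfolding entrance_density_def by measurable

text \<open>By symmetry the half-line carries half of the second moment of the standard normal law.
  The factor 2 therefore makes \<open>entrance_density 0\<close> a probability density.\<close>

lemma std_normal_second_moment:
  "integrable lborel (\<lambda>z. indicator {0<..} z * (2 * z\<^sup>2 * std_normal_density z))"
  "(\<integral>z. indicator {0<..} z * (2 * z\<^sup>2 * std_normal_density z) \<partial>lborel) = 1"
proof -
  let ?F = "\<lambda>z. z\<^sup>2 * std_normal_density z"
  have m: "has_bochner_integral lborel ?F 1"
    using std_normal_moment_even[of 1] by (simp add: mult.commute)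
  then have i: "integrable lborel ?F" and e: "(\<integral>z. ?F z \<partial>lborel) = 1"
    by (auto simp: has_bochner_integral_iff)
  have ip: "integrable lborel (\<lambda>z. indicator {0<..} z *\<^sub>R ?F z)" and im: "integrable lborel (\<lambda>z. indicator {..<0} z *\<^sub>R ?F z)"
    by (rule integrable_mult_indicator[OF _ i]; simp)+
  have "(\<integral>z. indicator {..<0} z *\<^sub>R ?F z \<partial>lborel) = (\<integral>z. indicator {0<..} z *\<^sub>R ?F z \<partial>lborel)"
    by (subst lborel_integral_real_affine[where c="-1" and t=0])
      (auto simp: std_normal_density_def indicator_def intro!: Bochner_Integration.integral_cong)
  moreover have "(\<integral>z. indicator {..<0} z *\<^sub>R ?F z \<partial>lborel) + (\<integral>z. indicator {0<..} z *\<^sub>R ?F z \<partial>lborel) =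
      (\<integral>z. indicator {..<0} z *\<^sub>R ?F z + indicator {0<..} z *\<^sub>R ?F z \<partial>lborel)"
    using ip im by simp
  moreover have "\<dots> = (\<integral>z. ?F z \<partial>lborel)"
    by (intro Bochner_Integration.integral_cong) (auto split: split_indicator)
  ultimately have h: "2 * (\<integral>z. indicator {0<..} z *\<^sub>R ?F z \<partial>lborel) = 1" using e by simp
  have eq: "indicator {0<..} z * (2 * z\<^sup>2 * std_normal_density z) = 2 * (indicator {0<..} z *\<^sub>R ?F z)" for z by simp
  show "integrable lborel (\<lambda>z. indicator {0<..} z * (2 * z\<^sup>2 * std_normal_density z))"
    unfolding eq using ip by simp
  show "(\<integral>z. indicator {0<..} z * (2 * z\<^sup>2 * std_normal_density z) \<partial>lborel) = 1"
    unfolding eq using h by simp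
qed

text \<open>As h(y) <= y, every entrance density lies below the one at r = 0. This bounds the masses
  by 1 and dominates limits in r, down to r = 0.\<close>

lemma entrance_density_bounds:
  assumes "r \<ge> 0"
  shows "0 \<le> entrance_density r z" "entrance_density r z \<le> indicator {0<..} z * (2 * z\<^sup>2 * std_normal_density z)"
proof -
  have w: "0 \<le> (if r = 0 then z else h_weight (sqrt r * z) / sqrt r)"
    "(if r = 0 then z else h_weight (sqrt r * z) / sqrt r) \<le> z" if "0 < z"
    using that assms h_weight_nonneg[of "sqrt r * z"] h_weight_le(1)[of "sqrt r * z"] by (auto simp: field_simps)
  show "0 \<le> entrance_density r z"
    unfolding entrance_density_def using w by (cases "0 < z") (simp_all only: indicator_simps(1) indicator_simps(2)
      greaterThan_iff mult_nonneg_nonneg normal_density_nonneg mult_1 mult_zero_left less_imp_le order_refl zero_le_numeral not_False_eq_True)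
  show "entrance_density r z \<le> indicator {0<..} z * (2 * z\<^sup>2 * std_normal_density z)"
  proof (cases "0 < z")
    case True
    have "2 * z * std_normal_density z * (if r = 0 then z else h_weight (sqrt r * z) / sqrt r) \<le> 2 * z * std_normal_density z * z"
      using True w by (intro mult_left_mono) auto
    then show ?thesis using True by (simp add: entrance_density_def power2_eq_square ac_simps)
  qed (simp add: entrance_density_def)
qed

lemma entrance_density_integrable:
  assumes "r \<ge> 0"
  shows "integrable lborel (entrance_density r)" "(\<integral>z. entrance_density r z \<partial>lborel) \<le> 1"
proof -
  show i: "integrable lborel (entrance_density r)"
  proof (rule Bochner_Integration.integrable_bound[OF std_normal_second_moment(1)])
    have "norm (entrance_density r z) \<le> norm (indicator {0<..} z * (2 * z\<^sup>2 * std_normal_density z))" for z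
      using entrance_density_bounds[OF assms, of z] by simp
    then show "AE z in lborel. norm (entrance_density r z) \<le> norm (indicator {0<..} z * (2 * z\<^sup>2 * std_normal_density z))"
      by simp
  qed measurable
  have "(\<integral>z. entrance_density r z \<partial>lborel) \<le> (\<integral>z. indicator {0<..} z * (2 * z\<^sup>2 * std_normal_density z) \<partial>lborel)"
    using entrance_density_bounds[OF assms] i std_normal_second_moment(1) by (intro integral_mono) auto
  then show "(\<integral>z. entrance_density r z \<partial>lborel) \<le> 1" by (simp add: std_normal_second_moment(2))
qed

text \<open>Brownian scaling \<open>y = sqrt r * z\<close> makes the right limit at \<open>r = 0\<close> visible.\<close>

lemma T_semigroup_at_0:
  assumes f: "f \<in> bounded_borel {0..}" and r: "r \<ge> 0"
  shows "T_semigroup r f 0 = (\<integral>z. entrance_density r z * f (sqrt r * z) \<partial>lborel)"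
proof (cases "r = 0")
  case True
  have "(\<integral>z. entrance_density r z * f (sqrt r * z) \<partial>lborel) =
      (\<integral>z. indicator {0<..} z * (2 * z\<^sup>2 * std_normal_density z) * f 0 \<partial>lborel)"
    using True by (intro Bochner_Integration.integral_cong) (auto simp: entrance_density_def power2_eq_square)
  also have "\<dots> = f 0" using std_normal_second_moment(2) by simp
  finally show ?thesis using True by simp
next
  case False
  then have r: "r > 0" using r by simp
  have g: "gauss_kernel r (sqrt r * z) = std_normal_density z / sqrt r" for z
    using r by (simp add: gauss_kernel_def std_normal_density_def power_mult_distrib real_sqrt_mult)
  have "T_semigroup r f 0 = sqrt r * (\<integral>z. T_density r 0 (sqrt r * z) * (indicator {0<..} (sqrt r * z) * f (sqrt r * z)) \<partial>lborel)"
    unfolding T_semigroup_density[OF f r]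
    using r by (subst lborel_integral_real_affine[where c="sqrt r" and t=0]) auto
  also have "\<dots> = (\<integral>z. sqrt r * (T_density r 0 (sqrt r * z) * (indicator {0<..} (sqrt r * z) * f (sqrt r * z))) \<partial>lborel)"
    by simp
  also have "\<dots> = (\<integral>z. entrance_density r z * f (sqrt r * z) \<partial>lborel)"
  proof (intro Bochner_Integration.integral_cong refl)
    fix z
    have e: "sqrt r * (2 * H * (sqrt r * z * (G / sqrt r) / r) * F) = 2 * z * G * (H / sqrt r) * F" for H G F
    proof -
      have "sqrt r / r = 1 / sqrt r" using r by (simp add: real_div_sqrt field_simps)
      moreover have "sqrt r * (G / sqrt r) = G" using r by simp
      then have "sqrt r * (2 * H * (sqrt r * z * (G / sqrt r) / r) * F) = 2 * z * G * H * F * (sqrt r / r)"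
        by (simp add: ac_simps)
      ultimately show ?thesis by simp
    qed
    show "sqrt r * (T_density r 0 (sqrt r * z) * (indicator {0<..} (sqrt r * z) * f (sqrt r * z))) =
      entrance_density r z * f (sqrt r * z)"
      using r e[of "h_weight (sqrt r * z)" "std_normal_density z" "f (sqrt r * z)"]
      by (cases "0 < z") (simp_all add: T_density_def k_density_def g entrance_density_def zero_less_mult_iff)
  qed
  finally show ?thesis .
qed

text \<open>Uniform in r, so the integrands of the jump integrals are bounded by a multiple of
  |u|.\<close>

lemma T_semigroup_at_0_bound:
  assumes f: "f \<in> bounded_borel {0..}" and c: "\<And>x. x \<in> {0..} \<Longrightarrow> \<bar>f x\<bar> \<le> c" and r: "r \<ge> 0"
  shows "\<bar>T_semigroup r f 0\<bar> \<le> c"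
proof -
  have c0: "0 \<le> c" using c[of 0] by simp
  have "norm (T_semigroup r f 0) \<le> (\<integral>z. norm (entrance_density r z * f (sqrt r * z)) \<partial>lborel)"
    unfolding T_semigroup_at_0[OF f r] by (rule integral_norm_bound)
  also have "\<dots> \<le> (\<integral>z. entrance_density r z * c \<partial>lborel)"
  proof (rule integral_mono_AE')
    have "norm (entrance_density r z * f (sqrt r * z)) \<le> entrance_density r z * c" for z
    proof (cases "0 < z")
      case True
      then have "\<bar>f (sqrt r * z)\<bar> \<le> c" using r by (intro c) auto
      then show ?thesis using entrance_density_bounds[OF r, of z] by (simp add: abs_mult mult_left_mono)
    qed (simp add: entrance_density_def)
    then show "AE z in lborel. norm (entrance_density r z * f (sqrt r * z)) \<le> entrance_density r z * c" by simp
    show "AE z in lborel. 0 \<le> entrance_density r z * c"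
      using entrance_density_bounds(1)[OF r] c0 by simp
  qed (use entrance_density_integrable[OF r] in auto)
  also have "\<dots> = (\<integral>z. entrance_density r z \<partial>lborel) * c" by simp
  also have "\<dots> \<le> 1 * c" using c0 entrance_density_integrable[OF r] by (intro mult_right_mono) auto
  finally show ?thesis by simp
qed

lemma entrance_measurable:
  assumes f: "f \<in> bounded_borel {0..}" and [measurable]: "a \<in> borel_measurable M" "b \<in> borel_measurable M"
  shows "(\<lambda>x. entrance_density (a x) (b x) * (indicator {0..} (a x) * f (sqrt (a x) * b x))) \<in> borel_measurable M"
proof -
  have [measurable]: "(\<lambda>y. indicator {0..} y *\<^sub>R f y) \<in> borel_measurable borel"
    by (rule iffD1[OF borel_measurable_restrict_space_iff bounded_borel_measurable[OF f]]) simp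
  have eq: "entrance_density (a x) (b x) * (indicator {0..} (a x) * f (sqrt (a x) * b x)) =
    entrance_density (a x) (b x) * (indicator {0..} (a x) * (\<lambda>y. indicator {0..} y *\<^sub>R f y) (sqrt (a x) * b x))" for x
    by (cases "0 < b x") (auto simp: entrance_density_def indicator_def)
  show ?thesis unfolding eq by measurable
qed

lemma T_semigroup_at_0_measurable:
  assumes f: "f \<in> bounded_borel {0..}"
  shows "(\<lambda>r. indicator {0..} r * T_semigroup r f 0) \<in> borel_measurable borel"
proof -
  have [measurable]: "(\<lambda>(r, z). entrance_density r z * (indicator {0..} r * f (sqrt r * z))) \<in> borel_measurable (borel \<Otimes>\<^sub>M lborel)"
    unfolding case_prod_beta by (rule entrance_measurable[OF f]) auto
  have "(\<lambda>r. \<integral>z. entrance_density r z * (indicator {0..} r * f (sqrt r * z)) \<partial>lborel) \<in> borel_measurable borel"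
    by measurable
  also have "(\<lambda>r. \<integral>z. entrance_density r z * (indicator {0..} r * f (sqrt r * z)) \<partial>lborel) = (\<lambda>r. indicator {0..} r * T_semigroup r f 0)"
    by (auto simp: T_semigroup_at_0[OF f] indicator_def)
  finally show ?thesis .
qed

text \<open>In the scaled form only the density and the argument sqrt r * z depend on r. Both are
  continuous in r for fixed z, and the density at r = 0 dominates. Continuity of f is used because
  its argument moves with r.\<close>

lemma T_semigroup_at_0_continuous:
  assumes f: "f \<in> bounded_continuous {0..}"
  shows "continuous_on {0..} (\<lambda>r. T_semigroup r f 0)"
  unfolding continuous_on_sequentially
proof (intro allI ballI impI)
  fix X :: "nat \<Rightarrow> real" and x :: real
  assume x: "x \<in> {0..}" and X: "(\<forall>n. X n \<in> {0..}) \<and> X \<longlonglongrightarrow> x"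
  have fb: "f \<in> bounded_borel {0..}" using f bounded_continuous_subset by auto
  have fc: "continuous_on {0..} f" using f by (simp add: bounded_continuous_def)
  obtain c where c: "0 \<le> c" "\<And>x. x \<in> {0..} \<Longrightarrow> \<bar>f x\<bar> \<le> c" using bounded_borelE[OF fb] by metis
  have X0: "0 \<le> X n" for n using X by auto
  have m: "(\<lambda>z. entrance_density r z * f (sqrt r * z)) \<in> borel_measurable lborel" if "0 \<le> r" for r
    using entrance_measurable[OF fb, of "\<lambda>_. r" lborel "\<lambda>z. z"] that by simp
  have "(\<lambda>n. \<integral>z. entrance_density (X n) z * f (sqrt (X n) * z) \<partial>lborel) \<longlonglongrightarrow>
      (\<integral>z. entrance_density x z * f (sqrt x * z) \<partial>lborel)"
  proof (rule integral_dominated_convergence)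
    show "integrable lborel (\<lambda>z. (indicator {0<..} z * (2 * z\<^sup>2 * std_normal_density z)) * c)"
      using std_normal_second_moment(1) by simp
    show "AE z in lborel. norm (entrance_density (X n) z * f (sqrt (X n) * z)) \<le> (indicator {0<..} z * (2 * z\<^sup>2 * std_normal_density z)) * c" for n
    proof (rule AE_I2)
      fix z :: real
      show "norm (entrance_density (X n) z * f (sqrt (X n) * z)) \<le> (indicator {0<..} z * (2 * z\<^sup>2 * std_normal_density z)) * c"
      proof (cases "0 < z")
        case True
        have "\<bar>entrance_density (X n) z\<bar> * \<bar>f (sqrt (X n) * z)\<bar> \<le> (indicator {0<..} z * (2 * z\<^sup>2 * std_normal_density z)) * c"
          using entrance_density_bounds[OF X0, of n z] True X0[of n] by (intro mult_mono c) auto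
        then show ?thesis by (simp add: abs_mult)
      qed (simp add: entrance_density_def)
    qed
    show "AE z in lborel. (\<lambda>n. entrance_density (X n) z * f (sqrt (X n) * z)) \<longlonglongrightarrow> entrance_density x z * f (sqrt x * z)"
    proof (rule AE_I2)
      fix z :: real
      show "(\<lambda>n. entrance_density (X n) z * f (sqrt (X n) * z)) \<longlonglongrightarrow> entrance_density x z * f (sqrt x * z)"
      proof (cases "0 < z")
        case z: True
        have sq: "(\<lambda>n. sqrt (X n)) \<longlonglongrightarrow> sqrt x" using X by (auto intro!: tendsto_intros)
        have fl: "(\<lambda>n. f (sqrt (X n) * z)) \<longlonglongrightarrow> f (sqrt x * z)"
          by (rule continuous_on_tendsto_compose[OF fc]) (use sq x X0 z in \<open>auto intro!: tendsto_intros\<close>)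
        \<comment> \<open>In q = sqrt r this is the difference quotient at 0 of q -> h(q z), whose
          derivative there is z.\<close>
        define w where "w q = (if q = 0 then z else h_weight (q * z) / q)" for q
        have "isCont w (sqrt x)"
        proof (cases "x = 0")
          case True
          have "((\<lambda>q. h_weight (q * z)) has_real_derivative z) (at 0)"
            unfolding h_weight_def by (auto intro!: derivative_eq_intros)
          then have "((\<lambda>q. h_weight (q * z) / q) \<longlongrightarrow> z) (at 0)"
            by (simp add: has_field_derivative_iff)
          then have "(w \<longlongrightarrow> w 0) (at 0)"
            by (rule filterlim_cong[THEN iffD1, rotated -1]) (auto simp: w_def eventually_at_filter)
          then show ?thesis using True by (simp add: isCont_def)
        next
          case False
          then have sx: "0 < sqrt x" using x by simp
          have "isCont (\<lambda>q. h_weight (q * z) / q) (sqrt x)"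
            unfolding h_weight_def using sx by (intro continuous_intros) auto
          then have "((\<lambda>q. h_weight (q * z) / q) \<longlongrightarrow> h_weight (sqrt x * z) / sqrt x) (at (sqrt x))"
            by (simp add: isCont_def)
          then have "(w \<longlongrightarrow> w (sqrt x)) (at (sqrt x))"
          proof (rule filterlim_cong[THEN iffD1, rotated -1])
            have "\<forall>\<^sub>F q in nhds (sqrt x). 0 < q" using sx by (intro eventually_nhds_in_open[of "{0<..}", simplified]) auto
            then show "\<forall>\<^sub>F q in at (sqrt x). h_weight (q * z) / q = w q"
              unfolding eventually_at_filter by (rule eventually_mono) (simp add: w_def)
          qed (use False in \<open>simp_all add: w_def\<close>)
          then show ?thesis by (simp add: isCont_def)
        qed
        then have "(\<lambda>n. w (sqrt (X n))) \<longlonglongrightarrow> w (sqrt x)" by (rule isCont_tendsto_compose[OF _ sq])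
        moreover have "entrance_density r z = 2 * z * std_normal_density z * w (sqrt r)" for r
          using z by (simp add: entrance_density_def w_def)
        ultimately show ?thesis by (auto intro!: tendsto_intros fl)
      qed (simp add: entrance_density_def)
    qed
  qed (use m x X0 in auto)
  then show "((\<lambda>r. T_semigroup r f 0) \<circ> X) \<longlonglongrightarrow> T_semigroup x f 0"
    using x X0 by (simp add: comp_def T_semigroup_at_0[OF fb])
qed

lemma kappa_h_weight:
  assumes "t > 0"
  shows "(\<integral>y. h_weight y * f y \<partial>kappa t) = T_semigroup t f 0 / 2"
  using assms by (simp add: T_semigroup_def)

text \<open>A jump at time s contributes to the state at time t the entrance law of age t - s; this
  superposes these laws over the jumps up to t. The absolute value and \<open>max\<close> in the
  proof only make the map total where the density is 0.\<close>

lemma entrance_mixture: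
  assumes fin: "finite_measure \<nu>" and s[measurable]: "s \<in> borel_measurable \<nu>"
  shows "\<exists>p\<in>finite_measures {0..}. \<forall>f\<in>bounded_borel {0..}.
    (\<integral>x. f x \<partial>p) = (\<integral>w. indicator {0..t} (s w) * T_semigroup (t - s w) f 0 \<partial>\<nu>)"
proof -
  have "\<exists>p\<in>finite_measures {0..}. \<forall>f\<in>bounded_borel {0..}.
    (\<integral>x. f x \<partial>p) = (\<integral>w. (\<integral>z. (indicator {0..t} (s w) * entrance_density (t - s w) z) * f (sqrt \<bar>t - s w\<bar> * max 0 z) \<partial>lborel) \<partial>\<nu>)"
  proof (rule mixture_measure[OF fin])
    show "(\<lambda>(w, z). indicator {0..t} (s w) * entrance_density (t - s w) z) \<in> borel_measurable (\<nu> \<Otimes>\<^sub>M lborel)"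
      unfolding case_prod_beta by measurable
    show "(\<lambda>(w, z). sqrt \<bar>t - s w\<bar> * max 0 z) \<in> measurable (\<nu> \<Otimes>\<^sub>M lborel) (restrict_space borel {0::real..})"
      unfolding case_prod_beta by (rule measurable_restrict_space2, simp, measurable)
    show "0 \<le> indicator {0..t} (s w) * entrance_density (t - s w) z" for w z
      by (auto split: split_indicator intro!: entrance_density_bounds)
    show "integrable lborel (\<lambda>z. indicator {0..t} (s w) * entrance_density (t - s w) z)" for w
      by (cases "s w \<in> {0..t}") (auto intro!: entrance_density_integrable)
    show "(\<integral>z. indicator {0..t} (s w) * entrance_density (t - s w) z \<partial>lborel) \<le> 1" for w
      by (cases "s w \<in> {0..t}") (auto intro!: entrance_density_integrable)
  qed
  moreover have "(\<integral>z. (indicator {0..t} (s w) * entrance_density (t - s w) z) * f (sqrt \<bar>t - s w\<bar> * max 0 z) \<partial>lborel) =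
      indicator {0..t} (s w) * T_semigroup (t - s w) f 0" if f: "f \<in> bounded_borel {0..}" for f w
  proof (cases "s w \<in> {0..t}")
    case True
    have "(\<integral>z. (indicator {0..t} (s w) * entrance_density (t - s w) z) * f (sqrt \<bar>t - s w\<bar> * max 0 z) \<partial>lborel) =
       (\<integral>z. entrance_density (t - s w) z * f (sqrt (t - s w) * z) \<partial>lborel)"
      using True by (intro Bochner_Integration.integral_cong) (auto simp: entrance_density_def split: split_indicator)
    then show ?thesis using True by (simp add: T_semigroup_at_0[OF f])
  qed simp
  ultimately show ?thesis by auto
qed

subsection \<open>Poisson random measures\<close>

lemma norm_iexp_diff_le: "cmod (iexp a - iexp b) \<le> \<bar>a - b\<bar>"
proof -
  have "iexp a - iexp b = iexp b * (iexp (a - b) - 1)"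
    by (simp add: algebra_simps flip: exp_add)
  then have "cmod (iexp a - iexp b) = cmod (iexp (a - b) - 1)"
    by (simp add: norm_mult)
  also have "\<dots> \<le> \<bar>a - b\<bar>"
    using iexp_approx1[of "a - b" 0] by simp
  finally show ?thesis .
qed

locale poisson_random = prob_space M + L: sigma_finite_measure L
  for M :: "'w measure" and L :: "'b measure" +
  fixes N :: "'w \<Rightarrow> 'b measure"
  assumes N: "poisson_random_measure M L N"
begin

lemma sets_N: "\<omega> \<in> space M \<Longrightarrow> sets (N \<omega>) = sets L"
  using N by (simp add: poisson_random_measure_def)

lemma space_N: "\<omega> \<in> space M \<Longrightarrow> space (N \<omega>) = space L"
  using sets_N by (rule sets_eq_imp_space_eq)

lemma measurable_N: "\<omega> \<in> space M \<Longrightarrow> f \<in> measurable L K \<Longrightarrow> f \<in> measurable (N \<omega>) K"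
  using sets_N by (metis measurable_cong_sets)

lemma emeasure_N_measurable [measurable]: "A \<in> sets L \<Longrightarrow> (\<lambda>\<omega>. emeasure (N \<omega>) A) \<in> borel_measurable M"
  using N by (simp add: poisson_random_measure_def)

definition count_event :: "'b set \<Rightarrow> nat \<Rightarrow> 'w set" where
  "count_event A n = {\<omega> \<in> space M. emeasure (N \<omega>) A = of_nat n}"

lemma count_event_sets [measurable]: "A \<in> sets L \<Longrightarrow> count_event A n \<in> sets M"
  unfolding count_event_def by measurable

lemma prob_count_event:
  "A \<in> sets L \<Longrightarrow> emeasure L A < \<infinity> \<Longrightarrow>
    prob (count_event A n) = measure L A ^ n / fact n * exp (- measure L A)"
  using N by (simp add: poisson_random_measure_def count_event_def)

lemma count_event_disjoint: "disjoint_family (count_event A)"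
  by (auto simp: disjoint_family_on_def count_event_def)

text \<open>The Poisson probabilities add up to 1, which leaves no mass for an infinite
  count.\<close>

lemma AE_count:
  assumes A[measurable]: "A \<in> sets L" and fin: "emeasure L A < \<infinity>"
  shows "AE \<omega> in M. \<exists>n. \<omega> \<in> count_event A n"
proof -
  let ?l = "measure L A"
  have "(\<lambda>n. ?l ^ n /\<^sub>R fact n * exp (- ?l)) sums (exp ?l * exp (- ?l))"
    by (intro sums_mult2 exp_converges)
  then have s: "(\<lambda>n. prob (count_event A n)) sums 1"
    by (simp add: prob_count_event[OF A fin] divide_inverse exp_minus mult.commute)
  have "(\<lambda>n. prob (count_event A n)) sums prob (\<Union>n. count_event A n)"
    by (rule finite_measure_UNION) (auto simp: count_event_disjoint)
  then have "prob (\<Union>n. count_event A n) = 1" using s sums_unique2 by blast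
  then have "AE \<omega> in M. \<omega> \<in> (\<Union>n. count_event A n)"
    by (subst prob_eq_1[symmetric]) auto
  then show ?thesis by auto
qed

lemma integral_count:
  fixes c :: "nat \<Rightarrow> complex"
  assumes A[measurable]: "A \<in> sets L" and fin: "emeasure L A < \<infinity>" and c: "\<And>n. cmod (c n) \<le> 1"
    and h: "AE \<omega> in M. \<forall>n. \<omega> \<in> count_event A n \<longrightarrow> h \<omega> = c n" and [measurable]: "h \<in> borel_measurable M"
  shows "(\<integral>\<omega>. h \<omega> \<partial>M) = (\<Sum>n. c n * prob (count_event A n))"
proof -
  let ?f = "\<lambda>n \<omega>. c n * indicator (count_event A n) \<omega>"
  have sums: "(\<lambda>n. ?f n \<omega>) sums c k" if "\<omega> \<in> count_event A k" for k \<omega>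
  proof -
    have "?f n \<omega> = (if n = k then c k else 0)" for n
      using that count_event_disjoint[of A] by (auto simp: disjoint_family_on_def indicator_def)
    then show ?thesis using sums_single[of k "\<lambda>_. c k"] by simp
  qed
  have s1: "summable (\<lambda>n. prob (count_event A n))"
    by (rule sums_summable[OF finite_measure_UNION]) (auto simp: count_event_disjoint)
  have "(\<integral>\<omega>. h \<omega> \<partial>M) = (\<integral>\<omega>. (\<Sum>n. ?f n \<omega>) \<partial>M)"
  proof (rule integral_cong_AE)
    show "AE \<omega> in M. h \<omega> = (\<Sum>n. ?f n \<omega>)"
      using h AE_count[OF A fin] by eventually_elim (use sums sums_unique in \<open>fastforce\<close>)
  qed measurable
  also have "\<dots> = (\<Sum>n. \<integral>\<omega>. ?f n \<omega> \<partial>M)"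
  proof (rule integral_suminf)
    show "integrable M (?f n)" for n
      by (rule integrable_const_bound[where B=1]) (use c in \<open>auto simp: norm_mult split: split_indicator\<close>)
    show "AE \<omega> in M. summable (\<lambda>n. norm (?f n \<omega>))"
    proof (rule AE_I2)
      fix \<omega>
      show "summable (\<lambda>n. norm (?f n \<omega>))"
      proof (cases "\<exists>k. \<omega> \<in> count_event A k")
        case True
        then obtain k where k: "\<omega> \<in> count_event A k" ..
        have "norm (?f n \<omega>) = (if n = k then norm (c k) else 0)" for n
          using k count_event_disjoint[of A] by (auto simp: disjoint_family_on_def indicator_def)
        then show ?thesis using sums_single[of k "\<lambda>n. norm (c n)"] by (simp add: sums_iff)
      qed simp
    qed
    have "norm (?f n \<omega>) = cmod (c n) * indicator (count_event A n) \<omega>" for n \<omega>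
      by (simp split: split_indicator)
    then have "(\<integral>\<omega>. norm (?f n \<omega>) \<partial>M) = cmod (c n) * prob (count_event A n)" for n
      using sets.sets_into_space[OF count_event_sets[OF A, of n]] by (simp only: integral_mult_right_zero) (simp add: Int_absorb2)
    moreover have "summable (\<lambda>n. cmod (c n) * prob (count_event A n))"
      by (rule summable_comparison_test'[OF s1, of 0]) (use c in \<open>auto intro!: mult_left_le_one_le\<close>)
    ultimately show "summable (\<lambda>n. \<integral>\<omega>. norm (?f n \<omega>) \<partial>M)" by simp
  qed
  also have "\<dots> = (\<Sum>n. c n * prob (count_event A n))"
  proof (intro arg_cong[where f=suminf] ext)
    fix n
    have "?f n \<omega> = c n * complex_of_real (indicator (count_event A n) \<omega>)" for \<omega>
      by (auto split: split_indicator)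
    then have "(\<integral>\<omega>. ?f n \<omega> \<partial>M) = c n * (\<integral>\<omega>. complex_of_real (indicator (count_event A n) \<omega>) \<partial>M)"
      by (simp only: integral_mult_right_zero)
    also have "(\<integral>\<omega>. complex_of_real (indicator (count_event A n) \<omega>) \<partial>M) = prob (count_event A n)"
      unfolding integral_complex_of_real
      using sets.sets_into_space[OF count_event_sets[OF A, of n]] by (simp add: Int_absorb2)
    finally show "(\<integral>\<omega>. ?f n \<omega> \<partial>M) = c n * prob (count_event A n)" .
  qed
  finally show ?thesis .
qed

lemma char_count:
  assumes A[measurable]: "A \<in> sets L" and fin: "emeasure L A < \<infinity>"
  shows "(\<integral>\<omega>. iexp (\<theta> * measure (N \<omega>) A) \<partial>M) = exp (measure L A * (iexp \<theta> - 1))"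
proof -
  let ?l = "measure L A"
  have [measurable]: "(\<lambda>\<omega>. measure (N \<omega>) A) \<in> borel_measurable M" unfolding measure_def by measurable
  have E: "exp (- complex_of_real ?l) = of_real (exp (- ?l))" by (metis exp_of_real of_real_minus)
  have "(\<integral>\<omega>. iexp (\<theta> * measure (N \<omega>) A) \<partial>M) = (\<Sum>n. iexp (\<theta> * real n) * prob (count_event A n))"
    by (rule integral_count[OF A fin]) (auto simp: count_event_def measure_def enn2real_of_nat intro!: AE_I2)
  also have "\<dots> = (\<Sum>n. (?l * iexp \<theta>) ^ n /\<^sub>R fact n * exp (- complex_of_real ?l))"
    by (intro arg_cong[where f=suminf] ext)
      (simp add: prob_count_event[OF A fin] power_mult_distrib scaleR_conv_of_real field_simps E
        exp_of_nat_mult[symmetric])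
  also have "\<dots> = exp (?l * iexp \<theta>) * exp (- complex_of_real ?l)"
    by (rule sums_unique[symmetric]) (intro sums_mult2 exp_converges)
  also have "\<dots> = exp (?l * (iexp \<theta> - 1))" by (simp add: algebra_simps flip: exp_add)
  finally show ?thesis .
qed

lemma expectation_count:
  assumes A[measurable]: "A \<in> sets L" and fin: "emeasure L A < \<infinity>"
  shows "(\<integral>\<^sup>+\<omega>. emeasure (N \<omega>) A \<partial>M) = emeasure L A"
proof -
  let ?l = "measure L A"
  have "(\<integral>\<^sup>+\<omega>. emeasure (N \<omega>) A \<partial>M) = (\<integral>\<^sup>+\<omega>. (\<Sum>n. of_nat n * indicator (count_event A n) \<omega>) \<partial>M)"
  proof (rule nn_integral_cong_AE)
    show "AE \<omega> in M. emeasure (N \<omega>) A = (\<Sum>n. of_nat n * indicator (count_event A n) \<omega>)"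
      using AE_count[OF A fin]
    proof eventually_elim
      case (elim \<omega>)
      then obtain k where k: "\<omega> \<in> count_event A k" ..
      have "of_nat n * indicator (count_event A n) \<omega> = (if n = k then of_nat k else 0 :: ennreal)" for n
        using k count_event_disjoint[of A] by (auto simp: disjoint_family_on_def indicator_def)
      then have "(\<Sum>n. of_nat n * indicator (count_event A n) \<omega>) = (of_nat k :: ennreal)"
        using sums_single[of k "\<lambda>_. of_nat k :: ennreal"] by (simp add: sums_iff)
      then show ?case using k by (simp add: count_event_def)
    qed
  qed
  also have "\<dots> = (\<Sum>n. of_nat n * emeasure M (count_event A n))"
    by (subst nn_integral_suminf) (auto simp: nn_integral_cmult_indicator)
  also have "\<dots> = (\<Sum>n. ennreal (real n * (?l ^ n / fact n * exp (- ?l))))"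
  proof -
    have "of_nat n * emeasure M (count_event A n) = ennreal (real n * prob (count_event A n))" for n
      by (simp add: emeasure_eq_measure ennreal_of_nat_eq_real_of_nat ennreal_mult)
    then show ?thesis by (simp only: prob_count_event[OF A fin])
  qed
  also have "\<dots> = ennreal ?l"
  proof (rule sums_unique[symmetric], rule sums_ennreal[THEN iffD2])
    have "(\<lambda>n. ?l * (?l ^ n /\<^sub>R fact n * exp (- ?l))) sums (?l * (exp ?l * exp (- ?l)))"
      by (intro sums_mult sums_mult2 exp_converges)
    moreover have "real (Suc n) * (?l ^ Suc n / fact (Suc n) * exp (- ?l)) = ?l * (?l ^ n /\<^sub>R fact n * exp (- ?l))" for n
    proof -
      have "real (Suc n) / fact (Suc n) = inverse (fact n)" by (simp add: field_simps del: of_nat_Suc)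
      then show ?thesis by (simp add: divide_inverse mult.assoc[symmetric] del: of_nat_Suc fact_Suc)
    qed
    ultimately have "(\<lambda>n. real (Suc n) * (?l ^ Suc n / fact (Suc n) * exp (- ?l))) sums ?l"
      by (simp add: exp_minus)
    then show "(\<lambda>n. real n * (?l ^ n / fact n * exp (- ?l))) sums ?l"
      by (subst (asm) sums_Suc_iff) simp
  qed auto
  also have "\<dots> = emeasure L A" using fin by (simp add: emeasure_eq_ennreal_measure less_top)
  finally show ?thesis .
qed

text \<open>Campbell's formula by the monotone class argument. Measurability is carried through the
  same induction because the monotone limit of the expectations needs it. A set of infinite
  intensity is exhausted by sets of finite intensity.\<close>

lemma nn_integral_N:
  assumes "g \<in> borel_measurable L"
  shows nn_integral_N_measurable: "(\<lambda>\<omega>. \<integral>\<^sup>+x. g x \<partial>N \<omega>) \<in> borel_measurable M"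
    and campbell: "(\<integral>\<^sup>+\<omega>. \<integral>\<^sup>+x. g x \<partial>N \<omega> \<partial>M) = (\<integral>\<^sup>+x. g x \<partial>L)"
proof -
  have "(\<lambda>\<omega>. \<integral>\<^sup>+x. g x \<partial>N \<omega>) \<in> borel_measurable M \<and> (\<integral>\<^sup>+\<omega>. \<integral>\<^sup>+x. g x \<partial>N \<omega> \<partial>M) = (\<integral>\<^sup>+x. g x \<partial>L)"
    using assms
  proof induction
    case (cong f g)
    have "(\<integral>\<^sup>+x. f x \<partial>N \<omega>) = (\<integral>\<^sup>+x. g x \<partial>N \<omega>)" if "\<omega> \<in> space M" for \<omega>
      using cong space_N[OF that] by (intro nn_integral_cong) auto
    moreover have "(\<integral>\<^sup>+x. f x \<partial>L) = (\<integral>\<^sup>+x. g x \<partial>L)" using cong by (intro nn_integral_cong) auto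
    ultimately show ?case using cong by (simp cong: measurable_cong nn_integral_cong)
  next
    case (set A)
    have eq: "(\<integral>\<^sup>+x. indicator A x \<partial>N \<omega>) = emeasure (N \<omega>) A" if "\<omega> \<in> space M" for \<omega>
      using set sets_N[OF that] by simp
    obtain B :: "nat \<Rightarrow> 'b set" where B: "range B \<subseteq> sets L" "(\<Union>i. B i) = space L" "\<And>i. emeasure L (B i) \<noteq> \<infinity>" "incseq B"
      using L.sigma_finite_incseq by metis
    have inc: "incseq (\<lambda>i. A \<inter> B i)"
      using B(4) unfolding incseq_def by blast
    have AB: "A \<inter> B i \<in> sets L" "incseq (\<lambda>i. A \<inter> B i)" "(\<Union>i. A \<inter> B i) = A" for i
      using B(1-3) set sets.sets_into_space[OF set] inc by auto
    have ABfin: "emeasure L (A \<inter> B i) < \<infinity>" for i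
      using B(3)[of i] emeasure_mono[of "A \<inter> B i" "B i" L] B(1) by (auto simp: less_top[symmetric] top_unique)
    have "(\<integral>\<^sup>+\<omega>. emeasure (N \<omega>) A \<partial>M) = (\<integral>\<^sup>+\<omega>. (SUP i. emeasure (N \<omega>) (A \<inter> B i)) \<partial>M)"
    proof (rule nn_integral_cong)
      fix \<omega> assume "\<omega> \<in> space M"
      then show "emeasure (N \<omega>) A = (SUP i. emeasure (N \<omega>) (A \<inter> B i))"
        using AB sets_N by (subst SUP_emeasure_incseq) auto
    qed
    also have "\<dots> = (SUP i. \<integral>\<^sup>+\<omega>. emeasure (N \<omega>) (A \<inter> B i) \<partial>M)"
    proof (rule nn_integral_monotone_convergence_SUP_AE)
      show "AE \<omega> in M. emeasure (N \<omega>) (A \<inter> B i) \<le> emeasure (N \<omega>) (A \<inter> B (Suc i))" for i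
      proof (rule AE_I2)
        fix \<omega> assume "\<omega> \<in> space M"
        then show "emeasure (N \<omega>) (A \<inter> B i) \<le> emeasure (N \<omega>) (A \<inter> B (Suc i))"
          using AB sets_N B(4) by (intro emeasure_mono) (auto simp: incseq_def dest: lift_Suc_mono_le)
      qed
    qed (use AB in auto)
    also have "\<dots> = (SUP i. emeasure L (A \<inter> B i))"
      using expectation_count[OF AB(1) ABfin] by simp
    also have "\<dots> = emeasure L A" using AB by (subst SUP_emeasure_incseq) auto
    finally have "(\<integral>\<^sup>+\<omega>. emeasure (N \<omega>) A \<partial>M) = emeasure L A" .
    then show ?case using set by (simp add: eq cong: measurable_cong nn_integral_cong)
  next
    case (mult f c)
    then have [measurable]: "(\<lambda>\<omega>. \<integral>\<^sup>+x. f x \<partial>N \<omega>) \<in> borel_measurable M" by blast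
    have "(\<integral>\<^sup>+x. c * f x \<partial>N \<omega>) = c * (\<integral>\<^sup>+x. f x \<partial>N \<omega>)" if "\<omega> \<in> space M" for \<omega>
      using mult that by (intro nn_integral_cmult measurable_N)
    then show ?case using mult by (simp add: nn_integral_cmult cong: measurable_cong nn_integral_cong)
  next
    case (add f g)
    then have [measurable]: "(\<lambda>\<omega>. \<integral>\<^sup>+x. f x \<partial>N \<omega>) \<in> borel_measurable M" "(\<lambda>\<omega>. \<integral>\<^sup>+x. g x \<partial>N \<omega>) \<in> borel_measurable M" by blast+
    have "(\<integral>\<^sup>+x. g x + f x \<partial>N \<omega>) = (\<integral>\<^sup>+x. g x \<partial>N \<omega>) + (\<integral>\<^sup>+x. f x \<partial>N \<omega>)" if "\<omega> \<in> space M" for \<omega>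
      using add that by (intro nn_integral_add measurable_N)
    then show ?case using add by (simp add: nn_integral_add cong: measurable_cong nn_integral_cong)
  next
    case (seq U)
    then have [measurable]: "(\<lambda>\<omega>. \<integral>\<^sup>+x. U i x \<partial>N \<omega>) \<in> borel_measurable M" for i by blast
    have eq: "(\<integral>\<^sup>+x. (SUP i. U i) x \<partial>N \<omega>) = (SUP i. \<integral>\<^sup>+x. U i x \<partial>N \<omega>)" if "\<omega> \<in> space M" for \<omega>
      unfolding SUP_apply using seq that by (intro nn_integral_monotone_convergence_SUP measurable_N) auto
    have inc: "incseq (\<lambda>i \<omega>. \<integral>\<^sup>+x. U i x \<partial>N \<omega>)"
      using seq by (auto simp: incseq_def le_fun_def intro!: nn_integral_mono)
    have "(\<integral>\<^sup>+\<omega>. (SUP i. \<integral>\<^sup>+x. U i x \<partial>N \<omega>) \<partial>M) = (SUP i. \<integral>\<^sup>+\<omega>. \<integral>\<^sup>+x. U i x \<partial>N \<omega> \<partial>M)"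
      using seq inc by (intro nn_integral_monotone_convergence_SUP) auto
    also have "\<dots> = (SUP i. \<integral>\<^sup>+x. U i x \<partial>L)" using seq by simp
    also have "\<dots> = (\<integral>\<^sup>+x. (SUP i. U i) x \<partial>L)"
      unfolding SUP_apply using seq by (intro nn_integral_monotone_convergence_SUP[symmetric]) auto
    finally have 1: "(\<integral>\<^sup>+\<omega>. (SUP i. \<integral>\<^sup>+x. U i x \<partial>N \<omega>) \<partial>M) = (\<integral>\<^sup>+x. (SUP i. U i) x \<partial>L)" .
    have g: "g = (SUP i. U i)" using seq by simp
    show ?case
      unfolding g
    proof
      show "(\<lambda>\<omega>. \<integral>\<^sup>+x. (SUP i. U i) x \<partial>N \<omega>) \<in> borel_measurable M"
        by (subst measurable_cong[OF eq]) auto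
      show "(\<integral>\<^sup>+\<omega>. \<integral>\<^sup>+x. (SUP i. U i) x \<partial>N \<omega> \<partial>M) = (\<integral>\<^sup>+x. (SUP i. U i) x \<partial>L)"
        by (rule trans[OF nn_integral_cong[OF eq] 1])
    qed
  qed
  then show "(\<lambda>\<omega>. \<integral>\<^sup>+x. g x \<partial>N \<omega>) \<in> borel_measurable M"
    "(\<integral>\<^sup>+\<omega>. \<integral>\<^sup>+x. g x \<partial>N \<omega> \<partial>M) = (\<integral>\<^sup>+x. g x \<partial>L)" by auto
qed

lemma integral_N_measurable:
  fixes G :: "'b \<Rightarrow> real"
  assumes G[measurable]: "G \<in> borel_measurable L"
  shows "(\<lambda>\<omega>. \<integral>x. G x \<partial>N \<omega>) \<in> borel_measurable M"
proof -
  have m: "(\<lambda>\<omega>. \<integral>\<^sup>+x. ennreal (G x) \<partial>N \<omega>) \<in> borel_measurable M"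
    "(\<lambda>\<omega>. \<integral>\<^sup>+x. ennreal (- G x) \<partial>N \<omega>) \<in> borel_measurable M"
    "(\<lambda>\<omega>. \<integral>\<^sup>+x. ennreal \<bar>G x\<bar> \<partial>N \<omega>) \<in> borel_measurable M"
    by (auto intro!: nn_integral_N_measurable)
  \<comment> \<open>The Bochner integral is 0 when G is not integrable for
    \<open>N \<omega>\<close>, so the set of such \<omega> has to be split off measurably.\<close>
  have eq: "(\<integral>x. G x \<partial>N \<omega>) = (if (\<integral>\<^sup>+x. ennreal \<bar>G x\<bar> \<partial>N \<omega>) < \<infinity> then
      enn2real (\<integral>\<^sup>+x. ennreal (G x) \<partial>N \<omega>) - enn2real (\<integral>\<^sup>+x. ennreal (- G x) \<partial>N \<omega>) else 0)"
    if "\<omega> \<in> space M" for \<omega>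
  proof -
    have "integrable (N \<omega>) G \<longleftrightarrow> (\<integral>\<^sup>+x. ennreal \<bar>G x\<bar> \<partial>N \<omega>) < \<infinity>"
      using measurable_N[OF that G] by (simp add: integrable_iff_bounded)
    then show ?thesis
      by (auto simp: real_lebesgue_integral_def not_integrable_integral_eq)
  qed
  show ?thesis
    by (subst measurable_cong[OF eq]) (use m in measurable)
qed

lemma integrable_N:
  fixes G :: "'b \<Rightarrow> real"
  assumes G: "integrable L G"
  shows AE_integrable_N: "AE \<omega> in M. integrable (N \<omega>) G"
    and integral_N_bound: "(\<integral>\<^sup>+\<omega>. ennreal \<bar>\<integral>x. G x \<partial>N \<omega>\<bar> \<partial>M) \<le> (\<integral>\<^sup>+x. ennreal \<bar>G x\<bar> \<partial>L)"
proof -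
  have [measurable]: "G \<in> borel_measurable L" using G by auto
  have c: "(\<integral>\<^sup>+\<omega>. \<integral>\<^sup>+x. ennreal \<bar>G x\<bar> \<partial>N \<omega> \<partial>M) = (\<integral>\<^sup>+x. ennreal \<bar>G x\<bar> \<partial>L)"
    by (rule campbell) simp
  also have "\<dots> < \<infinity>" using G by (simp add: integrable_iff_bounded)
  finally have "AE \<omega> in M. (\<integral>\<^sup>+x. ennreal \<bar>G x\<bar> \<partial>N \<omega>) \<noteq> \<infinity>"
    by (intro nn_integral_noteq_infinite nn_integral_N_measurable) auto
  then show "AE \<omega> in M. integrable (N \<omega>) G"
    using AE_space by eventually_elim (auto simp: integrable_iff_bounded less_top intro: measurable_N)
  have "(\<integral>\<^sup>+\<omega>. ennreal \<bar>\<integral>x. G x \<partial>N \<omega>\<bar> \<partial>M) \<le> (\<integral>\<^sup>+\<omega>. \<integral>\<^sup>+x. ennreal \<bar>G x\<bar> \<partial>N \<omega> \<partial>M)"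
  proof (rule nn_integral_mono)
    fix \<omega>
    show "ennreal \<bar>\<integral>x. G x \<partial>N \<omega>\<bar> \<le> (\<integral>\<^sup>+x. ennreal \<bar>G x\<bar> \<partial>N \<omega>)"
      using integral_norm_bound_ennreal[of "N \<omega>" G]
      by (cases "integrable (N \<omega>) G") (auto simp: not_integrable_integral_eq)
  qed
  then show "(\<integral>\<^sup>+\<omega>. ennreal \<bar>\<integral>x. G x \<partial>N \<omega>\<bar> \<partial>M) \<le> (\<integral>\<^sup>+x. ennreal \<bar>G x\<bar> \<partial>L)"
    by (simp add: c)
qed

lemma iexp_m1_integrable:
  assumes G: "integrable L G"
  shows "integrable L (\<lambda>x. iexp (G x) - 1)"
proof (rule Bochner_Integration.integrable_bound[OF G])
  have [measurable]: "G \<in> borel_measurable L" using G by auto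
  show "(\<lambda>x. iexp (G x) - 1) \<in> borel_measurable L" by measurable
  show "AE x in L. norm (iexp (G x) - 1) \<le> norm (G x)"
    using norm_iexp_diff_le[of _ 0] by (intro AE_I2) simp
qed

text \<open>The nonzero level sets are finitely many, disjoint and of finite intensity, so their
  counts are independent Poisson variables and the expectation factorizes.\<close>

lemma char_simple:
  fixes s :: "'b \<Rightarrow> real"
  assumes s: "Bochner_Integration.simple_bochner_integrable L s"
  shows "(\<integral>\<omega>. iexp (\<integral>x. s x \<partial>N \<omega>) \<partial>M) = exp (\<integral>x. iexp (s x) - 1 \<partial>L)"
proof -
  have sf: "simple_function L s" and fin: "emeasure L {x \<in> space L. s x \<noteq> 0} \<noteq> \<infinity>"
    using s by (auto simp: Bochner_Integration.simple_bochner_integrable.simps)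
  let ?V = "s ` space L - {0}"
  have "finite ?V" using sf by (auto simp: simple_function_def)
  then obtain c :: "nat \<Rightarrow> real" and n where c: "?V = c ` {..<n}" "inj_on c {..<n}"
    by (metis finite_imp_nat_seg_image_inj_on lessThan_def)
  define A where "A i = s -` {c i} \<inter> space L" for i
  have A: "A i \<in> sets L" for i unfolding A_def using sf by (rule simple_functionD)
  have cne: "c i \<noteq> 0" if "i < n" for i using c that by auto
  have dj: "disjoint_family_on A {..<n}"
    using c(2) by (auto simp: disjoint_family_on_def A_def inj_on_def)
  have Afin: "emeasure L (A i) < \<infinity>" if "i < n" for i
  proof -
    have "{x \<in> space L. s x \<noteq> 0} = s -` (- {0}) \<inter> space L" by auto
    also have "\<dots> \<in> sets L" using sf by (rule simple_functionD)
    finally have "emeasure L (A i) \<le> emeasure L {x \<in> space L. s x \<noteq> 0}"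
      using cne[OF that] by (intro emeasure_mono) (auto simp: A_def)
    then show ?thesis using fin by (auto simp: less_top[symmetric] top_unique)
  qed
  \<comment> \<open>Used twice: with the identity to integrate s, and with y -> e^(iy) - 1 for the
    exponent.\<close>
  have one: "\<phi> (s x) = (\<Sum>i<n. indicator (A i) x *\<^sub>R \<phi> (c i))"
    if x: "x \<in> space L" and \<phi>: "\<phi> 0 = 0" for x and \<phi> :: "real \<Rightarrow> 'z::real_vector"
  proof (cases "s x = 0")
    case True
    then have "(\<Sum>i<n. indicator (A i) x *\<^sub>R \<phi> (c i)) = 0"
      using cne by (intro sum.neutral) (auto simp: A_def indicator_def)
    then show ?thesis using True \<phi> by simp
  next
    case False
    then have "s x \<in> c ` {..<n}" using c(1) x by blast
    then obtain k where k: "k < n" "s x = c k" by auto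
    have "(\<Sum>i<n. indicator (A i) x *\<^sub>R \<phi> (c i)) = (\<Sum>i<n. if i = k then \<phi> (c k) else 0)"
      using k c(2) x by (intro sum.cong) (auto simp: A_def indicator_def inj_on_def)
    then show ?thesis using k by simp
  qed
  have AEint: "AE \<omega> in M. (\<integral>x. s x \<partial>N \<omega>) = (\<Sum>i<n. c i * measure (N \<omega>) (A i))"
  proof -
    have "AE \<omega> in M. \<forall>i\<in>{..<n}. \<exists>k. \<omega> \<in> count_event (A i) k"
      using A Afin by (intro AE_finite_allI AE_count) auto
    then show ?thesis using AE_space
    proof eventually_elim
      case (elim \<omega>)
      have "(\<integral>x. s x \<partial>N \<omega>) = (\<integral>x. (\<Sum>i<n. indicator (A i) x *\<^sub>R c i) \<partial>N \<omega>)"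
        using one[of _ "\<lambda>x. x"] space_N[OF elim(2)] by (intro Bochner_Integration.integral_cong) auto
      also have "\<dots> = (\<Sum>i<n. \<integral>x. indicator (A i) x *\<^sub>R c i \<partial>N \<omega>)"
      proof (rule Bochner_Integration.integral_sum)
        fix i assume i: "i \<in> {..<n}"
        then obtain k where "emeasure (N \<omega>) (A i) = of_nat k"
          using elim(1) by (auto simp: count_event_def)
        then have "emeasure (N \<omega>) (A i) < \<infinity>"
          by (simp add: ennreal_of_nat_eq_real_of_nat)
        then show "integrable (N \<omega>) (\<lambda>x. indicator (A i) x *\<^sub>R c i)"
          using A sets_N[OF elim(2)] by (intro integrable_scaleR_left) (simp add: integrable_indicator_iff)
      qed
      also have "\<dots> = (\<Sum>i<n. c i * measure (N \<omega>) (A i))"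
        using A[THEN sets.sets_into_space] space_N[OF elim(2)] by (simp add: Int_absorb2 mult.commute)
      finally show ?case .
    qed
  qed
  have mm[measurable]: "(\<lambda>\<omega>. measure (N \<omega>) (A i)) \<in> borel_measurable M" for i
    unfolding measure_def using A by measurable
  have [measurable]: "(\<lambda>\<omega>. \<integral>x. s x \<partial>N \<omega>) \<in> borel_measurable M"
    by (rule integral_N_measurable) (rule borel_measurable_simple_function[OF sf])
  have "(\<integral>\<omega>. iexp (\<integral>x. s x \<partial>N \<omega>) \<partial>M) = (\<integral>\<omega>. (\<Prod>i<n. iexp (c i * measure (N \<omega>) (A i))) \<partial>M)"
  proof (rule integral_cong_AE)
    show "AE \<omega> in M. iexp (\<integral>x. s x \<partial>N \<omega>) = (\<Prod>i<n. iexp (c i * measure (N \<omega>) (A i)))"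
      using AEint by eventually_elim (simp add: sum_distrib_left flip: exp_sum)
  qed measurable
  also have "\<dots> = (\<Prod>i<n. \<integral>\<omega>. iexp (c i * measure (N \<omega>) (A i)) \<partial>M)"
  proof (rule indep_vars_lebesgue_integral)
    have "indep_vars (\<lambda>_. borel) (\<lambda>i \<omega>. emeasure (N \<omega>) (A i)) {..<n}"
      using N A dj unfolding poisson_random_measure_def by blast
    then show "indep_vars (\<lambda>_. borel) (\<lambda>i \<omega>. iexp (c i * measure (N \<omega>) (A i))) {..<n}"
      unfolding measure_def by (rule indep_vars_compose2) measurable
    show "integrable M (\<lambda>\<omega>. iexp (c i * measure (N \<omega>) (A i)))" for i
      by (rule integrable_const_bound[where B=1]) auto
  qed simp
  also have "\<dots> = (\<Prod>i<n. exp (measure L (A i) * (iexp (c i) - 1)))"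
    using A Afin by (intro prod.cong char_count) auto
  also have "\<dots> = exp (\<Sum>i<n. measure L (A i) * (iexp (c i) - 1))" by (simp add: exp_sum)
  also have "(\<Sum>i<n. measure L (A i) * (iexp (c i) - 1)) = (\<Sum>i<n. \<integral>x. indicator (A i) x *\<^sub>R (iexp (c i) - 1) \<partial>L)"
    using A[THEN sets.sets_into_space] by (simp add: Int_absorb2 scaleR_conv_of_real)
  also have "\<dots> = (\<integral>x. (\<Sum>i<n. indicator (A i) x *\<^sub>R (iexp (c i) - 1)) \<partial>L)"
    using A Afin
    by (intro Bochner_Integration.integral_sum[symmetric] integrable_scaleR_left) (auto simp: integrable_indicator_iff)
  also have "\<dots> = (\<integral>x. iexp (s x) - 1 \<partial>L)"
    using one[of _ "\<lambda>y. iexp y - 1"] by (intro Bochner_Integration.integral_cong) auto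
  finally show ?thesis .
qed

text \<open>Simple functions are dense in L^1, and both the expectation on the left and the exponent
  on the right are 1-Lipschitz in the L^1 norm of G, because e^(ia) is 1-Lipschitz in a; on the
  left, Campbell's formula bounds the expected difference.\<close>

lemma char_N:
  fixes G :: "'b \<Rightarrow> real"
  assumes G: "integrable L G"
  shows "(\<integral>\<omega>. iexp (\<integral>x. G x \<partial>N \<omega>) \<partial>M) = exp (\<integral>x. iexp (G x) - 1 \<partial>L)"
proof -
  obtain x where "has_bochner_integral L G x" using G by (auto simp: integrable.simps)
  then obtain s where s: "\<And>i. Bochner_Integration.simple_bochner_integrable L (s i)"
    and lim: "(\<lambda>i. \<integral>\<^sup>+x. norm (G x - s i x) \<partial>L) \<longlonglongrightarrow> 0"
    unfolding has_bochner_integral.simps by blast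
  have [measurable]: "G \<in> borel_measurable L" using G by auto
  have si: "integrable L (s i)" for i
    using has_bochner_integral_simple_bochner_integrable[OF s] by (rule integrable.intros)
  have [measurable]: "s i \<in> borel_measurable L" for i using si[of i] by auto
  define e where "e i = (\<integral>x. \<bar>G x - s i x\<bar> \<partial>L)" for i
  have Gsi: "integrable L (\<lambda>x. G x - s i x)" for i using G si by auto
  have e_nn: "(\<integral>\<^sup>+x. ennreal \<bar>G x - s i x\<bar> \<partial>L) = ennreal (e i)" for i
    unfolding e_def using Gsi[of i] by (intro nn_integral_eq_integral) auto
  have e0: "0 \<le> e i" for i unfolding e_def by simp
  have "e \<longlonglongrightarrow> 0"
    using lim e0 unfolding real_norm_def e_nn ennreal_0[symmetric] by (subst (asm) tendsto_ennreal_iff) auto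
  have mN[measurable]: "(\<lambda>\<omega>. \<integral>x. g x \<partial>N \<omega>) \<in> borel_measurable M" if "g \<in> borel_measurable L" for g :: "'b \<Rightarrow> real"
    by (rule integral_N_measurable[OF that])
  have ii: "integrable M (\<lambda>\<omega>. iexp (\<integral>x. g x \<partial>N \<omega>))" if "g \<in> borel_measurable L" for g :: "'b \<Rightarrow> real"
    using mN[OF that] by (intro integrable_const_bound[where B=1]) auto
  have b1: "cmod ((\<integral>\<omega>. iexp (\<integral>x. G x \<partial>N \<omega>) \<partial>M) - (\<integral>\<omega>. iexp (\<integral>x. s i x \<partial>N \<omega>) \<partial>M)) \<le> e i" for i
  proof -
    let ?D = "\<lambda>\<omega>. \<bar>\<integral>x. G x - s i x \<partial>N \<omega>\<bar>"
    have [measurable]: "?D \<in> borel_measurable M" using mN[of "\<lambda>x. G x - s i x"] by measurable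
    have Db: "(\<integral>\<^sup>+\<omega>. ennreal (?D \<omega>) \<partial>M) \<le> ennreal (e i)"
      using integral_N_bound[OF Gsi] by (simp add: e_nn)
    then have Di: "integrable M ?D"
      by (intro integrableI_bounded) (auto intro: le_less_trans)
    have "cmod ((\<integral>\<omega>. iexp (\<integral>x. G x \<partial>N \<omega>) \<partial>M) - (\<integral>\<omega>. iexp (\<integral>x. s i x \<partial>N \<omega>) \<partial>M)) =
      cmod (\<integral>\<omega>. iexp (\<integral>x. G x \<partial>N \<omega>) - iexp (\<integral>x. s i x \<partial>N \<omega>) \<partial>M)"
      by (subst Bochner_Integration.integral_diff) (auto intro!: ii)
    also have "\<dots> \<le> (\<integral>\<omega>. cmod (iexp (\<integral>x. G x \<partial>N \<omega>) - iexp (\<integral>x. s i x \<partial>N \<omega>)) \<partial>M)"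
      by (rule integral_norm_bound)
    also have "\<dots> \<le> (\<integral>\<omega>. ?D \<omega> \<partial>M)"
    proof (rule integral_mono_AE)
      show "AE \<omega> in M. cmod (iexp (\<integral>x. G x \<partial>N \<omega>) - iexp (\<integral>x. s i x \<partial>N \<omega>)) \<le> ?D \<omega>"
        using AE_integrable_N[OF G] AE_integrable_N[OF si[of i]]
        by eventually_elim (simp add: norm_iexp_diff_le)
    qed (auto intro!: integrable_norm Bochner_Integration.integrable_diff ii Di)
    also have "\<dots> \<le> e i"
      using Db Di e0 by (simp add: nn_integral_eq_integral)
    finally show ?thesis .
  qed
  have b2: "cmod ((\<integral>x. iexp (G x) - 1 \<partial>L) - (\<integral>x. iexp (s i x) - 1 \<partial>L)) \<le> e i" for i
  proof -
    have "(\<integral>x. iexp (G x) - 1 \<partial>L) - (\<integral>x. iexp (s i x) - 1 \<partial>L) = (\<integral>x. (iexp (G x) - 1) - (iexp (s i x) - 1) \<partial>L)"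
      by (rule Bochner_Integration.integral_diff[symmetric]) (intro iexp_m1_integrable G si)+
    also have "cmod \<dots> \<le> (\<integral>x. \<bar>G x - s i x\<bar> \<partial>L)"
    proof (rule order_trans[OF integral_norm_bound integral_mono])
      show "integrable L (\<lambda>x. norm ((iexp (G x) - 1) - (iexp (s i x) - 1)))"
        by (intro integrable_norm Bochner_Integration.integrable_diff iexp_m1_integrable G si)
      show "norm ((iexp (G x) - 1) - (iexp (s i x) - 1)) \<le> \<bar>G x - s i x\<bar>" for x
        using norm_iexp_diff_le[of "G x" "s i x"] by simp
    qed (use Gsi[of i] in auto)
    finally show ?thesis by (simp add: e_def)
  qed
  have "(\<lambda>i. \<integral>\<omega>. iexp (\<integral>x. s i x \<partial>N \<omega>) \<partial>M) \<longlonglongrightarrow> (\<integral>\<omega>. iexp (\<integral>x. G x \<partial>N \<omega>) \<partial>M)"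
    by (rule LIM_zero_cancel, rule Lim_null_comparison[OF _ \<open>e \<longlonglongrightarrow> 0\<close>])
      (use b1 in \<open>simp add: norm_minus_commute\<close>)
  moreover have "(\<lambda>i. \<integral>x. iexp (s i x) - 1 \<partial>L) \<longlonglongrightarrow> (\<integral>x. iexp (G x) - 1 \<partial>L)"
    by (rule LIM_zero_cancel, rule Lim_null_comparison[OF _ \<open>e \<longlonglongrightarrow> 0\<close>])
      (use b2 in \<open>simp add: norm_minus_commute\<close>)
  then have "(\<lambda>i. exp (\<integral>x. iexp (s i x) - 1 \<partial>L)) \<longlonglongrightarrow> exp (\<integral>x. iexp (G x) - 1 \<partial>L)"
    by (rule tendsto_exp)
  ultimately show ?thesis
    unfolding char_simple[OF s] by (rule LIMSEQ_unique)
qed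

lemma char_compensated:
  fixes G :: "'b \<Rightarrow> real"
  assumes G: "integrable L G"
  shows "(\<integral>\<omega>. iexp ((\<integral>x. G x \<partial>N \<omega>) - (\<integral>x. G x \<partial>L)) \<partial>M) = exp (\<integral>x. iexp (G x) - 1 - \<i> * G x \<partial>L)"
proof -
  have "(\<integral>\<omega>. iexp ((\<integral>x. G x \<partial>N \<omega>) - (\<integral>x. G x \<partial>L)) \<partial>M) =
    (\<integral>\<omega>. iexp (\<integral>x. G x \<partial>N \<omega>) * exp (- (\<i> * (\<integral>x. G x \<partial>L))) \<partial>M)"
    by (simp add: right_diff_distrib exp_diff exp_minus divide_inverse)
  also have "\<dots> = exp (\<integral>x. iexp (G x) - 1 \<partial>L) * exp (- (\<i> * (\<integral>x. G x \<partial>L)))"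
    by (simp add: char_N[OF G])
  also have "\<dots> = exp ((\<integral>x. iexp (G x) - 1 \<partial>L) - (\<integral>x. \<i> * G x \<partial>L))"
    by (simp add: exp_diff exp_minus divide_inverse)
  also have "(\<integral>x. iexp (G x) - 1 \<partial>L) - (\<integral>x. \<i> * G x \<partial>L) = (\<integral>x. iexp (G x) - 1 - \<i> * G x \<partial>L)"
    using iexp_m1_integrable[OF G] G by (intro Bochner_Integration.integral_diff[symmetric]) auto
  finally show ?thesis .
qed

end

subsection \<open>Processes driven by the Poisson random measure\<close>

abbreviation (input) "signed_space \<equiv> signed_algebra {0::real..}"

locale jump_noise =
  fixes M :: "'w measure" and m :: "real measure" and N :: "'w \<Rightarrow> (real \<times> real) measure"
  assumes m_sets: "sets m = sets (restrict_space borel (- {0::real}))"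
    and m_finite: "finite_measure (density m (\<lambda>u. ennreal \<bar>u\<bar>))"
    and M_prob: "prob_space M"
    and N_poisson: "poisson_random_measure M (jump_intensity m) N"
begin

lemma space_m: "space m = - {0}"
  using sets_eq_imp_space_eq[OF m_sets] by (simp add: space_restrict_space)

lemma id_measurable_m: "(\<lambda>u. u) \<in> borel_measurable m"
proof -
  have "(\<lambda>u. u) \<in> borel_measurable (restrict_space borel (- {0::real}))"
    by (rule measurable_restrict_space1) simp
  then show ?thesis using m_sets by (simp cong: measurable_cong_sets)
qed

lemma nn_integral_abs_m: "(\<integral>\<^sup>+u. ennreal \<bar>u\<bar> \<partial>m) < \<infinity>"
proof -
  note [measurable] = id_measurable_m
  have "(\<integral>\<^sup>+u. ennreal \<bar>u\<bar> \<partial>m) = emeasure (density m (\<lambda>u. ennreal \<bar>u\<bar>)) (space m)"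
    by (subst emeasure_density[OF _ sets.top]) (auto intro!: nn_integral_cong)
  also have "\<dots> < \<infinity>"
    using finite_measure.emeasure_finite[OF m_finite] by (simp add: less_top[symmetric])
  finally show ?thesis .
qed

lemma integrable_m: "integrable m (\<lambda>u. u)"
  using nn_integral_abs_m id_measurable_m by (simp add: integrable_iff_bounded)

text \<open>m may have infinite mass near 0, but by Markov's inequality the sets |u| >= 1/n have
  finite measure, and they exhaust the space because 0 is excluded.\<close>

lemma sigma_finite_m: "sigma_finite_measure m"
proof
  note [measurable] = id_measurable_m
  define A where "A n = {u \<in> space m. 1 / real (Suc n) \<le> \<bar>u\<bar>}" for n
  have A: "A n \<in> sets m" for n unfolding A_def by measurable
  have "emeasure m (A n) \<noteq> \<infinity>" for n
  proof -
    have "emeasure m (A n) = (\<integral>\<^sup>+u. indicator (A n) u \<partial>m)" using A by simp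
    also have "\<dots> \<le> (\<integral>\<^sup>+u. ennreal (real (Suc n)) * ennreal \<bar>u\<bar> \<partial>m)"
    proof (rule nn_integral_mono)
      fix u
      have "1 \<le> real (Suc n) * \<bar>u\<bar>" if "u \<in> A n" using that by (simp add: A_def field_simps)
      then show "indicator (A n) u \<le> ennreal (real (Suc n)) * ennreal \<bar>u\<bar>"
        by (auto simp: indicator_def ennreal_mult[symmetric] simp del: of_nat_Suc)
    qed
    also have "\<dots> = ennreal (real (Suc n)) * (\<integral>\<^sup>+u. ennreal \<bar>u\<bar> \<partial>m)" by (rule nn_integral_cmult) measurable
    also have "\<dots> < \<infinity>" using nn_integral_abs_m by (simp add: ennreal_mult_less_top)
    finally show ?thesis by simp
  qed
  moreover have "(\<Union>n. A n) = space m"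
  proof -
    have "\<exists>n. 1 / real (Suc n) \<le> \<bar>u\<bar>" if "u \<in> space m" for u
    proof -
      obtain n where "inverse (real (Suc n)) < \<bar>u\<bar>" using reals_Archimedean[of "\<bar>u\<bar>"] \<open>u \<in> space m\<close> by (auto simp: space_m)
      then show ?thesis by (auto simp: inverse_eq_divide intro: less_imp_le)
    qed
    then show ?thesis by (auto simp: A_def)
  qed
  ultimately show "\<exists>B. countable B \<and> B \<subseteq> sets m \<and> \<Union> B = space m \<and> (\<forall>a\<in>B. emeasure m a \<noteq> \<infinity>)"
    using A by (intro exI[of _ "range A"]) auto
qed

abbreviation "time \<equiv> restrict_space lborel {0::real..}"
abbreviation "L \<equiv> jump_intensity m"

lemma sigma_finite_time: "sigma_finite_measure time"
  by (rule sigma_finite_measure_restrict_space) (auto intro: lborel.sigma_finite_measure_axioms)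

sublocale pair_sigma_finite time m
  unfolding pair_sigma_finite_def using sigma_finite_time sigma_finite_m by simp

lemma L_eq: "L = time \<Otimes>\<^sub>M m" by (simp add: jump_intensity_def)

lemma sigma_finite_L: "sigma_finite_measure L"
  unfolding L_eq by (rule sigma_finite_measure_axioms)

sublocale poisson_random M L N
  using M_prob sigma_finite_L N_poisson by (simp add: poisson_random_def poisson_random_axioms_def)

lemma id_measurable_time: "(\<lambda>s. s) \<in> borel_measurable time"
  by (rule measurable_restrict_space1) simp

lemma fst_measurable_L [measurable]: "fst \<in> borel_measurable L"
  unfolding L_eq by (rule measurable_compose[OF measurable_fst id_measurable_time])

lemma snd_measurable_L [measurable]: "snd \<in> borel_measurable L"
  unfolding L_eq by (rule measurable_compose[OF measurable_snd id_measurable_m])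

text \<open>All stochastic integrals that occur have integrands of the form \<open>\<theta>(s) u\<close>.\<close>

definition good_integrand :: "(real \<Rightarrow> real) \<Rightarrow> bool" where
  "good_integrand \<theta> \<longleftrightarrow> \<theta> \<in> borel_measurable borel \<and>
    (\<exists>c K. \<forall>s. \<bar>\<theta> s\<bar> \<le> c * indicator {0..K} s)"

definition jump_fun :: "(real \<Rightarrow> real) \<Rightarrow> real \<times> real \<Rightarrow> real" where
  "jump_fun \<theta> x = \<theta> (fst x) * snd x"

text \<open>The integral runs over all times; the horizon t is built into the integrand, so
  integrals with different horizons can be added.\<close>

definition comp_int :: "'w \<Rightarrow> (real \<Rightarrow> real) \<Rightarrow> real" where
  "comp_int \<omega> \<theta> = (\<integral>x. jump_fun \<theta> x \<partial>N \<omega>) - (\<integral>x. jump_fun \<theta> x \<partial>L)"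

lemma good_integrand_measurable: "good_integrand \<theta> \<Longrightarrow> \<theta> \<in> borel_measurable borel"
  by (simp add: good_integrand_def)

lemma good_integrand_lincomb:
  assumes "good_integrand \<theta>" "good_integrand \<eta>"
  shows "good_integrand (\<lambda>s. a * \<theta> s + b * \<eta> s)"
proof -
  obtain c K where c: "\<And>s. \<bar>\<theta> s\<bar> \<le> c * indicator {0..K} s" using assms by (auto simp: good_integrand_def)
  obtain d J where d: "\<And>s. \<bar>\<eta> s\<bar> \<le> d * indicator {0..J} s" using assms by (auto simp: good_integrand_def)
  have c': "\<bar>\<theta> s\<bar> \<le> \<bar>c\<bar> * indicator {0..max K J} s" and d': "\<bar>\<eta> s\<bar> \<le> \<bar>d\<bar> * indicator {0..max K J} s" for s
    using c[of s] d[of s] by (auto split: split_indicator_asm split_indicator)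
  have "\<bar>a * \<theta> s + b * \<eta> s\<bar> \<le> (\<bar>a\<bar> * \<bar>c\<bar> + \<bar>b\<bar> * \<bar>d\<bar>) * indicator {0..max K J} s" for s
  proof -
    have "\<bar>a * \<theta> s + b * \<eta> s\<bar> \<le> \<bar>a\<bar> * \<bar>\<theta> s\<bar> + \<bar>b\<bar> * \<bar>\<eta> s\<bar>"
      by (metis abs_mult abs_triangle_ineq)
    also have "\<dots> \<le> \<bar>a\<bar> * (\<bar>c\<bar> * indicator {0..max K J} s) + \<bar>b\<bar> * (\<bar>d\<bar> * indicator {0..max K J} s)"
      by (intro add_mono mult_left_mono c' d') auto
    finally show ?thesis by (simp add: algebra_simps)
  qed
  moreover have [measurable]: "\<theta> \<in> borel_measurable borel" "\<eta> \<in> borel_measurable borel"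
    using assms by (auto simp: good_integrand_def)
  ultimately show ?thesis unfolding good_integrand_def by (intro conjI) (measurable, blast)
qed

lemma good_integrand_integrable_time:
  assumes "good_integrand \<theta>"
  shows "integrable lborel \<theta>" "integrable time \<theta>" "s < 0 \<Longrightarrow> \<theta> s = 0"
proof -
  obtain c K where c: "\<And>s. \<bar>\<theta> s\<bar> \<le> c * indicator {0..K} s" using assms by (auto simp: good_integrand_def)
  have [measurable]: "\<theta> \<in> borel_measurable borel" using assms by (simp add: good_integrand_def)
  show i: "integrable lborel \<theta>"
  proof (rule Bochner_Integration.integrable_bound)
    show "integrable lborel (\<lambda>s. c * indicator {0..K} s)"
      by (intro integrable_mult_right integrable_real_indicator) (auto simp: emeasure_lborel_Icc_eq)
    show "AE s in lborel. norm (\<theta> s) \<le> norm (c * indicator {0..K} s)"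
      using c by (auto intro: order_trans[OF _ abs_ge_self])
  qed measurable
  show "integrable time \<theta>"
    using integrable_mult_indicator[OF _ i, of "{0..}"] by (simp add: integrable_restrict_space)
  show "\<theta> s = 0" if "s < 0" using c[of s] that by simp
qed

lemma jump_fun_measurable [measurable]:
  assumes [measurable]: "\<theta> \<in> borel_measurable borel"
  shows "jump_fun \<theta> \<in> borel_measurable L"
  unfolding jump_fun_def by measurable

lemma jump_fun_integrable:
  assumes "good_integrand \<theta>"
  shows "integrable L (jump_fun \<theta>)"
proof -
  have 1: "jump_fun \<theta> \<in> borel_measurable (time \<Otimes>\<^sub>M m)"
    using jump_fun_measurable[OF good_integrand_measurable[OF assms]] unfolding L_eq .
  have 2: "integrable time (\<lambda>s. \<integral>u. norm (jump_fun \<theta> (s, u)) \<partial>m)"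
    using good_integrand_integrable_time(2)[OF assms] by (simp add: jump_fun_def abs_mult)
  have 3: "AE s in time. integrable m (\<lambda>u. jump_fun \<theta> (s, u))"
    using integrable_m by (simp add: jump_fun_def)
  show ?thesis unfolding L_eq by (rule Fubini_integrable[OF 1 2 3])
qed

lemma comp_int_measurable:
  assumes "good_integrand \<theta>"
  shows "(\<lambda>\<omega>. comp_int \<omega> \<theta>) \<in> borel_measurable M"
  unfolding comp_int_def
  by (intro borel_measurable_diff borel_measurable_const integral_N_measurable jump_fun_measurable
      good_integrand_measurable assms)

text \<open>Only almost sure, since both functions have to be integrable for
  \<open>N \<omega>\<close>; the null set depends on them.\<close>

lemma comp_int_lincomb:
  assumes "good_integrand \<theta>" "good_integrand \<eta>"
  shows "AE \<omega> in M. comp_int \<omega> (\<lambda>s. a * \<theta> s + b * \<eta> s) = a * comp_int \<omega> \<theta> + b * comp_int \<omega> \<eta>"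
proof -
  have e: "jump_fun (\<lambda>s. a * \<theta> s + b * \<eta> s) = (\<lambda>x. a * jump_fun \<theta> x + b * jump_fun \<eta> x)"
    by (auto simp: jump_fun_def algebra_simps)
  show ?thesis
    using AE_integrable_N[OF jump_fun_integrable[OF assms(1)]] AE_integrable_N[OF jump_fun_integrable[OF assms(2)]]
    by eventually_elim (use jump_fun_integrable[OF assms(1)] jump_fun_integrable[OF assms(2)] in
      \<open>simp add: comp_int_def e algebra_simps\<close>)
qed

abbreviation "\<phi> \<equiv> jump_exponent m"

lemma jump_exponent_0 [simp]: "\<phi> 0 = 0"
  by (simp add: jump_exponent_def)

lemma char_comp_int:
  assumes \<theta>: "good_integrand \<theta>"
  shows "(\<integral>\<omega>. iexp (comp_int \<omega> \<theta>) \<partial>M) = exp (\<integral>s. \<phi> (\<theta> s) \<partial>lborel)"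
    and "integrable lborel (\<lambda>s. \<phi> (\<theta> s))"
proof -
  note [measurable] = good_integrand_measurable[OF \<theta>]
  let ?g = "\<lambda>x. iexp (jump_fun \<theta> x) - 1 - \<i> * jump_fun \<theta> x"
  have i: "integrable (time \<Otimes>\<^sub>M m) ?g"
    using iexp_m1_integrable[OF jump_fun_integrable[OF \<theta>]] jump_fun_integrable[OF \<theta>] unfolding L_eq
    by (intro Bochner_Integration.integrable_diff[of _ "\<lambda>x. iexp (jump_fun \<theta> x) - 1"]) auto
  have e: "(\<integral>u. ?g (s, u) \<partial>m) = \<phi> (\<theta> s)" for s
    by (simp add: jump_exponent_def jump_fun_def mult.commute)
  have it: "integrable time (\<lambda>s. \<phi> (\<theta> s))"
    using integrable_fst'[OF i] by (simp add: e)
  have ind: "indicator {0..} s *\<^sub>R \<phi> (\<theta> s) = \<phi> (\<theta> s)" for s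
    using good_integrand_integrable_time(3)[OF \<theta>, of s] by (auto split: split_indicator)
  show "integrable lborel (\<lambda>s. \<phi> (\<theta> s))"
    using it by (subst (asm) integrable_restrict_space) (auto simp: ind)
  have "(\<integral>\<omega>. iexp (comp_int \<omega> \<theta>) \<partial>M) = exp (\<integral>x. ?g x \<partial>L)"
    unfolding comp_int_def by (rule char_compensated[OF jump_fun_integrable[OF \<theta>]])
  also have "(\<integral>x. ?g x \<partial>L) = (\<integral>s. \<phi> (\<theta> s) \<partial>time)"
    unfolding L_eq using integral_fst'[OF i] by (simp add: e)
  also have "\<dots> = (\<integral>s. \<phi> (\<theta> s) \<partial>lborel)"
    by (subst integral_restrict_space) (auto simp: ind)
  finally show "(\<integral>\<omega>. iexp (comp_int \<omega> \<theta>) \<partial>M) = exp (\<integral>s. \<phi> (\<theta> s) \<partial>lborel)" .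
qed

text \<open>For s < t this is the mass that \<open>kappa (t - s)\<close> gives to h f. Written
  through T it has the value f(0) / 2 at s = t, which makes it right continuous in t for continuous
  f.\<close>

definition entrance_integrand :: "real \<Rightarrow> (real \<Rightarrow> real) \<Rightarrow> real \<Rightarrow> real" where
  "entrance_integrand t f s = indicator {0..t} s * (T_semigroup (t - s) f 0 / 2)"

lemma good_entrance_integrand:
  assumes f: "f \<in> bounded_borel {0..}"
  shows "good_integrand (entrance_integrand t f)"
proof -
  obtain c where c: "0 \<le> c" "\<And>x. x \<in> {0..} \<Longrightarrow> \<bar>f x\<bar> \<le> c" using bounded_borelE[OF f] by metis
  have b: "\<bar>entrance_integrand t f s\<bar> \<le> c / 2 * indicator {0..t} s" for s
    using T_semigroup_at_0_bound[OF f c(2), of "t - s"] by (auto simp: entrance_integrand_def split: split_indicator)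
  have [measurable]: "(\<lambda>r. indicator {0..} r * T_semigroup r f 0) \<in> borel_measurable borel"
    by (rule T_semigroup_at_0_measurable[OF f])
  have "(\<lambda>s. indicator {0..t} s * ((\<lambda>r. indicator {0..} r * T_semigroup r f 0) (t - s) / 2)) \<in> borel_measurable borel"
    by measurable
  also have "(\<lambda>s. indicator {0..t} s * ((\<lambda>r. indicator {0..} r * T_semigroup r f 0) (t - s) / 2)) = entrance_integrand t f"
    by (auto simp: entrance_integrand_def fun_eq_iff split: split_indicator)
  finally show ?thesis unfolding good_integrand_def using b by blast
qed

definition S_exponent :: "real \<Rightarrow> (real \<Rightarrow> real) \<Rightarrow> complex" where
  "S_exponent t f = (LINT s:{0..t}|lborel. \<phi> (\<integral>y. h_weight y * f y \<partial>kappa s))"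

text \<open>Time is reversed by s -> a + t - s. The shift a is 0 for the law at time t, and the
  present time in the Markov property. The two integrands can differ only at age 0, a null
  set.\<close>

lemma S_exponent_entrance:
  assumes f: "f \<in> bounded_borel {0..}"
  shows "(\<integral>s. \<phi> (indicator {a..a + t} s * (T_semigroup (a + t - s) f 0 / 2)) \<partial>lborel) = S_exponent t f"
proof -
  have "(\<integral>s. \<phi> (indicator {a..a + t} s * (T_semigroup (a + t - s) f 0 / 2)) \<partial>lborel) =
    (\<integral>s. \<phi> (indicator {a..a + t} (a + t + - 1 * s) * (T_semigroup (a + t - (a + t + - 1 * s)) f 0 / 2)) \<partial>lborel)"
    by (subst lborel_integral_real_affine[where c="-1" and t="a + t"]) simp_all
  also have "\<dots> = (\<integral>s. \<phi> (indicator {0..t} s * (T_semigroup s f 0 / 2)) \<partial>lborel)"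
    by (intro Bochner_Integration.integral_cong) (auto split: split_indicator)
  also have "\<dots> = (\<integral>s. indicator {0..t} s *\<^sub>R \<phi> (\<integral>y. h_weight y * f y \<partial>kappa s) \<partial>lborel)"
  proof (rule integral_cong_AE)
    have eq: "\<phi> (indicator {0..t} s * (T_semigroup s f 0 / 2)) = indicator {0..t} s *\<^sub>R \<phi> (\<integral>y. h_weight y * f y \<partial>kappa s)"
      if "s \<noteq> 0" for s
      using that by (auto simp: kappa_h_weight split: split_indicator)
    then show AE: "AE s in lborel. \<phi> (indicator {0..t} s * (T_semigroup s f 0 / 2)) = indicator {0..t} s *\<^sub>R \<phi> (\<integral>y. h_weight y * f y \<partial>kappa s)"
      using AE_lborel_singleton[of 0] by (auto elim: eventually_mono)
    have "integrable lborel (\<lambda>s. \<phi> (entrance_integrand t f s))"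
      by (rule char_comp_int(2)[OF good_entrance_integrand[OF f]])
    then have [measurable]: "(\<lambda>s. \<phi> (entrance_integrand t f s)) \<in> borel_measurable borel" by auto
    have "(\<lambda>s. \<phi> (entrance_integrand t f (t - s))) \<in> borel_measurable borel" by measurable
    moreover have "entrance_integrand t f (t - s) = indicator {0..t} s * (T_semigroup s f 0 / 2)" for s
      by (auto simp: entrance_integrand_def split: split_indicator)
    ultimately show m: "(\<lambda>s. \<phi> (indicator {0..t} s * (T_semigroup s f 0 / 2))) \<in> borel_measurable lborel" by simp
    have [measurable]: "(\<lambda>s. \<phi> (indicator {0..t} s * (T_semigroup s f 0 / 2))) \<in> borel_measurable borel" using m by simp
    \<comment> \<open>The version with \<open>kappa\<close> is measurable because it is a measurable
      function altered at one point.\<close>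
    have "(\<lambda>s. if s = 0 then indicator {0..t} 0 *\<^sub>R \<phi> (\<integral>y. h_weight y * f y \<partial>kappa 0)
       else \<phi> (indicator {0..t} s * (T_semigroup s f 0 / 2))) \<in> borel_measurable borel" by measurable
    also have "(\<lambda>s. if s = 0 then indicator {0..t} 0 *\<^sub>R \<phi> (\<integral>y. h_weight y * f y \<partial>kappa 0)
       else \<phi> (indicator {0..t} s * (T_semigroup s f 0 / 2))) = (\<lambda>s. indicator {0..t} s *\<^sub>R \<phi> (\<integral>y. h_weight y * f y \<partial>kappa s))"
      using eq by auto
    finally show "(\<lambda>s. indicator {0..t} s *\<^sub>R \<phi> (\<integral>y. h_weight y * f y \<partial>kappa s)) \<in> borel_measurable lborel" by simp
  qed
  finally show ?thesis by (simp add: S_exponent_def set_lebesgue_integral_def)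
qed

text \<open>All laws below are derived from this alone, so they hold at once for Z and for the right
  continuous realization. The exceptional null set may depend on t and f.\<close>

definition driven :: "(real \<Rightarrow> 'w \<Rightarrow> real set \<Rightarrow> real) \<Rightarrow> bool" where
  "driven W \<longleftrightarrow> (\<forall>t\<ge>0. W t \<in> measurable M signed_space) \<and>
    (\<forall>t\<ge>0. \<forall>f\<in>bounded_borel {0..}. AE \<omega> in M. signed_integral {0..} (W t \<omega>) f = comp_int \<omega> (entrance_integrand t f))"

lemma drivenD:
  assumes "driven W" "t \<ge> 0"
  shows "W t \<in> measurable M signed_space"
    and "f \<in> bounded_borel {0..} \<Longrightarrow> AE \<omega> in M. signed_integral {0..} (W t \<omega>) f = comp_int \<omega> (entrance_integrand t f)"
  using assms by (auto simp: driven_def)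

lemma drivenD_space: "driven W \<Longrightarrow> t \<ge> 0 \<Longrightarrow> \<omega> \<in> space M \<Longrightarrow> W t \<omega> \<in> signed_measures {0..}"
  using measurable_space[OF drivenD(1)] by force

lemma char_driven:
  assumes W: "driven W" and t: "t \<ge> 0" and f: "f \<in> bounded_borel {0..}"
  shows "(\<integral>\<omega>. iexp (signed_integral {0..} (W t \<omega>) f) \<partial>M) = exp (S_exponent t f)"
proof -
  note [measurable] = drivenD(1)[OF W t] measurable_signed_integral[OF f drivenD(1)[OF W t]]
    comp_int_measurable[OF good_entrance_integrand[OF f]]
  have "(\<integral>\<omega>. iexp (signed_integral {0..} (W t \<omega>) f) \<partial>M) = (\<integral>\<omega>. iexp (comp_int \<omega> (entrance_integrand t f)) \<partial>M)"
    using drivenD(2)[OF W t f] by (intro integral_cong_AE) (measurable, auto elim: eventually_mono)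
  also have "\<dots> = exp (\<integral>s. \<phi> (entrance_integrand t f s) \<partial>lborel)"
    by (rule char_comp_int(1)[OF good_entrance_integrand[OF f]])
  also have "(\<integral>s. \<phi> (entrance_integrand t f s) \<partial>lborel) = S_exponent t f"
    using S_exponent_entrance[OF f, of 0 t] by (simp add: entrance_integrand_def)
  finally show ?thesis .
qed

text \<open>The law of \<open>(W\<^sub>r)\<^sub>r\<^sub>\<le>\<^sub>s\<close> together with \<open>W\<^sub>s\<^sub>+\<^sub>t\<close>: the integrand of \<open>W\<^sub>s\<^sub>+\<^sub>t(f)\<close> agrees on
  \<open>[0, s]\<close> with the one of \<open>W\<^sub>s(T\<^sub>t f)\<close>, and its remainder is carried by \<open>(s, s + t]\<close>.\<close>

lemma joint_char_driven:
  assumes W: "driven W" and s: "s \<ge> 0" and t: "t \<ge> 0" and f: "f \<in> bounded_borel {0..}"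
    and xs: "\<And>r g. (r, g) \<in> set xs \<Longrightarrow> 0 \<le> r \<and> r \<le> s \<and> g \<in> bounded_borel {0..}"
  shows "(\<integral>\<omega>. iexp ((\<Sum>(r, g)\<leftarrow>xs. signed_integral {0..} (W r \<omega>) g) + signed_integral {0..} (W (s + t) \<omega>) f) \<partial>M) =
    (\<integral>\<omega>. iexp ((\<Sum>(r, g)\<leftarrow>xs. signed_integral {0..} (W r \<omega>) g) + signed_integral {0..} (W s \<omega>) (T_semigroup t f)) \<partial>M) *
    exp (S_exponent t f)"
proof -
  define \<theta> where "\<theta> = (\<lambda>q. \<Sum>(r, g)\<leftarrow>xs. entrance_integrand r g q)"
  define P where "P \<omega> = (\<Sum>(r, g)\<leftarrow>xs. signed_integral {0..} (W r \<omega>) g)" for \<omega>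
  \<comment> \<open>The past functionals combine into one compensated integral, whose integrand
    vanishes after time s.\<close>
  have "good_integrand \<theta> \<and> (AE \<omega> in M. P \<omega> = comp_int \<omega> \<theta>) \<and> P \<in> borel_measurable M \<and> (\<forall>q>s. \<theta> q = 0)"
    using xs unfolding \<theta>_def P_def
  proof (induction xs)
    case Nil
    have "good_integrand (\<lambda>q. 0)" by (auto simp: good_integrand_def intro!: exI[of _ 0])
    then show ?case by (simp add: comp_int_def jump_fun_def)
  next
    case (Cons x xs)
    obtain r g where x: "x = (r, g)" by force
    have r: "0 \<le> r" "r \<le> s" and g: "g \<in> bounded_borel {0..}" using Cons.prems[of r g] by (auto simp: x)
    let ?\<theta> = "\<lambda>q. \<Sum>(r, g)\<leftarrow>xs. entrance_integrand r g q"
    let ?P = "\<lambda>\<omega>. \<Sum>(r, g)\<leftarrow>xs. signed_integral {0..} (W r \<omega>) g"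
    have IH: "good_integrand ?\<theta>" "AE \<omega> in M. ?P \<omega> = comp_int \<omega> ?\<theta>" "?P \<in> borel_measurable M" "\<forall>q>s. ?\<theta> q = 0"
      using Cons by auto
    have gg: "good_integrand (entrance_integrand r g)" by (rule good_entrance_integrand[OF g])
    have m: "(\<lambda>\<omega>. signed_integral {0..} (W r \<omega>) g) \<in> borel_measurable M"
      by (rule measurable_signed_integral[OF g drivenD(1)[OF W r(1)]])
    have "AE \<omega> in M. signed_integral {0..} (W r \<omega>) g + ?P \<omega> = comp_int \<omega> (\<lambda>q. 1 * entrance_integrand r g q + 1 * ?\<theta> q)"
      using IH(2) drivenD(2)[OF W r(1) g] comp_int_lincomb[OF gg IH(1), of 1 1]
      by eventually_elim simp
    moreover have "good_integrand (\<lambda>q. 1 * entrance_integrand r g q + 1 * ?\<theta> q)"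
      by (rule good_integrand_lincomb[OF gg IH(1)])
    moreover have "entrance_integrand r g q = 0" if "q > s" for q
      using that r by (simp add: entrance_integrand_def)
    ultimately show ?case using m IH(3,4) by (simp add: x)
  qed
  then have \<theta>: "good_integrand \<theta>" and P: "AE \<omega> in M. P \<omega> = comp_int \<omega> \<theta>" and Pm: "P \<in> borel_measurable M"
    and \<theta>0: "\<And>q. q > s \<Longrightarrow> \<theta> q = 0" by auto
  have Tf: "T_semigroup t f \<in> bounded_borel {0..}" by (rule T_semigroup_bounded_borel[OF f t])
  have st: "s + t \<ge> 0" using s t by simp
  have gen: "(\<integral>\<omega>. iexp (P \<omega> + signed_integral {0..} (W r \<omega>) g) \<partial>M) = exp (\<integral>q. \<phi> (\<theta> q + entrance_integrand r g q) \<partial>lborel)"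
    and geni: "integrable lborel (\<lambda>q. \<phi> (\<theta> q + entrance_integrand r g q))"
    if r: "r \<ge> 0" and g: "g \<in> bounded_borel {0..}" for r g
  proof -
    have gg: "good_integrand (entrance_integrand r g)" by (rule good_entrance_integrand[OF g])
    have gs: "good_integrand (\<lambda>q. 1 * \<theta> q + 1 * entrance_integrand r g q)"
      by (rule good_integrand_lincomb[OF \<theta> gg])
    note [measurable] = Pm measurable_signed_integral[OF g drivenD(1)[OF W r]] comp_int_measurable[OF gs]
    have AE: "AE \<omega> in M. iexp (P \<omega> + signed_integral {0..} (W r \<omega>) g) = iexp (comp_int \<omega> (\<lambda>q. 1 * \<theta> q + 1 * entrance_integrand r g q))"
      using P drivenD(2)[OF W r g] comp_int_lincomb[OF \<theta> gg, of 1 1] by eventually_elim simp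
    have "(\<integral>\<omega>. iexp (P \<omega> + signed_integral {0..} (W r \<omega>) g) \<partial>M) = (\<integral>\<omega>. iexp (comp_int \<omega> (\<lambda>q. 1 * \<theta> q + 1 * entrance_integrand r g q)) \<partial>M)"
      by (rule integral_cong_AE[OF _ _ AE]) measurable
    then show "(\<integral>\<omega>. iexp (P \<omega> + signed_integral {0..} (W r \<omega>) g) \<partial>M) = exp (\<integral>q. \<phi> (\<theta> q + entrance_integrand r g q) \<partial>lborel)"
      using char_comp_int(1)[OF gs] by simp
    show "integrable lborel (\<lambda>q. \<phi> (\<theta> q + entrance_integrand r g q))"
      using char_comp_int(2)[OF gs] by simp
  qed
  let ?R = "\<lambda>q. indicator {s..s + t} q * (T_semigroup (s + t - q) f 0 / 2)"
  \<comment> \<open>Before s, the semigroup law at 0 turns T_(s+t-q) into T_(s-q) T_t; after s, the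
    integrands of the past vanish and the exponent of 0 is 0. At q = s the closed intervals overlap,
    hence the exclusion of this null set.\<close>
  have pw: "\<phi> (\<theta> q + entrance_integrand (s + t) f q) = \<phi> (\<theta> q + entrance_integrand s (T_semigroup t f) q) + \<phi> (?R q)"
    if "q \<noteq> s" for q
  proof (cases "q < s")
    case True
    have "entrance_integrand (s + t) f q = entrance_integrand s (T_semigroup t f) q"
      using True t T_semigroup_add[OF f, of "s - q" t 0] by (auto simp: entrance_integrand_def algebra_simps split: split_indicator)
    then show ?thesis using True by simp
  next
    case False
    then have q: "q > s" using that by simp
    then show ?thesis using \<theta>0[OF q] s by (auto simp: entrance_integrand_def split: split_indicator)
  qed
  have iR: "integrable lborel (\<lambda>q. \<phi> (?R q))"
  proof -
    have "good_integrand ?R"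
    proof -
      have g: "good_integrand (entrance_integrand (s + t) f)" by (rule good_entrance_integrand[OF f])
      then obtain c K where c: "\<And>q. \<bar>entrance_integrand (s + t) f q\<bar> \<le> c * indicator {0..K} q" by (auto simp: good_integrand_def)
      have eq: "?R = (\<lambda>q. indicator {s..} q * entrance_integrand (s + t) f q)"
        using s by (auto simp: entrance_integrand_def fun_eq_iff split: split_indicator)
      have "\<bar>indicator {s..} q * entrance_integrand (s + t) f q\<bar> \<le> c * indicator {0..K} q" for q
        using c[of q] by (auto split: split_indicator)
      moreover have [measurable]: "entrance_integrand (s + t) f \<in> borel_measurable borel" using g by (rule good_integrand_measurable)
      ultimately show ?thesis unfolding eq good_integrand_def by (intro conjI) (measurable, blast)
    qed
    then show ?thesis by (rule char_comp_int(2))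
  qed
  have "(\<integral>q. \<phi> (\<theta> q + entrance_integrand (s + t) f q) \<partial>lborel) =
    (\<integral>q. \<phi> (\<theta> q + entrance_integrand s (T_semigroup t f) q) + \<phi> (?R q) \<partial>lborel)"
  proof (rule integral_cong_AE)
    show "AE q in lborel. \<phi> (\<theta> q + entrance_integrand (s + t) f q) = \<phi> (\<theta> q + entrance_integrand s (T_semigroup t f) q) + \<phi> (?R q)"
      using AE_lborel_singleton[of s] by eventually_elim (rule pw)
    show "(\<lambda>q. \<phi> (\<theta> q + entrance_integrand (s + t) f q)) \<in> borel_measurable lborel"
      using geni[OF st f] by (rule borel_measurable_integrable)
    show "(\<lambda>q. \<phi> (\<theta> q + entrance_integrand s (T_semigroup t f) q) + \<phi> (?R q)) \<in> borel_measurable lborel"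
      using geni[OF s Tf] iR by (intro borel_measurable_add borel_measurable_integrable)
  qed
  also have "\<dots> = (\<integral>q. \<phi> (\<theta> q + entrance_integrand s (T_semigroup t f) q) \<partial>lborel) + S_exponent t f"
    using geni[OF s Tf] iR S_exponent_entrance[OF f, of s t] by simp
  finally show ?thesis
    using gen[OF st f] gen[OF s Tf] by (simp add: P_def exp_add)
qed

end

section \<open>The adjoint of T, natural filtrations and integration against kernels\<close>

lemma signed_integral_zero:
  assumes "\<nu> \<in> signed_measures E"
  shows "signed_integral E \<nu> (\<lambda>x. 0) = 0"
  using signed_integral_lincomb[OF assms bounded_borelI bounded_borelI, of "\<lambda>x. 0" 0 "\<lambda>x. 0" 0 0 0] by simp

lemma bounded_borel_zero: "(\<lambda>x. 0) \<in> bounded_borel E"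
  by (rule bounded_borelI[where c=0]) auto

lemma signed_plus_measurable [measurable (raw)]:
  assumes "a \<in> measurable A (signed_algebra E)" "b \<in> measurable A (signed_algebra E)"
  shows "(\<lambda>x. signed_plus (a x) (b x)) \<in> measurable A (signed_algebra E)"
proof (rule measurable_signed_algebraI)
  have ab: "a x \<in> signed_measures E" "b x \<in> signed_measures E" if "x \<in> space A" for x
    using measurable_space[OF assms(1) that] measurable_space[OF assms(2) that] by auto
  show "signed_plus (a x) (b x) \<in> signed_measures E" if "x \<in> space A" for x
    by (rule signed_plus_in) (use ab that in auto)
  fix f assume f: "f \<in> bounded_borel E"
  have "(\<lambda>x. signed_integral E (a x) f + signed_integral E (b x) f) \<in> borel_measurable A"
    using assms f by measurable
  then show "(\<lambda>x. signed_integral E (signed_plus (a x) (b x)) f) \<in> borel_measurable A"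
    by (subst measurable_cong[where g="\<lambda>x. signed_integral E (a x) f + signed_integral E (b x) f"])
      (auto simp: signed_integral_plus[OF ab f])
qed

text \<open>The adjoint of T_t on signed measures. The integrals of indicators determine it, so the
  choice is unique.\<close>

definition T_dual :: "real \<Rightarrow> (real set \<Rightarrow> real) \<Rightarrow> real set \<Rightarrow> real" where
  "T_dual t \<mu> = (SOME \<mu>'. \<mu>' \<in> signed_measures {0..} \<and>
    (\<forall>f\<in>bounded_borel {0..}. signed_integral {0..} \<mu>' f = signed_integral {0..} \<mu> (T_semigroup t f)))"

lemma T_dual:
  assumes "\<mu> \<in> signed_measures {0..}" "t \<ge> 0"
  shows T_dual_in: "T_dual t \<mu> \<in> signed_measures {0..}"
    and signed_integral_T_dual: "\<And>f. f \<in> bounded_borel {0..} \<Longrightarrow>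
      signed_integral {0..} (T_dual t \<mu>) f = signed_integral {0..} \<mu> (T_semigroup t f)"
proof -
  have "\<exists>\<mu>'. \<mu>' \<in> signed_measures {0..} \<and>
    (\<forall>f\<in>bounded_borel {0..}. signed_integral {0..} \<mu>' f = signed_integral {0..} \<mu> (T_semigroup t f))"
    using T_semigroup_dual[OF assms] by blast
  from someI_ex[OF this] show "T_dual t \<mu> \<in> signed_measures {0..}"
    "\<And>f. f \<in> bounded_borel {0..} \<Longrightarrow> signed_integral {0..} (T_dual t \<mu>) f = signed_integral {0..} \<mu> (T_semigroup t f)"
    by (auto simp: T_dual_def)
qed

text \<open>The choice does no harm to measurability: the sigma-algebra is generated by integrals,
  and those of the dual are integrals of the original measure against T_t f.\<close>

lemma T_dual_measurable [measurable (raw)]: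
  assumes a: "a \<in> measurable A signed_space" and t: "t \<ge> 0"
  shows "(\<lambda>x. T_dual t (a x)) \<in> measurable A signed_space"
proof (rule measurable_signed_algebraI)
  have ax: "a x \<in> signed_measures {0..}" if "x \<in> space A" for x
    using measurable_space[OF a that] by simp
  show "T_dual t (a x) \<in> signed_measures {0..}" if "x \<in> space A" for x
    by (rule T_dual_in[OF ax[OF that] t])
  fix f :: "real \<Rightarrow> real" assume f: "f \<in> bounded_borel {0..}"
  have "(\<lambda>x. signed_integral {0..} (a x) (T_semigroup t f)) \<in> borel_measurable A"
    by (rule measurable_signed_integral[OF T_semigroup_bounded_borel[OF f t] a])
  then show "(\<lambda>x. signed_integral {0..} (T_dual t (a x)) f) \<in> borel_measurable A"
    by (subst measurable_cong[where g="\<lambda>x. signed_integral {0..} (a x) (T_semigroup t f)"])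
      (auto simp: signed_integral_T_dual[OF ax t f])
qed

lemma space_natural_filtration: "space (natural_filtration M S X t) = space M"
  by (simp add: natural_filtration_def space_measure_of_conv)

lemma measurable_natural_filtration:
  assumes "0 \<le> r" "ennreal r \<le> t" "\<And>\<omega>. \<omega> \<in> space M \<Longrightarrow> X r \<omega> \<in> space S"
  shows "X r \<in> measurable (natural_filtration M S X t) S"
proof (rule measurableI)
  fix B assume "B \<in> sets S"
  then show "X r -` B \<inter> space (natural_filtration M S X t) \<in> sets (natural_filtration M S X t)"
    using assms unfolding space_natural_filtration
    by (auto simp: natural_filtration_def intro!: sigma_sets.Basic)
qed (use assms in \<open>simp add: space_natural_filtration\<close>)

lemma sets_natural_filtration:
  "sets (natural_filtration M S X t) =
    sigma_sets (space M) {X s -` B \<inter> space M | s B. 0 \<le> s \<and> ennreal s \<le> t \<and> B \<in> sets S}"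
  unfolding natural_filtration_def by (rule sets_measure_of) auto

lemma sets_natural_filtration_subset:
  assumes "\<And>r. 0 \<le> r \<Longrightarrow> X r \<in> measurable M S"
  shows "sets (natural_filtration M S X t) \<subseteq> sets M"
proof -
  have "{X s -` B \<inter> space M |s B. 0 \<le> s \<and> ennreal s \<le> t \<and> B \<in> sets S} \<subseteq> sets M"
    using assms by (auto intro: measurable_sets)
  then show ?thesis unfolding sets_natural_filtration by (rule sets.sigma_sets_subset)
qed

lemma sets_natural_filtration_mono:
  assumes "s \<le> t"
  shows "sets (natural_filtration M S X s) \<subseteq> sets (natural_filtration M S X t)"
proof -
  have "{X r -` B \<inter> space M |r B. 0 \<le> r \<and> ennreal r \<le> s \<and> B \<in> sets S} \<subseteq>
    {X r -` B \<inter> space M |r B. 0 \<le> r \<and> ennreal r \<le> t \<and> B \<in> sets S}"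
    using assms order_trans by blast
  then show ?thesis unfolding sets_natural_filtration by (rule sigma_sets_mono')
qed

lemma integral_bind_complex:
  fixes f :: "'b \<Rightarrow> complex"
  assumes f[measurable]: "f \<in> borel_measurable K" and b: "\<And>x. cmod (f x) \<le> 1"
    and N[measurable]: "N \<in> measurable M (subprob_algebra K)" and M: "prob_space M"
    and NP: "\<And>x. x \<in> space M \<Longrightarrow> prob_space (N x)"
  shows "(\<integral>y. f y \<partial>(M \<bind> N)) = (\<integral>x. (\<integral>y. f y \<partial>N x) \<partial>M)"
proof -
  interpret prob_space M by fact
  have sN: "sets (N x) = sets K" if "x \<in> space M" for x by (rule sets_kernel[OF N that])
  have sB: "sets (M \<bind> N) = sets K" using sN not_empty by (rule sets_bind)
  have pB: "prob_space (M \<bind> N)" using NP by (intro prob_space_bind[OF _ N]) auto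
  have em: "AE x in M. emeasure (N x) (space (N x)) \<le> ennreal 1"
    using NP by (auto simp: prob_space.emeasure_space_1)
  have ib: "integrable Q f" if "prob_space Q" "sets Q = sets K" for Q
  proof -
    interpret Q: prob_space Q by fact
    show ?thesis using that b by (intro Q.integrable_const_bound[where B=1]) (auto cong: measurable_cong_sets)
  qed
  have iN: "integrable (N x) f" if "x \<in> space M" for x using ib NP sN that by auto
  have Reb: "\<bar>Re (f x)\<bar> \<le> 1" "\<bar>Im (f x)\<bar> \<le> 1" for x
    using abs_Re_le_cmod[of "f x"] abs_Im_le_cmod[of "f x"] b[of x] by linarith+
  have eq: "(\<integral>y. f y \<partial>N x) = Complex (\<integral>y. Re (f y) \<partial>N x) (\<integral>y. Im (f y) \<partial>N x)" if "x \<in> space M" for x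
    using iN[OF that] by (simp add: complex_eq_iff)
  have io: "integrable M (\<lambda>x. \<integral>y. f y \<partial>N x)"
  proof (rule integrable_const_bound[where B=1])
    show "AE x in M. norm (\<integral>y. f y \<partial>N x) \<le> 1"
    proof (rule AE_I2)
      fix x assume x: "x \<in> space M"
      interpret Nx: prob_space "N x" by (rule NP[OF x])
      have "norm (\<integral>y. f y \<partial>N x) \<le> (\<integral>y. norm (f y) \<partial>N x)" by (rule integral_norm_bound)
      also have "\<dots> \<le> (\<integral>y. 1 \<partial>N x)" using iN[OF x] b by (intro integral_mono) auto
      finally show "norm (\<integral>y. f y \<partial>N x) \<le> 1" by (simp add: Nx.prob_space)
    qed
    show "(\<lambda>x. \<integral>y. f y \<partial>N x) \<in> borel_measurable M"
      by (rule measurable_compose[OF N integral_measurable_subprob_algebra[OF f]])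
  qed
  have R: "(\<integral>y. Re (f y) \<partial>(M \<bind> N)) = (\<integral>x. (\<integral>y. Re (f y) \<partial>N x) \<partial>M)"
    by (rule integral_bind[OF _ _ N finite_measure_axioms em, where B=1]) (use Reb in auto)
  have I: "(\<integral>y. Im (f y) \<partial>(M \<bind> N)) = (\<integral>x. (\<integral>y. Im (f y) \<partial>N x) \<partial>M)"
    by (rule integral_bind[OF _ _ N finite_measure_axioms em, where B=1]) (use Reb in auto)
  have "(\<integral>x. (\<integral>y. Re (f y) \<partial>N x) \<partial>M) = (\<integral>x. Re (\<integral>y. f y \<partial>N x) \<partial>M)"
    using eq by (intro Bochner_Integration.integral_cong) auto
  moreover have "(\<integral>x. (\<integral>y. Im (f y) \<partial>N x) \<partial>M) = (\<integral>x. Im (\<integral>y. f y \<partial>N x) \<partial>M)"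
    using eq by (intro Bochner_Integration.integral_cong) auto
  ultimately show ?thesis
    using R I ib[OF pB sB] io by (simp add: complex_eq_iff)
qed

section \<open>The kernels of S, their semigroup law and the Markov identity\<close>

context jump_noise
begin

text \<open>The law of the transported initial state plus the mass immigrated up to time t. It gives
  existence of S_t, with measurability in the initial state coming from joint measurability of the
  sum.\<close>

definition S_kernel :: "(real \<Rightarrow> 'w \<Rightarrow> real set \<Rightarrow> real) \<Rightarrow> real \<Rightarrow> (real set \<Rightarrow> real) \<Rightarrow> (real set \<Rightarrow> real) measure" where
  "S_kernel W t \<mu> = distr M signed_space (\<lambda>\<omega>. signed_plus (T_dual t \<mu>) (W t \<omega>))"

lemma S_kernel_measurable_fun:
  assumes "driven W" "t \<ge> 0" "\<mu> \<in> signed_measures {0..}"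
  shows "(\<lambda>\<omega>. signed_plus (T_dual t \<mu>) (W t \<omega>)) \<in> measurable M signed_space"
  using T_dual_in[OF assms(3,2)] by (intro signed_plus_measurable drivenD(1)[OF assms(1,2)] measurable_const) simp

lemma signed_integral_S_kernel:
  assumes "driven W" "t \<ge> 0" "\<mu> \<in> signed_measures {0..}" "\<omega> \<in> space M" "f \<in> bounded_borel {0..}"
  shows "signed_integral {0..} (signed_plus (T_dual t \<mu>) (W t \<omega>)) f =
    signed_integral {0..} \<mu> (T_semigroup t f) + signed_integral {0..} (W t \<omega>) f"
  using assms T_dual[OF assms(3,2)] drivenD_space[OF assms(1,2,4)] by (simp add: signed_integral_plus)

lemma has_S_law_iff:
  "has_S_law m t \<mu> Q \<longleftrightarrow> prob_space Q \<and> sets Q = sets signed_space \<and>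
    (\<forall>f\<in>bounded_borel {0..}. (\<integral>\<nu>. iexp (signed_integral {0..} \<nu> f) \<partial>Q) =
      iexp (signed_integral {0..} \<mu> (T_semigroup t f)) * exp (S_exponent t f))"
  by (simp add: has_S_law_def S_exponent_def exp_add)

lemma has_S_law_S_kernel:
  assumes W: "driven W" and t: "t \<ge> 0" and \<mu>: "\<mu> \<in> signed_measures {0..}"
  shows "has_S_law m t \<mu> (S_kernel W t \<mu>)"
  unfolding has_S_law_iff
proof (intro conjI ballI)
  note mf = S_kernel_measurable_fun[OF assms]
  show "prob_space (S_kernel W t \<mu>)" unfolding S_kernel_def by (rule prob_space_distr[OF mf])
  show "sets (S_kernel W t \<mu>) = sets signed_space" by (simp add: S_kernel_def)
  fix f :: "real \<Rightarrow> real" assume f: "f \<in> bounded_borel {0..}"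
  have [measurable]: "(\<lambda>\<nu>. signed_integral {0..} \<nu> f) \<in> borel_measurable signed_space"
    by (rule measurable_signed_integral[OF f]) simp
  have "(\<integral>\<nu>. iexp (signed_integral {0..} \<nu> f) \<partial>S_kernel W t \<mu>) =
    (\<integral>\<omega>. iexp (signed_integral {0..} (signed_plus (T_dual t \<mu>) (W t \<omega>)) f) \<partial>M)"
    unfolding S_kernel_def by (rule integral_distr[OF mf]) measurable
  also have "\<dots> = (\<integral>\<omega>. iexp (signed_integral {0..} \<mu> (T_semigroup t f)) * iexp (signed_integral {0..} (W t \<omega>) f) \<partial>M)"
    by (intro Bochner_Integration.integral_cong)
      (auto simp: signed_integral_S_kernel[OF assms _ f] ring_distribs exp_add)
  also have "\<dots> = iexp (signed_integral {0..} \<mu> (T_semigroup t f)) * exp (S_exponent t f)"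
    by (simp add: char_driven[OF W t f])
  finally show "(\<integral>\<nu>. iexp (signed_integral {0..} \<nu> f) \<partial>S_kernel W t \<mu>) =
      iexp (signed_integral {0..} \<mu> (T_semigroup t f)) * exp (S_exponent t f)" .
qed

lemma has_S_law_unique:
  assumes "has_S_law m t \<mu> Q" "has_S_law m t \<mu> Q'"
  shows "Q = Q'"
  using assms bounded_continuous_subset[of "{0::real..}"] unfolding has_S_law_iff
  by (intro signed_law_unique) (auto intro: prob_space.finite_measure)

lemma S_semigroup_eq:
  assumes "has_S_law m t \<mu> Q"
  shows "S_semigroup m t \<mu> = Q"
  unfolding S_semigroup_def using assms has_S_law_unique by (intro the_equality) auto

lemma S_semigroup_S_kernel:
  assumes "driven W" "t \<ge> 0" "\<mu> \<in> signed_measures {0..}"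
  shows "S_semigroup m t \<mu> = S_kernel W t \<mu>"
  by (rule S_semigroup_eq[OF has_S_law_S_kernel[OF assms]])

lemma S_semigroup_measurable:
  assumes W: "driven W" and t: "t \<ge> 0"
  shows "S_semigroup m t \<in> measurable signed_space (prob_algebra signed_space)"
proof -
  have "(\<lambda>\<mu>. S_kernel W t \<mu>) \<in> measurable signed_space (prob_algebra signed_space)"
    unfolding S_kernel_def
  proof (rule measurable_distr_prob_space2)
    show "(\<lambda>_. M) \<in> measurable signed_space (prob_algebra M)"
      by (rule measurable_const) (simp add: space_prob_algebra prob_space_axioms)
    show "(\<lambda>(\<mu>, \<omega>). signed_plus (T_dual t \<mu>) (W t \<omega>)) \<in> measurable (signed_space \<Otimes>\<^sub>M M) signed_space"
      unfolding case_prod_beta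
      by (intro signed_plus_measurable T_dual_measurable measurable_fst t
          measurable_compose[OF measurable_snd drivenD(1)[OF W t]])
  qed
  then show ?thesis
    by (subst measurable_cong[where g="S_kernel W t"]) (auto simp: S_semigroup_S_kernel[OF W t])
qed

lemma S_semigroup_has_law:
  assumes "driven W" "t \<ge> 0" "\<mu> \<in> signed_measures {0..}"
  shows "has_S_law m t \<mu> (S_semigroup m t \<mu>)"
  using has_S_law_S_kernel[OF assms] S_semigroup_S_kernel[OF assms] by simp

text \<open>The case of an empty past in \<open>joint_char_driven\<close>; it is an identity of
  exponentials, which is all that the semigroup law needs.\<close>

lemma S_exponent_add:
  assumes W: "driven W" and f: "f \<in> bounded_borel {0..}" and s: "s \<ge> 0" and t: "t \<ge> 0"
  shows "exp (S_exponent (s + t) f) = exp (S_exponent s (T_semigroup t f)) * exp (S_exponent t f)"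
  using joint_char_driven[OF W s t f, of "[]"] char_driven[OF W _ f, of "s + t"]
    char_driven[OF W s T_semigroup_bounded_borel[OF f t]] s t by simp

text \<open>Laws are determined by characteristic functionals, so each identity reduces to checking
  \<open>has_S_law\<close> for the other side. For the composition, the semigroup law of T handles
  the initial state and \<open>S_exponent_add\<close> the immigration.\<close>

lemma transition_semigroup_S:
  assumes W: "driven W"
  shows "transition_semigroup signed_space (S_semigroup m)"
  unfolding transition_semigroup_def
proof (intro conjI allI ballI impI)
  show "S_semigroup m t \<in> measurable signed_space (prob_algebra signed_space)" if "0 \<le> t" for t
    by (rule S_semigroup_measurable[OF W that])
  fix \<mu> :: "real set \<Rightarrow> real" assume "\<mu> \<in> space signed_space"
  then have \<mu>: "\<mu> \<in> signed_measures {0..}" by simp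
  show "S_semigroup m 0 \<mu> = return signed_space \<mu>"
  proof (rule S_semigroup_eq)
    show "has_S_law m 0 \<mu> (return signed_space \<mu>)"
      unfolding has_S_law_iff
    proof (intro conjI ballI)
      show "prob_space (return signed_space \<mu>)" using \<mu> by (simp add: prob_space_return)
      fix f :: "real \<Rightarrow> real" assume f: "f \<in> bounded_borel {0..}"
      have [measurable]: "(\<lambda>\<nu>. signed_integral {0..} \<nu> f) \<in> borel_measurable signed_space"
        by (rule measurable_signed_integral[OF f]) simp
      have "AE s in lborel. indicator {0..0::real} s *\<^sub>R \<phi> (\<integral>y. h_weight y * f y \<partial>kappa s) = 0"
        using AE_lborel_singleton[of "0::real"] by eventually_elim simp
      then have "S_exponent 0 f = 0"
        unfolding S_exponent_def set_lebesgue_integral_def by (rule integral_eq_zero_AE)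
      moreover have "(\<integral>\<nu>. iexp (signed_integral {0..} \<nu> f) \<partial>return signed_space \<mu>) = iexp (signed_integral {0..} \<mu> f)"
        using \<mu> by (intro integral_return) auto
      ultimately show "(\<integral>\<nu>. iexp (signed_integral {0..} \<nu> f) \<partial>return signed_space \<mu>) =
          iexp (signed_integral {0..} \<mu> (T_semigroup 0 f)) * exp (S_exponent 0 f)" by simp
    qed simp
  qed
  fix s t :: real assume s: "0 \<le> s" and t: "0 \<le> t"
  let ?Q = "S_semigroup m s \<mu>"
  have Q: "has_S_law m s \<mu> ?Q" by (rule S_semigroup_has_law[OF W s \<mu>])
  then have pQ: "prob_space ?Q" and sQ: "sets ?Q = sets signed_space" by (auto simp: has_S_law_def)
  have spQ: "space ?Q = signed_measures {0..}" using sets_eq_imp_space_eq[OF sQ] by simp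
  have Km: "S_semigroup m t \<in> measurable ?Q (prob_algebra signed_space)"
    using S_semigroup_measurable[OF W t] sQ by (simp cong: measurable_cong_sets)
  note Ks = measurable_prob_algebraD[OF Km]
  have ne: "space ?Q \<noteq> {}" using spQ \<mu> by auto
  have law: "has_S_law m t \<nu> (S_semigroup m t \<nu>)" if "\<nu> \<in> space ?Q" for \<nu>
    using that S_semigroup_has_law[OF W t] spQ by simp
  have sB: "sets (?Q \<bind> S_semigroup m t) = sets signed_space"
    using law ne by (intro sets_bind) (auto simp: has_S_law_def)
  show "S_semigroup m (s + t) \<mu> = ?Q \<bind> S_semigroup m t"
  proof (rule S_semigroup_eq)
    show "has_S_law m (s + t) \<mu> (?Q \<bind> S_semigroup m t)"
      unfolding has_S_law_iff
    proof (intro conjI ballI)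
      show "prob_space (?Q \<bind> S_semigroup m t)"
        using law by (intro prob_space.prob_space_bind[OF pQ _ Ks]) (auto simp: has_S_law_def)
      show "sets (?Q \<bind> S_semigroup m t) = sets signed_space" by (rule sB)
      fix f :: "real \<Rightarrow> real" assume f: "f \<in> bounded_borel {0..}"
      let ?e = "\<lambda>\<nu>. iexp (signed_integral {0..} \<nu> f)"
      have [measurable]: "(\<lambda>\<nu>. signed_integral {0..} \<nu> f) \<in> borel_measurable signed_space"
        by (rule measurable_signed_integral[OF f]) simp
      have Tf: "T_semigroup t f \<in> bounded_borel {0..}" by (rule T_semigroup_bounded_borel[OF f t])
      have "(\<integral>\<nu>. ?e \<nu> \<partial>(?Q \<bind> S_semigroup m t)) = (\<integral>\<nu>. (\<integral>\<nu>'. ?e \<nu>' \<partial>S_semigroup m t \<nu>) \<partial>?Q)"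
        by (rule integral_bind_complex[OF _ _ Ks pQ]) (use law in \<open>auto simp: has_S_law_def\<close>)
      also have "\<dots> = (\<integral>\<nu>. iexp (signed_integral {0..} \<nu> (T_semigroup t f)) * exp (S_exponent t f) \<partial>?Q)"
        using law f by (intro Bochner_Integration.integral_cong) (auto simp: has_S_law_iff)
      also have "\<dots> = (\<integral>\<nu>. iexp (signed_integral {0..} \<nu> (T_semigroup t f)) \<partial>?Q) * exp (S_exponent t f)"
        by simp
      also have "\<dots> = iexp (signed_integral {0..} \<mu> (T_semigroup s (T_semigroup t f))) * exp (S_exponent s (T_semigroup t f)) * exp (S_exponent t f)"
        using Q Tf by (simp add: has_S_law_iff)
      also have "signed_integral {0..} \<mu> (T_semigroup s (T_semigroup t f)) = signed_integral {0..} \<mu> (T_semigroup (s + t) f)"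
        by (rule signed_integral_cong[OF \<mu> T_semigroup_bounded_borel[OF Tf s]]) (simp add: T_semigroup_add[OF f s t])
      finally show "(\<integral>\<nu>. ?e \<nu> \<partial>(?Q \<bind> S_semigroup m t)) =
          iexp (signed_integral {0..} \<mu> (T_semigroup (s + t) f)) * exp (S_exponent (s + t) f)"
        by (simp add: S_exponent_add[OF W f s t])
    qed
  qed
qed

text \<open>Let \<omega>' be an independent copy of \<omega>. The pair of \<omega>, seen through the
  past sigma-algebra, and W at time s + t has the same law as the pair of \<omega> and the sum of
  the transported state at time s with W at time t along \<omega>'. \<open>joint_char_driven\<close>
  is exactly the equality of their characteristic functionals; integrating over A then gives the
  claim.\<close>

lemma markov_identity:
  assumes W: "driven W" and s: "s \<ge> 0" and t: "t \<ge> 0" and f: "f \<in> bounded_borel {0..}"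
    and A: "A \<in> sets (natural_filtration M signed_space W (ennreal s))"
  shows "(\<integral>\<omega>. indicator A \<omega> * iexp (signed_integral {0..} (W (s + t) \<omega>) f) \<partial>M) =
    (\<integral>\<omega>. indicator A \<omega> * iexp (signed_integral {0..} (W s \<omega>) (T_semigroup t f)) \<partial>M) * exp (S_exponent t f)"
proof -
  let ?F = "natural_filtration M signed_space W (ennreal s)"
  let ?P = "?F \<Otimes>\<^sub>M signed_space"
  have st: "s + t \<ge> 0" using s t by simp
  have Wsp: "W r \<omega> \<in> signed_measures {0..}" if "r \<ge> 0" "\<omega> \<in> space M" for r \<omega>
    by (rule drivenD_space[OF W that])
  have WF: "W r \<in> measurable ?F signed_space" if "0 \<le> r" "r \<le> s" for r
    using that Wsp by (intro measurable_natural_filtration) (auto simp: ennreal_leI)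
  have sub: "sets ?F \<subseteq> sets M" by (rule sets_natural_filtration_subset) (rule drivenD(1)[OF W])
  have idF: "(\<lambda>\<omega>. \<omega>) \<in> measurable M ?F"
  proof (rule measurableI)
    fix A assume "A \<in> sets ?F"
    then have "A \<in> sets M" using sub by auto
    moreover have "(\<lambda>\<omega>. \<omega>) -` A \<inter> space M = A" using sets.sets_into_space[OF \<open>A \<in> sets M\<close>] by auto
    ultimately show "(\<lambda>\<omega>. \<omega>) -` A \<inter> space M \<in> sets M" by simp
  qed (simp add: space_natural_filtration)
  note W_meas = drivenD(1)[OF W]
  interpret MM: pair_prob_space M M ..
  have m1: "(\<lambda>\<omega>. (\<omega>, W (s + t) \<omega>)) \<in> measurable M ?P"
    by (intro measurable_Pair idF W_meas st)
  have m2: "(\<lambda>x. (fst x, signed_plus (T_dual t (W s (fst x))) (W t (snd x)))) \<in> measurable (M \<Otimes>\<^sub>M M) ?P"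
    by (intro measurable_Pair measurable_compose[OF measurable_fst idF] signed_plus_measurable T_dual_measurable t
        measurable_compose[OF measurable_fst W_meas[OF s]] measurable_compose[OF measurable_snd W_meas[OF t]])
  define Q1 where "Q1 = distr M ?P (\<lambda>\<omega>. (\<omega>, W (s + t) \<omega>))"
  define Q2 where "Q2 = distr (M \<Otimes>\<^sub>M M) ?P (\<lambda>x. (fst x, signed_plus (T_dual t (W s (fst x))) (W t (snd x))))"
  \<comment> \<open>An index is a finite list of past times with test functions, together with a
    test function for the new state.\<close>
  define I' :: "((real \<times> (real \<Rightarrow> real)) list \<times> (real \<Rightarrow> real)) set" where
    "I' = {(xs, g). (\<forall>(r, g)\<in>set xs. 0 \<le> r \<and> r \<le> s \<and> g \<in> bounded_borel {0..}) \<and> g \<in> bounded_borel {0..}}"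
  define P where "P xs \<omega> = (\<Sum>(r, g)\<leftarrow>xs. signed_integral {0..} (W r \<omega>) g)" for xs :: "(real \<times> (real \<Rightarrow> real)) list" and \<omega>
  define v where "v k x = P (fst k) (fst x) + signed_integral {0..} (snd x) (snd k)"
    for k :: "(real \<times> (real \<Rightarrow> real)) list \<times> (real \<Rightarrow> real)" and x :: "'w \<times> (real set \<Rightarrow> real)"
  have spP: "space ?P = space M \<times> signed_measures {0..}" by (simp add: space_pair_measure space_natural_filtration)
  have Pm: "P xs \<in> borel_measurable ?F" if "\<forall>(r, g)\<in>set xs. 0 \<le> r \<and> r \<le> s \<and> g \<in> bounded_borel {0..}" for xs
    using that
  proof (induction xs)
    case Nil
    have "P [] = (\<lambda>\<omega>. 0)" by (auto simp: P_def)
    then show ?case by simp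
  next
    case (Cons x xs)
    obtain r g where x: "x = (r, g)" by force
    have "P (x # xs) = (\<lambda>\<omega>. signed_integral {0..} (W r \<omega>) g + P xs \<omega>)" by (auto simp: P_def x)
    moreover have "(\<lambda>\<omega>. signed_integral {0..} (W r \<omega>) g) \<in> borel_measurable ?F"
      using Cons.prems x by (intro measurable_signed_integral WF) auto
    ultimately show ?case using Cons by simp
  qed
  have vm: "v k \<in> borel_measurable ?P" if "k \<in> I'" for k
    unfolding v_def[abs_def] using that
    by (intro borel_measurable_add measurable_compose[OF measurable_fst Pm] measurable_signed_integral measurable_snd)
      (auto simp: I'_def)
  have spQ: "space Q1 = space M \<times> signed_measures {0..}" unfolding Q1_def space_distr by (rule spP)
  have Q12: "Q1 = Q2"
  proof (rule finite_measure_eq_char[where I=I' and v=v])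
    show "finite_measure Q1" unfolding Q1_def by (intro prob_space.finite_measure prob_space_distr m1)
    show "finite_measure Q2" unfolding Q2_def by (intro prob_space.finite_measure MM.prob_space_distr m2)
    show "sets Q1 = sets Q2" by (simp add: Q1_def Q2_def)
    show "v k \<in> borel_measurable Q1" if "k \<in> I'" for k using vm[OF that] by (simp add: Q1_def cong: measurable_cong_sets)
    have z: "([], \<lambda>x. 0) \<in> I'" by (auto simp: I'_def bounded_borel_zero)
    then show "I' \<noteq> {}" by blast
    show "\<exists>k\<in>I'. \<forall>x\<in>space Q1. v k x = a * v i x + b * v j x" if ij: "i \<in> I'" "j \<in> I'" for i j a b
    proof -
      obtain xs g ys h where i: "i = (xs, g)" and j: "j = (ys, h)" by (cases i, cases j)
      have xs: "\<forall>(r, g)\<in>set xs. 0 \<le> r \<and> r \<le> s \<and> g \<in> bounded_borel {0..}" and g: "g \<in> bounded_borel {0..}"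
        and ys: "\<forall>(r, g)\<in>set ys. 0 \<le> r \<and> r \<le> s \<and> g \<in> bounded_borel {0..}" and h: "h \<in> bounded_borel {0..}"
        using ij by (auto simp: I'_def i j)
      \<comment> \<open>Linear combinations of indices: scale the test functions in each list and
        concatenate the lists. The term \<open>0 * g x\<close> brings the scaling into the shape of
        \<open>bounded_borel_lincomb\<close>.\<close>
      define sc :: "real \<Rightarrow> real \<times> (real \<Rightarrow> real) \<Rightarrow> real \<times> (real \<Rightarrow> real)" where
        "sc c = (\<lambda>(r, g). (r, \<lambda>x. c * g x + 0 * g x))" for c
      have scP: "P (map (sc c) zs) \<omega> = c * P zs \<omega>"
        if "\<forall>(r, g)\<in>set zs. 0 \<le> r \<and> r \<le> s \<and> g \<in> bounded_borel {0..}" "\<omega> \<in> space M" for c zs \<omega>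
        using that
      proof (induction zs)
        case (Cons z zs)
        obtain r g where z: "z = (r, g)" by force
        have "signed_integral {0..} (W r \<omega>) (\<lambda>x. c * g x + 0 * g x) = c * signed_integral {0..} (W r \<omega>) g"
          using Cons.prems z signed_integral_lincomb[OF Wsp[of r \<omega>], of g g c 0] by auto
        then show ?case using Cons by (simp add: P_def sc_def z ring_distribs)
      qed (simp add: P_def)
      have sc_ok: "\<forall>(r, g)\<in>set (map (sc c) zs). 0 \<le> r \<and> r \<le> s \<and> g \<in> bounded_borel {0..}"
        if "\<forall>(r, g)\<in>set zs. 0 \<le> r \<and> r \<le> s \<and> g \<in> bounded_borel {0..}" for c zs
      proof
        fix y assume "y \<in> set (map (sc c) zs)"
        then obtain r g where rg: "(r, g) \<in> set zs" and y: "y = sc c (r, g)" by auto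
        have g: "g \<in> bounded_borel {0..}" and "0 \<le> r" "r \<le> s" using that rg by auto
        then show "case y of (r, g) \<Rightarrow> 0 \<le> r \<and> r \<le> s \<and> g \<in> bounded_borel {0..}"
          using bounded_borel_lincomb[OF g g, of c 0] by (simp add: y sc_def)
      qed
      let ?k = "(map (sc a) xs @ map (sc b) ys, \<lambda>x. a * g x + b * h x)"
      have "?k \<in> I'"
        using sc_ok[OF xs, of a] sc_ok[OF ys, of b] bounded_borel_lincomb[OF g h, of a b] by (auto simp: I'_def)
      moreover have "v ?k x = a * v i x + b * v j x" if "x \<in> space Q1" for x
      proof -
        have x: "fst x \<in> space M" "snd x \<in> signed_measures {0..}" using that unfolding spQ by (auto elim: SigmaE)
        have "P (map (sc a) xs @ map (sc b) ys) (fst x) = P (map (sc a) xs) (fst x) + P (map (sc b) ys) (fst x)"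
          by (simp add: P_def)
        also have "\<dots> = a * P xs (fst x) + b * P ys (fst x)"
          unfolding scP[OF xs x(1)] scP[OF ys x(1)] ..
        finally show ?thesis
          unfolding v_def i j fst_conv snd_conv signed_integral_lincomb[OF x(2) g h]
          by (simp add: distrib_left)
      qed
      ultimately show ?thesis by blast
    qed
    show "(\<integral>x. iexp (v k x) \<partial>Q1) = (\<integral>x. iexp (v k x) \<partial>Q2)" if k: "k \<in> I'" for k
    proof -
      obtain xs g where k': "k = (xs, g)" by force
      have xs: "\<forall>(r, g)\<in>set xs. 0 \<le> r \<and> r \<le> s \<and> g \<in> bounded_borel {0..}" and g: "g \<in> bounded_borel {0..}"
        using k by (auto simp: I'_def k')
      have Tg: "T_semigroup t g \<in> bounded_borel {0..}" by (rule T_semigroup_bounded_borel[OF g t])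
      note [measurable] = vm[OF k]
      have PM: "P xs \<in> borel_measurable M" by (rule measurable_compose[OF idF Pm[OF xs]])
      have mT[measurable]: "(\<lambda>\<omega>. signed_integral {0..} (W s \<omega>) (T_semigroup t g)) \<in> borel_measurable M"
        by (rule measurable_signed_integral[OF Tg W_meas[OF s]])
      have mW[measurable]: "(\<lambda>\<omega>. signed_integral {0..} (W t \<omega>) g) \<in> borel_measurable M"
        by (rule measurable_signed_integral[OF g W_meas[OF t]])
      note [measurable] = PM
      have "(\<integral>x. iexp (v k x) \<partial>Q1) = (\<integral>\<omega>. iexp (v k (\<omega>, W (s + t) \<omega>)) \<partial>M)"
        unfolding Q1_def by (rule integral_distr[OF m1]) measurable
      also have "\<dots> = (\<integral>\<omega>. iexp (P xs \<omega> + signed_integral {0..} (W s \<omega>) (T_semigroup t g)) \<partial>M) * exp (S_exponent t g)"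
        using joint_char_driven[OF W s t g, of xs] xs by (auto simp: v_def P_def k')
      also have "\<dots> = (\<integral>\<omega>. iexp (P xs \<omega> + signed_integral {0..} (W s \<omega>) (T_semigroup t g)) * (\<integral>\<omega>'. iexp (signed_integral {0..} (W t \<omega>') g) \<partial>M) \<partial>M)"
        by (simp add: char_driven[OF W t g])
      also have "\<dots> = (\<integral>\<omega>. \<integral>\<omega>'. iexp (P xs \<omega> + signed_integral {0..} (W s \<omega>) (T_semigroup t g)) * iexp (signed_integral {0..} (W t \<omega>') g) \<partial>M \<partial>M)"
        by simp
      also have "\<dots> = (\<integral>x. iexp (P xs (fst x) + signed_integral {0..} (W s (fst x)) (T_semigroup t g)) * iexp (signed_integral {0..} (W t (snd x)) g) \<partial>(M \<Otimes>\<^sub>M M))"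
        by (subst MM.integral_fst'[symmetric]) (auto intro!: MM.integrable_const_bound[where B=1] simp: norm_mult)
      also have "\<dots> = (\<integral>x. iexp (v k (fst x, signed_plus (T_dual t (W s (fst x))) (W t (snd x)))) \<partial>(M \<Otimes>\<^sub>M M))"
        by (intro Bochner_Integration.integral_cong)
          (auto simp: space_pair_measure v_def k' signed_integral_S_kernel[OF W t Wsp[OF s] _ g] exp_add ring_distribs)
      also have "\<dots> = (\<integral>x. iexp (v k x) \<partial>Q2)"
        unfolding Q2_def by (rule integral_distr[OF m2, symmetric]) measurable
      finally show ?thesis .
    qed
    \<comment> \<open>To see that the functionals generate the product sigma-algebra, isolate its
      coordinates: one past time with test function 0 for the new state, or an empty past.\<close>
    let ?G = "{v i -` B \<inter> space Q1 |i B. i \<in> I' \<and> B \<in> sets borel}"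
    let ?A = "sigma (space Q1) ?G"
    have spA: "space ?A = space M \<times> signed_measures {0..}" using spQ by (simp add: space_measure_of_conv)
    have vA: "v k \<in> borel_measurable ?A" if "k \<in> I'" for k
    proof (rule measurableI)
      fix B :: "real set" assume "B \<in> sets borel"
      then have "v k -` B \<inter> space Q1 \<in> ?G" using that by blast
      then have "v k -` B \<inter> space Q1 \<in> sets ?A" by (intro in_measure_of) auto
      then show "v k -` B \<inter> space ?A \<in> sets ?A" by (simp only: space_measure_of_conv)
    qed simp
    have fstA: "fst \<in> measurable ?A ?F"
      unfolding natural_filtration_def
    proof (rule measurable_measure_of)
      fix C assume "C \<in> {W r -` B \<inter> space M |r B. 0 \<le> r \<and> ennreal r \<le> ennreal s \<and> B \<in> sets signed_space}"
      then obtain r B where C: "C = W r -` B \<inter> space M" and r: "0 \<le> r" "r \<le> s" and B: "B \<in> sets signed_space"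
        using s by (auto simp: ennreal_le_iff)
      have "(\<lambda>x. W r (fst x)) \<in> measurable ?A signed_space"
      proof (rule measurable_signed_algebraI)
        show "W r (fst x) \<in> signed_measures {0..}" if "x \<in> space ?A" for x
          using that Wsp[OF r(1)] spA by auto
        fix g :: "real \<Rightarrow> real" assume g: "g \<in> bounded_borel {0..}"
        have "([(r, g)], \<lambda>x. 0) \<in> I'" using g r by (auto simp: I'_def bounded_borel_zero)
        then have "v ([(r, g)], \<lambda>x. 0) \<in> borel_measurable ?A" by (rule vA)
        moreover have "v ([(r, g)], \<lambda>x. 0) x = signed_integral {0..} (W r (fst x)) g" if "x \<in> space ?A" for x
        proof -
          have "snd x \<in> signed_measures {0..}" using that unfolding spA by (auto elim: SigmaE)
          then show ?thesis by (simp add: v_def P_def signed_integral_zero)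
        qed
        ultimately show "(\<lambda>x. signed_integral {0..} (W r (fst x)) g) \<in> borel_measurable ?A"
          by (rule measurable_cong[THEN iffD1, rotated])
      qed
      from measurable_sets[OF this B] have "(\<lambda>x. W r (fst x)) -` B \<inter> space ?A \<in> sets ?A" .
      also have "(\<lambda>x. W r (fst x)) -` B \<inter> space ?A = fst -` C \<inter> space ?A" using spA by (auto simp: C)
      finally show "fst -` C \<inter> space ?A \<in> sets ?A" .
    qed (use spA in auto)
    have sndA: "snd \<in> measurable ?A signed_space"
    proof (rule measurable_signed_algebraI)
      show "snd x \<in> signed_measures {0..}" if "x \<in> space ?A" for x
        using that unfolding spA by (auto elim: SigmaE)
      fix g :: "real \<Rightarrow> real" assume g: "g \<in> bounded_borel {0..}"
      have "([], g) \<in> I'" using g by (auto simp: I'_def)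
      from vA[OF this] show "(\<lambda>x. signed_integral {0..} (snd x) g) \<in> borel_measurable ?A"
        by (simp add: v_def[abs_def] P_def)
    qed
    have "(\<lambda>x. x) \<in> measurable ?A ?P" using measurable_Pair[OF fstA sndA] by simp
    then show "(\<lambda>x. x) \<in> measurable ?A Q1" by (simp add: Q1_def cong: measurable_cong_sets)
  qed
  have A'[measurable]: "A \<in> sets ?F" by (rule A)
  have AM[measurable]: "A \<in> sets M" using A sub by auto
  have Tf: "T_semigroup t f \<in> bounded_borel {0..}" by (rule T_semigroup_bounded_borel[OF f t])
  have e[measurable]: "(\<lambda>x. indicator A (fst x) * iexp (signed_integral {0..} (snd x) f)) \<in> borel_measurable ?P"
  proof -
    have "(\<lambda>x. signed_integral {0..} (snd x) f) \<in> borel_measurable ?P"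
      by (rule measurable_signed_integral[OF f measurable_snd])
    then show ?thesis by measurable
  qed
  note [measurable] = measurable_signed_integral[OF Tf W_meas[OF s]] measurable_signed_integral[OF f W_meas[OF t]]
  have "(\<integral>\<omega>. indicator A \<omega> * iexp (signed_integral {0..} (W (s + t) \<omega>) f) \<partial>M) =
    (\<integral>x. indicator A (fst x) * iexp (signed_integral {0..} (snd x) f) \<partial>Q1)"
    unfolding Q1_def by (subst integral_distr[OF m1 e]) simp
  also have "\<dots> = (\<integral>x. indicator A (fst x) * iexp (signed_integral {0..} (signed_plus (T_dual t (W s (fst x))) (W t (snd x))) f) \<partial>(M \<Otimes>\<^sub>M M))"
    unfolding Q12 unfolding Q2_def by (subst integral_distr[OF m2 e]) simp
  also have "\<dots> = (\<integral>x. (indicator A (fst x) * iexp (signed_integral {0..} (W s (fst x)) (T_semigroup t f))) * iexp (signed_integral {0..} (W t (snd x)) f) \<partial>(M \<Otimes>\<^sub>M M))"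
    by (intro Bochner_Integration.integral_cong)
      (auto simp: space_pair_measure signed_integral_S_kernel[OF W t Wsp[OF s] _ f] exp_add ring_distribs)
  also have "\<dots> = (\<integral>\<omega>. \<integral>\<omega>'. (indicator A \<omega> * iexp (signed_integral {0..} (W s \<omega>) (T_semigroup t f))) * iexp (signed_integral {0..} (W t \<omega>') f) \<partial>M \<partial>M)"
    by (subst MM.integral_fst'[symmetric])
      (auto intro!: MM.integrable_const_bound[where B=1] simp: norm_mult split: split_indicator)
  also have "\<dots> = (\<integral>\<omega>. indicator A \<omega> * iexp (signed_integral {0..} (W s \<omega>) (T_semigroup t f)) \<partial>M) * exp (S_exponent t f)"
    by (simp add: char_driven[OF W t f])
  finally show ?thesis .
qed

end

lemma null_finite_measure:
  "null_measure (restrict_space borel E) \<in> finite_measures E"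
  by (auto simp: finite_measures_def intro: finite_measureI)

lemma signed_zero_in: "(\<lambda>_. 0) \<in> signed_measures E"
proof -
  have "measure_diff (null_measure (restrict_space borel E)) (null_measure (restrict_space borel E)) \<in> signed_measures E"
    by (intro measure_diff_signed null_finite_measure)
  then show ?thesis by (simp add: measure_diff_def)
qed

section \<open>Conditional laws from characteristic functionals\<close>

context jump_noise
begin

text \<open>For each A the hypothesis \<open>id\<close> identifies the characteristic functional of
  R on A \<inter> D with that of the mixture of S_t(V, .) over A \<inter> D. Uniqueness of laws
  gives equal mass to B, which characterizes the conditional expectation. The set D is where a
  stopping time is finite; for deterministic times it is the whole space.\<close>

lemma cond_exp_S:
  assumes W: "driven W" and t: "t \<ge> 0" and sub: "subalgebra M F" and D: "D \<in> sets F"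
    and V: "V \<in> measurable (restrict_space F D) signed_space"
    and R: "R \<in> measurable M signed_space" and B: "B \<in> sets signed_space"
    and id: "\<And>A f. A \<in> sets F \<Longrightarrow> f \<in> bounded_continuous {0..} \<Longrightarrow>
      (\<integral>\<omega>. indicator (A \<inter> D) \<omega> * iexp (signed_integral {0..} (R \<omega>) f) \<partial>M) =
      (\<integral>\<omega>. indicator (A \<inter> D) \<omega> * iexp (signed_integral {0..} (V \<omega>) (T_semigroup t f)) \<partial>M) * exp (S_exponent t f)"
  shows "AE \<omega> in M. \<omega> \<in> D \<longrightarrow>
    real_cond_exp M F (indicator {\<omega> \<in> space M. \<omega> \<in> D \<and> R \<omega> \<in> B}) \<omega> = measure (S_semigroup m t (V \<omega>)) B"
proof -
  interpret S: finite_measure_subalgebra M F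
    using sub finite_measure_axioms by (simp add: finite_measure_subalgebra_def finite_measure_subalgebra_axioms_def)
  interpret MM: pair_prob_space M M ..
  have FM: "A \<in> sets M" if "A \<in> sets F" for A using sub that by (auto simp: subalgebra_def)
  have spF: "space F = space M" using sub by (simp add: subalgebra_def)
  note [measurable] = FM[OF D]
  \<comment> \<open>V is given only on D. Extended by the zero measure it is a total state variable
    on which the kernel can act.\<close>
  define V' where "V' = (\<lambda>\<omega>. if \<omega> \<in> D then V \<omega> else (\<lambda>_. 0))"
  have V'F: "V' \<in> measurable F signed_space"
  proof -
    have "{\<omega> \<in> space F. \<omega> \<in> D} \<in> sets F" using D by (simp add: Collect_conj_eq Int_absorb1 sets.sets_into_space flip: Int_def)
    moreover have "(\<lambda>_. (\<lambda>_. 0)) \<in> measurable (restrict_space F {x. x \<notin> D}) signed_space"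
      by (rule measurable_const) (simp add: signed_zero_in)
    ultimately show ?thesis unfolding V'_def using V by (subst measurable_If_restrict_space_iff) auto
  qed
  have V'M: "V' \<in> measurable M signed_space" by (rule measurable_from_subalg[OF sub V'F])
  have V'sp: "V' \<omega> \<in> signed_measures {0..}" if "\<omega> \<in> space M" for \<omega> using measurable_space[OF V'M that] by simp
  have SB[measurable]: "(\<lambda>\<omega>. measure (S_semigroup m t (V' \<omega>)) B) \<in> borel_measurable F"
    by (rule measurable_compose[OF measurable_compose[OF V'F measurable_prob_algebraD[OF S_semigroup_measurable[OF W t]]]
        measurable_measure_subprob_algebra[OF B]])
  define g where "g = (\<lambda>\<omega>. indicator D \<omega> * measure (S_semigroup m t (V' \<omega>)) B)"
  have gF: "g \<in> borel_measurable F" unfolding g_def using D by measurable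
  have prob: "prob_space (S_semigroup m t (V' \<omega>))" if "\<omega> \<in> space M" for \<omega>
    using S_semigroup_has_law[OF W t V'sp[OF that]] by (simp add: has_S_law_def)
  have gint: "integrable M g"
  proof (rule integrable_const_bound[where B=1])
    show "AE \<omega> in M. norm (g \<omega>) \<le> 1"
    proof (rule AE_I2)
      fix \<omega> assume "\<omega> \<in> space M"
      then interpret p: prob_space "S_semigroup m t (V' \<omega>)" by (rule prob)
      show "norm (g \<omega>) \<le> 1" by (auto simp: g_def split: split_indicator)
    qed
    show "g \<in> borel_measurable M" by (rule measurable_from_subalg[OF sub gF])
  qed
  let ?E = "{\<omega> \<in> space M. \<omega> \<in> D \<and> R \<omega> \<in> B}"
  have RB[measurable]: "{\<omega> \<in> space M. R \<omega> \<in> B} \<in> sets M"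
    using measurable_sets[OF R B] by (simp add: vimage_def Int_def conj_commute)
  have Em[measurable]: "?E \<in> sets M"
  proof -
    have "?E = D \<inter> {\<omega> \<in> space M. R \<omega> \<in> B}" by auto
    then show ?thesis using RB FM[OF D] by simp
  qed
  have m2: "(\<lambda>x. signed_plus (T_dual t (V' (fst x))) (W t (snd x))) \<in> measurable (M \<Otimes>\<^sub>M M) signed_space"
    by (intro signed_plus_measurable T_dual_measurable t measurable_compose[OF measurable_fst V'M]
        measurable_compose[OF measurable_snd drivenD(1)[OF W t]])
  have key: "(\<integral>\<omega>\<in>A. indicat_real ?E \<omega> \<partial>M) = (\<integral>\<omega>\<in>A. g \<omega> \<partial>M)" if A: "A \<in> sets F" for A
  proof -
    have [measurable]: "A \<in> sets M" by (rule FM[OF A])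
    let ?D = "density M (\<lambda>\<omega>. ennreal (indicator (A \<inter> D) \<omega>))"
    have fD: "finite_measure ?D"
    proof
      have "emeasure ?D (space M) = (\<integral>\<^sup>+\<omega>. ennreal (indicator (A \<inter> D) \<omega>) * indicator (space M) \<omega> \<partial>M)"
        by (rule emeasure_density) auto
      also have "\<dots> \<le> (\<integral>\<^sup>+\<omega>. 1 \<partial>M)" by (intro nn_integral_mono) (auto split: split_indicator)
      also have "\<dots> = 1" by (simp add: emeasure_space_1)
      finally show "emeasure ?D (space ?D) \<noteq> \<infinity>" by (auto simp: top_unique)
    qed
    interpret D: finite_measure ?D by (rule fD)
    interpret DM: pair_sigma_finite ?D M ..
    have fDM: "finite_measure (?D \<Otimes>\<^sub>M M)"
    proof
      show "emeasure (?D \<Otimes>\<^sub>M M) (space (?D \<Otimes>\<^sub>M M)) \<noteq> \<infinity>"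
        unfolding space_pair_measure by (subst emeasure_pair_measure_Times) (auto simp: ennreal_mult_eq_top_iff)
    qed
    interpret DM': finite_measure "?D \<Otimes>\<^sub>M M" by (rule fDM)
    have sDM: "sets (?D \<Otimes>\<^sub>M M) = sets (M \<Otimes>\<^sub>M M)" by (intro sets_pair_measure_cong) auto
    have m1': "R \<in> measurable ?D signed_space" using R by simp
    have m2': "(\<lambda>x. signed_plus (T_dual t (V' (fst x))) (W t (snd x))) \<in> measurable (?D \<Otimes>\<^sub>M M) signed_space"
      using m2 sDM by (simp cong: measurable_cong_sets)
    define Q1 where "Q1 = distr ?D signed_space R"
    \<comment> \<open>The mixture of S_t(V', .) over A \<inter> D, with the immigrated part taken
      along an independent second coordinate.\<close>
    define Q2 where "Q2 = distr (?D \<Otimes>\<^sub>M M) signed_space (\<lambda>x. signed_plus (T_dual t (V' (fst x))) (W t (snd x)))"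
    have "Q1 = Q2"
    proof (rule signed_law_unique)
      show "finite_measure Q1" unfolding Q1_def by (rule D.finite_measure_distr[OF m1'])
      show "finite_measure Q2" unfolding Q2_def by (rule DM'.finite_measure_distr[OF m2'])
      fix f :: "real \<Rightarrow> real" assume fc: "f \<in> bounded_continuous {0..}"
      then have f: "f \<in> bounded_borel {0..}" using bounded_continuous_subset by auto
      have Tf: "T_semigroup t f \<in> bounded_borel {0..}" by (rule T_semigroup_bounded_borel[OF f t])
      have e[measurable]: "(\<lambda>\<nu>. iexp (signed_integral {0..} \<nu> f)) \<in> borel_measurable signed_space"
      proof -
        have "(\<lambda>\<nu>. signed_integral {0..} \<nu> f) \<in> borel_measurable signed_space"
          by (rule measurable_signed_integral[OF f]) simp
        then show ?thesis by measurable
      qed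
      note [measurable] = measurable_signed_integral[OF Tf V'M] measurable_signed_integral[OF f drivenD(1)[OF W t]]
        measurable_signed_integral[OF f R]
      have "(\<integral>\<nu>. iexp (signed_integral {0..} \<nu> f) \<partial>Q1) = (\<integral>\<omega>. iexp (signed_integral {0..} (R \<omega>) f) \<partial>?D)"
        unfolding Q1_def by (rule integral_distr[OF m1' e])
      also have "\<dots> = (\<integral>\<omega>. indicator (A \<inter> D) \<omega> *\<^sub>R iexp (signed_integral {0..} (R \<omega>) f) \<partial>M)"
        by (rule integral_density) auto
      also have "\<dots> = (\<integral>\<omega>. indicator (A \<inter> D) \<omega> * iexp (signed_integral {0..} (R \<omega>) f) \<partial>M)"
        by (intro Bochner_Integration.integral_cong) (auto split: split_indicator)
      also have "\<dots> = (\<integral>\<omega>. indicator (A \<inter> D) \<omega> * iexp (signed_integral {0..} (V \<omega>) (T_semigroup t f)) \<partial>M) * exp (S_exponent t f)"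
        by (rule id[OF A fc])
      also have "(\<integral>\<omega>. indicator (A \<inter> D) \<omega> * iexp (signed_integral {0..} (V \<omega>) (T_semigroup t f)) \<partial>M) =
          (\<integral>\<omega>. indicator (A \<inter> D) \<omega> *\<^sub>R iexp (signed_integral {0..} (V' \<omega>) (T_semigroup t f)) \<partial>M)"
        by (intro Bochner_Integration.integral_cong) (auto simp: V'_def split: split_indicator)
      also have "\<dots> = (\<integral>\<omega>. iexp (signed_integral {0..} (V' \<omega>) (T_semigroup t f)) \<partial>?D)"
        by (rule integral_density[symmetric]) auto
      also have "\<dots> * exp (S_exponent t f) = (\<integral>\<omega>. iexp (signed_integral {0..} (V' \<omega>) (T_semigroup t f)) * (\<integral>\<omega>'. iexp (signed_integral {0..} (W t \<omega>') f) \<partial>M) \<partial>?D)"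
        by (simp add: char_driven[OF W t f])
      also have "\<dots> = (\<integral>\<omega>. \<integral>\<omega>'. iexp (signed_integral {0..} (V' \<omega>) (T_semigroup t f)) * iexp (signed_integral {0..} (W t \<omega>') f) \<partial>M \<partial>?D)"
        by simp
      also have "\<dots> = (\<integral>x. iexp (signed_integral {0..} (V' (fst x)) (T_semigroup t f)) * iexp (signed_integral {0..} (W t (snd x)) f) \<partial>(?D \<Otimes>\<^sub>M M))"
      proof -
        have "(\<lambda>x. iexp (signed_integral {0..} (V' (fst x)) (T_semigroup t f)) * iexp (signed_integral {0..} (W t (snd x)) f)) \<in> borel_measurable (M \<Otimes>\<^sub>M M)"
          by measurable
        then have "(\<lambda>x. iexp (signed_integral {0..} (V' (fst x)) (T_semigroup t f)) * iexp (signed_integral {0..} (W t (snd x)) f)) \<in> borel_measurable (?D \<Otimes>\<^sub>M M)"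
          using sDM by (simp cong: measurable_cong_sets)
        then have "integrable (?D \<Otimes>\<^sub>M M) (\<lambda>x. iexp (signed_integral {0..} (V' (fst x)) (T_semigroup t f)) * iexp (signed_integral {0..} (W t (snd x)) f))"
          by (intro DM'.integrable_const_bound[where B=1]) (auto simp: norm_mult)
        from DM.integral_fst'[OF this] show ?thesis by simp
      qed
      also have "\<dots> = (\<integral>x. iexp (signed_integral {0..} (signed_plus (T_dual t (V' (fst x))) (W t (snd x))) f) \<partial>(?D \<Otimes>\<^sub>M M))"
        by (intro Bochner_Integration.integral_cong)
          (auto simp: space_pair_measure signed_integral_S_kernel[OF W t V'sp _ f] exp_add ring_distribs)
      also have "\<dots> = (\<integral>\<nu>. iexp (signed_integral {0..} \<nu> f) \<partial>Q2)"
        unfolding Q2_def by (rule integral_distr[OF m2' e, symmetric])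
      finally show "(\<integral>\<nu>. iexp (signed_integral {0..} \<nu> f) \<partial>Q1) = (\<integral>\<nu>. iexp (signed_integral {0..} \<nu> f) \<partial>Q2)" .
    qed (simp_all add: Q1_def Q2_def)
    have iB: "(indicator B :: _ \<Rightarrow> real) \<in> borel_measurable signed_space" using B by simp
    have "(\<integral>\<omega>\<in>A. indicat_real ?E \<omega> \<partial>M) = (\<integral>\<omega>. indicator (A \<inter> D) \<omega> *\<^sub>R indicat_real B (R \<omega>) \<partial>M)"
      unfolding set_lebesgue_integral_def by (intro Bochner_Integration.integral_cong) (auto split: split_indicator)
    also have "\<dots> = (\<integral>\<omega>. indicat_real B (R \<omega>) \<partial>?D)"
      using measurable_compose[OF R iB] by (subst integral_density) auto
    also have "\<dots> = (\<integral>\<nu>. indicat_real B \<nu> \<partial>Q1)"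
      unfolding Q1_def by (rule integral_distr[OF m1' iB, symmetric])
    also have "\<dots> = (\<integral>\<nu>. indicat_real B \<nu> \<partial>Q2)" using \<open>Q1 = Q2\<close> by simp
    also have "\<dots> = (\<integral>x. indicat_real B (signed_plus (T_dual t (V' (fst x))) (W t (snd x))) \<partial>(?D \<Otimes>\<^sub>M M))"
      unfolding Q2_def by (rule integral_distr[OF m2' iB])
    also have "\<dots> = (\<integral>\<omega>. \<integral>\<omega>'. indicat_real B (signed_plus (T_dual t (V' \<omega>)) (W t \<omega>')) \<partial>M \<partial>?D)"
    proof -
      have "integrable (?D \<Otimes>\<^sub>M M) (\<lambda>x. indicat_real B (signed_plus (T_dual t (V' (fst x))) (W t (snd x))) :: real)"
        using measurable_compose[OF m2' iB] by (intro DM'.integrable_const_bound[where B=1]) (auto split: split_indicator)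
      from DM.integral_fst'[OF this] show ?thesis by simp
    qed
    also have "\<dots> = (\<integral>\<omega>. measure (S_semigroup m t (V' \<omega>)) B \<partial>?D)"
    proof (intro Bochner_Integration.integral_cong refl)
      fix \<omega> assume "\<omega> \<in> space ?D"
      then have sp: "V' \<omega> \<in> signed_measures {0..}" using V'sp by simp
      note mk = S_kernel_measurable_fun[OF W t sp]
      have "B \<inter> space signed_space = B" using sets.sets_into_space[OF B] by auto
      then have "measure (S_semigroup m t (V' \<omega>)) B = (\<integral>\<nu>. indicat_real B \<nu> \<partial>S_kernel W t (V' \<omega>))"
        unfolding S_semigroup_S_kernel[OF W t sp] by (simp add: S_kernel_def)
      also have "\<dots> = (\<integral>\<omega>'. indicat_real B (signed_plus (T_dual t (V' \<omega>)) (W t \<omega>')) \<partial>M)"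
        unfolding S_kernel_def by (rule integral_distr[OF mk iB])
      finally show "(\<integral>\<omega>'. indicat_real B (signed_plus (T_dual t (V' \<omega>)) (W t \<omega>')) \<partial>M) = measure (S_semigroup m t (V' \<omega>)) B" by simp
    qed
    also have "\<dots> = (\<integral>\<omega>. indicator (A \<inter> D) \<omega> *\<^sub>R measure (S_semigroup m t (V' \<omega>)) B \<partial>M)"
      using measurable_from_subalg[OF sub SB] by (subst integral_density) auto
    also have "\<dots> = (\<integral>\<omega>\<in>A. g \<omega> \<partial>M)"
      unfolding set_lebesgue_integral_def g_def by (intro Bochner_Integration.integral_cong) (auto split: split_indicator)
    finally show ?thesis .
  qed
  have "AE \<omega> in M. real_cond_exp M F (indicator ?E) \<omega> = g \<omega>"
    by (rule S.real_cond_exp_charact[OF key _ gint gF]) (simp_all add: integrable_indicator_iff emeasure_eq_measure)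
  then show ?thesis by eventually_elim (simp add: g_def V'_def)
qed

subsection \<open>The process Z\<close>

text \<open>The integrands differ only at s = t. The intensity gives no mass to that instant, so
  almost surely N has no jump there either.\<close>

lemma entrance_AE_kappa:
  assumes f: "f \<in> bounded_borel {0..}" and t: "t \<ge> 0"
  shows "AE \<omega> in M. compensated_integral (N \<omega>) L t (\<lambda>s u. u * (\<integral>y. h_weight y * f y \<partial>kappa (t - s))) =
    comp_int \<omega> (entrance_integrand t f)"
proof -
  define K where "K s = indicator {0..t} s * (\<integral>y. h_weight y * f y \<partial>kappa (t - s))" for s
  have eq: "K s = entrance_integrand t f s" if "s \<noteq> t" for s
    using that by (auto simp: K_def entrance_integrand_def kappa_h_weight split: split_indicator)
  have "K = (\<lambda>s. if s = t then K t else entrance_integrand t f s)" using eq by auto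
  also have "\<dots> \<in> borel_measurable borel"
    using good_integrand_measurable[OF good_entrance_integrand[OF f, of t]] by measurable
  finally have [measurable]: "K \<in> borel_measurable borel" .
  have [measurable]: "entrance_integrand t f \<in> borel_measurable borel"
    by (rule good_integrand_measurable[OF good_entrance_integrand[OF f]])
  let ?B = "{x \<in> space L. fst x = t}"
  have B[measurable]: "?B \<in> sets L" by measurable
  have "?B = {t} \<times> space m"
    using t by (auto simp: L_eq space_pair_measure space_restrict_space)
  moreover have "{t} \<in> sets time" using t by (simp add: sets_restrict_space_iff)
  \<comment> \<open>m may be infinite, but the factor of the single instant is 0, so the product is
    0.\<close>
  ultimately have "emeasure L ?B = emeasure time {t} * emeasure m (space m)"
    unfolding L_eq using M2.emeasure_pair_measure_Times[of "{t}" time "space m"] by simp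
  also have "emeasure time {t} = 0" using t by (simp add: emeasure_restrict_space)
  finally have B0: "emeasure L ?B = 0" by simp
  have *: "(LINT x:{0..t} \<times> UNIV|Q. snd x * (\<integral>y. h_weight y * f y \<partial>kappa (t - fst x))) = (\<integral>x. jump_fun (entrance_integrand t f) x \<partial>Q)"
    if sQ: "sets Q = sets L" and Q0: "emeasure Q ?B = 0" for Q
  proof -
    have spQ: "space Q = space L" by (rule sets_eq_imp_space_eq[OF sQ])
    have "(LINT x:{0..t} \<times> UNIV|Q. snd x * (\<integral>y. h_weight y * f y \<partial>kappa (t - fst x))) = (\<integral>x. jump_fun K x \<partial>Q)"
      unfolding set_lebesgue_integral_def
      by (intro Bochner_Integration.integral_cong) (auto simp: K_def jump_fun_def indicator_def)
    also have "\<dots> = (\<integral>x. jump_fun (entrance_integrand t f) x \<partial>Q)"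
    proof (rule integral_cong_AE)
      have "jump_fun K \<in> borel_measurable L" "jump_fun (entrance_integrand t f) \<in> borel_measurable L" by measurable
      then show "jump_fun K \<in> borel_measurable Q" "jump_fun (entrance_integrand t f) \<in> borel_measurable Q"
        using sQ by (auto cong: measurable_cong_sets)
      have "AE x in Q. \<not> fst x = t"
        using Q0 B sQ by (subst AE_iff_measurable[where N="?B"]) (auto simp: spQ)
      then show "AE x in Q. jump_fun K x = jump_fun (entrance_integrand t f) x"
        by eventually_elim (simp add: jump_fun_def eq)
    qed
    finally show ?thesis .
  qed
  have "(\<integral>\<^sup>+\<omega>. emeasure (N \<omega>) ?B \<partial>M) = 0"
    using expectation_count[OF B] B0 by simp
  then have "AE \<omega> in M. emeasure (N \<omega>) ?B = 0"
    by (subst (asm) nn_integral_0_iff_AE) auto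
  then show ?thesis
    using AE_space
  proof eventually_elim
    case (elim \<omega>)
    then show ?case
      using *[OF sets_N elim(1)] *[OF refl B0] by (simp add: compensated_integral_def comp_int_def)
  qed
qed

lemma h_weight_bounded_borel:
  assumes "f \<in> bounded_borel {0..}"
  shows "(\<lambda>x. h_weight x * f x) \<in> bounded_borel {0<..}"
proof -
  obtain c where c: "0 \<le> c" "\<And>x. x \<in> {0..} \<Longrightarrow> \<bar>f x\<bar> \<le> c" using bounded_borelE[OF assms] by metis
  have [measurable]: "f \<in> borel_measurable (restrict_space borel {0<..})"
    by (rule measurable_restrict_mono[OF bounded_borel_measurable[OF assms]]) auto
  have [measurable]: "h_weight \<in> borel_measurable (restrict_space borel {0<..})"
    by (rule measurable_restrict_space1) measurable
  show ?thesis
  proof (rule bounded_borelI)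
    fix x :: real assume x: "x \<in> {0<..}"
    have "\<bar>h_weight x\<bar> * \<bar>f x\<bar> \<le> 1 * c"
      using x c h_weight_le(2)[of x] h_weight_nonneg[of x] by (intro mult_mono) auto
    then show "\<bar>h_weight x * f x\<bar> \<le> c" by (simp add: abs_mult)
  qed measurable
qed

lemma Z_process_signed:
  assumes y: "Y t \<omega> \<in> signed_measures {0<..}"
  shows Z_process_in: "Z_process Y t \<omega> \<in> signed_measures {0..}"
    and signed_integral_Z: "\<And>f. f \<in> bounded_borel {0..} \<Longrightarrow>
      signed_integral {0..} (Z_process Y t \<omega>) f = signed_integral {0<..} (Y t \<omega>) (\<lambda>x. h_weight x * f x)"
proof -
  have ex: "\<exists>p'\<in>finite_measures {0..}. \<forall>f\<in>bounded_borel {0..}. (\<integral>x. f x \<partial>p') = (\<integral>x. h_weight x * f x \<partial>p)"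
    if p: "p \<in> finite_measures {0<..}" for p
  proof -
    have sp: "sets p = sets (restrict_space borel {0<..})" and spp: "space p = {0<..}" using finite_measuresD[OF p] by auto
    have idm: "(\<lambda>x. x) \<in> borel_measurable p"
      using measurable_restrict_space1[OF measurable_ident, of borel "{0<..}"] sp by (simp add: id_def cong: measurable_cong_sets)
    have [measurable]: "fst \<in> borel_measurable (p \<Otimes>\<^sub>M (lborel :: real measure))"
      by (rule measurable_compose[OF measurable_fst idm])
    \<comment> \<open>The Lebesgue variable of \<open>mixture_measure\<close> is a dummy here; the
      normal density merely integrates it out to 1.\<close>
    have "\<exists>p'\<in>finite_measures {0..}. \<forall>f\<in>bounded_borel {0..}.
      (\<integral>x. f x \<partial>p') = (\<integral>x. (\<integral>z. (h_weight x * std_normal_density z) * f x \<partial>lborel) \<partial>p)"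
    proof (rule mixture_measure)
      show "finite_measure p" by (rule finite_measuresD[OF p])
      show "(\<lambda>(x, z). h_weight x * std_normal_density z) \<in> borel_measurable (p \<Otimes>\<^sub>M lborel)"
        unfolding case_prod_beta by measurable
      show "(\<lambda>(x, z). x) \<in> measurable (p \<Otimes>\<^sub>M (lborel :: real measure)) (restrict_space borel {0..})"
        unfolding case_prod_beta by (rule measurable_restrict_space2) (auto simp: space_pair_measure spp)
      show "0 \<le> h_weight x * std_normal_density z" if "x \<in> space p" for x z
        using that by (simp add: spp h_weight_nonneg)
      show "integrable lborel (\<lambda>z. h_weight x * std_normal_density z)" for x by simp
      show "(\<integral>z. h_weight x * std_normal_density z \<partial>lborel) \<le> 1" for x using h_weight_le by simp
    qed
    moreover have "(\<integral>z. (h_weight x * std_normal_density z) * f x \<partial>lborel) = h_weight x * f x" for x and f :: "real \<Rightarrow> real"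
      by simp
    ultimately show ?thesis by simp
  qed
  obtain p n where pn: "p \<in> finite_measures {0<..}" "n \<in> finite_measures {0<..}"
    "\<And>f. f \<in> bounded_borel {0<..} \<Longrightarrow> signed_integral {0<..} (Y t \<omega>) f = (\<integral>x. f x \<partial>p) - (\<integral>x. f x \<partial>n)"
    using signed_measuresE[OF y] by metis
  obtain p' n' where pn': "p' \<in> finite_measures {0..}" "n' \<in> finite_measures {0..}"
    "\<And>f. f \<in> bounded_borel {0..} \<Longrightarrow> (\<integral>x. f x \<partial>p') = (\<integral>x. h_weight x * f x \<partial>p)"
    "\<And>f. f \<in> bounded_borel {0..} \<Longrightarrow> (\<integral>x. f x \<partial>n') = (\<integral>x. h_weight x * f x \<partial>n)"
    using ex[OF pn(1)] ex[OF pn(2)] by metis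
  have md: "measure_diff p' n' \<in> signed_measures {0..}" by (rule measure_diff_signed[OF pn'(1,2)])
  have SI: "signed_integral {0..} (measure_diff p' n') f = signed_integral {0<..} (Y t \<omega>) (\<lambda>x. h_weight x * f x)"
    if "f \<in> bounded_borel {0..}" for f
    using that by (simp add: signed_integral_diff[OF pn'(1,2)] pn' pn(3) h_weight_bounded_borel)
  have "Z_process Y t \<omega> A = measure_diff p' n' A" for A
  proof (cases "A \<in> sets (restrict_space borel {0..})")
    case True
    have "measure_diff p' n' A = signed_integral {0..} (measure_diff p' n') (indicator A)"
      by (rule signed_integral_indicator[OF md True, symmetric])
    then show ?thesis using True by (simp add: Z_process_def SI bounded_borel_indicator)
  qed (simp add: Z_process_def signed_measures_notin_sets[OF md])
  then have eq: "Z_process Y t \<omega> = measure_diff p' n'" by auto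
  show "Z_process Y t \<omega> \<in> signed_measures {0..}" by (simp add: eq md)
  show "signed_integral {0..} (Z_process Y t \<omega>) f = signed_integral {0<..} (Y t \<omega>) (\<lambda>x. h_weight x * f x)"
    if "f \<in> bounded_borel {0..}" for f using SI[OF that] by (simp add: eq)
qed

lemma driven_Z:
  assumes Y: "is_Y_process M m N Y"
  shows "driven (Z_process Y)"
  unfolding driven_def
proof (intro conjI allI impI ballI)
  fix t :: real assume t: "0 \<le> t"
  have Ym: "Y t \<in> measurable M (signed_algebra {0<..})" using Y t by (simp add: is_Y_process_def)
  have Ys: "Y t \<omega> \<in> signed_measures {0<..}" if "\<omega> \<in> space M" for \<omega>
    using measurable_space[OF Ym that] by simp
  show "Z_process Y t \<in> measurable M signed_space"
  proof (rule measurable_signed_algebraI)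
    show "Z_process Y t \<omega> \<in> signed_measures {0..}" if "\<omega> \<in> space M" for \<omega> by (rule Z_process_in[of Y t \<omega>, OF Ys[OF that]])
    fix f :: "real \<Rightarrow> real" assume f: "f \<in> bounded_borel {0..}"
    have "(\<lambda>\<omega>. signed_integral {0<..} (Y t \<omega>) (\<lambda>x. h_weight x * f x)) \<in> borel_measurable M"
      by (rule measurable_signed_integral[OF h_weight_bounded_borel[OF f] Ym])
    then show "(\<lambda>\<omega>. signed_integral {0..} (Z_process Y t \<omega>) f) \<in> borel_measurable M"
      by (rule measurable_cong[THEN iffD1, rotated]) (simp add: signed_integral_Z[of Y t, OF Ys f])
  qed
  fix f :: "real \<Rightarrow> real" assume f: "f \<in> bounded_borel {0..}"
  have "AE \<omega> in M. signed_integral {0<..} (Y t \<omega>) (\<lambda>x. h_weight x * f x) =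
    compensated_integral (N \<omega>) L t (\<lambda>s u. u * (\<integral>y. h_weight y * f y \<partial>kappa (t - s)))"
    using Y t h_weight_bounded_borel[OF f] by (simp add: is_Y_process_def)
  then show "AE \<omega> in M. signed_integral {0..} (Z_process Y t \<omega>) f = comp_int \<omega> (entrance_integrand t f)"
    using entrance_AE_kappa[OF f t] AE_space by eventually_elim (simp add: signed_integral_Z[of Y t, OF Ys f])
qed

lemma markov_driven:
  assumes W: "driven W"
  shows "markov_process M signed_space (natural_filtration M signed_space W) W (S_semigroup m)"
  unfolding markov_process_def
proof (intro conjI allI impI ballI)
  show Wm: "W t \<in> measurable M signed_space" if "0 \<le> t" for t by (rule drivenD(1)[OF W that])
  show WF: "W t \<in> measurable (natural_filtration M signed_space W (ennreal t)) signed_space" if "0 \<le> t" for t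
    using that drivenD_space[OF W that] by (intro measurable_natural_filtration) auto
  fix s t :: real and B assume s: "0 \<le> s" and t: "0 \<le> t" and B: "B \<in> sets signed_space"
  let ?F = "natural_filtration M signed_space W (ennreal s)"
  have sub: "subalgebra M ?F"
    using sets_natural_filtration_subset[OF Wm] by (simp add: subalgebra_def space_natural_filtration)
  have "AE \<omega> in M. \<omega> \<in> space M \<longrightarrow>
    real_cond_exp M ?F (indicator {\<omega> \<in> space M. \<omega> \<in> space M \<and> W (s + t) \<omega> \<in> B}) \<omega> = measure (S_semigroup m t (W s \<omega>)) B"
  proof (rule cond_exp_S[OF W t sub])
    show "space M \<in> sets ?F" using sets.top[of ?F] by (simp add: space_natural_filtration)
    show "W s \<in> measurable (restrict_space ?F (space M)) signed_space"
      by (rule measurable_restrict_space1[OF WF[OF s]])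
    fix A and f :: "real \<Rightarrow> real" assume A: "A \<in> sets ?F" and "f \<in> bounded_continuous {0..}"
    then have f: "f \<in> bounded_borel {0..}" using bounded_continuous_subset by auto
    have "A \<inter> space M = A" using sets.sets_into_space[OF A] by (auto simp: space_natural_filtration)
    then show "(\<integral>\<omega>. indicator (A \<inter> space M) \<omega> * iexp (signed_integral {0..} (W (s + t) \<omega>) f) \<partial>M) =
      (\<integral>\<omega>. indicator (A \<inter> space M) \<omega> * iexp (signed_integral {0..} (W s \<omega>) (T_semigroup t f)) \<partial>M) * exp (S_exponent t f)"
      using markov_identity[OF W s t f A] by simp
  qed (use Wm[of "s + t"] s t B in auto)
  then show "AE \<omega> in M. real_cond_exp M ?F (indicator {\<omega> \<in> space M. W (s + t) \<omega> \<in> B}) \<omega> = measure (S_semigroup m t (W s \<omega>)) B"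
    using AE_space by eventually_elim simp
qed

end

subsection \<open>The strong Markov property\<close>

lemma space_right_limit_filtration:
  "space (right_limit_filtration (natural_filtration M S X) t) = space M"
  by (simp add: right_limit_filtration_def space_natural_filtration space_measure_of_conv)

text \<open>An intersection of sigma-algebras over a nonempty index set, nonempty because t is below
  infinity, is already a sigma-algebra.\<close>

lemma sets_right_limit_filtration:
  assumes "t < \<infinity>"
  shows "sets (right_limit_filtration (natural_filtration M S X) t) =
    (\<Inter>u\<in>{t<..}. sets (natural_filtration M S X u))"
proof -
  let ?I = "\<Inter>u\<in>{t<..}. sets (natural_filtration M S X u)"
  have inf: "\<infinity> \<in> {t<..}" using assms by simp
  have I: "?I \<subseteq> Pow (space M)"
    using inf sets.space_closed[of "natural_filtration M S X \<infinity>"] by (auto simp: space_natural_filtration)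
  have "sigma_sets (space M) ?I \<subseteq> sets (natural_filtration M S X u)" if "u \<in> {t<..}" for u
    using sets.sigma_sets_subset[of ?I "natural_filtration M S X u"] that by (auto simp: space_natural_filtration)
  then have "sigma_sets (space M) ?I = ?I" by (intro antisym) (auto intro: sigma_sets.Basic)
  moreover have "t \<noteq> \<infinity>" using assms by auto
  ultimately show ?thesis
    using I by (simp add: right_limit_filtration_def space_natural_filtration sets_measure_of)
qed

lemma right_limit_filtration_le:
  assumes "t < u"
  shows "sets (right_limit_filtration (natural_filtration M S X) t) \<subseteq> sets (natural_filtration M S X u)"
  using assms by (subst sets_right_limit_filtration) (auto simp: less_top intro: less_le_trans)

lemma natural_filtration_le_right_limit:
  "sets (natural_filtration M S X t) \<subseteq> sets (right_limit_filtration (natural_filtration M S X) t)"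
proof (cases "t = \<infinity>")
  case True
  then show ?thesis by (simp add: right_limit_filtration_def)
next
  case False
  then show ?thesis
    using sets_natural_filtration_mono[of t _ M S X]
    by (subst sets_right_limit_filtration) (auto simp: less_top dest: less_imp_le)
qed

lemma filtration_right_limit:
  "filtration (space M) (right_limit_filtration (natural_filtration M S X))"
proof
  fix s t :: ennreal assume st: "s \<le> t"
  show "sets (right_limit_filtration (natural_filtration M S X) s) \<subseteq> sets (right_limit_filtration (natural_filtration M S X) t)"
  proof (cases "s = t")
    case False
    then have "s < t" using st by simp
    then show ?thesis
      using right_limit_filtration_le[of s t M S X] natural_filtration_le_right_limit[of M S X t] by blast
  qed simp
qed (rule space_right_limit_filtration)

text \<open>The strong Markov argument works with right continuity against bounded continuous
  functions; the metric enters only for the paths of the realization.\<close>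

locale right_continuous_driven = jump_noise +
  fixes X :: "real \<Rightarrow> 'a \<Rightarrow> real set \<Rightarrow> real"
  assumes X_driven: "driven X"
    and X_right_continuous: "\<And>\<omega> t f. \<omega> \<in> space M \<Longrightarrow> t \<ge> 0 \<Longrightarrow> f \<in> bounded_continuous {0..} \<Longrightarrow>
      ((\<lambda>s. signed_integral {0..} (X s \<omega>) f) \<longlongrightarrow> signed_integral {0..} (X t \<omega>) f) (at_right t)"
begin

abbreviation "Fn \<equiv> natural_filtration M signed_space X"
abbreviation "Fp \<equiv> right_limit_filtration Fn"

sublocale Fp: filtration "space M" Fp
  by (rule filtration_right_limit)

lemma X_measurable: "t \<ge> 0 \<Longrightarrow> X t \<in> measurable M signed_space"
  by (rule drivenD(1)[OF X_driven])

lemma X_in: "t \<ge> 0 \<Longrightarrow> \<omega> \<in> space M \<Longrightarrow> X t \<omega> \<in> signed_measures {0..}"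
  by (rule drivenD_space[OF X_driven])

lemma X_Fn: "0 \<le> r \<Longrightarrow> ennreal r \<le> t \<Longrightarrow> X r \<in> measurable (Fn t) signed_space"
  by (rule measurable_natural_filtration) (simp_all add: X_in)

lemma Fn_subset: "sets (Fn t) \<subseteq> sets M"
  by (rule sets_natural_filtration_subset) (rule X_measurable)

lemma Fp_subset: "sets (Fp t) \<subseteq> sets M"
proof (cases "t = \<infinity>")
  case True
  then show ?thesis using Fn_subset[of \<infinity>] by (simp add: right_limit_filtration_def)
next
  case False
  then show ?thesis using right_limit_filtration_le[of t \<infinity> M signed_space X] Fn_subset[of \<infinity>] by (auto simp: less_top)
qed

lemma bounded_continuous_borel: "f \<in> bounded_continuous {0::real..} \<Longrightarrow> f \<in> bounded_borel {0..}"
  using bounded_continuous_subset by auto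

definition grid :: "nat \<Rightarrow> real \<Rightarrow> nat" where
  "grid n r = nat \<lfloor>2 ^ n * r\<rfloor>"

text \<open>\<open>dyadic n (grid n r)\<close> is the least multiple of 2^(-n) strictly above r.
  Strictness serves twice: X is evaluated to the right of r, where right continuity applies, and the
  event that the grid point is a given one lies in the natural filtration at that point, although
  stopping times are taken for the right limit filtration.\<close>

definition dyadic :: "nat \<Rightarrow> nat \<Rightarrow> real" where
  "dyadic n k = (real k + 1) / 2 ^ n"

lemma dyadic_nonneg: "0 \<le> dyadic n k"
  by (simp add: dyadic_def)

lemma dyadic_grid:
  assumes "0 \<le> r"
  shows "r < dyadic n (grid n r)" "dyadic n (grid n r) \<le> r + (1 / 2) ^ n"
proof -
  have "real (grid n r) = of_int \<lfloor>2 ^ n * r\<rfloor>" using assms by (simp add: grid_def)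
  then have "2 ^ n * r < real (grid n r) + 1" "real (grid n r) \<le> 2 ^ n * r" by linarith+
  then show "r < dyadic n (grid n r)" "dyadic n (grid n r) \<le> r + (1 / 2) ^ n"
    by (simp_all add: dyadic_def field_simps power_one_over)
qed

lemma dyadic_grid_tendsto:
  assumes "0 \<le> r"
  shows "(\<lambda>n. dyadic n (grid n r)) \<longlonglongrightarrow> r"
proof (rule tendsto_sandwich[where f="\<lambda>_. r" and h="\<lambda>n. r + (1 / 2) ^ n"])
  have "(\<lambda>n. r + (1 / 2) ^ n) \<longlonglongrightarrow> r + 0" by (intro tendsto_intros LIMSEQ_power_zero) auto
  then show "(\<lambda>n. r + (1 / 2) ^ n) \<longlonglongrightarrow> r" by simp
qed (use dyadic_grid[OF assms] in \<open>auto intro!: always_eventually less_imp_le\<close>)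

lemma X_tendsto:
  assumes "\<omega> \<in> space M" "t \<ge> 0" "f \<in> bounded_continuous {0..}"
    and "s \<longlonglongrightarrow> t" "eventually (\<lambda>n. t < s n) sequentially"
  shows "(\<lambda>n. signed_integral {0..} (X (s n) \<omega>) f) \<longlonglongrightarrow> signed_integral {0..} (X t \<omega>) f"
proof (rule filterlim_compose[OF X_right_continuous[OF assms(1-3)]])
  show "filterlim s (at_right t) sequentially"
    unfolding filterlim_at using assms(4,5) by (auto elim: eventually_mono)
qed

section \<open>A fixed stopping time of the right limit filtration\<close>

context
  fixes \<tau> :: "'a \<Rightarrow> ennreal"
  assumes \<tau>: "stopping_time Fp \<tau>"
begin

abbreviation "pre \<equiv> Fp.pre_sigma \<tau>"
abbreviation "\<tau>r \<omega> \<equiv> enn2real (\<tau> \<omega>)"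

lemma \<tau>_measurable [measurable]: "\<tau> \<in> borel_measurable M"
  by (rule measurable_stopping_time[OF \<tau>]) (simp_all add: Fp_subset space_right_limit_filtration)

lemma \<tau>_le_sets: "{\<omega> \<in> space M. \<tau> \<omega> \<le> t} \<in> sets (Fp t)"
  using stopping_timeD[OF \<tau>, of t] by (simp add: pred_def space_right_limit_filtration)

lemma pre_subset: "sets pre \<subseteq> sets M"
proof
  fix A assume "A \<in> sets pre"
  then have "{\<omega> \<in> A. \<tau> \<omega> \<le> \<infinity>} \<in> sets (Fp \<infinity>)" by (rule Fp.sets_pre_sigmaD[OF \<tau>])
  then show "A \<in> sets M" using Fp_subset by auto
qed

text \<open>A strict inequality leaves a rational r between \<tau> and c, and the right limit
  filtration at r is contained in the natural one at c.\<close>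

lemma pre_less:
  assumes A: "A \<in> sets pre"
  shows "{\<omega> \<in> A. \<tau> \<omega> < c} \<in> sets (Fn c)"
proof -
  have "{\<omega> \<in> A. \<tau> \<omega> < c} = (\<Union>r\<in>{r::rat. ennreal (real_of_rat r) < c}. {\<omega> \<in> A. \<tau> \<omega> \<le> ennreal (real_of_rat r)})"
  proof (intro set_eqI iffI)
    fix \<omega> assume "\<omega> \<in> {\<omega> \<in> A. \<tau> \<omega> < c}"
    then have \<omega>: "\<omega> \<in> A" "\<tau> \<omega> < c" by auto
    obtain r where "\<tau> \<omega> < ennreal (real_of_rat r)" "ennreal (real_of_rat r) < c"
      using ennreal_rat_dense[OF \<omega>(2)] by blast
    then show "\<omega> \<in> (\<Union>r\<in>{r::rat. ennreal (real_of_rat r) < c}. {\<omega> \<in> A. \<tau> \<omega> \<le> ennreal (real_of_rat r)})"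
      using \<omega>(1) by (intro UN_I[of r]) (simp_all add: less_imp_le)
  next
    fix \<omega> assume "\<omega> \<in> (\<Union>r\<in>{r::rat. ennreal (real_of_rat r) < c}. {\<omega> \<in> A. \<tau> \<omega> \<le> ennreal (real_of_rat r)})"
    then obtain r where "ennreal (real_of_rat r) < c" "\<omega> \<in> A" "\<tau> \<omega> \<le> ennreal (real_of_rat r)" by blast
    then show "\<omega> \<in> {\<omega> \<in> A. \<tau> \<omega> < c}" by (simp add: le_less_trans)
  qed
  also have "\<dots> \<in> sets (Fn c)"
  proof (rule sets.countable_UN')
    show "(\<lambda>r. {\<omega> \<in> A. \<tau> \<omega> \<le> ennreal (real_of_rat r)}) ` {r::rat. ennreal (real_of_rat r) < c} \<subseteq> sets (Fn c)"
      using Fp.sets_pre_sigmaD[OF \<tau> A] right_limit_filtration_le[of _ c M signed_space X] by blast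
  qed (rule countableI_type)
  finally show ?thesis .
qed

text \<open>The grid index is k exactly when k / 2^n <= \<tau> < (k + 1) / 2^n. This is a difference
  of events covered by \<open>pre_less\<close>, so \<open>markov_identity\<close> applies on it at
  the deterministic time \<open>dyadic n k\<close>.\<close>

lemma grid_event:
  assumes A: "A \<in> sets pre"
  shows "{\<omega> \<in> A. \<tau> \<omega> < \<infinity> \<and> grid n (\<tau>r \<omega>) = k} \<in> sets (Fn (ennreal (dyadic n k)))"
proof -
  have "\<tau> \<omega> < \<infinity> \<and> grid n (\<tau>r \<omega>) = k \<longleftrightarrow> \<tau> \<omega> < ennreal (dyadic n k) \<and> \<not> \<tau> \<omega> < ennreal (real k / 2 ^ n)" for \<omega>
  proof (cases "\<tau> \<omega>")
    case (real r)
    have "grid n r = k \<longleftrightarrow> real k \<le> 2 ^ n * r \<and> 2 ^ n * r < real k + 1"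
      using real by (auto simp: grid_def nat_eq_iff floor_eq_iff)
    also have "\<dots> \<longleftrightarrow> r < dyadic n k \<and> \<not> r < real k / 2 ^ n"
      by (auto simp: dyadic_def field_simps)
    finally show ?thesis using real by (simp add: ennreal_less_iff)
  qed simp
  then have "{\<omega> \<in> A. \<tau> \<omega> < \<infinity> \<and> grid n (\<tau>r \<omega>) = k} =
    {\<omega> \<in> A. \<tau> \<omega> < ennreal (dyadic n k)} - {\<omega> \<in> A. \<tau> \<omega> < ennreal (real k / 2 ^ n)}" by auto
  moreover have "sets (Fn (ennreal (real k / 2 ^ n))) \<subseteq> sets (Fn (ennreal (dyadic n k)))"
    by (intro sets_natural_filtration_mono ennreal_leI) (simp add: dyadic_def divide_right_mono)
  ultimately show ?thesis using pre_less[OF A] by auto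
qed

lemma X_grid_measurable:
  assumes f: "f \<in> bounded_borel {0..}" and t: "t \<ge> 0"
  shows "(\<lambda>\<omega>. signed_integral {0..} (X (dyadic n (grid n (\<tau>r \<omega>)) + t) \<omega>) f) \<in> borel_measurable M"
proof (rule measurable_compose_countable[where g="\<lambda>\<omega>. grid n (\<tau>r \<omega>)"])
  show "(\<lambda>\<omega>. signed_integral {0..} (X (dyadic n k + t) \<omega>) f) \<in> borel_measurable M" for k
    using dyadic_nonneg[of n k] t by (intro measurable_signed_integral[OF f X_measurable]) auto
  show "(\<lambda>\<omega>. grid n (\<tau>r \<omega>)) \<in> measurable M (count_space UNIV)"
    unfolding grid_def by measurable
qed

lemma X_grid_tendsto:
  assumes \<omega>: "\<omega> \<in> space M" and t: "t \<ge> 0" and f: "f \<in> bounded_continuous {0..}"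
  shows "(\<lambda>n. signed_integral {0..} (X (dyadic n (grid n (\<tau>r \<omega>)) + t) \<omega>) f) \<longlonglongrightarrow>
    signed_integral {0..} (X (\<tau>r \<omega> + t) \<omega>) f"
proof (rule X_tendsto[OF \<omega> _ f])
  show "(\<lambda>n. dyadic n (grid n (\<tau>r \<omega>)) + t) \<longlonglongrightarrow> \<tau>r \<omega> + t"
    by (intro tendsto_intros dyadic_grid_tendsto) simp
qed (use t dyadic_grid[of "\<tau>r \<omega>"] in auto)

lemma X_stopped_real_measurable:
  assumes f: "f \<in> bounded_continuous {0..}" and t: "t \<ge> 0"
  shows "(\<lambda>\<omega>. signed_integral {0..} (X (\<tau>r \<omega> + t) \<omega>) f) \<in> borel_measurable M"
  by (rule borel_measurable_LIMSEQ_real[OF X_grid_tendsto X_grid_measurable])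
    (use f t bounded_continuous_borel in auto)

lemma X_stopped_measurable:
  assumes t: "t \<ge> 0"
  shows "(\<lambda>\<omega>. X (\<tau>r \<omega> + t) \<omega>) \<in> measurable M signed_space"
  by (rule measurable_signed_algebraI_continuous) (use t X_in X_stopped_real_measurable in auto)

text \<open>On each grid cell the approximating time is deterministic, and the difference of the two
  sides integrates to 0 by \<open>markov_identity\<close>. Summing over the cells and letting n grow
  gives the claim by bounded convergence. Pointwise convergence uses continuity of both f and T_t
  f.\<close>

lemma stopped_identity:
  assumes A: "A \<in> sets pre" and t: "t \<ge> 0" and f: "f \<in> bounded_continuous {0..}"
  shows "(\<integral>\<omega>. indicator (A \<inter> {\<omega> \<in> space M. \<tau> \<omega> < \<infinity>}) \<omega> * iexp (signed_integral {0..} (X (\<tau>r \<omega> + t) \<omega>) f) \<partial>M) =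
    (\<integral>\<omega>. indicator (A \<inter> {\<omega> \<in> space M. \<tau> \<omega> < \<infinity>}) \<omega> * iexp (signed_integral {0..} (X (\<tau>r \<omega>) \<omega>) (T_semigroup t f)) \<partial>M) *
    exp (S_exponent t f)"
proof -
  let ?D = "A \<inter> {\<omega> \<in> space M. \<tau> \<omega> < \<infinity>}"
  let ?e = "exp (S_exponent t f)"
  let ?Tf = "T_semigroup t f"
  have fb: "f \<in> bounded_borel {0..}" by (rule bounded_continuous_borel[OF f])
  have Tfc: "?Tf \<in> bounded_continuous {0..}" by (rule T_semigroup_bounded_continuous[OF f t])
  have Tfb: "?Tf \<in> bounded_borel {0..}" by (rule bounded_continuous_borel[OF Tfc])
  have AM[measurable]: "A \<in> sets M" using A pre_subset by auto
  define s where "s n \<omega> = dyadic n (grid n (\<tau>r \<omega>))" for n \<omega>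
  define h where "h n \<omega> = iexp (signed_integral {0..} (X (s n \<omega> + t) \<omega>) f) - ?e * iexp (signed_integral {0..} (X (s n \<omega>) \<omega>) ?Tf)" for n \<omega>
  define H where "H \<omega> = iexp (signed_integral {0..} (X (\<tau>r \<omega> + t) \<omega>) f) - ?e * iexp (signed_integral {0..} (X (\<tau>r \<omega>) \<omega>) ?Tf)" for \<omega>
  have [measurable]: "(\<lambda>\<omega>. signed_integral {0..} (X (s n \<omega> + t) \<omega>) f) \<in> borel_measurable M" for n
    unfolding s_def by (rule X_grid_measurable[OF fb t])
  have [measurable]: "(\<lambda>\<omega>. signed_integral {0..} (X (s n \<omega>) \<omega>) ?Tf) \<in> borel_measurable M" for n
    unfolding s_def using X_grid_measurable[OF Tfb order_refl] by simp
  have [measurable]: "(\<lambda>\<omega>. signed_integral {0..} (X (\<tau>r \<omega> + t) \<omega>) f) \<in> borel_measurable M"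
    by (rule X_stopped_real_measurable[OF f t])
  have [measurable]: "(\<lambda>\<omega>. signed_integral {0..} (X (\<tau>r \<omega>) \<omega>) ?Tf) \<in> borel_measurable M"
    using X_stopped_real_measurable[OF Tfc order_refl] by simp
  have hm[measurable]: "h n \<in> borel_measurable M" for n unfolding h_def by measurable
  have Hm[measurable]: "H \<in> borel_measurable M" unfolding H_def by measurable
  have hb: "cmod (h n \<omega>) \<le> 1 + cmod ?e" for n \<omega>
    unfolding h_def by (rule order_trans[OF norm_triangle_ineq4]) (simp add: norm_mult)
  have zero: "(\<integral>\<omega>. indicator ?D \<omega> *\<^sub>R h n \<omega> \<partial>M) = 0" for n
  proof -
    define C where "C k = {\<omega> \<in> A. \<tau> \<omega> < \<infinity> \<and> grid n (\<tau>r \<omega>) = k}" for k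
    have CF: "C k \<in> sets (Fn (ennreal (dyadic n k)))" for k unfolding C_def by (rule grid_event[OF A])
    then have CM[measurable]: "C k \<in> sets M" for k using Fn_subset by auto
    have D: "?D = (\<Union>k. C k)" using sets.sets_into_space[OF AM] by (auto simp: C_def)
    have Ck: "(LINT \<omega>:C k|M. h n \<omega>) = 0" for k
    proof -
      have m1: "(\<lambda>\<omega>. signed_integral {0..} (X (dyadic n k + t) \<omega>) f) \<in> borel_measurable M"
        using dyadic_nonneg[of n k] t by (intro measurable_signed_integral[OF fb X_measurable]) auto
      have m2: "(\<lambda>\<omega>. signed_integral {0..} (X (dyadic n k) \<omega>) ?Tf) \<in> borel_measurable M"
        using dyadic_nonneg[of n k] by (intro measurable_signed_integral[OF Tfb X_measurable]) auto
      note [measurable] = m1 m2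
      have i1: "integrable M (\<lambda>\<omega>. indicator (C k) \<omega> * iexp (signed_integral {0..} (X (dyadic n k + t) \<omega>) f))"
        by (rule integrable_const_bound[where B=1]) (auto simp: norm_mult split: split_indicator)
      have i2: "integrable M (\<lambda>\<omega>. indicator (C k) \<omega> * iexp (signed_integral {0..} (X (dyadic n k) \<omega>) ?Tf))"
        by (rule integrable_const_bound[where B=1]) (auto simp: norm_mult split: split_indicator)
      have "(LINT \<omega>:C k|M. h n \<omega>) =
        (\<integral>\<omega>. indicator (C k) \<omega> * iexp (signed_integral {0..} (X (dyadic n k + t) \<omega>) f) -
          indicator (C k) \<omega> * iexp (signed_integral {0..} (X (dyadic n k) \<omega>) ?Tf) * ?e \<partial>M)"
        unfolding set_lebesgue_integral_def
        by (intro Bochner_Integration.integral_cong) (auto simp: C_def h_def s_def split: split_indicator)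
      also have "\<dots> = (\<integral>\<omega>. indicator (C k) \<omega> * iexp (signed_integral {0..} (X (dyadic n k + t) \<omega>) f) \<partial>M) -
          (\<integral>\<omega>. indicator (C k) \<omega> * iexp (signed_integral {0..} (X (dyadic n k) \<omega>) ?Tf) * ?e \<partial>M)"
        by (rule Bochner_Integration.integral_diff[OF i1 integrable_mult_left[OF i2]])
      also have "\<dots> = 0"
        using markov_identity[OF X_driven dyadic_nonneg t fb CF] by simp
      finally show ?thesis .
    qed
    have "set_integrable M (\<Union>k. C k) (h n)"
      unfolding set_integrable_def
      using hb[of n] by (intro integrable_const_bound[where B="1 + cmod ?e"])
        (auto split: split_indicator intro: order_trans[of 0])
    then have "(LINT \<omega>:(\<Union>k. C k)|M. h n \<omega>) = (\<Sum>k. LINT \<omega>:C k|M. h n \<omega>)"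
      by (intro lebesgue_integral_countable_add CM) (auto simp: C_def)
    then have "(LINT \<omega>:(\<Union>k. C k)|M. h n \<omega>) = 0" unfolding Ck by simp
    then show ?thesis unfolding D set_lebesgue_integral_def .
  qed
  have "(\<lambda>n. \<integral>\<omega>. indicator ?D \<omega> *\<^sub>R h n \<omega> \<partial>M) \<longlonglongrightarrow> (\<integral>\<omega>. indicator ?D \<omega> *\<^sub>R H \<omega> \<partial>M)"
  proof (rule integral_dominated_convergence[where w="\<lambda>_. 1 + cmod ?e"])
    show "AE \<omega> in M. (\<lambda>n. indicator ?D \<omega> *\<^sub>R h n \<omega>) \<longlonglongrightarrow> indicator ?D \<omega> *\<^sub>R H \<omega>"
    proof (rule AE_I2)
      fix \<omega> assume \<omega>: "\<omega> \<in> space M"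
      show "(\<lambda>n. indicator ?D \<omega> *\<^sub>R h n \<omega>) \<longlonglongrightarrow> indicator ?D \<omega> *\<^sub>R H \<omega>"
        unfolding h_def H_def s_def
        using X_grid_tendsto[OF \<omega> t f] X_grid_tendsto[OF \<omega> order_refl Tfc]
        by (intro tendsto_intros) auto
    qed
    show "AE \<omega> in M. norm (indicator ?D \<omega> *\<^sub>R h n \<omega>) \<le> 1 + cmod ?e" for n
      using hb[of n] by (intro AE_I2) (auto split: split_indicator intro: order_trans[of 0])
  qed auto
  then have H0: "(\<integral>\<omega>. indicator ?D \<omega> *\<^sub>R H \<omega> \<partial>M) = 0"
    unfolding zero by (simp add: LIMSEQ_const_iff)
  have i1: "integrable M (\<lambda>\<omega>. indicator ?D \<omega> * iexp (signed_integral {0..} (X (\<tau>r \<omega> + t) \<omega>) f))"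
    by (rule integrable_const_bound[where B=1]) (auto simp: norm_mult split: split_indicator)
  have i2: "integrable M (\<lambda>\<omega>. indicator ?D \<omega> * iexp (signed_integral {0..} (X (\<tau>r \<omega>) \<omega>) ?Tf))"
    by (rule integrable_const_bound[where B=1]) (auto simp: norm_mult split: split_indicator)
  have "(\<integral>\<omega>. indicator ?D \<omega> * iexp (signed_integral {0..} (X (\<tau>r \<omega> + t) \<omega>) f) \<partial>M) -
    (\<integral>\<omega>. indicator ?D \<omega> * iexp (signed_integral {0..} (X (\<tau>r \<omega>) \<omega>) ?Tf) * ?e \<partial>M) =
    (\<integral>\<omega>. indicator ?D \<omega> * iexp (signed_integral {0..} (X (\<tau>r \<omega> + t) \<omega>) f) -
      indicator ?D \<omega> * iexp (signed_integral {0..} (X (\<tau>r \<omega>) \<omega>) ?Tf) * ?e \<partial>M)"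
    by (rule Bochner_Integration.integral_diff[OF i1 integrable_mult_left[OF i2], symmetric])
  also have "\<dots> = (\<integral>\<omega>. indicator ?D \<omega> *\<^sub>R H \<omega> \<partial>M)"
    by (intro Bochner_Integration.integral_cong) (auto simp: H_def split: split_indicator)
  finally show ?thesis using H0 by simp
qed

text \<open>Progressive measurability. The approximating times are capped at u, so the states used
  belong to \<open>Fn (ennreal u)\<close>; as \<tau> <= c < u, the capped times still lie strictly
  above \<tau> and converge to it.\<close>

lemma stopped_Fn_measurable:
  assumes c: "0 \<le> c" "c < u" and f: "f \<in> bounded_continuous {0..}"
  shows "(\<lambda>\<omega>. if \<tau> \<omega> \<le> ennreal c then signed_integral {0..} (X (\<tau>r \<omega>) \<omega>) f else 0) \<in> borel_measurable (Fn (ennreal u))"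
proof -
  let ?F = "Fn (ennreal u)"
  have spF: "space ?F = space M" by (rule space_natural_filtration)
  have le: "{\<omega> \<in> space M. \<tau> \<omega> \<le> ennreal a} \<in> sets ?F" if "a \<le> c" for a
  proof -
    have "ennreal a < ennreal u" using that c by (simp add: ennreal_lessI)
    then show ?thesis using \<tau>_le_sets right_limit_filtration_le by blast
  qed
  have Pc[measurable]: "Measurable.pred ?F (\<lambda>\<omega>. \<tau> \<omega> \<le> ennreal c)"
    using le[of c] by (simp add: pred_def spF)
  \<comment> \<open>\<tau> is known at time u only as far as it does not exceed c. Elsewhere it is
    replaced by 0, which makes q measurable at time u.\<close>
  define q where "q \<omega> = (if \<tau> \<omega> \<le> ennreal c then \<tau>r \<omega> else 0)" for \<omega>
  have q0: "0 \<le> q \<omega>" "q \<omega> \<le> c" for \<omega>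
    using c by (auto simp: q_def enn2real_leI)
  have [measurable]: "q \<in> borel_measurable ?F"
  proof (rule borel_measurableI_le)
    fix a :: real
    consider "a < 0" | "c \<le> a" | "0 \<le> a" "a < c" by linarith
    then show "{\<omega> \<in> space ?F. q \<omega> \<le> a} \<in> sets ?F"
    proof cases
      case 1
      have "{\<omega> \<in> space ?F. q \<omega> \<le> a} = {}" using q0(1) 1 by (auto simp: not_le intro: less_le_trans)
      then show ?thesis by (metis sets.empty_sets)
    next
      case 2
      have "{\<omega> \<in> space ?F. q \<omega> \<le> a} = space ?F" using q0(2) 2 by (auto intro: order_trans)
      then show ?thesis by simp
    next
      case 3
      have "q \<omega> \<le> a \<longleftrightarrow> \<tau> \<omega> \<le> ennreal a \<or> \<not> \<tau> \<omega> \<le> ennreal c" for \<omega>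
        using 3 c by (cases "\<tau> \<omega>") (auto simp: q_def ennreal_le_iff top_unique)
      then have "{\<omega> \<in> space ?F. q \<omega> \<le> a} = {\<omega> \<in> space M. \<tau> \<omega> \<le> ennreal a} \<union> (space ?F - {\<omega> \<in> space M. \<tau> \<omega> \<le> ennreal c})"
        by (auto simp: spF)
      then show ?thesis using le[of a] le[of c] 3 by auto
    qed
  qed
  show ?thesis
  proof (rule borel_measurable_LIMSEQ_real)
    show "(\<lambda>\<omega>. if \<tau> \<omega> \<le> ennreal c then signed_integral {0..} (X (min (dyadic n (grid n (q \<omega>))) u) \<omega>) f else 0) \<in> borel_measurable ?F" for n
    proof -
      have "(\<lambda>\<omega>. signed_integral {0..} (X (min (dyadic n (grid n (q \<omega>))) u) \<omega>) f) \<in> borel_measurable ?F"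
      proof (rule measurable_compose_countable[where g="\<lambda>\<omega>. grid n (q \<omega>)"])
        show "(\<lambda>\<omega>. signed_integral {0..} (X (min (dyadic n k) u) \<omega>) f) \<in> borel_measurable ?F" for k
          using dyadic_nonneg[of n k] c
          by (intro measurable_signed_integral[OF bounded_continuous_borel[OF f] X_Fn]) (auto intro: ennreal_leI)
        show "(\<lambda>\<omega>. grid n (q \<omega>)) \<in> measurable ?F (count_space UNIV)"
          unfolding grid_def by measurable
      qed
      then show ?thesis by measurable
    qed
    fix \<omega> assume "\<omega> \<in> space ?F"
    then have \<omega>: "\<omega> \<in> space M" by (simp add: spF)
    show "(\<lambda>n. if \<tau> \<omega> \<le> ennreal c then signed_integral {0..} (X (min (dyadic n (grid n (q \<omega>))) u) \<omega>) f else 0) \<longlonglongrightarrow>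
      (if \<tau> \<omega> \<le> ennreal c then signed_integral {0..} (X (\<tau>r \<omega>) \<omega>) f else 0)"
    proof (cases "\<tau> \<omega> \<le> ennreal c")
      case True
      then have q: "q \<omega> = \<tau>r \<omega>" by (simp add: q_def)
      have qu: "\<tau>r \<omega> < u" using q0(2)[of \<omega>] c q by simp
      have "(\<lambda>n. min (dyadic n (grid n (\<tau>r \<omega>))) u) \<longlonglongrightarrow> min (\<tau>r \<omega>) u"
        by (intro tendsto_min dyadic_grid_tendsto) auto
      then have "(\<lambda>n. min (dyadic n (grid n (\<tau>r \<omega>))) u) \<longlonglongrightarrow> \<tau>r \<omega>" using qu by simp
      then have "(\<lambda>n. signed_integral {0..} (X (min (dyadic n (grid n (\<tau>r \<omega>))) u) \<omega>) f) \<longlonglongrightarrow> signed_integral {0..} (X (\<tau>r \<omega>) \<omega>) f"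
        using dyadic_grid(1)[of "\<tau>r \<omega>"] qu by (intro X_tendsto[OF \<omega> _ f]) auto
      then show ?thesis using True q by simp
    qed simp
  qed
qed

text \<open>At a finite time t the required event has to lie in the natural filtration at every u >
  t, which is what \<open>stopped_Fn_measurable\<close> provides with t in the role of c.\<close>

lemma X_stopped_pre_measurable:
  "(\<lambda>\<omega>. X (\<tau>r \<omega>) \<omega>) \<in> measurable (restrict_space pre {\<omega>. \<tau> \<omega> < \<infinity>}) signed_space"
proof (rule measurable_signed_algebraI_continuous)
  show "X (\<tau>r \<omega>) \<omega> \<in> signed_measures {0..}" if "\<omega> \<in> space (restrict_space pre {\<omega>. \<tau> \<omega> < \<infinity>})" for \<omega>
    using that by (intro X_in) (auto simp: space_restrict_space Fp.space_pre_sigma)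
  fix f :: "real \<Rightarrow> real" assume f: "f \<in> bounded_continuous {0..}"
  define G where "G c \<omega> = (if \<tau> \<omega> \<le> c then signed_integral {0..} (X (\<tau>r \<omega>) \<omega>) f else 0)" for c \<omega>
  define V where "V \<omega> = (if \<tau> \<omega> < \<infinity> then signed_integral {0..} (X (\<tau>r \<omega>) \<omega>) f else 0)" for \<omega>
  have GF: "G (ennreal c) \<in> borel_measurable (Fn u)" if "0 \<le> c" "ennreal c < u" for c u
  proof -
    obtain u' where u': "c < u'" "ennreal u' \<le> u"
    proof (cases u)
      case (real r)
      then show ?thesis using that \<open>ennreal c < u\<close> \<open>0 \<le> c\<close> by (intro that[of r]) (auto simp: ennreal_less_iff)
    next
      case top
      then show ?thesis by (intro that[of "c + 1"]) auto
    qed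
    have "G (ennreal c) \<in> borel_measurable (Fn (ennreal u'))"
      unfolding G_def[abs_def] by (rule stopped_Fn_measurable[OF that(1) u'(1) f])
    moreover have "subalgebra (Fn u) (Fn (ennreal u'))"
      using sets_natural_filtration_mono[OF u'(2)] by (simp add: subalgebra_def space_natural_filtration)
    ultimately show ?thesis using measurable_from_subalg by blast
  qed
  have V: "V \<in> borel_measurable pre"
  proof (rule measurableI)
    fix B :: "real set" assume B: "B \<in> sets borel"
    show "V -` B \<inter> space pre \<in> sets pre"
    proof (rule Fp.sets_pre_sigmaI[OF \<tau>])
      fix t :: ennreal
      show "{\<omega> \<in> V -` B \<inter> space pre. \<tau> \<omega> \<le> t} \<in> sets (Fp t)"
      proof (cases t)
        case (real c)
        have "{\<omega> \<in> V -` B \<inter> space pre. \<tau> \<omega> \<le> t} \<in> sets (Fn u)" if u: "t < u" for u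
        proof -
          have "{\<omega> \<in> V -` B \<inter> space pre. \<tau> \<omega> \<le> t} = (G (ennreal c) -` B \<inter> space (Fn u)) \<inter> {\<omega> \<in> space M. \<tau> \<omega> \<le> t}"
            using real by (auto simp: V_def G_def Fp.space_pre_sigma space_natural_filtration intro: le_less_trans)
          moreover have "G (ennreal c) -` B \<inter> space (Fn u) \<in> sets (Fn u)"
            using GF[of c u] real u B by (intro measurable_sets) auto
          moreover have "{\<omega> \<in> space M. \<tau> \<omega> \<le> t} \<in> sets (Fn u)"
            using \<tau>_le_sets right_limit_filtration_le[OF u] by blast
          ultimately show ?thesis by auto
        qed
        then show ?thesis using real by (subst sets_right_limit_filtration) auto
      next
        \<comment> \<open>At infinity there is no later time to use, but the filtration is the
          natural one by definition, and V is the limit of its truncations to \<tau> <= n.\<close>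
        case top
        have "V \<in> borel_measurable (Fn \<infinity>)"
        proof (rule borel_measurable_LIMSEQ_real)
          show "G (ennreal (real n)) \<in> borel_measurable (Fn \<infinity>)" for n
            by (rule GF) auto
          fix \<omega>
          show "(\<lambda>n. G (ennreal (real n)) \<omega>) \<longlonglongrightarrow> V \<omega>"
          proof (cases "\<tau> \<omega>")
            case (real r)
            obtain k :: nat where "r \<le> real k" using real_arch_simple by blast
            then have "G (ennreal (real n)) \<omega> = V \<omega>" if "n \<ge> k" for n
              using that real by (simp add: G_def V_def ennreal_le_iff)
            then show ?thesis by (intro tendsto_eventually eventually_sequentiallyI[of k])
          qed (simp add: G_def V_def top_unique)
        qed
        from measurable_sets[OF this B] show ?thesis
          using top by (simp add: right_limit_filtration_def Fp.space_pre_sigma space_natural_filtration Int_def conj_commute)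
      qed
    qed
  qed simp
  have "V \<in> borel_measurable (restrict_space pre {\<omega>. \<tau> \<omega> < \<infinity>})" by (rule measurable_restrict_space1[OF V])
  then show "(\<lambda>\<omega>. signed_integral {0..} (X (\<tau>r \<omega>) \<omega>) f) \<in> borel_measurable (restrict_space pre {\<omega>. \<tau> \<omega> < \<infinity>})"
    by (rule measurable_cong[THEN iffD1, rotated]) (simp add: V_def space_restrict_space)
qed

lemma stopped_cond_exp:
  assumes t: "t \<ge> 0" and B: "B \<in> sets signed_space"
  shows "AE \<omega> in M. \<tau> \<omega> < \<infinity> \<longrightarrow>
    real_cond_exp M pre (indicator {\<omega> \<in> space M. \<tau> \<omega> < \<infinity> \<and> X (\<tau>r \<omega> + t) \<omega> \<in> B}) \<omega> =
    measure (S_semigroup m t (X (\<tau>r \<omega>) \<omega>)) B"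
proof -
  let ?D = "{\<omega> \<in> space M. \<tau> \<omega> < \<infinity>}"
  have sub: "subalgebra M pre" using pre_subset by (simp add: subalgebra_def Fp.space_pre_sigma)
  have D: "?D \<in> sets pre"
  proof -
    have [measurable]: "\<tau> \<in> borel_measurable pre" by (rule Fp.measurable_stopping_time_pre_sigma[OF \<tau>])
    have "{\<omega> \<in> space pre. \<tau> \<omega> < \<infinity>} \<in> sets pre" by measurable
    then show ?thesis by (simp add: Fp.space_pre_sigma)
  qed
  have sM: "A \<subseteq> space M" if "A \<in> sets pre" for A
    using sets.sets_into_space[OF that] by (simp add: Fp.space_pre_sigma)
  have "sets (restrict_space pre {\<omega>. \<tau> \<omega> < \<infinity>}) = sets (restrict_space pre ?D)"
    unfolding sets_restrict_space by (intro image_cong refl) (use sM in blast)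
  then have V: "(\<lambda>\<omega>. X (\<tau>r \<omega>) \<omega>) \<in> measurable (restrict_space pre ?D) signed_space"
    using X_stopped_pre_measurable by (simp cong: measurable_cong_sets)
  have "AE \<omega> in M. \<omega> \<in> ?D \<longrightarrow>
    real_cond_exp M pre (indicator {\<omega> \<in> space M. \<omega> \<in> ?D \<and> X (\<tau>r \<omega> + t) \<omega> \<in> B}) \<omega> =
    measure (S_semigroup m t (X (\<tau>r \<omega>) \<omega>)) B"
    by (rule cond_exp_S[OF X_driven t sub D V X_stopped_measurable[OF t] B]) (rule stopped_identity[OF _ t])
  moreover have "{\<omega> \<in> space M. \<omega> \<in> ?D \<and> X (\<tau>r \<omega> + t) \<omega> \<in> B} = {\<omega> \<in> space M. \<tau> \<omega> < \<infinity> \<and> X (\<tau>r \<omega> + t) \<omega> \<in> B}"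
    by auto
  ultimately show ?thesis using AE_space by (auto elim: eventually_elim2)
qed

end

lemma strong_markov:
  "strong_markov_process M signed_space Fp X (S_semigroup m)"
  unfolding strong_markov_process_def markov_process_def
proof (intro conjI allI impI ballI)
  show "X t \<in> measurable M signed_space" if "0 \<le> t" for t by (rule X_measurable[OF that])
  show XF: "X t \<in> measurable (Fp (ennreal t)) signed_space" if "0 \<le> t" for t
  proof (rule measurable_from_subalg[OF _ X_Fn[OF that order_refl]])
    show "subalgebra (Fp (ennreal t)) (Fn (ennreal t))"
      using natural_filtration_le_right_limit
      by (simp add: subalgebra_def space_natural_filtration space_right_limit_filtration)
  qed
  show "(\<lambda>\<omega>. X (enn2real (\<tau> \<omega>)) \<omega>) \<in> measurable (restrict_space (Fp.pre_sigma \<tau>) {\<omega>. \<tau> \<omega> < \<infinity>}) signed_space"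
    if "stopping_time Fp \<tau>" for \<tau> by (rule X_stopped_pre_measurable[OF that])
  show "AE \<omega> in M. \<tau> \<omega> < \<infinity> \<longrightarrow>
    real_cond_exp M (Fp.pre_sigma \<tau>) (indicator {\<omega> \<in> space M. \<tau> \<omega> < \<infinity> \<and> X (enn2real (\<tau> \<omega>) + t) \<omega> \<in> B}) \<omega> =
    measure (S_semigroup m t (X (enn2real (\<tau> \<omega>)) \<omega>)) B"
    if "stopping_time Fp \<tau>" "0 \<le> t" "B \<in> sets signed_space" for \<tau> t B
    by (rule stopped_cond_exp[OF that])
  fix s t :: real and B assume s: "0 \<le> s" and t: "0 \<le> t" and B: "B \<in> sets signed_space"
  let ?F = "Fp (ennreal s)"
  \<comment> \<open>The right limit filtration is larger than the natural one, so its Markov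
    property is not covered by \<open>markov_identity\<close>; it is the stopped identity at a
    constant stopping time.\<close>
  let ?\<tau> = "\<lambda>_::'a. ennreal s"
  have \<tau>: "stopping_time Fp ?\<tau>" by (rule stopping_time_const)
  have sub: "subalgebra M ?F" using Fp_subset by (simp add: subalgebra_def space_right_limit_filtration)
  have "AE \<omega> in M. \<omega> \<in> space M \<longrightarrow>
    real_cond_exp M ?F (indicator {\<omega> \<in> space M. \<omega> \<in> space M \<and> X (s + t) \<omega> \<in> B}) \<omega> = measure (S_semigroup m t (X s \<omega>)) B"
  proof (rule cond_exp_S[OF X_driven t sub])
    show "space M \<in> sets ?F" using sets.top[of ?F] by (simp add: space_right_limit_filtration)
    show "X s \<in> measurable (restrict_space ?F (space M)) signed_space"
      by (rule measurable_restrict_space1[OF XF[OF s]])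
    fix A and f :: "real \<Rightarrow> real" assume A: "A \<in> sets ?F" and f: "f \<in> bounded_continuous {0..}"
    have "A \<in> sets (Fp.pre_sigma ?\<tau>)"
    proof (rule Fp.sets_pre_sigmaI[OF \<tau>])
      show "{\<omega> \<in> A. ennreal s \<le> t} \<in> sets (Fp t)" for t
        using A Fp.sets_F_mono[of "ennreal s" t] by (cases "ennreal s \<le> t") auto
    qed
    from stopped_identity[OF \<tau> this t f] s
    show "(\<integral>\<omega>. indicator (A \<inter> space M) \<omega> * iexp (signed_integral {0..} (X (s + t) \<omega>) f) \<partial>M) =
      (\<integral>\<omega>. indicator (A \<inter> space M) \<omega> * iexp (signed_integral {0..} (X s \<omega>) (T_semigroup t f)) \<partial>M) * exp (S_exponent t f)"
      by simp
  qed (use X_measurable[of "s + t"] s t B in auto)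
  then show "AE \<omega> in M. real_cond_exp M ?F (indicator {\<omega> \<in> space M. X (s + t) \<omega> \<in> B}) \<omega> = measure (S_semigroup m t (X s \<omega>)) B"
    using AE_space by eventually_elim simp
qed

end

subsection \<open>A right continuous realization\<close>

lemma r_dist_summable:
  "summable (\<lambda>n. (1 / 2) ^ Suc n * min 1 \<bar>(\<integral>x. F (Suc n) x \<partial>p) - (\<integral>x. F (Suc n) x \<partial>q)\<bar> :: real)"
proof (rule summable_comparison_test'[where N=0])
  show "summable (\<lambda>n. (1 / 2) ^ Suc n :: real)"
    using summable_mult[OF summable_geometric[of "1 / 2 :: real"], of "1 / 2"] by simp
qed (simp add: abs_mult)

lemma r_dist_nonneg: "0 \<le> r_dist F p q"
  unfolding r_dist_def by (rule suminf_nonneg[OF r_dist_summable]) simp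

text \<open>Each term tends to 0 and is at most 2^(-n-1), so Tannery's theorem allows the limit
  under the sum.\<close>

lemma r_dist_tendsto:
  assumes lim: "\<And>n. ((\<lambda>s. \<integral>x. F (Suc n) x \<partial>P s) \<longlongrightarrow> (\<integral>x. F (Suc n) x \<partial>p)) G" and G: "G \<noteq> bot"
  shows "((\<lambda>s. r_dist F (P s) p) \<longlongrightarrow> 0) G"
proof -
  let ?a = "\<lambda>n s. (1 / 2) ^ Suc n * min 1 \<bar>(\<integral>x. F (Suc n) x \<partial>P s) - (\<integral>x. F (Suc n) x \<partial>p)\<bar> :: real"
  have l0: "((\<lambda>s. ?a n s) \<longlongrightarrow> 0) G" for n
  proof -
    have "((\<lambda>s. ?a n s) \<longlongrightarrow> (1 / 2) ^ Suc n * min 1 \<bar>(\<integral>x. F (Suc n) x \<partial>p) - (\<integral>x. F (Suc n) x \<partial>p)\<bar>) G"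
      by (intro tendsto_intros tendsto_min lim)
    then show ?thesis by simp
  qed
  have "summable (\<lambda>n. (1 / 2) ^ Suc n :: real)"
    using summable_mult[OF summable_geometric[of "1 / 2 :: real"], of "1 / 2"] by simp
  then have "((\<lambda>s. suminf (\<lambda>n. ?a n s)) \<longlongrightarrow> suminf (\<lambda>n. 0)) G"
    by (intro tannerys_theorem[where M="\<lambda>n. (1 / 2) ^ Suc n", THEN conjunct2, THEN conjunct2] l0 G)
      (auto simp: abs_mult intro!: always_eventually)
  then show ?thesis by (simp add: r_dist_def)
qed

text \<open>\<open>rho_dist\<close> is an infimum over decompositions, so any chosen pair of
  decompositions bounds it from above. Convergence of the two parts separately then forces
  convergence in \<open>rho_dist\<close>.\<close>

lemma rho_dist_bounds:
  assumes "p \<in> finite_measures E" "n \<in> finite_measures E" "p' \<in> finite_measures E" "n' \<in> finite_measures E"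
  shows "0 \<le> rho_dist E F (measure_diff p n) (measure_diff p' n')"
    and "rho_dist E F (measure_diff p n) (measure_diff p' n') \<le> r_dist F p p' + r_dist F n n'"
proof -
  let ?S = "{r_dist F \<mu>p \<nu>p + r_dist F \<mu>n \<nu>n | \<mu>p \<mu>n \<nu>p \<nu>n.
      \<mu>p \<in> finite_measures E \<and> \<mu>n \<in> finite_measures E \<and>
      \<nu>p \<in> finite_measures E \<and> \<nu>n \<in> finite_measures E \<and>
      measure_diff \<mu>p \<mu>n = measure_diff p n \<and> measure_diff \<nu>p \<nu>n = measure_diff p' n'}"
  have mem: "r_dist F p p' + r_dist F n n' \<in> ?S" using assms by blast
  have nn: "0 \<le> x" if "x \<in> ?S" for x using that by (auto intro: add_nonneg_nonneg r_dist_nonneg)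
  show "0 \<le> rho_dist E F (measure_diff p n) (measure_diff p' n')"
    unfolding rho_dist_def by (rule cInf_greatest[OF _ nn]) (use mem in blast)
  show "rho_dist E F (measure_diff p n) (measure_diff p' n') \<le> r_dist F p p' + r_dist F n n'"
    unfolding rho_dist_def by (rule cInf_lower[OF mem]) (rule bdd_belowI[where m=0], rule nn)
qed

lemma uniformly_dense_seq_continuous:
  fixes E :: "'a::topological_space set"
  assumes d: "compatible_metric E d" and F: "uniformly_dense_seq E d F" and n: "n \<ge> 1"
  shows "F n \<in> bounded_continuous E"
proof -
  interpret Metric_space E d using d by (simp add: compatible_metric_def)
  have bu: "F n \<in> bounded_uniformly_continuous E d" using F n by (simp add: uniformly_dense_seq_def)
  then have "uniformly_continuous_map (metric (E, d)) euclidean_metric (F n)"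
    by (simp add: bounded_uniformly_continuous_def)
  then have "continuous_map (mtopology_of (metric (E, d))) (mtopology_of euclidean_metric) (F n)"
    by (rule uniformly_continuous_imp_continuous_map)
  then have "continuous_map (top_of_set E) euclidean (F n)"
    using d by (simp add: compatible_metric_def)
  then show ?thesis
    using bu by (simp add: bounded_continuous_def bounded_uniformly_continuous_def)
qed

section \<open>The realization as a difference of superposed entrance laws\<close>

context jump_noise
begin

text \<open>Shared by the intensity and by \<open>N \<omega>\<close> for almost every \<omega>, so
  that the sums over jumps and their compensators are handled by the same lemmas.\<close>

definition locally_integrable :: "(real \<times> real) measure \<Rightarrow> bool" where
  "locally_integrable Q \<longleftrightarrow> sets Q = sets L \<and>
    (\<forall>n::nat. (\<integral>\<^sup>+x. indicator {0..real n} (fst x) * ennreal \<bar>snd x\<bar> \<partial>Q) < \<infinity>)"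

lemma entrance_integrand_bound:
  assumes f: "f \<in> bounded_borel {0..}" and c: "0 \<le> c" "\<And>x. x \<in> {0..} \<Longrightarrow> \<bar>f x\<bar> \<le> c"
  shows "\<bar>entrance_integrand t f s\<bar> \<le> c * indicator {0..t} s"
  using T_semigroup_at_0_bound[OF f c(2), of "t - s"] c(1)
  by (auto simp: entrance_integrand_def split: split_indicator)

lemma locally_integrable_dominating:
  assumes Q: "locally_integrable Q"
  shows "integrable Q (\<lambda>x. indicator {0..real n} (fst x) * \<bar>snd x\<bar>)"
proof -
  have sets: "sets Q = sets L" using Q by (simp add: locally_integrable_def)
  have "(\<lambda>x. indicator {0..real n} (fst x) * \<bar>snd x\<bar>) \<in> borel_measurable L" by measurable
  then have m: "(\<lambda>x. indicator {0..real n} (fst x) * \<bar>snd x\<bar>) \<in> borel_measurable Q"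
    using sets by (simp cong: measurable_cong_sets)
  have "(\<integral>\<^sup>+x. ennreal (norm (indicator {0..real n} (fst x) * \<bar>snd x\<bar>)) \<partial>Q) =
    (\<integral>\<^sup>+x. indicator {0..real n} (fst x) * ennreal \<bar>snd x\<bar> \<partial>Q)"
    by (intro nn_integral_cong) (auto split: split_indicator)
  then show ?thesis using Q m by (simp add: locally_integrable_def integrable_iff_bounded)
qed

text \<open>The weights in use are the positive and the negative part of the jump size; domination
  by |u| gives them the integrability of |u|.\<close>

definition jump_weight :: "(real \<Rightarrow> real) \<Rightarrow> bool" where
  "jump_weight w \<longleftrightarrow> w \<in> borel_measurable borel \<and> (\<forall>u. 0 \<le> w u \<and> w u \<le> \<bar>u\<bar>)"

lemma jump_weight_parts: "jump_weight (\<lambda>u. max 0 u)" "jump_weight (\<lambda>u. max 0 (- u))"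
  by (auto simp: jump_weight_def)

lemma entrance_weight_measurable:
  assumes Q: "locally_integrable Q" and w: "jump_weight w" and f: "f \<in> bounded_borel {0..}"
  shows "(\<lambda>x. entrance_integrand t f (fst x) * w (snd x)) \<in> borel_measurable Q"
proof -
  have [measurable]: "w \<in> borel_measurable borel" using w by (simp add: jump_weight_def)
  have [measurable]: "entrance_integrand t f \<in> borel_measurable borel"
    by (rule good_integrand_measurable[OF good_entrance_integrand[OF f]])
  have "(\<lambda>x. entrance_integrand t f (fst x) * w (snd x)) \<in> borel_measurable L" by measurable
  then show ?thesis using Q by (simp add: locally_integrable_def cong: measurable_cong_sets)
qed

lemma entrance_weight_bound:
  assumes w: "jump_weight w" and f: "f \<in> bounded_borel {0..}" and c: "0 \<le> c" "\<And>x. x \<in> {0..} \<Longrightarrow> \<bar>f x\<bar> \<le> c"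
    and t: "t \<le> real n"
  shows "\<bar>entrance_integrand t f (fst x) * w (snd x)\<bar> \<le> c * (indicator {0..real n} (fst x) * \<bar>snd x\<bar>)"
proof -
  have "\<bar>entrance_integrand t f (fst x)\<bar> * \<bar>w (snd x)\<bar> \<le> (c * indicator {0..real n} (fst x)) * \<bar>snd x\<bar>"
  proof (rule mult_mono)
    have "c * indicator {0..t} (fst x) \<le> c * indicator {0..real n} (fst x)"
      using t c(1) by (auto split: split_indicator)
    then show "\<bar>entrance_integrand t f (fst x)\<bar> \<le> c * indicator {0..real n} (fst x)"
      using entrance_integrand_bound[OF f c, of t "fst x"] by linarith
  qed (use w c(1) in \<open>auto simp: jump_weight_def\<close>)
  then show ?thesis by (simp add: abs_mult ac_simps)
qed

lemma entrance_weight_integrable: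
  assumes Q: "locally_integrable Q" and w: "jump_weight w" and f: "f \<in> bounded_borel {0..}"
  shows "integrable Q (\<lambda>x. entrance_integrand t f (fst x) * w (snd x))"
proof -
  obtain c where c: "0 \<le> c" "\<And>x. x \<in> {0..} \<Longrightarrow> \<bar>f x\<bar> \<le> c" using bounded_borelE[OF f] by metis
  obtain n :: nat where n: "t \<le> real n" using real_arch_simple by blast
  show ?thesis
  proof (rule Bochner_Integration.integrable_bound)
    show "integrable Q (\<lambda>x. c * (indicator {0..real n} (fst x) * \<bar>snd x\<bar>))"
      by (intro integrable_mult_right locally_integrable_dominating Q)
    show "AE x in Q. norm (entrance_integrand t f (fst x) * w (snd x)) \<le> norm (c * (indicator {0..real n} (fst x) * \<bar>snd x\<bar>))"
      using entrance_weight_bound[OF w f c n] by (intro AE_I2) (auto intro: order_trans[OF _ abs_ge_self])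
  qed (rule entrance_weight_measurable[OF Q w f])
qed

lemma jump_mixture_exists:
  assumes Q: "locally_integrable Q" and w: "jump_weight w"
  shows "\<exists>p\<in>finite_measures {0..}. \<forall>f\<in>bounded_borel {0..}.
    (\<integral>x. f x \<partial>p) = (\<integral>x. entrance_integrand t f (fst x) * w (snd x) \<partial>Q)"
proof -
  have sets: "sets Q = sets L" using Q by (simp add: locally_integrable_def)
  have [measurable]: "w \<in> borel_measurable borel" using w by (simp add: jump_weight_def)
  have fst[measurable]: "fst \<in> borel_measurable Q" and snd[measurable]: "snd \<in> borel_measurable Q"
    using sets fst_measurable_L snd_measurable_L by (auto cong: measurable_cong_sets)
  \<comment> \<open>The factor 1/2 converts T_(t-s) f(0) into the mass that the entrance measure of
    age t - s gives to h f.\<close>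
  define g where "g x = indicator {0..t} (fst x) * (w (snd x) / 2)" for x :: "real \<times> real"
  have g0: "0 \<le> g x" for x using w by (simp add: g_def jump_weight_def)
  have [measurable]: "g \<in> borel_measurable Q" unfolding g_def by measurable
  let ?\<nu> = "density Q (\<lambda>x. ennreal (g x))"
  obtain n :: nat where n: "t \<le> real n" using real_arch_simple by blast
  have fin: "finite_measure ?\<nu>"
  proof
    have "emeasure ?\<nu> (space Q) = (\<integral>\<^sup>+x. ennreal (g x) * indicator (space Q) x \<partial>Q)"
      by (rule emeasure_density) auto
    also have "\<dots> \<le> (\<integral>\<^sup>+x. indicator {0..real n} (fst x) * ennreal \<bar>snd x\<bar> \<partial>Q)"
    proof (rule nn_integral_mono)
      fix x :: "real \<times> real"
      have "w (snd x) / 2 \<le> \<bar>snd x\<bar>" using w unfolding jump_weight_def by (smt (verit) field_sum_of_halves)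
      then show "ennreal (g x) * indicator (space Q) x \<le> indicator {0..real n} (fst x) * ennreal \<bar>snd x\<bar>"
        using n by (auto simp: g_def split: split_indicator intro!: ennreal_leI)
    qed
    also have "\<dots> < \<infinity>" using Q by (simp add: locally_integrable_def)
    finally show "emeasure ?\<nu> (space ?\<nu>) \<noteq> \<infinity>" by simp
  qed
  obtain p where p: "p \<in> finite_measures {0..}"
    "\<And>f. f \<in> bounded_borel {0..} \<Longrightarrow> (\<integral>x. f x \<partial>p) = (\<integral>x. indicator {0..t} (fst x) * T_semigroup (t - fst x) f 0 \<partial>?\<nu>)"
    using entrance_mixture[OF fin, of fst t] by auto
  have "(\<integral>x. f x \<partial>p) = (\<integral>x. entrance_integrand t f (fst x) * w (snd x) \<partial>Q)" if f: "f \<in> bounded_borel {0..}" for f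
  proof -
    have eq: "indicator {0..t} s * T_semigroup (t - s) f 0 = 2 * entrance_integrand t f s" for s
      by (simp add: entrance_integrand_def)
    have [measurable]: "entrance_integrand t f \<in> borel_measurable borel"
      by (rule good_integrand_measurable[OF good_entrance_integrand[OF f]])
    have "(\<integral>x. f x \<partial>p) = (\<integral>x. 2 * entrance_integrand t f (fst x) \<partial>?\<nu>)" using p(2)[OF f] by (simp add: eq)
    also have "\<dots> = (\<integral>x. g x *\<^sub>R (2 * entrance_integrand t f (fst x)) \<partial>Q)"
      using g0 by (intro integral_density) auto
    also have "\<dots> = (\<integral>x. entrance_integrand t f (fst x) * w (snd x) \<partial>Q)"
      by (intro Bochner_Integration.integral_cong) (auto simp: g_def entrance_integrand_def split: split_indicator)
    finally show ?thesis .
  qed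
  with p(1) show ?thesis by blast
qed

definition jump_mixture :: "(real \<times> real) measure \<Rightarrow> (real \<Rightarrow> real) \<Rightarrow> real \<Rightarrow> real measure" where
  "jump_mixture Q w t = (SOME p. p \<in> finite_measures {0..} \<and> (\<forall>f\<in>bounded_borel {0..}.
    (\<integral>x. f x \<partial>p) = (\<integral>x. entrance_integrand t f (fst x) * w (snd x) \<partial>Q)))"

lemma jump_mixture:
  assumes "locally_integrable Q" "jump_weight w"
  shows "jump_mixture Q w t \<in> finite_measures {0..}"
    and "\<And>f. f \<in> bounded_borel {0..} \<Longrightarrow>
      (\<integral>x. f x \<partial>jump_mixture Q w t) = (\<integral>x. entrance_integrand t f (fst x) * w (snd x) \<partial>Q)"
proof -
  have "\<exists>p. p \<in> finite_measures {0..} \<and> (\<forall>f\<in>bounded_borel {0..}.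
    (\<integral>x. f x \<partial>p) = (\<integral>x. entrance_integrand t f (fst x) * w (snd x) \<partial>Q))"
    using jump_mixture_exists[OF assms, of t] by blast
  from someI_ex[OF this] show "jump_mixture Q w t \<in> finite_measures {0..}"
    "\<And>f. f \<in> bounded_borel {0..} \<Longrightarrow>
      (\<integral>x. f x \<partial>jump_mixture Q w t) = (\<integral>x. entrance_integrand t f (fst x) * w (snd x) \<partial>Q)"
    by (auto simp: jump_mixture_def)
qed

text \<open>Dominated convergence over the jumps. A jump before t has an integrand continuous in t,
  and one after t is not seen by times close to t. A jump exactly at t already counts with f(0) / 2,
  the right limit of its later contributions; this fixes the value needed at age 0.\<close>

lemma entrance_weight_right_continuous:
  assumes Q: "locally_integrable Q" and w: "jump_weight w" and f: "f \<in> bounded_continuous {0..}"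
  shows "((\<lambda>s. \<integral>x. entrance_integrand s f (fst x) * w (snd x) \<partial>Q) \<longlongrightarrow>
    (\<integral>x. entrance_integrand t f (fst x) * w (snd x) \<partial>Q)) (at_right t)"
proof (rule tendsto_at_right_sequentially[where b="t + 1"])
  have fb: "f \<in> bounded_borel {0..}" using f bounded_continuous_subset by auto
  obtain c where c: "0 \<le> c" "\<And>x. x \<in> {0..} \<Longrightarrow> \<bar>f x\<bar> \<le> c" using bounded_borelE[OF fb] by metis
  obtain n :: nat where n: "t + 1 \<le> real n" using real_arch_simple by blast
  fix S :: "nat \<Rightarrow> real" assume S: "\<And>n. t < S n" "\<And>n. S n < t + 1" "S \<longlonglongrightarrow> t"
  show "(\<lambda>n. \<integral>x. entrance_integrand (S n) f (fst x) * w (snd x) \<partial>Q) \<longlonglongrightarrow>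
    (\<integral>x. entrance_integrand t f (fst x) * w (snd x) \<partial>Q)"
  proof (rule integral_dominated_convergence)
    show "integrable Q (\<lambda>x. c * (indicator {0..real n} (fst x) * \<bar>snd x\<bar>))"
      by (intro integrable_mult_right locally_integrable_dominating Q)
    show "AE x in Q. norm (entrance_integrand (S k) f (fst x) * w (snd x)) \<le> c * (indicator {0..real n} (fst x) * \<bar>snd x\<bar>)" for k
      using entrance_weight_bound[OF w fb c, of "S k" n] S(2)[of k] n by (intro AE_I2) simp
    show "AE x in Q. (\<lambda>n. entrance_integrand (S n) f (fst x) * w (snd x)) \<longlonglongrightarrow> entrance_integrand t f (fst x) * w (snd x)"
    proof (intro AE_I2 tendsto_mult tendsto_const)
      fix x :: "real \<times> real"
      let ?s = "fst x"
      consider "?s < 0" | "0 \<le> ?s" "?s \<le> t" | "t < ?s" by linarith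
      then show "(\<lambda>n. entrance_integrand (S n) f ?s) \<longlonglongrightarrow> entrance_integrand t f ?s"
      proof cases
        case 1
        then show ?thesis by (simp add: entrance_integrand_def)
      next
        case 2
        have lim: "(\<lambda>n. T_semigroup (S n - ?s) f 0) \<longlonglongrightarrow> T_semigroup (t - ?s) f 0"
        proof (rule continuous_on_tendsto_compose[OF T_semigroup_at_0_continuous[OF f]])
          show "(\<lambda>n. S n - ?s) \<longlonglongrightarrow> t - ?s" by (intro tendsto_intros S)
          show "\<forall>\<^sub>F n in sequentially. S n - ?s \<in> {0..}"
            using S(1) 2 by (intro always_eventually allI) (auto intro: less_imp_le le_less_trans)
        qed (use 2 in simp)
        have "(\<lambda>n. T_semigroup (S n - ?s) f 0 / 2) \<longlonglongrightarrow> T_semigroup (t - ?s) f 0 / 2"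
          by (intro tendsto_divide lim tendsto_const) simp
        moreover have "entrance_integrand (S n) f ?s = T_semigroup (S n - ?s) f 0 / 2" for n
          using 2 S(1)[of n] by (simp add: entrance_integrand_def)
        moreover have "entrance_integrand t f ?s = T_semigroup (t - ?s) f 0 / 2"
          using 2 by (simp add: entrance_integrand_def)
        ultimately show ?thesis by (simp only:)
      next
        case 3
        have "eventually (\<lambda>n. S n < ?s) sequentially" by (rule order_tendstoD(2)[OF S(3) 3])
        then have "eventually (\<lambda>n. entrance_integrand (S n) f ?s = entrance_integrand t f ?s) sequentially"
          using 3 by (auto simp: entrance_integrand_def elim: eventually_mono)
        then show ?thesis by (rule tendsto_eventually)
      qed
    qed
  qed (rule entrance_weight_measurable[OF Q w fb])+
qed simp

lemma locally_integrable_L: "locally_integrable L"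
  unfolding locally_integrable_def
proof (intro conjI allI)
  fix n :: nat
  have "\<forall>s. \<bar>indicator {0..real n} s\<bar> \<le> 1 * indicat_real {0..real n} s" by simp
  then have "good_integrand (indicator {0..real n})"
    unfolding good_integrand_def by (intro conjI) (measurable, blast)
  from jump_fun_integrable[OF this]
  have "(\<integral>\<^sup>+x. ennreal (norm (jump_fun (indicator {0..real n}) x)) \<partial>L) < \<infinity>" by (simp add: integrable_iff_bounded)
  also have "(\<integral>\<^sup>+x. ennreal (norm (jump_fun (indicator {0..real n}) x)) \<partial>L) =
    (\<integral>\<^sup>+x. indicator {0..real n} (fst x) * ennreal \<bar>snd x\<bar> \<partial>L)"
    by (intro nn_integral_cong) (auto simp: jump_fun_def split: split_indicator)
  finally show "(\<integral>\<^sup>+x. indicator {0..real n} (fst x) * ennreal \<bar>snd x\<bar> \<partial>L) < \<infinity>" .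
qed simp

text \<open>\<open>right_continuous_paths\<close> speaks of every path. Off this event, which has
  probability 1, the realization is set to 0.\<close>

definition good_event :: "'w set" where
  "good_event = {\<omega> \<in> space M. locally_integrable (N \<omega>)}"

lemma good_event_sets [measurable]: "good_event \<in> sets M"
proof -
  have "(\<lambda>x. indicator {0..real n} (fst x) * ennreal \<bar>snd x\<bar>) \<in> borel_measurable L" for n by measurable
  then have [measurable]: "(\<lambda>\<omega>. \<integral>\<^sup>+x. indicator {0..real n} (fst x) * ennreal \<bar>snd x\<bar> \<partial>N \<omega>) \<in> borel_measurable M" for n
    by (rule nn_integral_N_measurable)
  have "good_event = {\<omega> \<in> space M. \<forall>n::nat. (\<integral>\<^sup>+x. indicator {0..real n} (fst x) * ennreal \<bar>snd x\<bar> \<partial>N \<omega>) < \<infinity>}"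
    using sets_N by (auto simp: good_event_def locally_integrable_def)
  also have "\<dots> \<in> sets M" by measurable
  finally show ?thesis .
qed

lemma AE_good_event: "AE \<omega> in M. \<omega> \<in> good_event"
proof -
  have "AE \<omega> in M. \<forall>n::nat. (\<integral>\<^sup>+x. indicator {0..real n} (fst x) * ennreal \<bar>snd x\<bar> \<partial>N \<omega>) < \<infinity>"
    unfolding AE_all_countable
  proof
    fix n :: nat
    have m: "(\<lambda>x. indicator {0..real n} (fst x) * ennreal \<bar>snd x\<bar>) \<in> borel_measurable L" by measurable
    have "(\<integral>\<^sup>+\<omega>. (\<integral>\<^sup>+x. indicator {0..real n} (fst x) * ennreal \<bar>snd x\<bar> \<partial>N \<omega>) \<partial>M) \<noteq> \<infinity>"
      using locally_integrable_L unfolding campbell[OF m] by (simp add: locally_integrable_def less_top)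
    from nn_integral_noteq_infinite[OF nn_integral_N_measurable[OF m] this]
    show "AE \<omega> in M. (\<integral>\<^sup>+x. indicator {0..real n} (fst x) * ennreal \<bar>snd x\<bar> \<partial>N \<omega>) < \<infinity>"
      by (simp add: less_top)
  qed
  then show ?thesis using AE_space
    by eventually_elim (simp add: good_event_def locally_integrable_def sets_N)
qed

text \<open>Here v weights the jumps of N and w the compensator, so that positive jumps can be
  grouped with the compensator of negative ones and conversely.\<close>

definition X_part :: "(real \<Rightarrow> real) \<Rightarrow> (real \<Rightarrow> real) \<Rightarrow> real \<Rightarrow> 'w \<Rightarrow> real measure" where
  "X_part v w t \<omega> = (if \<omega> \<in> good_event then
      SOME r. r \<in> finite_measures {0..} \<and> (\<forall>f\<in>bounded_borel {0..}.
        (\<integral>x. f x \<partial>r) = (\<integral>x. f x \<partial>jump_mixture (N \<omega>) v t) + (\<integral>x. f x \<partial>jump_mixture L w t))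
    else null_measure (restrict_space borel {0..}))"

text \<open>The compensator of the positive jumps is added to the negative part, so that both parts are
  measures.\<close>

definition X_realization :: "real \<Rightarrow> 'w \<Rightarrow> real set \<Rightarrow> real" where
  "X_realization t \<omega> = measure_diff (X_part (\<lambda>u. max 0 u) (\<lambda>u. max 0 (- u)) t \<omega>)
    (X_part (\<lambda>u. max 0 (- u)) (\<lambda>u. max 0 u) t \<omega>)"

lemma X_part:
  assumes v: "jump_weight v" and w: "jump_weight w"
  shows X_part_in: "X_part v w t \<omega> \<in> finite_measures {0..}"
    and X_part_integral: "\<And>f. f \<in> bounded_borel {0..} \<Longrightarrow> (\<integral>x. f x \<partial>X_part v w t \<omega>) =
      (if \<omega> \<in> good_event then (\<integral>x. entrance_integrand t f (fst x) * v (snd x) \<partial>N \<omega>) +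
        (\<integral>x. entrance_integrand t f (fst x) * w (snd x) \<partial>L) else 0)"
proof -
  have "X_part v w t \<omega> \<in> finite_measures {0..} \<and> (\<forall>f\<in>bounded_borel {0..}.
    (\<integral>x. f x \<partial>X_part v w t \<omega>) = (if \<omega> \<in> good_event then (\<integral>x. entrance_integrand t f (fst x) * v (snd x) \<partial>N \<omega>) +
        (\<integral>x. entrance_integrand t f (fst x) * w (snd x) \<partial>L) else 0))"
  proof (cases "\<omega> \<in> good_event")
    case True
    then have lN: "locally_integrable (N \<omega>)" by (simp add: good_event_def)
    note jN = jump_mixture[where t=t, OF lN v] and jL = jump_mixture[where t=t, OF locally_integrable_L w]
    have "\<exists>r. r \<in> finite_measures {0..} \<and> (\<forall>f\<in>bounded_borel {0..}.
        (\<integral>x. f x \<partial>r) = (\<integral>x. f x \<partial>jump_mixture (N \<omega>) v t) + (\<integral>x. f x \<partial>jump_mixture L w t))"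
      using finite_measures_add[OF jN(1) jL(1)] by blast
    from someI_ex[OF this] show ?thesis using True jN(2) jL(2) by (simp add: X_part_def)
  next
    case False
    then show ?thesis by (simp add: X_part_def null_finite_measure)
  qed
  then show "X_part v w t \<omega> \<in> finite_measures {0..}"
    "\<And>f. f \<in> bounded_borel {0..} \<Longrightarrow> (\<integral>x. f x \<partial>X_part v w t \<omega>) =
      (if \<omega> \<in> good_event then (\<integral>x. entrance_integrand t f (fst x) * v (snd x) \<partial>N \<omega>) +
        (\<integral>x. entrance_integrand t f (fst x) * w (snd x) \<partial>L) else 0)" by blast+
qed

lemma X_part_right_continuous:
  assumes v: "jump_weight v" and w: "jump_weight w" and f: "f \<in> bounded_continuous {0..}"
  shows "((\<lambda>s. \<integral>x. f x \<partial>X_part v w s \<omega>) \<longlongrightarrow> (\<integral>x. f x \<partial>X_part v w t \<omega>)) (at_right t)"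
proof -
  have fb: "f \<in> bounded_borel {0..}" using f bounded_continuous_subset by auto
  show ?thesis
  proof (cases "\<omega> \<in> good_event")
    case True
    then have lN: "locally_integrable (N \<omega>)" by (simp add: good_event_def)
    show ?thesis
      unfolding X_part_integral[OF v w fb] using True
      by (auto intro!: tendsto_add entrance_weight_right_continuous lN locally_integrable_L v w f)
  qed (simp add: X_part_integral[OF v w fb])
qed

lemma X_realization_in: "X_realization t \<omega> \<in> signed_measures {0..}"
  unfolding X_realization_def by (intro measure_diff_signed X_part_in jump_weight_parts)

lemma signed_integral_X:
  assumes f: "f \<in> bounded_borel {0..}"
  shows "signed_integral {0..} (X_realization t \<omega>) f =
    (if \<omega> \<in> good_event then comp_int \<omega> (entrance_integrand t f) else 0)"
proof -
  let ?e = "\<lambda>x. entrance_integrand t f (fst x)"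
  have dec: "(\<integral>x. jump_fun (entrance_integrand t f) x \<partial>Q) =
      (\<integral>x. ?e x * max 0 (snd x) \<partial>Q) - (\<integral>x. ?e x * max 0 (- snd x) \<partial>Q)"
    if Q: "locally_integrable Q" for Q
  proof -
    have "(\<integral>x. jump_fun (entrance_integrand t f) x \<partial>Q) = (\<integral>x. ?e x * max 0 (snd x) - ?e x * max 0 (- snd x) \<partial>Q)"
      by (intro Bochner_Integration.integral_cong) (auto simp: jump_fun_def max_def)
    also have "\<dots> = (\<integral>x. ?e x * max 0 (snd x) \<partial>Q) - (\<integral>x. ?e x * max 0 (- snd x) \<partial>Q)"
      by (rule Bochner_Integration.integral_diff) (rule entrance_weight_integrable[OF Q _ f], rule jump_weight_parts)+
    finally show ?thesis .
  qed
  have "signed_integral {0..} (X_realization t \<omega>) f =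
    (\<integral>x. f x \<partial>X_part (\<lambda>u. max 0 u) (\<lambda>u. max 0 (- u)) t \<omega>) - (\<integral>x. f x \<partial>X_part (\<lambda>u. max 0 (- u)) (\<lambda>u. max 0 u) t \<omega>)"
    unfolding X_realization_def by (intro signed_integral_diff X_part_in jump_weight_parts f)
  also have "\<dots> = (if \<omega> \<in> good_event then comp_int \<omega> (entrance_integrand t f) else 0)"
    using dec[OF locally_integrable_L] dec[of "N \<omega>"]
    by (auto simp: X_part_integral jump_weight_parts f comp_int_def good_event_def)
  finally show ?thesis .
qed

lemma driven_X: "driven X_realization"
  unfolding driven_def
proof (intro conjI allI impI ballI)
  fix t :: real assume "0 \<le> t"
  show "X_realization t \<in> measurable M signed_space"
  proof (rule measurable_signed_algebraI)
    fix f :: "real \<Rightarrow> real" assume f: "f \<in> bounded_borel {0..}"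
    have [measurable]: "(\<lambda>\<omega>. comp_int \<omega> (entrance_integrand t f)) \<in> borel_measurable M"
      by (rule comp_int_measurable[OF good_entrance_integrand[OF f]])
    have "(\<lambda>\<omega>. if \<omega> \<in> good_event then comp_int \<omega> (entrance_integrand t f) else 0) \<in> borel_measurable M"
      by measurable
    then show "(\<lambda>\<omega>. signed_integral {0..} (X_realization t \<omega>) f) \<in> borel_measurable M"
      by (simp only: signed_integral_X[OF f])
  qed (rule X_realization_in)
  fix f :: "real \<Rightarrow> real" assume f: "f \<in> bounded_borel {0..}"
  show "AE \<omega> in M. signed_integral {0..} (X_realization t \<omega>) f = comp_int \<omega> (entrance_integrand t f)"
    using AE_good_event by eventually_elim (simp add: signed_integral_X[OF f])
qed

lemma right_continuous_driven_X: "right_continuous_driven M m N X_realization"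
proof (intro right_continuous_driven.intro right_continuous_driven_axioms.intro jump_noise_axioms driven_X)
  fix \<omega> t and f :: "real \<Rightarrow> real"
  assume f: "f \<in> bounded_continuous {0..}"
  then have fb: "f \<in> bounded_borel {0..}" using bounded_continuous_subset by auto
  have eq: "signed_integral {0..} (X_realization s \<omega>) f =
    (\<integral>x. f x \<partial>X_part (\<lambda>u. max 0 u) (\<lambda>u. max 0 (- u)) s \<omega>) - (\<integral>x. f x \<partial>X_part (\<lambda>u. max 0 (- u)) (\<lambda>u. max 0 u) s \<omega>)" for s
    unfolding X_realization_def by (intro signed_integral_diff X_part_in jump_weight_parts fb)
  show "((\<lambda>s. signed_integral {0..} (X_realization s \<omega>) f) \<longlongrightarrow> signed_integral {0..} (X_realization t \<omega>) f) (at_right t)"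
    unfolding eq by (intro tendsto_diff X_part_right_continuous jump_weight_parts f)
qed

lemma right_continuous_paths_X:
  assumes F: "\<And>n. n \<ge> 1 \<Longrightarrow> F n \<in> bounded_continuous {0..}"
  shows "right_continuous_paths (rho_dist {0..} F) M X_realization"
  unfolding right_continuous_paths_def
proof (intro ballI allI impI)
  fix \<omega> t
  let ?P = "\<lambda>s. X_part (\<lambda>u. max 0 u) (\<lambda>u. max 0 (- u)) s \<omega>" and ?N = "\<lambda>s. X_part (\<lambda>u. max 0 (- u)) (\<lambda>u. max 0 u) s \<omega>"
  have in_fm: "?P s \<in> finite_measures {0..}" "?N s \<in> finite_measures {0..}" for s
    by (intro X_part_in jump_weight_parts)+
  have "((\<lambda>s. r_dist F (?P s) (?P t)) \<longlongrightarrow> 0) (at_right t)" "((\<lambda>s. r_dist F (?N s) (?N t)) \<longlongrightarrow> 0) (at_right t)"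
    by (intro r_dist_tendsto X_part_right_continuous jump_weight_parts F; simp)+
  then have lim: "((\<lambda>s. r_dist F (?P s) (?P t) + r_dist F (?N s) (?N t)) \<longlongrightarrow> 0 + 0) (at_right t)"
    by (rule tendsto_add)
  show "((\<lambda>s. rho_dist {0..} F (X_realization s \<omega>) (X_realization t \<omega>)) \<longlongrightarrow> 0) (at_right t)"
    unfolding X_realization_def
    by (rule tendsto_sandwich[OF _ _ tendsto_const lim[simplified]])
      (intro always_eventually allI rho_dist_bounds in_fm)+
qed

text \<open>The null set in \<open>driven\<close> depends on the test function, but countably many
  half-lines determine a signed measure, so a single null set per time suffices.\<close>

lemma driven_unique:
  assumes W: "driven W" and W': "driven W'" and t: "t \<ge> 0"
  shows "AE \<omega> in M. W t \<omega> = W' t \<omega>"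
proof -
  have rs: "B \<inter> {0::real..} \<in> sets (restrict_space borel {0..})" if "B \<in> sets borel" for B
    using that by (auto simp: sets_restrict_space)
  have val: "AE \<omega> in M. W t \<omega> (B \<inter> {0..}) = W' t \<omega> (B \<inter> {0..})" if B: "B \<in> sets borel" for B
  proof -
    note i = bounded_borel_indicator[OF rs[OF B]]
    show ?thesis
      using drivenD(2)[OF W t i] drivenD(2)[OF W' t i] AE_space
      by eventually_elim
        (simp add: signed_integral_indicator[OF drivenD_space[OF W t] rs[OF B]]
          signed_integral_indicator[OF drivenD_space[OF W' t] rs[OF B]])
  qed
  have "AE \<omega> in M. \<forall>q\<in>\<rat>. W t \<omega> ({..q} \<inter> {0..}) = W' t \<omega> ({..q} \<inter> {0..})"
    by (subst AE_ball_countable[OF countable_rat]) (simp add: val)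
  moreover have "AE \<omega> in M. W t \<omega> (UNIV \<inter> {0..}) = W' t \<omega> (UNIV \<inter> {0..})"
    by (rule val) simp
  ultimately show ?thesis using AE_space
  proof eventually_elim
    case (elim \<omega>)
    then show ?case
      by (intro signed_measures_eqI_rat[OF drivenD_space[OF W t] drivenD_space[OF W' t]]) auto
  qed
qed

lemma same_fdds_driven:
  assumes W: "driven W" and W': "driven W'"
  shows "same_fdds signed_space M W M W'"
  unfolding same_fdds_def
proof (intro allI impI)
  fix J :: "real set" assume J: "finite J \<and> J \<subseteq> {0..}"
  have J0: "t \<ge> 0" if "t \<in> J" for t using that J by auto
  have "AE \<omega> in M. \<forall>t\<in>J. W t \<omega> = W' t \<omega>"
    using J driven_unique[OF W W'] J0 by (intro AE_finite_allI) auto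
  then have "AE \<omega> in M. (\<lambda>t\<in>J. W t \<omega>) = (\<lambda>t\<in>J. W' t \<omega>)"
    by eventually_elim (auto intro: restrict_ext)
  then show "distr M (PiM J (\<lambda>_. signed_space)) (\<lambda>\<omega>. \<lambda>t\<in>J. W t \<omega>) = distr M (PiM J (\<lambda>_. signed_space)) (\<lambda>\<omega>. \<lambda>t\<in>J. W' t \<omega>)"
    by (intro distr_cong_AE measurable_restrict drivenD(1)[OF W] drivenD(1)[OF W'] J0) auto
qed

end

theorem theorem5p3:
  fixes M :: "'w measure"
    and m :: "real measure"
    and N :: "'w \<Rightarrow> (real \<times> real) measure"
    and Y :: "real \<Rightarrow> 'w \<Rightarrow> real set \<Rightarrow> real"
    and d :: "real \<Rightarrow> real \<Rightarrow> real"
    and F :: "nat \<Rightarrow> real \<Rightarrow> real"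
  assumes m_sets: "sets m = sets (restrict_space borel (- {0::real}))"
    and m_finite: "finite_measure (density m (\<lambda>u. ennreal \<bar>u\<bar>))"
    and M_prob: "prob_space M"
    and N_poisson: "poisson_random_measure M (jump_intensity m) N"
    and Y_process: "is_Y_process M m N Y"
    and d_metric: "compatible_metric {0..} d"
    and F_dense: "uniformly_dense_seq {0..} d F"
  shows "(\<forall>t\<ge>0. \<forall>\<mu>\<in>signed_measures {0..}. \<exists>!Q. has_S_law m t \<mu> Q)
    \<and> transition_semigroup (signed_algebra {0..}) (S_semigroup m)
    \<and> markov_process M (signed_algebra {0..})
        (natural_filtration M (signed_algebra {0..}) (Z_process Y)) (Z_process Y) (S_semigroup m)
    \<and> (\<exists>(M' :: 'w measure) X. prob_space M'
        \<and> same_fdds (signed_algebra {0..}) M (Z_process Y) M' X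
        \<and> right_continuous_paths (rho_dist {0..} F) M' X
        \<and> strong_markov_process M' (signed_algebra {0..})
            (right_limit_filtration (natural_filtration M' (signed_algebra {0..}) X))
            X (S_semigroup m))"
proof -
  interpret jump_noise M m N
    by (rule jump_noise.intro[OF m_sets m_finite M_prob N_poisson])
  interpret X: right_continuous_driven M m N X_realization
    by (rule right_continuous_driven_X)
  have Z: "driven (Z_process Y)" by (rule driven_Z[OF Y_process])
  show ?thesis
  \<comment> \<open>The realization is a modification of Z on the original probability space, so M
    itself serves as M'.\<close>
  proof (intro conjI allI impI ballI exI)
    show "\<exists>!Q. has_S_law m t \<mu> Q" if "0 \<le> t" "\<mu> \<in> signed_measures {0..}" for t \<mu>
      using has_S_law_S_kernel[OF Z that] has_S_law_unique by blast
    show "transition_semigroup (signed_algebra {0..}) (S_semigroup m)"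
      by (rule transition_semigroup_S[OF Z])
    show "markov_process M (signed_algebra {0..})
        (natural_filtration M (signed_algebra {0..}) (Z_process Y)) (Z_process Y) (S_semigroup m)"
      by (rule markov_driven[OF Z])
    show "prob_space M" by (rule M_prob)
    show "same_fdds (signed_algebra {0..}) M (Z_process Y) M X_realization"
      by (rule same_fdds_driven[OF Z driven_X])
    show "right_continuous_paths (rho_dist {0..} F) M X_realization"
      by (rule right_continuous_paths_X) (rule uniformly_dense_seq_continuous[OF d_metric F_dense])
    show "strong_markov_process M (signed_algebra {0..})
            (right_limit_filtration (natural_filtration M (signed_algebra {0..}) X_realization))
            X_realization (S_semigroup m)"
      by (rule X.strong_markov)
  qed
qed

end
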